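(* Let $A>0$, $B>0$. Uniformly for $x\ge 2$, $T\ge 1$ and multiplicative functions $f,r\in\mathcal M(x;A,B)$ with $|f|\le r$, we have $$M(x;f)\ll \frac{x}{\log x}\Big\{\int_{1/\log x}^1\frac{H_T(\alpha)}{\alpha}\,d\alpha+\frac{e^{Z(x;r)}}{\sqrt T}+\frac{e^{Z(x;r)}\log_2 x}{T}\Big\},$$ with implied constant depending only on $A,B$. Moreover, for every fixed $c>0$, if in addition $$Z(x;r)-Z(y;r)\ge c\log\Big(\frac{\log x}{\log y}\Big)+O(1)\qquad(2\le y\le x),$$ then the last term inside the braces may be omitted (the implied constant then depending also on $c$ and on the constant in this $O(1)$).
   Context: Throughout, $p$ denotes a prime, $s=\sigma+i\tau$ with $\sigma,\tau$ real, and $\log_2=\log\log$. For $x\ge2$ and $A,B>0$, $\mathcal M(x;A,B)$ is the class of complex multiplicative functions $f$ such that $\max_{p\le x}|f(p)|\le A$ and $\sum_{p^\nu\le x,\ \nu\ge2}|f(p^\nu)|\log(p^\nu)/p^\nu\le B$. $M(x;f):=\sum_{n\le x}f(n)$ and $Z(y;f):=\sum_{p\le y}f(p)/p$. Define $v_f(s;x):=\sum_{p\le x}f(p)p^{-s}$ and, for $\alpha>0$, $T\ge1$, $$H_T(\alpha)^2:=\sum_{k\in\mathbb Z,\ |k|\le T}\frac{1}{k^2+1}\max_{\sigma=1+\alpha,\ |\tau-k|\le1/2}\big|e^{v_f(s;x)}\big|^2.$$ The notation $F\ll G$ means $|F|\le C|G|$ for some constant $C$, also for complex quantities.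
   Formalization: The range x ≥ 2 is replaced by x ≥ 3: for f = r = indicator of n = 1 and x = e, the integral and log_2 x vanish, so the right side is e/√T → 0 while M(x;f) = 1, and uniformity also fails for x near e. *)

theory Defs
  imports "HOL-Analysis.Analysis"
begin

definition multiplicative :: "(nat \<Rightarrow> 'a::comm_semiring_1) \<Rightarrow> bool" where
  "multiplicative f \<longleftrightarrow> f 1 = 1 \<and>
     (\<forall>m n. m > 0 \<longrightarrow> n > 0 \<longrightarrow> coprime m n \<longrightarrow> f (m * n) = f m * f n)"

definition classM :: "real \<Rightarrow> real \<Rightarrow> real \<Rightarrow> (nat \<Rightarrow> 'a::real_normed_field) \<Rightarrow> bool" where
  "classM x A B f \<longleftrightarrow>
     (\<forall>p. prime p \<and> real p \<le> x \<longrightarrow> norm (f p) \<le> A) \<and>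
     (\<Sum>n | real n \<le> x \<and> (\<exists>p \<nu>. prime p \<and> 2 \<le> \<nu> \<and> n = p ^ \<nu>).
        norm (f n) * ln (real n) / real n) \<le> B"

definition Msum :: "real \<Rightarrow> (nat \<Rightarrow> 'a::comm_monoid_add) \<Rightarrow> 'a" where
  "Msum x f = (\<Sum>n\<in>{1..nat \<lfloor>x\<rfloor>}. f n)"

definition Zsum :: "real \<Rightarrow> (nat \<Rightarrow> 'a::real_normed_field) \<Rightarrow> 'a" where
  "Zsum y f = (\<Sum>p | prime p \<and> real p \<le> y. f p / of_nat p)"

definition vsum :: "(nat \<Rightarrow> complex) \<Rightarrow> complex \<Rightarrow> real \<Rightarrow> complex" where
  "vsum f s x = (\<Sum>p | prime p \<and> real p \<le> x. f p * of_nat p powr (- s))"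

definition HT :: "(nat \<Rightarrow> complex) \<Rightarrow> real \<Rightarrow> real \<Rightarrow> real \<Rightarrow> real" where
  "HT f x T \<alpha> = sqrt (\<Sum>k | real_of_int \<bar>k\<bar> \<le> T.
      1 / (real_of_int k ^ 2 + 1) *
      (SUP \<tau>\<in>{real_of_int k - 1/2 .. real_of_int k + 1/2}.
          cmod (exp (vsum f (Complex (1 + \<alpha>) \<tau>) x)) ^ 2))"

end

theory Submission
  imports Defs "HOL-Number_Theory.Number_Theory" "HOL-Real_Asymp.Real_Asymp"
    "HOL-Computational_Algebra.Squarefree" "HOL-Computational_Algebra.Formal_Power_Series"
    "HOL-Complex_Analysis.Complex_Analysis"
begin

text \<open>
  Write \<open>f = h * g\<close> as a Dirichlet convolution, where \<open>g\<close> is the exponential multiplicative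
  function with \<open>g(p\<^sup>k) = f(p)\<^sup>k / k!\<close> for \<open>p \<le> x\<close>. Then \<open>\<Sum> |h(d)| (1 + log d) / d\<close> is bounded,
  so it suffices to treat \<open>g\<close>, whose Dirichlet series is \<open>exp (v\<^sub>f(s; x))\<close>.
  The identity \<open>g log = (f log) * g\<close> over primes and the Brun--Titchmarsh inequality give
  \<open>M(y; g) \<lless> (y / log y) (1 + \<integral>\<^sub>1\<^sup>y |M(t; g)| t\<^sup>-\<^sup>2 dt)\<close>. In the integral, \<open>M(t; g)\<close> is replaced by
  \<open>N(t) / log t\<close> with \<open>N(t) = \<Sum>\<^bsub>n \<le> t\<^esub> g(n) log n\<close>, the factor \<open>1 / log t\<close> is opened as an
  integral of \<open>t\<^sup>-\<^sup>2\<^sup>\<alpha>\<close> over \<open>1 / log x \<le> \<alpha> \<le> 1\<close>, and \<open>N\<close> is smoothed by the Riesz weights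
  \<open>1 - (n / t)\<^sup>\<kappa>\<close> with \<open>\<kappa> = \<surd>T\<close>, at a cost of \<open>e\<^sup>Z / \<surd>T\<close>.
  For fixed \<open>\<alpha>\<close>, Cauchy--Schwarz and Plancherel reduce matters to the mean square of
  \<open>exp (v\<^sub>f(s; x)) \<Sum> f(p) log p p\<^sup>-\<^sup>s\<close> on the line \<open>\<sigma> = 1 + \<alpha>\<close>. On the window \<open>|\<tau> - k| \<le> 1/2\<close> the
  exponential is bounded by its maximum and the prime sum has mean square \<open>\<lless> 1 / \<alpha>\<close>: the windows
  with \<open>|k| \<le> T\<close> yield \<open>H\<^sub>T(\<alpha>)\<close>, the others at most \<open>exp (\<Sum> |f(p)| p\<^sup>-\<^sup>1\<^sup>-\<^sup>\<alpha>) / T\<close>. Integrated over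
  \<open>\<alpha>\<close> this gives \<open>e\<^sup>Z log\<^sub>2 x / T\<close>; under the regularity hypothesis the integrand is
  \<open>\<lless> e\<^sup>Z (\<alpha> log x)\<^sup>-\<^sup>c / \<alpha>\<close> and the last term becomes \<open>e\<^sup>Z / T\<close>.
\<close>

section \<open>Primes in short intervals\<close>

text \<open>A sharp cutoff would put the weight 1/|s|^2 on the line; its mass beyond |\<tau>| = T is
  about 1/T, which after the square root and the integration over \<alpha> leaves e^Z log_2 x / sqrt
  T. Riesz weights replace it by \<kappa>^2/|s(s+\<kappa>)|^2, with mass about \<kappa>^2/T^3 beyond
  T, at the price e^Z/\<kappa>. With \<kappa> = sqrt T both terms of the theorem come out. The
  exponential g is preferred to f because g log is a convolution of g with a function supported on
  primes: on the line the derivative of the series is, up to sign, v' exp v, so that only the prime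
  sum v' needs a mean square. The bound for M(y; g) refers to itself at y/p. Induction closes it
  because the primes up to y^\<delta> carry a weight proportional to \<delta>, while larger primes
  admit averaging over short intervals; this averaging is why an upper-bound sieve in intervals is
  needed. Terms bounded in terms of A and B alone are absorbed by the integral of
  H_T(\<alpha>)/\<alpha>, which has a positive lower bound.\<close>

lemma card_multiples_Ioc:
  fixes a b :: real and d :: nat
  assumes "0 \<le> a" "a \<le> b" "d > 0"
  shows "real (card {n::nat. a < real n \<and> real n \<le> b \<and> d dvd n}) \<le> (b - a) / d + 1"
    and "real (card {n::nat. a < real n \<and> real n \<le> b \<and> d dvd n}) \<ge> (b - a) / d - 1"
    and "finite {n::nat. a < real n \<and> real n \<le> b \<and> d dvd n}"
proof -
  let ?S = "{n::nat. a < real n \<and> real n \<le> b \<and> d dvd n}"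
  have S: "?S = (\<lambda>k. d * k) ` {nat \<lfloor>a/d\<rfloor> <.. nat \<lfloor>b/d\<rfloor>}"
  proof (intro equalityI subsetI)
    fix n assume "n \<in> ?S"
    then obtain k where "n = d * k" by (auto elim: dvdE)
    with \<open>n \<in> ?S\<close> have k: "n = d * k" "a < real d * k" "real d * k \<le> b" by auto
    have "a / d < k" "k \<le> b / d" using k assms by (simp_all add: field_simps)
    moreover have "0 \<le> a / d" "0 \<le> b / d" using assms by auto
    ultimately have "nat \<lfloor>a/d\<rfloor> < k" "k \<le> nat \<lfloor>b/d\<rfloor>" by linarith+
    hence "k \<in> {nat \<lfloor>a/d\<rfloor> <.. nat \<lfloor>b/d\<rfloor>}" by (simp only: greaterThanAtMost_iff)
    thus "n \<in> (\<lambda>k. d * k) ` {nat \<lfloor>a/d\<rfloor> <.. nat \<lfloor>b/d\<rfloor>}"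
      unfolding k(1) by (rule imageI)
  next
    fix n assume "n \<in> (\<lambda>k. d * k) ` {nat \<lfloor>a/d\<rfloor> <.. nat \<lfloor>b/d\<rfloor>}"
    then obtain k where k': "n = d * k" and "k \<in> {nat \<lfloor>a/d\<rfloor> <.. nat \<lfloor>b/d\<rfloor>}" by (rule imageE)
    hence k: "n = d * k" "nat \<lfloor>a/d\<rfloor> < k" "k \<le> nat \<lfloor>b/d\<rfloor>" by (simp_all only: greaterThanAtMost_iff)
    have "0 \<le> a/d" "0 \<le> b/d" using assms by auto
    hence "a/d < k" "k \<le> b/d" using k by linarith+
    thus "n \<in> ?S" using k assms by (simp add: field_simps)
  qed
  have "card ?S = nat \<lfloor>b/d\<rfloor> - nat \<lfloor>a/d\<rfloor>"
    unfolding S by (subst card_image) (use assms in \<open>auto simp: inj_on_def\<close>)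
  moreover have "0 \<le> a/d" "a/d \<le> b/d" using assms by (auto simp: divide_right_mono)
  ultimately have "real (card ?S) = of_int \<lfloor>b/d\<rfloor> - of_int \<lfloor>a/d\<rfloor>"
    by (simp add: floor_mono nat_mono of_nat_diff)
  thus "real (card ?S) \<le> (b - a) / d + 1" "real (card ?S) \<ge> (b - a) / d - 1"
    unfolding diff_divide_distrib by linarith+
  show "finite ?S" unfolding S by simp
qed

text \<open>The Moebius function on squarefree arguments, the only ones at which the sieve evaluates
  it; elsewhere it does not vanish, which spares a case distinction.\<close>

definition sqf_sign :: "nat \<Rightarrow> real" where
  "sqf_sign n = (-1) ^ card (prime_factors n)"

lemma sqf_sign_prime_mult:
  assumes "prime p" "\<not> p dvd n" "n > 0"
  shows "sqf_sign (p * n) = - sqf_sign n"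
proof -
  have "prime_factors (p * n) = insert p (prime_factors n)"
    using assms by (subst prime_factors_product) (auto simp: prime_prime_factors)
  moreover have "p \<notin> prime_factors n" using assms by (auto simp: prime_factors_dvd)
  ultimately show ?thesis by (simp add: sqf_sign_def)
qed

lemma sqf_sign_sq: "sqf_sign n ^ 2 = 1"
  by (simp add: sqf_sign_def flip: power_mult)

lemma abs_sqf_sign: "\<bar>sqf_sign n\<bar> = 1"
  by (simp add: sqf_sign_def power_abs)

text \<open>Toggling a prime p that divides k/j is a sign-reversing involution of the divisors
  between j and k. Squarefreeness of k keeps p out of j, so the toggled divisor is still a multiple
  of j.\<close>

lemma sum_sqf_sign_between_eq_0:
  assumes "squarefree k" "j dvd k" "j \<noteq> k"
  shows "(\<Sum>d | j dvd d \<and> d dvd k. sqf_sign d) = 0"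
proof -
  have k0: "k > 0" using assms by (metis not_squarefree_0 gr0I)
  obtain m where m: "k = j * m" using assms by auto
  with assms k0 have "m \<noteq> 1" "m > 0" by auto
  then obtain p where p: "prime p" "p dvd m" by (metis prime_factor_nat)
  have sqd: "\<not> p ^ 2 dvd k" using assms(1) p squarefreeD[of k p] by auto
  have pj: "\<not> p dvd j" using sqd p m by (metis dvd_mult_cancel_left mult_dvd_mono power2_eq_square)
  have pk: "p dvd k" using m p by auto
  let ?D = "{d. j dvd d \<and> d dvd k}"
  have fin: "finite ?D" using k0 by (rule_tac finite_subset[of _ "{..k}"]) (auto dest: dvd_imp_le)
  define i where "i d = (if p dvd d then d div p else p * d)" for d
  have cop: "coprime p j" using p pj by (simp add: prime_imp_coprime)
  have iD: "i d \<in> ?D \<and> i (i d) = d \<and> sqf_sign (i d) = - sqf_sign d" if d: "d \<in> ?D" for d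
  proof (cases "p dvd d")
    case True
    then obtain e where e: "d = p * e" by auto
    have p0: "p > 0" using p by (simp add: prime_gt_0_nat)
    have npe: "\<not> p dvd e" using d sqd e by (metis (no_types, lifting) dvd_trans mem_Collect_eq mult_dvd_mono dvd_refl power2_eq_square)
    have ie: "i d = e" using e p0 by (simp add: i_def)
    have e0: "e > 0" using d k0 e by (auto intro!: Nat.gr0I)
    have "j dvd e" using d e cop by (metis coprime_commute coprime_dvd_mult_right_iff mem_Collect_eq)
    moreover have "e dvd k" using d e by auto
    moreover have "i e = d" using npe e by (simp add: i_def)
    ultimately show ?thesis using ie e sqf_sign_prime_mult[OF p(1) npe e0] by auto
  next
    case False
    have p0: "p > 0" using p by (simp add: prime_gt_0_nat)
    have "d > 0" using d k0 by (auto intro!: Nat.gr0I)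
    moreover have "coprime p d" using p False by (simp add: prime_imp_coprime)
    hence "p * d dvd k" using pk d by (auto intro: divides_mult)
    ultimately show ?thesis using d False p0 sqf_sign_prime_mult[OF p(1) False] by (auto simp: i_def)
  qed
  have "sum sqf_sign ?D = (\<Sum>d\<in>?D. - sqf_sign d)"
    by (rule sum.reindex_bij_witness[of _ i i]) (use iD in auto)
  thus ?thesis by (simp add: sum_negf)
qed

lemma sum_inverse_squares_le: "(\<Sum>m=1..n. 1 / real m ^ 2) \<le> 2"
proof -
  have *: "(\<Sum>m=1..n. 1 / real m ^ 2) \<le> 2 - 1 / real n" if "n \<ge> 1" for n
    using that
  proof (induction n rule: dec_induct)
    case (step n)
    have "1 / real (Suc n) ^ 2 \<le> 1 / real n - 1 / real (Suc n)"
    proof -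
      have "1 / real (Suc n) ^ 2 \<le> 1 / (real n * real (Suc n))"
        using step by (intro divide_left_mono) (auto simp: power2_eq_square)
      also have "\<dots> = 1 / real n - 1 / real (Suc n)" using step by (simp add: field_simps)
      finally show ?thesis .
    qed
    thus ?case using step by simp
  qed simp
  show ?thesis
  proof (cases "n \<ge> 1")
    case True
    have "2 - 1 / real n \<le> 2" by simp
    with *[OF True] show ?thesis by linarith
  qed (simp add: not_le)
qed

definition sqf_upto :: "nat \<Rightarrow> nat set" where
  "sqf_upto z = {k. 1 \<le> k \<and> k \<le> z \<and> squarefree k}"

lemma finite_sqf_upto [simp]: "finite (sqf_upto z)"
  by (rule finite_subset[of _ "{..z}"]) (auto simp: sqf_upto_def)

text \<open>Writing n = k m^2 with k squarefree bounds the harmonic sum by the product of this sum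
  with that of 1/m^2, which is at most 2; hence the factor 1/2.\<close>

lemma sum_inverse_sqf_upto_ge:
  assumes "z \<ge> 1"
  shows "(\<Sum>k\<in>sqf_upto z. 1 / real k) \<ge> ln z / 2"
proof -
  have "ln (real z) \<le> ln (real z + 1)" using assms by simp
  also have "\<dots> \<le> harm z" using ln_le_harm[of z] by (simp add: add.commute)
  also have "harm z = (\<Sum>n\<in>{1..z}. 1 / real n)" by (simp add: harm_def inverse_eq_divide)
  also have "\<dots> = (\<Sum>n\<in>{1..z}. 1 / (real (squarefree_part n) * real (square_part n) ^ 2))"
  proof (rule sum.cong)
    fix n assume "n \<in> {1..z}"
    have "real n = real (squarefree_part n * square_part n ^ 2)" using squarefree_decompose[of n] by simp
    thus "1 / real n = 1 / (real (squarefree_part n) * real (square_part n) ^ 2)" by simp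
  qed simp
  also have "\<dots> = (\<Sum>(k,m)\<in>(\<lambda>n. (squarefree_part n, square_part n)) ` {1..z}. 1 / (real k * real m ^ 2))"
    by (subst sum.reindex) (auto simp: inj_on_def intro: squarefree_decompose[THEN trans] | metis squarefree_decompose)+
  also have "\<dots> \<le> (\<Sum>(k,m)\<in>sqf_upto z \<times> {1..z}. 1 / (real k * real m ^ 2))"
  proof (rule sum_mono2)
    show "(\<lambda>n. (squarefree_part n, square_part n)) ` {1..z} \<subseteq> sqf_upto z \<times> {1..z}"
    proof (clarsimp simp: sqf_upto_def)
      fix n assume n: "Suc 0 \<le> n" "n \<le> z"
      have d: "squarefree_part n dvd n" by (subst (2) squarefree_decompose) auto
      have d2: "square_part n dvd n" by (subst (2) squarefree_decompose) auto
      have "squarefree_part n > 0" "square_part n > 0" using n by (auto intro!: Nat.gr0I)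
      thus "Suc 0 \<le> squarefree_part n \<and> squarefree_part n \<le> z \<and> Suc 0 \<le> square_part n \<and> square_part n \<le> z"
        using dvd_imp_le[OF d] dvd_imp_le[OF d2] n by auto
    qed
  qed auto
  also have "\<dots> = (\<Sum>k\<in>sqf_upto z. 1 / real k) * (\<Sum>m\<in>{1..z}. 1 / real m ^ 2)"
    by (simp add: sum_product sum.cartesian_product)
  also have "\<dots> \<le> (\<Sum>k\<in>sqf_upto z. 1 / real k) * 2"
    by (intro mult_left_mono sum_inverse_squares_le sum_nonneg) auto
  finally show ?thesis by simp
qed

text \<open>Selberg's sieve with \<open>\<lambda>\<^sub>d = \<mu>(d) d \<Sum>\<^bsub>d|k\<le>z\<^esub> \<mu>\<^sup>2(k)/k\<close>: not quite the optimal weights, but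
  the diagonalised form stays explicit.\<close>

lemma card_primes_Ioc_sieve:
  fixes a H :: real and z :: nat
  assumes a: "0 \<le> a" and H: "0 \<le> H" and z: "z \<ge> 1"
  defines "G \<equiv> (\<Sum>k\<in>sqf_upto z. 1 / real k)"
  shows "real (card {p. prime p \<and> z < p \<and> a < real p \<and> real p \<le> a + H}) \<le> H / G + real z ^ 4"
proof -
  let ?K = "sqf_upto z"
  define lam where "lam d = sqf_sign d * real d * (\<Sum>k\<in>{k\<in>?K. d dvd k}. 1 / real k)" for d
  let ?I = "{n::nat. a < real n \<and> real n \<le> a + H}"
  have finI: "finite ?I" using card_multiples_Ioc(3)[of a "a+H" 1] a H by simp
  have one_K: "1 \<in> ?K" using z by (auto simp: sqf_upto_def)
  have G1: "G \<ge> 1"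
    unfolding G_def using member_le_sum[of 1 ?K "\<lambda>k. 1 / real k"] one_K by simp
  define S where "S n = (\<Sum>d\<in>{d\<in>?K. d dvd n}. lam d)" for n
  \<comment> \<open>A prime above z has 1 as its only divisor in \<open>sqf_upto z\<close>, so the
    majorant \<open>S n ^ 2\<close> equals \<open>G ^ 2\<close> there. Dividing by
    \<open>G ^ 2\<close> at the end replaces the usual normalisation of the weight at 1.\<close>
  have S_prime: "S p = G" if "prime p" "z < p" for p
  proof -
    have "{d\<in>?K. d dvd p} = {1}"
      using that one_K by (auto simp: sqf_upto_def prime_nat_iff)
    thus ?thesis by (simp add: S_def lam_def G_def sqf_sign_def)
  qed
  have dvdK: "d \<in> ?K" if "k \<in> ?K" "d dvd k" for k d
    using that squarefree_mono[of d k] by (auto simp: sqf_upto_def dest: dvd_imp_le intro!: Suc_leI Nat.gr0I)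
  \<comment> \<open>Moebius inversion over the multiples of j: once the sums are exchanged,
    \<open>sum_sqf_sign_between_eq_0\<close> leaves only k = j.\<close>
  have diag: "(\<Sum>d\<in>{d\<in>?K. j dvd d}. lam d / d) = sqf_sign j / j" if j: "j \<in> ?K" for j
  proof -
    have "(\<Sum>d\<in>{d\<in>?K. j dvd d}. lam d / d) = (\<Sum>d\<in>{d\<in>?K. j dvd d}. \<Sum>k\<in>{k\<in>?K. d dvd k}. sqf_sign d / k)"
    proof (rule sum.cong)
      fix d assume "d \<in> {d\<in>?K. j dvd d}"
      hence "real d > 0" by (auto simp: sqf_upto_def)
      hence "lam d / d = sqf_sign d * (\<Sum>k\<in>{k\<in>?K. d dvd k}. 1 / real k)" by (simp add: lam_def)
      thus "lam d / d = (\<Sum>k\<in>{k\<in>?K. d dvd k}. sqf_sign d / k)" by (simp add: sum_distrib_left)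
    qed simp
    also have "\<dots> = (\<Sum>k\<in>?K. \<Sum>d\<in>{d\<in>?K. j dvd d \<and> d dvd k}. sqf_sign d / k)"
      by (subst sum.swap_restrict) (auto intro!: sum.cong)
    also have "\<dots> = (\<Sum>k\<in>?K. if k = j then sqf_sign j / j else 0)"
    proof (rule sum.cong)
      fix k assume k: "k \<in> ?K"
      have "{d\<in>?K. j dvd d \<and> d dvd k} = {d. j dvd d \<and> d dvd k}" using dvdK[OF k] by auto
      moreover have "(\<Sum>d\<in>{d. j dvd d \<and> d dvd k}. sqf_sign d / k) = (if k = j then sqf_sign j / j else 0)"
      proof (cases "k = j")
        case True
        hence "{d. j dvd d \<and> d dvd k} = {j}" by (auto intro: dvd_antisym)
        thus ?thesis using True by simp
      next
        case False
        show ?thesis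
        proof (cases "j dvd k")
          case True
          have "(\<Sum>d | j dvd d \<and> d dvd k. sqf_sign d) = 0"
            by (rule sum_sqf_sign_between_eq_0) (use k True False in \<open>auto simp: sqf_upto_def\<close>)
          thus ?thesis using False by (simp flip: sum_divide_distrib)
        next
          case F2: False
          hence "{d. j dvd d \<and> d dvd k} = {}" by (auto dest: dvd_trans)
          thus ?thesis using False by (simp only: sum.empty if_False)
        qed
      qed
      ultimately show "(\<Sum>d\<in>{d\<in>?K. j dvd d \<and> d dvd k}. sqf_sign d / k) = (if k = j then sqf_sign j / j else 0)"
        by simp
    qed simp
    also have "\<dots> = sqf_sign j / j" using j by simp
    finally show ?thesis .
  qed
  \<comment> \<open>Since 1/lcm(d, e) = gcd(d, e)/(d e) and the gcd is the sum of
    \<open>totient j\<close> over common divisors j, the form is diagonal in the sums of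
    \<open>diag\<close>. It becomes the sum of \<open>totient j\<close> / j^2, at most G.\<close>
  have form: "(\<Sum>d\<in>?K. \<Sum>e\<in>?K. lam d * lam e / lcm d e) \<le> G"
  proof -
    have "(\<Sum>d\<in>?K. \<Sum>e\<in>?K. lam d * lam e / lcm d e)
        = (\<Sum>d\<in>?K. \<Sum>e\<in>?K. \<Sum>j\<in>?K. if j dvd d \<and> j dvd e then totient j * (lam d / d) * (lam e / e) else 0)"
    proof (intro sum.cong refl)
      fix d e assume de: "d \<in> ?K" "e \<in> ?K"
      hence pos: "d > 0" "e > 0" by (auto simp: sqf_upto_def)
      have "real (gcd d e) = (\<Sum>j | j dvd gcd d e. real (totient j))"
        using totient_divisor_sum[of "gcd d e"] by (metis of_nat_sum)
      also have "{j. j dvd gcd d e} = {j\<in>?K. j dvd d \<and> j dvd e}" using dvdK[OF de(1)] by auto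
      also have "(\<Sum>j\<in>\<dots>. real (totient j)) = (\<Sum>j\<in>?K. if j dvd d \<and> j dvd e then real (totient j) else 0)"
        by (simp add: sum.inter_filter)
      finally have g: "real (gcd d e) = \<dots>" .
      have "real (lcm d e) * real (gcd d e) = real d * real e"
        by (metis lcm_mult_gcd of_nat_mult normalize_nat_def id_apply)
      hence "1 / real (lcm d e) = real (gcd d e) / (real d * real e)"
        using pos by (simp add: field_simps)
      hence "lam d * lam e / lcm d e = real (gcd d e) * ((lam d / d) * (lam e / e))"
        by (simp add: divide_inverse mult_ac)
      also have "\<dots> = (\<Sum>j\<in>?K. if j dvd d \<and> j dvd e then totient j * (lam d / d) * (lam e / e) else 0)"
        unfolding g sum_distrib_right by (intro sum.cong) auto
      finally show "lam d * lam e / lcm d e = \<dots>" .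
    qed
    also have "\<dots> = (\<Sum>d\<in>?K. \<Sum>j\<in>?K. \<Sum>e\<in>?K. if j dvd d \<and> j dvd e then totient j * (lam d / d) * (lam e / e) else 0)"
      by (intro sum.cong refl sum.swap)
    also have "\<dots> = (\<Sum>j\<in>?K. \<Sum>d\<in>?K. \<Sum>e\<in>?K. if j dvd d \<and> j dvd e then totient j * (lam d / d) * (lam e / e) else 0)"
      by (rule sum.swap)
    also have "\<dots> = (\<Sum>j\<in>?K. real (totient j) * (\<Sum>d\<in>{d\<in>?K. j dvd d}. lam d / d) ^ 2)"
    proof (intro sum.cong refl)
      fix j
      have *: "(\<Sum>d\<in>{d\<in>?K. j dvd d}. lam d / d) = (\<Sum>d\<in>?K. if j dvd d then lam d / d else 0)"
        by (simp add: sum.inter_filter)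
      show "(\<Sum>d\<in>?K. \<Sum>e\<in>?K. if j dvd d \<and> j dvd e then totient j * (lam d / d) * (lam e / e) else 0)
         = real (totient j) * (\<Sum>d\<in>{d\<in>?K. j dvd d}. lam d / d) ^ 2"
      proof -
        define t where "t d = (if j dvd d then lam d / d else 0)" for d
        have "(\<Sum>d\<in>?K. \<Sum>e\<in>?K. if j dvd d \<and> j dvd e then totient j * (lam d / d) * (lam e / e) else 0)
          = (\<Sum>d\<in>?K. \<Sum>e\<in>?K. real (totient j) * (t d * t e))"
          by (intro sum.cong refl) (simp add: t_def)
        also have "\<dots> = real (totient j) * (sum t ?K) ^ 2"
          unfolding power2_eq_square sum_product by (simp only: sum_distrib_left)
        finally show ?thesis unfolding * t_def .
      qed
    qed
    also have "\<dots> = (\<Sum>j\<in>?K. real (totient j) * (1 / real j ^ 2))"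
      by (intro sum.cong refl, subst diag) (auto simp: power_divide sqf_sign_sq)
    also have "\<dots> \<le> (\<Sum>j\<in>?K. 1 / real j)"
    proof (intro sum_mono)
      fix j assume "j \<in> ?K"
      hence "j > 0" by (auto simp: sqf_upto_def)
      moreover have "real (totient j) \<le> j" using totient_le[of j] by simp
      ultimately show "real (totient j) * (1 / real j ^ 2) \<le> 1 / real j"
        by (simp add: field_simps power2_eq_square)
    qed
    finally show ?thesis by (simp add: G_def)
  qed
  have lam_le: "\<bar>lam d\<bar> \<le> z * G" if "d \<in> ?K" for d
  proof -
    have "\<bar>lam d\<bar> = real d * (\<Sum>k\<in>{k\<in>?K. d dvd k}. 1 / real k)"
      by (simp add: lam_def abs_mult abs_sqf_sign sum_nonneg)
    also have "\<dots> \<le> z * G" unfolding G_def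
      by (intro mult_mono sum_mono2 sum_nonneg) (use that in \<open>auto simp: sqf_upto_def\<close>)
    finally show ?thesis .
  qed
  have cardK: "card ?K \<le> z"
  proof -
    have "?K \<subseteq> {1..z}" by (auto simp: sqf_upto_def)
    from card_mono[OF _ this] show ?thesis by simp
  qed
  \<comment> \<open>Controls the remainders: each count of multiples is off by at most 1, so the
    total error is at most the square of this sum.\<close>
  have sum_lam: "(\<Sum>d\<in>?K. \<bar>lam d\<bar>) \<le> real z ^ 2 * G"
  proof -
    have "(\<Sum>d\<in>?K. \<bar>lam d\<bar>) \<le> card ?K * (z * G)" using lam_le by (intro sum_bounded_above) auto
    also have "\<dots> \<le> real z * (z * G)" using cardK G1 by (intro mult_right_mono) auto
    finally show ?thesis by (simp add: power2_eq_square)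
  qed
  let ?P = "{p. prime p \<and> z < p \<and> a < real p \<and> real p \<le> a + H}"
  have "real (card ?P) * G ^ 2 = (\<Sum>p\<in>?P. S p ^ 2)" using S_prime by simp
  also have "\<dots> \<le> (\<Sum>n\<in>?I. S n ^ 2)" by (intro sum_mono2 finI) auto
  also have "\<dots> = (\<Sum>n\<in>?I. \<Sum>d\<in>?K. \<Sum>e\<in>?K. if d dvd n \<and> e dvd n then lam d * lam e else 0)"
  proof (intro sum.cong refl)
    fix n
    have "S n = (\<Sum>d\<in>?K. if d dvd n then lam d else 0)" by (simp add: S_def sum.inter_filter)
    thus "S n ^ 2 = (\<Sum>d\<in>?K. \<Sum>e\<in>?K. if d dvd n \<and> e dvd n then lam d * lam e else 0)"
      by (simp add: power2_eq_square sum_product) (intro sum.cong; auto)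
  qed
  also have "\<dots> = (\<Sum>d\<in>?K. \<Sum>e\<in>?K. \<Sum>n\<in>?I. if d dvd n \<and> e dvd n then lam d * lam e else 0)"
    by (subst sum.swap) (intro sum.cong refl sum.swap)
  also have "\<dots> \<le> (\<Sum>d\<in>?K. \<Sum>e\<in>?K. lam d * lam e * (H / lcm d e) + \<bar>lam d\<bar> * \<bar>lam e\<bar>)"
  proof (intro sum_mono)
    fix d e assume de: "d \<in> ?K" "e \<in> ?K"
    have l0: "lcm d e > 0" using de by (auto simp: sqf_upto_def lcm_pos_nat)
    let ?c = "real (card {n. a < real n \<and> real n \<le> a + H \<and> lcm d e dvd n})"
    have "(\<Sum>n\<in>?I. if d dvd n \<and> e dvd n then lam d * lam e else 0) = (\<Sum>n\<in>{n\<in>?I. d dvd n \<and> e dvd n}. lam d * lam e)"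
      by (rule sum.inter_filter[symmetric, OF finI])
    also have "{n\<in>?I. d dvd n \<and> e dvd n} = {n. a < real n \<and> real n \<le> a + H \<and> lcm d e dvd n}" by auto
    also have "(\<Sum>n\<in>\<dots>. lam d * lam e) = ?c * (lam d * lam e)" by simp
    also have "\<dots> = lam d * lam e * (H / lcm d e) + (?c - H / lcm d e) * (lam d * lam e)" by (simp add: algebra_simps)
    also have "(?c - H / lcm d e) * (lam d * lam e) \<le> \<bar>?c - H / lcm d e\<bar> * \<bar>lam d * lam e\<bar>"
      by (simp flip: abs_mult)
    also have "\<bar>?c - H / lcm d e\<bar> * \<bar>lam d * lam e\<bar> \<le> 1 * \<bar>lam d * lam e\<bar>"
    proof (rule mult_right_mono)
      have "a \<le> a + H" using H by simp
      from card_multiples_Ioc(1,2)[OF a this l0, unfolded add_diff_cancel_left'] show "\<bar>?c - H / lcm d e\<bar> \<le> 1" by linarith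
    qed simp
    finally show "(\<Sum>n\<in>?I. if d dvd n \<and> e dvd n then lam d * lam e else 0) \<le> lam d * lam e * (H / lcm d e) + \<bar>lam d\<bar> * \<bar>lam e\<bar>"
      by (simp only: abs_mult mult_1_left)
  qed
  also have "\<dots> = H * (\<Sum>d\<in>?K. \<Sum>e\<in>?K. lam d * lam e / lcm d e) + (\<Sum>d\<in>?K. \<bar>lam d\<bar>) ^ 2"
    by (simp add: sum.distrib sum_distrib_left power2_eq_square sum_product mult_ac)
  also have "\<dots> \<le> H * G + (real z ^ 2 * G) ^ 2"
    using form H sum_lam by (intro add_mono mult_left_mono power_mono sum_nonneg) auto
  also have "H * G + (real z ^ 2 * G) ^ 2 = (H / G + real z ^ 4) * G ^ 2"
  proof -
    have "H / G * G ^ 2 = H * G" using G1 by (simp add: power2_eq_square)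
    thus ?thesis by (simp add: distrib_right power_mult_distrib)
  qed
  finally have "real (card ?P) * G ^ 2 \<le> (H / G + real z ^ 4) * G ^ 2" .
  moreover have "G ^ 2 > 0" using G1 by simp
  ultimately show ?thesis by (rule mult_right_le_imp_le)
qed

section \<open>Brun-Titchmarsh and Chebyshev bounds\<close>

lemma ln_le_two_sqrt:
  assumes "x > 0" shows "ln x \<le> 2 * sqrt x"
proof -
  have "ln (sqrt x) \<le> sqrt x - 1" using assms by (intro ln_le_minus_one) auto
  thus ?thesis using assms by (simp add: ln_sqrt)
qed

lemma finite_primes_le_real [simp]: "finite {p::nat. prime p \<and> real p \<le> y}"
  by (rule finite_subset[of _ "{..nat \<lfloor>y\<rfloor>}"]) (auto simp: le_nat_floor)

theorem brun_titchmarsh: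
  fixes a H :: real
  assumes a: "0 \<le> a" and H: "1 < H"
  shows "real (card {p. prime p \<and> a < real p \<and> real p \<le> a + H}) \<le> 60 * H / ln H"
proof -
  \<comment> \<open>With z near H^(1/8) the sieve error \<open>z ^ 4\<close> is of order
    \<open>sqrt H\<close>, negligible against H / ln H, while G is still at least ln H / 16. The
    primes up to z escape the sieve and are counted trivially.\<close>
  define w where "w = H powr (1/8)"
  define z where "z = nat \<lceil>w\<rceil>"
  have w1: "w > 1" using H by (simp add: w_def)
  hence zw: "w \<le> z" "real z \<le> 2 * w" unfolding z_def by linarith+
  have z1: "z \<ge> 1" using zw w1 by linarith
  define G where "G = (\<Sum>k\<in>sqf_upto z. 1 / real k)"
  have lnH: "ln H > 0" using H by simp
  have "ln H / 16 = ln w / 2" using H by (simp add: w_def ln_powr)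
  also have "\<dots> \<le> ln z / 2" using zw w1 by simp
  also have "\<dots> \<le> G" unfolding G_def by (rule sum_inverse_sqf_upto_ge[OF z1])
  finally have GG: "ln H / 16 \<le> G" .
  let ?P = "{p. prime p \<and> a < real p \<and> real p \<le> a + H}"
  let ?Q = "{p. prime p \<and> z < p \<and> a < real p \<and> real p \<le> a + H}"
  have fin: "finite ?Q" by (rule finite_subset[OF _ finite_primes_le_real[of "a+H"]]) auto
  have "card ?P \<le> card (?Q \<union> {1..z})"
    by (rule card_mono) (use fin in \<open>auto dest: prime_gt_0_nat simp: not_less\<close>)
  also have "\<dots> \<le> card ?Q + z" using card_Un_le[of ?Q "{1..z}"] by simp
  finally have "real (card ?P) \<le> real (card ?Q) + z" by linarith
  also have "\<dots> \<le> H / G + real z ^ 4 + z"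
    using card_primes_Ioc_sieve[OF a _ z1, of H] H by (simp add: G_def)
  finally have 1: "real (card ?P) \<le> H / G + real z ^ 4 + z" .
  have 2: "H / G \<le> 16 * H / ln H" 
  proof -
    have G0: "G > 0" using GG lnH by linarith
    have "H / G \<le> H / (ln H / 16)"
      by (rule divide_left_mono[OF GG]) (use G0 lnH H in \<open>auto intro: mult_pos_pos\<close>)
    thus ?thesis by (simp add: mult.commute)
  qed
  have 3: "real z ^ 4 + z \<le> 18 * sqrt H"
  proof -
    have "w ^ 4 = w powr 4" using w1 by (subst powr_numeral) auto
    also have "\<dots> = H powr (1/2)" unfolding w_def by (subst powr_powr) simp
    finally have w4: "w ^ 4 = sqrt H" using H by (simp add: powr_half_sqrt)
    have "real z ^ 4 \<le> (2 * w) ^ 4" using zw by (intro power_mono) auto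
    also have "\<dots> = 16 * sqrt H" using w4 by (simp add: power_mult_distrib)
    finally have 1: "real z ^ 4 \<le> 16 * sqrt H" .
    have "w \<le> w ^ 4" using w1 power_increasing[of 1 4 w] by simp
    thus ?thesis using 1 zw w4 by linarith
  qed
  have 4: "18 * sqrt H \<le> 36 * H / ln H"
  proof -
    have "18 * sqrt H * ln H \<le> 18 * sqrt H * (2 * sqrt H)"
      using ln_le_two_sqrt[of H] H by (intro mult_left_mono) auto
    also have "\<dots> = 36 * H" using H by simp
    finally show ?thesis using lnH by (simp add: field_simps)
  qed
  have "real (card ?P) \<le> 16 * H / ln H + 36 * H / ln H" using 1 2 3 4 by linarith
  also have "\<dots> \<le> 60 * H / ln H" using lnH H by (simp add: field_simps)
  finally show ?thesis .
qed

definition theta :: "real \<Rightarrow> real" where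
  "theta y = (\<Sum>p | prime p \<and> real p \<le> y. ln (real p))"

text \<open>Chebyshev's bound, read off from Brun-Titchmarsh on (0, y]. The absolute value covers
  negative y, where the sum is empty.\<close>

lemma theta_le: "theta y \<le> 60 * \<bar>y\<bar>"
proof (cases "y \<ge> 2")
  case True
  have "theta y \<le> real (card {p::nat. prime p \<and> real p \<le> y}) * ln y"
    unfolding theta_def by (intro sum_bounded_above) (auto dest: prime_gt_0_nat)
  also have "{p::nat. prime p \<and> real p \<le> y} = {p. prime p \<and> 0 < real p \<and> real p \<le> 0 + y}"
    by (auto dest: prime_gt_0_nat)
  also have "real (card \<dots>) * ln y \<le> 60 * y / ln y * ln y"
    using True by (intro mult_right_mono brun_titchmarsh) auto
  finally show ?thesis using True by simp
next
  case False
  have "{p::nat. prime p \<and> real p \<le> y} = {}" using False by (auto dest: prime_ge_2_nat)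
  thus ?thesis unfolding theta_def by (simp only: sum.empty)
qed

text \<open>The interval has length u/(l+1), which exceeds u^(1/4) because l is at most
  \<open>sqrt u\<close>. Hence the logarithm in the denominator of Brun-Titchmarsh is at least ln u
  / 4 and cancels the weight ln p \<le> ln u; the constant is 60 * 4.\<close>

lemma sum_ln_primes_short_le:
  fixes u l :: real
  assumes l: "l \<ge> 4" and u: "u \<ge> l ^ 2"
  shows "(\<Sum>p | prime p \<and> u / (1 + 1/l) < real p \<and> real p \<le> u. ln (real p)) \<le> 240 * u / l"
proof -
  define H where "H = u - u / (1 + 1/l)"
  have Heq: "H = u / (l + 1)" using l by (simp add: H_def field_simps)
  have l0: "l > 0" using l by simp
  have u16: "u \<ge> 16" using u l power_mono[of 4 l 2] by simp
  have su: "l \<le> sqrt u" using u l by (simp add: real_le_rsqrt)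
  have sq4: "sqrt u \<ge> 4" using su l by simp
  have "H \<ge> u / (sqrt u + sqrt u)" unfolding Heq using su l sq4 u16
    by (intro divide_left_mono mult_pos_pos) auto
  also have "u / (sqrt u + sqrt u) = sqrt u / 2" using u16 by (simp add: field_simps flip: power2_eq_square)
  also have "sqrt u / 2 \<ge> sqrt (sqrt u)"
  proof -
    have "2 \<le> sqrt (sqrt u)" by (rule real_le_rsqrt) (use sq4 in simp)
    hence "2 * sqrt (sqrt u) \<le> sqrt (sqrt u) * sqrt (sqrt u)"
      by (rule mult_right_mono) (use u16 in simp)
    moreover have "sqrt u \<ge> 0" using sq4 by linarith
    ultimately show ?thesis by simp
  qed
  finally have Hs: "H \<ge> sqrt (sqrt u)" .
  have "sqrt (sqrt u) > 1" using u16 by simp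
  hence H1: "H > 1" using Hs by (rule less_le_trans)
  have "ln (sqrt (sqrt u)) \<le> ln H" using Hs H1 \<open>sqrt (sqrt u) > 1\<close> by (subst ln_le_cancel_iff) linarith+
  hence lnH: "ln u / 4 \<le> ln H" using u16 by (simp add: ln_sqrt)
  have lnu: "ln u > 0" using u16 by simp
  have "(\<Sum>p | prime p \<and> u / (1 + 1/l) < real p \<and> real p \<le> u. ln (real p))
      \<le> real (card {p. prime p \<and> u / (1 + 1/l) < real p \<and> real p \<le> u}) * ln u"
    by (intro sum_bounded_above) (auto dest: prime_gt_0_nat)
  also have "{p. prime p \<and> u / (1 + 1/l) < real p \<and> real p \<le> u}
     = {p. prime p \<and> u / (1 + 1/l) < real p \<and> real p \<le> u / (1 + 1/l) + H}" by (simp add: H_def)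
  also have "real (card \<dots>) * ln u \<le> 60 * H / ln H * ln u"
    using l u16 H1 by (intro mult_right_mono brun_titchmarsh) auto
  also have "\<dots> = 60 * H * (ln u / ln H)" by simp
  also have "ln u / ln H \<le> 4" using lnH lnu by (simp add: field_simps)
  hence "60 * H * (ln u / ln H) \<le> 60 * H * 4" using H1 by (intro mult_left_mono) auto
  also have "\<dots> \<le> 240 * u / l" unfolding Heq using l u16 by (simp add: field_simps)
  finally show ?thesis by (simp add: H_def)
qed

section \<open>Exponential multiplicative functions\<close>

text \<open>The values \<open>a p 0\<close> are never read, so \<open>a p 0 = 1\<close> becomes a
  hypothesis wherever a possibly trivial prime power is split off. As \<open>prime_factors 0\<close>
  is empty, the value at 0 is 1.\<close>

definition mulfun :: "(nat \<Rightarrow> nat \<Rightarrow> 'a::comm_monoid_mult) \<Rightarrow> nat \<Rightarrow> 'a" where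
  "mulfun a n = (\<Prod>p\<in>prime_factors n. a p (multiplicity p n))"

lemma mulfun_1 [simp]: "mulfun a 1 = 1" "mulfun a (Suc 0) = 1"
  by (simp_all add: mulfun_def)

lemma norm_mulfun:
  "norm (mulfun a n :: 'a::{real_normed_field}) = mulfun (\<lambda>p k. norm (a p k)) n"
  by (simp add: mulfun_def prod_norm)

lemma mulfun_nonneg:
  "(\<And>p k. a p k \<ge> 0) \<Longrightarrow> mulfun a n \<ge> (0 :: real)"
  by (simp add: mulfun_def prod_nonneg)

lemma mulfun_prime_power_mult:
  assumes "prime p" "\<not> p dvd m" "a p 0 = 1"
  shows "mulfun a (p ^ k * m) = a p k * mulfun a m"
proof (cases "k = 0 \<or> m = 0")
  case False
  hence k: "k > 0" and m: "m > 0" by auto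
  have pf: "prime_factors (p ^ k * m) = insert p (prime_factors m)"
    using assms k m by (subst prime_factors_product) (auto simp: prime_prime_factors prime_factors_power)
  have np: "p \<notin> prime_factors m" using assms by (auto simp: prime_factors_dvd)
  have 1: "multiplicity p (p ^ k * m) = k"
    using assms m by (simp add: prime_elem_multiplicity_mult_distrib not_dvd_imp_multiplicity_0)
  have 2: "multiplicity q (p ^ k * m) = multiplicity q m" if "q \<in> prime_factors m" for q
  proof -
    have "q \<noteq> p" "prime q" using that np by auto
    thus ?thesis using assms m
      by (cases "m = 0") (simp_all add: prime_elem_multiplicity_mult_distrib multiplicity_distinct_prime_power)
  qed
  show ?thesis unfolding mulfun_def pf using np 1 2 by simp
qed (use assms in auto)

lemma prime_power_decompE:
  fixes n :: nat
  assumes "n > 0" "prime p"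
  obtains k m where "n = p ^ k * m" "\<not> p dvd m" "m > 0" "k = multiplicity p n"
proof -
  obtain m where m: "n = p ^ multiplicity p n * m" "\<not> p dvd m"
    using assms multiplicity_decompose'[of n p] by (metis bot_nat_0.not_eq_extremum not_prime_unit)
  with assms that[of "multiplicity p n" m] show ?thesis by auto
qed

lemma nat_prime_power_induct [consumes 1, case_names one step]:
  fixes n :: nat
  assumes "n > 0"
    and one: "P 1"
    and step: "\<And>p k m. prime p \<Longrightarrow> k > 0 \<Longrightarrow> m > 0 \<Longrightarrow> \<not> p dvd m \<Longrightarrow> P m \<Longrightarrow> P (p ^ k * m)"
  shows "P n"
  using \<open>n > 0\<close>
proof (induction n rule: less_induct)
  case (less n)
  show ?case
  proof (cases "n = 1")
    case False
    then obtain p where p: "prime p" "p dvd n" by (metis prime_factor_nat)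
    obtain k m where km: "n = p ^ k * m" "\<not> p dvd m" "m > 0" "k = multiplicity p n"
      using prime_power_decompE[OF \<open>n > 0\<close> p(1)] by blast
    have k: "k > 0" using km p by (cases k) auto
    have "1 < p ^ k" using p k by (metis one_less_power prime_gt_1_nat)
    hence "m < n" using km(3) by (subst km(1)) simp
    hence "P (p ^ k * m)" using less.IH[of m] step[OF p(1) k km(3,2)] km(3) by blast
    thus ?thesis by (simp flip: km(1))
  qed (use one in simp)
qed

section \<open>Dirichlet convolution and Euler product bounds\<close>

lemma bij_betw_divisors_prime_power_mult:
  assumes p: "prime p" and "\<not> p dvd m" "m > (0::nat)"
  shows "bij_betw (\<lambda>(j,d). p ^ j * d) ({..k} \<times> {d. d dvd m}) {d. d dvd p ^ k * m}"
proof (rule bij_betwI')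
  fix x y assume "x \<in> {..k} \<times> {d. d dvd m}" "y \<in> {..k} \<times> {d. d dvd m}"
  then obtain j d j' d' where xy: "x = (j,d)" "y = (j',d')" "d dvd m" "d' dvd m" by auto
  have nd: "\<not> p dvd d" "\<not> p dvd d'" using xy assms by (auto dest: dvd_trans)
  have mu: "multiplicity p (p ^ j * d) = j" if "\<not> p dvd d" for j d
    using p that by (cases "d = 0") (auto simp: prime_elem_multiplicity_mult_distrib not_dvd_imp_multiplicity_0)
  have "j = j'" if "p ^ j * d = p ^ j' * d'" using mu[OF nd(1), of j] mu[OF nd(2), of j'] that by simp
  thus "((case x of (j,d) \<Rightarrow> p ^ j * d) = (case y of (j,d) \<Rightarrow> p ^ j * d)) = (x = y)"
    using xy p by (auto simp: prime_gt_0_nat)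
next
  fix x assume "x \<in> {..k} \<times> {d. d dvd m}"
  thus "(case x of (j,d) \<Rightarrow> p ^ j * d) \<in> {d. d dvd p ^ k * m}"
    by (auto intro!: mult_dvd_mono le_imp_power_dvd)
next
  fix y assume y: "y \<in> {d. d dvd p ^ k * m}"
  have m0: "p ^ k * m > 0" using assms by (simp add: prime_gt_0_nat)
  hence "y > 0" using y by (auto intro!: Nat.gr0I)
  then obtain j d where jd: "y = p ^ j * d" "\<not> p dvd d" using prime_power_decompE[OF _ p] by metis
  have dm: "coprime d (p ^ k)" using jd p by (metis coprime_commute coprime_power_left_iff prime_imp_coprime)
  have "d dvd p ^ k * m" using y jd by (metis dvd_mult_right mem_Collect_eq)
  hence 1: "d dvd m" using dm by (metis coprime_dvd_mult_right_iff)
  have "coprime (p ^ j) m" using assms by (metis coprime_power_left_iff prime_imp_coprime)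
  moreover have "p ^ j dvd p ^ k * m" using y jd by (metis dvd_mult_left mem_Collect_eq)
  ultimately have "p ^ j dvd p ^ k" by (metis coprime_dvd_mult_left_iff)
  hence "j \<le> k" using p by (metis power_dvd_imp_le prime_gt_1_nat)
  thus "\<exists>x\<in>{..k} \<times> {d. d dvd m}. y = (case x of (j,d) \<Rightarrow> p ^ j * d)" using 1 jd by auto
qed

text \<open>Divisors of p^k m factor uniquely as p^j d, so the divisor sum splits into a local
  factor and the sum for m: Dirichlet convolution amounts to multiplying the Bell series prime by
  prime.\<close>

lemma mulfun_convolution:
  fixes a b c :: "nat \<Rightarrow> nat \<Rightarrow> 'a::comm_ring_1"
  assumes "n > 0"
    and a0: "\<And>p. a p 0 = 1" and b0: "\<And>p. b p 0 = 1"
    and c: "\<And>p k. prime p \<Longrightarrow> p ^ k dvd n \<Longrightarrow> c p k = (\<Sum>j\<le>k. a p j * b p (k - j))"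
  shows "(\<Sum>d | d dvd n. mulfun a d * mulfun b (n div d)) = mulfun c n"
  using \<open>n > 0\<close> c
proof (induction n rule: nat_prime_power_induct)
  case (step p k m)
  have c0: "c p 0 = 1" using step.prems[of p 0] step.hyps a0 b0 by simp
  have p0: "p > 0" using step by (simp add: prime_gt_0_nat)
  have "(\<Sum>d | d dvd p ^ k * m. mulfun a d * mulfun b (p ^ k * m div d))
      = (\<Sum>(j,d)\<in>{..k} \<times> {d. d dvd m}. mulfun a (p ^ j * d) * mulfun b (p ^ k * m div (p ^ j * d)))"
    using sum.reindex_bij_betw[OF bij_betw_divisors_prime_power_mult[of p m k],
        where g = "\<lambda>d. mulfun a d * mulfun b (p ^ k * m div d)"] step.hyps by (simp add: case_prod_unfold)
  also have "\<dots> = (\<Sum>(j,d)\<in>{..k} \<times> {d. d dvd m}. (a p j * b p (k - j)) * (mulfun a d * mulfun b (m div d)))"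
  proof (rule sum.cong, simp, clarsimp)
    fix j d assume j: "j \<le> k" and d: "d dvd m"
    obtain e where e: "m = d * e" using d by auto
    have d0: "d > 0" using e step.hyps(3) by auto
    have nd: "\<not> p dvd d" "\<not> p dvd m div d" using e step.hyps(4) d0 by auto
    have "p ^ k * m = (p ^ j * d) * (p ^ (k - j) * e)"
      using j e by (metis (no_types, opaque_lifting) le_add_diff_inverse mult.assoc mult.left_commute power_add)
    moreover have "p ^ j * d > 0" using d0 p0 by simp
    ultimately have "p ^ k * m div (p ^ j * d) = p ^ (k - j) * (m div d)"
      using d0 e by (metis nonzero_mult_div_cancel_left not_gr_zero)
    thus "mulfun a (p ^ j * d) * mulfun b (p ^ k * m div (p ^ j * d)) = a p j * b p (k - j) * (mulfun a d * mulfun b (m div d))"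
      using mulfun_prime_power_mult[of p d a j] mulfun_prime_power_mult[of p "m div d" b "k - j"] step.hyps(1) nd a0 b0
      by (simp add: mult_ac)
  qed
  also have "\<dots> = (\<Sum>j\<le>k. a p j * b p (k - j)) * (\<Sum>d | d dvd m. mulfun a d * mulfun b (m div d))"
    by (simp add: sum_product sum.cartesian_product)
  also have "(\<Sum>d | d dvd m. mulfun a d * mulfun b (m div d)) = mulfun c m"
    using step.IH step.prems by (meson dvd_mult)
  also have "(\<Sum>j\<le>k. a p j * b p (k - j)) = c p k" using step.prems[of p k] step.hyps by simp
  also have "c p k * mulfun c m = mulfun c (p ^ k * m)"
    using mulfun_prime_power_mult[of p m c k] step.hyps c0 by simp
  finally show ?case .
qed simp

lemma multiplicative_eq_mulfun:
  fixes f :: "nat \<Rightarrow> 'a::comm_semiring_1"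
  assumes "multiplicative f" "n > 0"
  shows "f n = mulfun (\<lambda>p k. f (p ^ k)) n"
  using \<open>n > 0\<close>
proof (induction n rule: nat_prime_power_induct)
  case one
  show ?case using assms by (simp add: multiplicative_def)
next
  case (step p k m)
  have "coprime (p ^ k) m" using step by (metis coprime_power_left_iff prime_imp_coprime)
  hence "f (p ^ k * m) = f (p ^ k) * f m"
    using assms step unfolding multiplicative_def by (meson prime_gt_0_nat zero_less_power)
  thus ?case using step mulfun_prime_power_mult[OF step.hyps(1,4), of "\<lambda>p k. f (p ^ k)" k] assms
    by (simp add: multiplicative_def)
qed

text \<open>Each n splits as p^k m with both factors at most X. Dropping the joint constraint p^k m
  \<le> X only adds nonnegative terms, and the sum then factors.\<close>

lemma sum_mulfun_le_prod:
  fixes a :: "nat \<Rightarrow> nat \<Rightarrow> real" and X :: nat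
  assumes a: "\<And>p k. a p k \<ge> 0" and a0: "\<And>p. a p 0 = 1"
    and P: "finite P" "\<And>p. p \<in> P \<Longrightarrow> prime p"
  shows "(\<Sum>n | 1 \<le> n \<and> n \<le> X \<and> prime_factors n \<subseteq> P. mulfun a n)
     \<le> (\<Prod>p\<in>P. 1 + (\<Sum>k | 1 \<le> k \<and> p ^ k \<le> X. a p k))"
  using P
proof (induction P rule: finite_induct)
  case empty
  have "{n. 1 \<le> n \<and> n \<le> X \<and> prime_factors n \<subseteq> {}} \<subseteq> {1}" by (auto simp: prime_factorization_empty_iff)
  hence "(\<Sum>n | 1 \<le> n \<and> n \<le> X \<and> prime_factors n \<subseteq> {}. mulfun a n) \<le> (\<Sum>n\<in>{1}. mulfun a n)"
    using a by (intro sum_mono2) (auto simp: mulfun_nonneg)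
  thus ?case by simp
next
  case (insert p P)
  have p: "prime p" using insert by auto
  let ?S = "\<lambda>P. {n. 1 \<le> n \<and> n \<le> X \<and> prime_factors n \<subseteq> P}"
  let ?E = "{k. p ^ k \<le> X}"
  have finS: "finite (?S P)" for P by (rule finite_subset[of _ "{..X}"]) auto
  have finE: "finite ?E"
  proof (rule finite_subset[of _ "{..X}"])
    show "?E \<subseteq> {..X}" using prime_gt_1_nat[OF p] less_exp
      by auto (meson dual_order.trans less_imp_le power_gt_expt)
  qed simp
  have finE1: "finite {k. 1 \<le> k \<and> p ^ k \<le> X}" by (rule finite_subset[OF _ finE]) auto
  have npd: "\<not> p dvd m" if "m \<in> ?S P" for m
  proof
    assume "p dvd m"
    hence "p \<in> prime_factors m" using that p by (auto simp: prime_factors_dvd)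
    thus False using that insert by auto
  qed
  have sub: "?S (insert p P) \<subseteq> (\<lambda>(k,m). p ^ k * m) ` (?E \<times> ?S P)"
  proof
    fix n assume n: "n \<in> ?S (insert p P)"
    hence n0: "n > 0" by auto
    obtain k m where km: "n = p ^ k * m" "\<not> p dvd m" "m > 0" "k = multiplicity p n"
      using prime_power_decompE[OF n0 p] by blast
    have "p ^ k dvd n" "m dvd n" by (simp_all add: km(1))
    hence le: "p ^ k \<le> X" "m \<le> X" using n n0 by (auto dest: dvd_imp_le)
    have "prime_factors m \<subseteq> prime_factors n" using \<open>m dvd n\<close> n0 dvd_prime_factors by blast
    moreover have "p \<notin> prime_factors m" using km by auto
    ultimately have "prime_factors m \<subseteq> P" using n by auto
    thus "n \<in> (\<lambda>(k,m). p ^ k * m) ` (?E \<times> ?S P)" using km le by force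
  qed
  have "(\<Sum>n\<in>?S (insert p P). mulfun a n) \<le> (\<Sum>n\<in>(\<lambda>(k,m). p ^ k * m) ` (?E \<times> ?S P). mulfun a n)"
    using sub finS finE a by (intro sum_mono2) (auto simp: mulfun_nonneg)
  also have "\<dots> \<le> (\<Sum>(k,m)\<in>?E \<times> ?S P. mulfun a (p ^ k * m))"
    by (rule order_trans[OF sum_image_le]) (use a finS finE in \<open>auto simp: mulfun_nonneg case_prod_unfold\<close>)
  also have "\<dots> = (\<Sum>(k,m)\<in>?E \<times> ?S P. a p k * mulfun a m)"
    using mulfun_prime_power_mult[OF p npd, of _ a] a0 by (intro sum.cong) auto
  also have "\<dots> = (\<Sum>k\<in>?E. a p k) * (\<Sum>m\<in>?S P. mulfun a m)"
    by (simp add: sum_product sum.cartesian_product)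
  finally have 1: "(\<Sum>n\<in>?S (insert p P). mulfun a n) \<le> \<dots>" .
  have "(\<Sum>k\<in>?E. a p k) \<le> (\<Sum>k\<in>insert 0 {k. 1 \<le> k \<and> p ^ k \<le> X}. a p k)"
  proof (rule sum_mono2)
    show "finite (insert 0 {k. 1 \<le> k \<and> p ^ k \<le> X})" using finE1 by simp
  qed (use a in \<open>auto simp: Suc_le_eq\<close>)
  also have "\<dots> = 1 + (\<Sum>k | 1 \<le> k \<and> p ^ k \<le> X. a p k)"
    using a0 finE1 by (subst sum.insert) auto
  finally have 2: "(\<Sum>k\<in>?E. a p k) \<le> 1 + (\<Sum>k | 1 \<le> k \<and> p ^ k \<le> X. a p k)" .
  have 3: "(\<Sum>m\<in>?S P. mulfun a m) \<le> (\<Prod>p\<in>P. 1 + (\<Sum>k | 1 \<le> k \<and> p ^ k \<le> X. a p k))"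
    using insert by auto
  have "(\<Sum>k\<in>?E. a p k) * (\<Sum>m\<in>?S P. mulfun a m)
      \<le> (1 + (\<Sum>k | 1 \<le> k \<and> p ^ k \<le> X. a p k)) * (\<Prod>p\<in>P. 1 + (\<Sum>k | 1 \<le> k \<and> p ^ k \<le> X. a p k))"
  proof (rule mult_mono[OF 2 3])
    show "0 \<le> 1 + (\<Sum>k | 1 \<le> k \<and> p ^ k \<le> X. a p k)"
      by (intro add_nonneg_nonneg sum_nonneg a) simp
    show "0 \<le> (\<Sum>m\<in>?S P. mulfun a m)" by (intro sum_nonneg mulfun_nonneg a)
  qed
  with 1 show ?case unfolding prod.insert[OF insert.hyps(1,2)] by linarith
qed

lemma sum_mulfun_le_prod_upto:
  fixes a :: "nat \<Rightarrow> nat \<Rightarrow> real" and X :: nat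
  assumes a: "\<And>p k. a p k \<ge> 0" and a0: "\<And>p. a p 0 = 1"
  shows "(\<Sum>n\<in>{1..X}. mulfun a n) \<le> (\<Prod>p | prime p \<and> p \<le> X. 1 + (\<Sum>k | 1 \<le> k \<and> p ^ k \<le> X. a p k))"
proof -
  let ?P = "{p. prime p \<and> p \<le> X}"
  have "{1..X} = {n. 1 \<le> n \<and> n \<le> X \<and> prime_factors n \<subseteq> ?P}"
  proof -
    have "p \<le> n" if "n \<in> {1..X}" "p \<in> prime_factors n" for n p
      using that by (intro dvd_imp_le) auto
    thus ?thesis by fastforce
  qed
  hence "(\<Sum>n\<in>{1..X}. mulfun a n) = (\<Sum>n | 1 \<le> n \<and> n \<le> X \<and> prime_factors n \<subseteq> ?P. mulfun a n)"
    by (rule sum.cong) (rule refl)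
  also have "\<dots> \<le> (\<Prod>p\<in>?P. 1 + (\<Sum>k | 1 \<le> k \<and> p ^ k \<le> X. a p k))"
    using a a0 by (intro sum_mulfun_le_prod) auto
  finally show ?thesis .
qed

lemma sum_mulfun_le_exp:
  fixes a :: "nat \<Rightarrow> nat \<Rightarrow> real" and X :: nat
  assumes a: "\<And>p k. a p k \<ge> 0" and a0: "\<And>p. a p 0 = 1"
  shows "(\<Sum>n\<in>{1..X}. mulfun a n) \<le> exp (\<Sum>p | prime p \<and> p \<le> X. \<Sum>k | 1 \<le> k \<and> p ^ k \<le> X. a p k)"
proof -
  let ?P = "{p. prime p \<and> p \<le> X}"
  have "(\<Sum>n\<in>{1..X}. mulfun a n) \<le> (\<Prod>p\<in>?P. 1 + (\<Sum>k | 1 \<le> k \<and> p ^ k \<le> X. a p k))"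
    using sum_mulfun_le_prod_upto[of a X] a a0 by simp
  also have "\<dots> \<le> (\<Prod>p\<in>?P. exp (\<Sum>k | 1 \<le> k \<and> p ^ k \<le> X. a p k))"
    using a by (intro prod_mono conjI exp_ge_add_one_self add_nonneg_nonneg sum_nonneg) auto
  also have "\<dots> = exp (\<Sum>p\<in>?P. \<Sum>k | 1 \<le> k \<and> p ^ k \<le> X. a p k)" by (simp add: exp_sum)
  finally show ?thesis .
qed

section \<open>Dirichlet series of exponential multiplicative functions\<close>

definition expmult :: "(nat \<Rightarrow> 'a::real_normed_field) \<Rightarrow> nat \<Rightarrow> 'a" where
  "expmult F = mulfun (\<lambda>p k. F p ^ k / fact k)"

lemma expmult_1 [simp]: "expmult F 1 = 1" "expmult F (Suc 0) = 1"
  by (simp_all add: expmult_def)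

lemma expmult_prime_power_mult:
  "prime p \<Longrightarrow> \<not> p dvd m \<Longrightarrow> expmult F (p ^ k * m) = F p ^ k / fact k * expmult F m"
  unfolding expmult_def by (subst mulfun_prime_power_mult) auto

lemma norm_expmult: "norm (expmult F n) = expmult (\<lambda>p. norm (F p)) n"
  by (simp add: expmult_def norm_mulfun norm_divide norm_power)

lemma expmult_nonneg: "(\<And>p. b p \<ge> 0) \<Longrightarrow> expmult b n \<ge> (0::real)"
  unfolding expmult_def by (rule mulfun_nonneg) auto

lemma expmult_cong:
  "(\<And>p. prime p \<Longrightarrow> p dvd n \<Longrightarrow> F p = F' p) \<Longrightarrow> expmult F n = expmult F' n"
  unfolding expmult_def mulfun_def by (intro prod.cong refl) (metis in_prime_factors_imp_dvd in_prime_factors_imp_prime)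

lemma prod_prime_powers_eq:
  fixes h :: "nat \<Rightarrow> 'a::comm_semiring_1"
  assumes "n > 0" "h 1 = 1" "\<And>m n. h (m * n) = h m * h n"
  shows "h n = mulfun (\<lambda>p k. h p ^ k) n"
proof -
  have "h (p ^ k) = h p ^ k" for p k by (induction k) (use assms in auto)
  moreover have "h n = mulfun (\<lambda>p k. h (p ^ k)) n"
    by (rule multiplicative_eq_mulfun) (use assms in \<open>auto simp: multiplicative_def\<close>)
  ultimately show ?thesis by simp
qed

text \<open>A completely multiplicative factor is absorbed into the base of the powers
  \<open>F p ^ k\<close>. Thus identities stated at s = 0 hold at every s after twisting by
  n^(-s).\<close>

lemma expmult_twist:
  fixes h :: "nat \<Rightarrow> 'a::real_normed_field"
  assumes "n > 0" "h 1 = 1" "\<And>m n. h (m * n) = h m * h n"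
  shows "expmult F n * h n = expmult (\<lambda>p. F p * h p) n"
proof -
  have "h n = mulfun (\<lambda>p k. h p ^ k) n" by (rule prod_prime_powers_eq[OF assms])
  thus ?thesis
    by (simp add: expmult_def mulfun_def prod.distrib[symmetric] power_mult_distrib)
qed

text \<open>This is where the exponential shape is used: F * F^(k-1)/(k-1)! = k * F^k/k!. It removes
  the higher prime powers from the logarithmic derivative, so that \<open>expmult_ln\<close>
  involves primes only.\<close>

lemma expmult_div_prime:
  assumes "prime p" "p dvd n" "n > 0"
  shows "F p * expmult F (n div p) = of_nat (multiplicity p n) * expmult F n"
proof -
  obtain k m where km: "n = p ^ k * m" "\<not> p dvd m" "m > 0" "k = multiplicity p n"
    using prime_power_decompE[OF assms(3,1)] by blast
  have "k \<noteq> 0" using km(1,2) assms(2) by (intro notI) simp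
  then obtain j where j: "k = Suc j" by (cases k) auto
  have "n div p = p ^ j * m" using assms(1) by (subst km(1)) (simp add: j prime_gt_0_nat)
  hence "F p * expmult F (n div p) = F p * (F p ^ j / fact j * expmult F m)"
    using assms km(2) by (simp add: expmult_prime_power_mult)
  also have "\<dots> = of_nat k * (F p ^ k / fact k * expmult F m)"
  proof -
    have "(fact (Suc j) :: 'a) = of_nat (Suc j) * fact j" by (rule fact_Suc)
    moreover have "(of_nat (Suc j) :: 'a) \<noteq> 0" by (rule of_nat_neq_0)
    ultimately show ?thesis unfolding j by (simp del: of_nat_Suc fact_Suc)
  qed
  also have "F p ^ k / fact k * expmult F m = expmult F n"
    using expmult_prime_power_mult[OF assms(1) km(2), of F k] by (simp flip: km(1))
  finally show ?thesis using km(4) by simp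
qed

lemma ln_eq_sum_multiplicity:
  assumes "n > 0"
  shows "ln (real n) = (\<Sum>p\<in>prime_factors n. real (multiplicity p n) * ln (real p))"
proof -
  have e: "(\<Prod>p\<in>prime_factors n. p ^ multiplicity p n) = n"
    using prod_prime_factors[of n] assms by simp
  have "ln (\<Prod>p\<in>prime_factors n. real p ^ multiplicity p n) = (\<Sum>p\<in>prime_factors n. ln (real p ^ multiplicity p n))"
    by (rule ln_prod) (auto dest: in_prime_factors_imp_prime prime_gt_0_nat)
  also have "\<dots> = (\<Sum>p\<in>prime_factors n. real (multiplicity p n) * ln (real p))"
    by (intro sum.cong refl ln_realpow)
  also have "(\<Prod>p\<in>prime_factors n. real p ^ multiplicity p n) = real (\<Prod>p\<in>prime_factors n. p ^ multiplicity p n)"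
    by simp
  also have "\<dots> = real n" by (simp only: e)
  finally show ?thesis .
qed

lemma expmult_ln:
  fixes F :: "nat \<Rightarrow> 'a::real_normed_field"
  assumes "n > 0"
  shows "expmult F n * of_real (ln (real n)) = (\<Sum>p\<in>prime_factors n. F p * of_real (ln (real p)) * expmult F (n div p))"
proof -
  have "expmult F n * of_real (ln (real n)) =
      (\<Sum>p\<in>prime_factors n. of_real (ln (real p)) * (of_nat (multiplicity p n) * expmult F n))"
    unfolding ln_eq_sum_multiplicity[OF assms] by (simp add: sum_distrib_left mult_ac)
  also have "\<dots> = (\<Sum>p\<in>prime_factors n. of_real (ln (real p)) * (F p * expmult F (n div p)))"
    by (intro sum.cong refl, subst expmult_div_prime) (use assms in \<open>auto dest: in_prime_factors_imp_prime in_prime_factors_imp_dvd\<close>)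
  finally show ?thesis by (simp add: mult_ac)
qed

lemma sum_exp_series_le:
  fixes y :: real
  assumes "y \<ge> 0" "finite S" "0 \<notin> S"
  shows "1 + (\<Sum>k\<in>S. y ^ k / fact k) \<le> exp y"
proof -
  have "1 + (\<Sum>k\<in>S. y ^ k / fact k) = (\<Sum>k\<in>insert 0 S. y ^ k /\<^sub>R fact k)"
    using assms by (simp add: divide_inverse mult.commute)
  also have "\<dots> \<le> (\<Sum>k. y ^ k /\<^sub>R fact k)"
    using assms by (intro sum_le_suminf summable_exp_generic) auto
  finally show ?thesis by (simp add: exp_def)
qed

lemma finite_prime_powers_le: "prime p \<Longrightarrow> finite {k. p ^ k \<le> (X::nat)}"
proof (rule finite_subset[of _ "{..X}"])
  assume p: "prime p"
  have "k \<le> X" if "p ^ k \<le> X" for k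
  proof -
    have "k < p ^ k" using prime_gt_1_nat[OF p] by (simp add: power_gt_expt)
    thus ?thesis using that by linarith
  qed
  thus "{k. p ^ k \<le> X} \<subseteq> {..X}" by auto
qed simp

lemma sum_expmult_le_exp:
  fixes b :: "nat \<Rightarrow> real"
  assumes b: "\<And>p. b p \<ge> 0"
  shows "(\<Sum>n\<in>{1..X}. expmult b n) \<le> exp (\<Sum>p | prime p \<and> p \<le> X. b p)"
proof -
  have "(\<Sum>n\<in>{1..X}. expmult b n) \<le> (\<Prod>p | prime p \<and> p \<le> X. 1 + (\<Sum>k | 1 \<le> k \<and> p ^ k \<le> X. b p ^ k / fact k))"
    unfolding expmult_def using b by (intro sum_mulfun_le_prod_upto) auto
  also have "\<dots> \<le> (\<Prod>p | prime p \<and> p \<le> X. exp (b p))"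
  proof (rule prod_mono, rule conjI)
    fix p assume p: "p \<in> {p. prime p \<and> p \<le> X}"
    show "0 \<le> 1 + (\<Sum>k | 1 \<le> k \<and> p ^ k \<le> X. b p ^ k / fact k)"
      using b by (intro add_nonneg_nonneg sum_nonneg) auto
    have "finite {k. 1 \<le> k \<and> p ^ k \<le> X}"
      by (rule finite_subset[OF _ finite_prime_powers_le[of p X]]) (use p in auto)
    thus "1 + (\<Sum>k | 1 \<le> k \<and> p ^ k \<le> X. b p ^ k / fact k) \<le> exp (b p)"
      by (intro sum_exp_series_le b) auto
  qed
  also have "\<dots> = exp (\<Sum>p | prime p \<and> p \<le> X. b p)" by (simp add: exp_sum)
  finally show ?thesis .
qed

lemma expmult_summable:
  fixes F :: "nat \<Rightarrow> 'a::{real_normed_field,banach}"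
  assumes P: "finite P" and F: "\<And>p. p \<notin> P \<Longrightarrow> F p = 0"
  shows "(\<lambda>n. norm (expmult F n)) summable_on {1..}"
proof (rule nonneg_bdd_above_summable_on)
  show "bdd_above (sum (\<lambda>n. norm (expmult F n)) ` {G. G \<subseteq> {1..} \<and> finite G})"
  proof (rule bdd_aboveI2)
    fix G :: "nat set" assume G: "G \<in> {G. G \<subseteq> {1..} \<and> finite G}"
    have "G \<subseteq> {1..Max (insert 0 G)}" using G by auto
    hence "(\<Sum>n\<in>G. norm (expmult F n)) \<le> (\<Sum>n\<in>{1..Max (insert 0 G)}. expmult (\<lambda>p. norm (F p)) n)"
      unfolding norm_expmult by (intro sum_mono2) (auto intro: expmult_nonneg)
    also have "\<dots> \<le> exp (\<Sum>p | prime p \<and> p \<le> Max (insert 0 G). norm (F p))"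
      by (rule sum_expmult_le_exp) auto
    also have "\<dots> \<le> exp (\<Sum>p\<in>P. norm (F p))"
    proof -
      have "(\<Sum>p | prime p \<and> p \<le> Max (insert 0 G). norm (F p)) = (\<Sum>p\<in>{p. prime p \<and> p \<le> Max (insert 0 G)} \<inter> P. norm (F p))"
        by (rule sum.mono_neutral_right) (use F in auto)
      also have "\<dots> \<le> (\<Sum>p\<in>P. norm (F p))" using P by (intro sum_mono2) auto
      finally show ?thesis by simp
    qed
    finally show "(\<Sum>n\<in>G. norm (expmult F n)) \<le> exp (\<Sum>p\<in>P. norm (F p))" by simp
  qed
qed auto

lemma has_sum_finite_sum:
  fixes f :: "'i \<Rightarrow> 'b \<Rightarrow> 'a::topological_comm_monoid_add"
  assumes "finite I" "\<And>i. i \<in> I \<Longrightarrow> (f i has_sum s i) A"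
  shows "((\<lambda>x. \<Sum>i\<in>I. f i x) has_sum (\<Sum>i\<in>I. s i)) A"
  using assms by (induction I rule: finite_induct) (auto intro!: has_sum_add)

lemma expmult_zero: "n \<ge> 2 \<Longrightarrow> expmult (\<lambda>_. 0) n = 0"
proof -
  assume n: "n \<ge> 2"
  then obtain p where p: "prime p" "p dvd n" by (metis One_nat_def Suc_1 not_less_eq_eq order_refl prime_factor_nat)
  hence "p \<in> prime_factors n" using n by (auto simp: prime_factors_dvd)
  moreover have "multiplicity p n > 0" using p n by (auto simp: prime_multiplicity_gt_zero_iff)
  ultimately show ?thesis unfolding expmult_def mulfun_def by (intro prod_zero) (auto intro!: bexI[of _ p])
qed

text \<open>Adjoining a prime p to P multiplies two absolutely convergent series: n = p^k m with p
  not dividing m, where the sum over k is the exponential series of \<open>F p\<close>.\<close>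

lemma expmult_has_sum_aux:
  fixes F :: "nat \<Rightarrow> 'a::{real_normed_field,banach}"
  assumes "finite P" "\<And>p. p \<in> P \<Longrightarrow> prime p"
  shows "(expmult (\<lambda>p. if p \<in> P then F p else 0) has_sum exp (\<Sum>p\<in>P. F p)) {1..}"
  using assms
proof (induction P rule: finite_induct)
  case empty
  have "(expmult (\<lambda>p. 0 :: 'a) has_sum 1) {1..} \<longleftrightarrow> ((\<lambda>_. 1 :: 'a) has_sum 1) {1::nat}"
    by (rule has_sum_cong_neutral) (auto intro!: expmult_zero)
  thus ?case by (simp add: has_sum_finite_iff)
next
  case (insert p P)
  have p: "prime p" and p0: "p > 0" using insert by (auto simp: prime_gt_0_nat)
  define E where "E = expmult (\<lambda>q. if q \<in> P then F q else 0)"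
  define E' where "E' = expmult (\<lambda>q. if q \<in> insert p P then F q else 0)"
  define B where "B = {m::nat. m \<ge> 1 \<and> \<not> p dvd m}"
  define S where "S = exp (\<Sum>q\<in>P. F q)"
  define f where "f = (\<lambda>(k,m). (F p ^ k /\<^sub>R fact k) * E m)"
  have IH: "(E has_sum S) {1..}" using insert by (auto simp: E_def S_def)
  \<comment> \<open>Since p is not in P, \<open>expmult_div_prime\<close> has left side 0 while the
    multiplicity is positive. The series over all m therefore already runs over m prime to
    p.\<close>
  have Ezero: "E m = 0" if "p dvd m" "m \<ge> 1" for m
  proof -
    have "(if p \<in> P then F p else 0) * E (m div p) = of_nat (multiplicity p m) * E m"
      unfolding E_def by (rule expmult_div_prime[OF p]) (use that in auto)
    moreover have "multiplicity p m > 0" using that p by (auto simp: prime_multiplicity_gt_zero_iff)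
    ultimately show ?thesis using insert.hyps by auto
  qed
  have "(E has_sum S) {1..} \<longleftrightarrow> (E has_sum S) B"
    by (rule has_sum_cong_neutral) (auto simp: B_def Ezero)
  hence EB: "(E has_sum S) B" using IH by simp
  have "(\<lambda>m. norm (E m)) summable_on {1..}"
    unfolding E_def by (rule expmult_summable[OF insert.hyps(1)]) auto
  hence EnB: "(\<lambda>m. norm (E m)) summable_on B"
    by (rule summable_on_subset_banach) (auto simp: B_def)
  have expn: "summable (\<lambda>k. norm (F p ^ k /\<^sub>R fact k))" by (rule summable_norm_exp)
  have exps: "((\<lambda>k. F p ^ k /\<^sub>R fact k) has_sum exp (F p)) UNIV"
    by (rule norm_summable_imp_has_sum[OF expn exp_converges])
  have "(\<lambda>x. norm (f x)) summable_on (Sigma UNIV (\<lambda>_. B))"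
  proof (rule Infinite_Sum.abs_summable_on_Sigma_iff[THEN iffD2], intro conjI ballI)
    fix k :: nat
    show "(\<lambda>m. norm (f (k, m))) summable_on B"
      using summable_on_cmult_right[OF EnB, of "norm (F p ^ k /\<^sub>R fact k)"] by (simp only: f_def prod.case norm_mult)
  next
    have "(\<Sum>\<^sub>\<infinity>m\<in>B. norm (f (k, m))) = norm (F p ^ k /\<^sub>R fact k) * (\<Sum>\<^sub>\<infinity>m\<in>B. norm (E m))" for k
      unfolding f_def prod.case norm_mult by (rule infsum_cmult_right')
    moreover have "(\<lambda>k. norm (F p ^ k /\<^sub>R fact k)) summable_on UNIV"
      by (rule norm_summable_imp_summable_on) (use expn in simp)
    hence "(\<lambda>k. norm (F p ^ k /\<^sub>R fact k) * (\<Sum>\<^sub>\<infinity>m\<in>B. norm (E m))) summable_on UNIV"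
      by (rule summable_on_cmult_left)
    ultimately have "(\<lambda>k. \<Sum>\<^sub>\<infinity>m\<in>B. norm (f (k, m))) summable_on UNIV" by simp
    thus "(\<lambda>k. norm (\<Sum>\<^sub>\<infinity>m\<in>B. norm (f (k, m)))) summable_on UNIV"
      by (rule iffD1[OF summable_on_iff_abs_summable_on_real])
  qed
  hence summ: "f summable_on (Sigma UNIV (\<lambda>_. B))" by (rule Infinite_Sum.abs_summable_summable)
  have "(f has_sum (exp (F p) * S)) (Sigma UNIV (\<lambda>_. B))"
  proof (rule has_sum_SigmaI[OF _ _ summ])
    fix k :: nat
    show "((\<lambda>m. f (k, m)) has_sum ((F p ^ k /\<^sub>R fact k) * S)) B"
      unfolding f_def prod.case by (rule has_sum_cmult_right[OF EB])
  next
    show "((\<lambda>k. F p ^ k /\<^sub>R fact k * S) has_sum exp (F p) * S) UNIV"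
      by (rule has_sum_cmult_left[OF exps])
  qed
  also have "(f has_sum (exp (F p) * S)) (Sigma UNIV (\<lambda>_. B)) \<longleftrightarrow> (E' has_sum exp (\<Sum>q\<in>insert p P. F q)) {1..}"
  proof (rule has_sum_reindex_bij_witness[of _ "\<lambda>n. (multiplicity p n, n div p ^ multiplicity p n)" "\<lambda>(k,m). p ^ k * m"])
    fix a assume a: "a \<in> Sigma UNIV (\<lambda>_::nat. B)"
    then obtain k m where km: "a = (k, m)" "m \<ge> 1" "\<not> p dvd m" by (auto simp: B_def)
    have mu: "multiplicity p (p ^ k * m) = k"
      using p km by (simp add: prime_elem_multiplicity_mult_distrib not_dvd_imp_multiplicity_0)
    show "(multiplicity p (case a of (k,m) \<Rightarrow> p ^ k * m), (case a of (k,m) \<Rightarrow> p ^ k * m) div p ^ multiplicity p (case a of (k,m) \<Rightarrow> p ^ k * m)) = a"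
      using p0 by (simp add: km(1) mu)
    show "(case a of (k,m) \<Rightarrow> p ^ k * m) \<in> {1..}" using km p0 by (simp add: Suc_le_eq)
    have Em: "E' m = E m" unfolding E_def E'_def using km(3) by (intro expmult_cong) auto
    have "E' (p ^ k * m) = F p ^ k / fact k * E' m"
      unfolding E'_def by (subst expmult_prime_power_mult[OF p km(3)]) simp
    thus "E' (case a of (k,m) \<Rightarrow> p ^ k * m) = f a" by (simp add: km(1) f_def Em scaleR_conv_of_real divide_inverse mult_ac of_real_inverse)
  next
    fix n :: nat assume n: "n \<in> {1..}"
    hence n0: "n > 0" by auto
    have dec: "p ^ multiplicity p n * (n div p ^ multiplicity p n) = n"
      by (simp add: multiplicity_dvd)
    thus "(case (multiplicity p n, n div p ^ multiplicity p n) of (k,m) \<Rightarrow> p ^ k * m) = n" by simp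
    have "\<not> p dvd n div p ^ multiplicity p n"
      using multiplicity_decompose[of n p] n0 p by (auto dest: prime_gt_1_nat)
    moreover have "n div p ^ multiplicity p n \<ge> 1" using dec n0 by (metis One_nat_def Suc_leI gr0I mult_0_right)
    ultimately show "(multiplicity p n, n div p ^ multiplicity p n) \<in> Sigma UNIV (\<lambda>_. B)" by (simp add: B_def)
  next
    show "exp (F p) * S = exp (\<Sum>q\<in>insert p P. F q)" using insert.hyps by (simp add: S_def exp_add)
  qed
  finally show ?case by (simp add: E'_def)
qed

lemma expmult_has_sum:
  fixes F :: "nat \<Rightarrow> 'a::{real_normed_field,banach}"
  assumes "finite P" "\<And>p. p \<in> P \<Longrightarrow> prime p" "\<And>p. p \<notin> P \<Longrightarrow> F p = 0"
  shows "(expmult F has_sum exp (\<Sum>p\<in>P. F p)) {1..}"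
proof -
  have "(\<lambda>p. if p \<in> P then F p else 0) = F" using assms(3) by auto
  thus ?thesis using expmult_has_sum_aux[OF assms(1,2), of F] by simp
qed

text \<open>The logarithmic derivative of \<open>\<Sum> expmult F n n\<^sup>-\<^sup>s = exp (\<Sum> F p p\<^sup>-\<^sup>s)\<close>, at \<open>s = 0\<close>.\<close>

lemma expmult_ln_has_sum:
  fixes F :: "nat \<Rightarrow> 'a::{real_normed_field,banach}"
  assumes P: "finite P" "\<And>p. p \<in> P \<Longrightarrow> prime p" "\<And>p. p \<notin> P \<Longrightarrow> F p = 0"
  shows "((\<lambda>n. expmult F n * of_real (ln (real n))) has_sum
           ((\<Sum>p\<in>P. F p * of_real (ln (real p))) * exp (\<Sum>p\<in>P. F p))) {1..}"
proof -
  let ?E = "exp (\<Sum>p\<in>P. F p)"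
  have E: "(expmult F has_sum ?E) {1..}" by (rule expmult_has_sum[OF P])
  \<comment> \<open>The multiples n = p m of a fixed p carry a copy of the whole series, scaled by
    c.\<close>
  have one: "((\<lambda>n. if p dvd n then c * expmult F (n div p) else 0) has_sum (c * ?E)) {1..}" if "p \<in> P" for p c
  proof -
    have p0: "p > 0" using P(2)[OF that] by (simp add: prime_gt_0_nat)
    have "((\<lambda>m. c * expmult F m) has_sum (c * ?E)) {1..}" by (rule has_sum_cmult_right[OF E])
    also have "?this \<longleftrightarrow> ((\<lambda>n. if p dvd n then c * expmult F (n div p) else 0) has_sum (c * ?E)) {n. n \<ge> 1 \<and> p dvd n}"
      by (rule has_sum_reindex_bij_witness[of _ "\<lambda>n. n div p" "\<lambda>m. p * m"])
         (use p0 in \<open>auto simp: Suc_le_eq elim!: dvdE\<close>)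
    also have "\<dots> \<longleftrightarrow> ((\<lambda>n. if p dvd n then c * expmult F (n div p) else 0) has_sum (c * ?E)) {1..}"
      by (rule has_sum_cong_neutral) auto
    finally show ?thesis .
  qed
  have "((\<lambda>n. \<Sum>p\<in>P. if p dvd n then (F p * of_real (ln (real p))) * expmult F (n div p) else 0) has_sum
      (\<Sum>p\<in>P. F p * of_real (ln (real p)) * ?E)) {1..}"
    by (rule has_sum_finite_sum[OF P(1) one])
  also have "(\<Sum>p\<in>P. F p * of_real (ln (real p)) * ?E) = (\<Sum>p\<in>P. F p * of_real (ln (real p))) * ?E"
    by (simp add: sum_distrib_right)
  finally have *: "((\<lambda>n. \<Sum>p\<in>P. if p dvd n then (F p * of_real (ln (real p))) * expmult F (n div p) else 0) has_sum
      (\<Sum>p\<in>P. F p * of_real (ln (real p))) * ?E) {1..}" .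
  show ?thesis
  proof (rule has_sum_cong[THEN iffD1, OF _ *])
    fix n :: nat assume n: "n \<in> {1..}"
    have "expmult F n * of_real (ln (real n)) = (\<Sum>p\<in>prime_factors n. F p * of_real (ln (real p)) * expmult F (n div p))"
      by (rule expmult_ln) (use n in auto)
    also have "\<dots> = (\<Sum>p\<in>P \<inter> prime_factors n. F p * of_real (ln (real p)) * expmult F (n div p))"
      by (rule sum.mono_neutral_right) (use P(3) in auto)
    also have "\<dots> = (\<Sum>p\<in>P \<inter> prime_factors n. if p dvd n then F p * of_real (ln (real p)) * expmult F (n div p) else 0)"
      by (intro sum.cong) auto
    also have "\<dots> = (\<Sum>p\<in>P. if p dvd n then F p * of_real (ln (real p)) * expmult F (n div p) else 0)"
      by (rule sum.mono_neutral_left) (use P n in \<open>auto simp: prime_factors_dvd\<close>)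
    finally show "(\<Sum>p\<in>P. if p dvd n then F p * of_real (ln (real p)) * expmult F (n div p) else 0) = expmult F n * of_real (ln (real n))"
      by simp
  qed
qed

text \<open>The Plancherel identity below is for finite sums, so the series must be cut off. The
  tail is dominated by that of the positive series with coefficients from \<open>b\<close>; hence X0
  depends on the moduli only and serves all twists by p^(-i\<tau>) at once.\<close>

lemma expmult_ln_truncation:
  fixes b :: "nat \<Rightarrow> real"
  assumes P: "finite P" "\<And>p. p \<in> P \<Longrightarrow> prime p" "\<And>p. p \<notin> P \<Longrightarrow> b p = 0" and b: "\<And>p. b p \<ge> 0"
  obtains X0 where "\<And>X F. X \<ge> X0 \<Longrightarrow> (\<And>p. norm (F p :: complex) = b p) \<Longrightarrow>
     norm ((\<Sum>p\<in>P. F p * of_real (ln (real p))) * exp (\<Sum>p\<in>P. F p) - (\<Sum>n\<in>{1..X}. expmult F n * of_real (ln (real n)))) \<le> 1"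
proof -
  define S where "S = (\<Sum>p\<in>P. b p * ln (real p)) * exp (\<Sum>p\<in>P. b p)"
  have S: "((\<lambda>n. expmult b n * ln (real n)) has_sum S) {1..}"
    using expmult_ln_has_sum[of P b] P by (simp add: S_def)
  have "eventually (\<lambda>Y. dist (\<Sum>n\<in>Y. expmult b n * ln (real n)) S < 1) (finite_subsets_at_top {1..})"
    using S unfolding has_sum_def by (rule tendstoD) simp
  from this[unfolded eventually_finite_subsets_at_top] obtain Y where
    "finite Y \<and> Y \<subseteq> {1..} \<and> (\<forall>Y'. finite Y' \<and> Y \<subseteq> Y' \<and> Y' \<subseteq> {1..} \<longrightarrow> dist (\<Sum>n\<in>Y'. expmult b n * ln (real n)) S < 1)"
    by (rule exE)
  hence Y: "finite Y" "Y \<subseteq> {1..}"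
    "\<And>Y'. finite Y' \<Longrightarrow> Y \<subseteq> Y' \<Longrightarrow> Y' \<subseteq> {1..} \<Longrightarrow> dist (\<Sum>n\<in>Y'. expmult b n * ln (real n)) S < 1"
    by simp_all
  show ?thesis
  proof (rule that[of "Max (insert 0 Y)"])
    fix X :: nat and F :: "nat \<Rightarrow> complex"
    assume X: "X \<ge> Max (insert 0 Y)" and F: "\<And>p. norm (F p) = b p"
    have F0: "\<And>p. p \<notin> P \<Longrightarrow> F p = 0" using F P(3) by (metis norm_eq_zero)
    have "Y \<subseteq> {1..X}" using X Y by auto
    hence d: "dist (\<Sum>n\<in>{1..X}. expmult b n * ln (real n)) S < 1" by (intro Y(3)) auto
    define V where "V = (\<Sum>p\<in>P. F p * of_real (ln (real p))) * exp (\<Sum>p\<in>P. F p)"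
    have V: "((\<lambda>n. expmult F n * of_real (ln (real n))) has_sum V) {1..}"
      unfolding V_def by (rule expmult_ln_has_sum) (use P F0 in auto)
    have fin: "((\<lambda>n. g n) has_sum (\<Sum>n\<in>{1..X}. g n)) {1..X}" for g :: "nat \<Rightarrow> 'z::{topological_comm_monoid_add,t2_space}"
      by (simp add: has_sum_finite_iff)
    have VD: "((\<lambda>n. expmult F n * of_real (ln (real n))) has_sum (V - (\<Sum>n\<in>{1..X}. expmult F n * of_real (ln (real n))))) ({1..} - {1..X})"
      by (rule has_sum_Diff[OF V fin]) auto
    have SD: "((\<lambda>n. expmult b n * ln (real n)) has_sum (S - (\<Sum>n\<in>{1..X}. expmult b n * ln (real n)))) ({1..} - {1..X})"
      by (rule has_sum_Diff[OF S fin]) auto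
    have "norm (V - (\<Sum>n\<in>{1..X}. expmult F n * of_real (ln (real n)))) \<le> S - (\<Sum>n\<in>{1..X}. expmult b n * ln (real n))"
    proof (rule norm_has_sum_bound[OF _ VD])
      have "norm (expmult F n * of_real (ln (real n))) = expmult b n * ln (real n)" if "n \<in> {1..} - {1..X}" for n
      proof -
        have "norm (expmult F n) = expmult b n" unfolding norm_expmult F ..
        thus ?thesis using that by (simp add: norm_mult)
      qed
      with SD show "((\<lambda>n. norm (expmult F n * of_real (ln (real n)))) has_sum (S - (\<Sum>n\<in>{1..X}. expmult b n * ln (real n)))) ({1..} - {1..X})"
        by (subst has_sum_cong) auto
    qed
    also have "\<dots> \<le> 1" using d by (simp add: dist_real_def)
    finally show "norm ((\<Sum>p\<in>P. F p * of_real (ln (real p))) * exp (\<Sum>p\<in>P. F p) - (\<Sum>n\<in>{1..X}. expmult F n * of_real (ln (real n)))) \<le> 1"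
      by (simp add: V_def)
  qed
qed

section \<open>A Plancherel identity for Riesz means\<close>

lemma cauchy_kernel_integral:
  fixes b :: real assumes b: "b > 0"
  shows "integrable lborel (\<lambda>t. 1 / (b\<^sup>2 + t\<^sup>2))"
    and "(LBINT t. 1 / (b\<^sup>2 + t\<^sup>2)) = pi / b"
proof -
  have nz: "b\<^sup>2 + t\<^sup>2 > 0" for t
    using b by (intro add_pos_nonneg) auto
  have D: "((\<lambda>t. arctan (t / b) / b) has_real_derivative 1 / (b\<^sup>2 + t\<^sup>2)) (at t)" for t
  proof -
    have "((\<lambda>t. arctan (t / b) / b) has_real_derivative (inverse (1 + (t / b)\<^sup>2) * (1 / b)) / b) (at t)"
      using b by (auto intro!: derivative_eq_intros)
    also have "(inverse (1 + (t / b)\<^sup>2) * (1 / b)) / b = 1 / (b\<^sup>2 + t\<^sup>2)"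
    proof -
      have "1 + (t / b)\<^sup>2 = (b\<^sup>2 + t\<^sup>2) / b\<^sup>2" using b by (simp add: field_simps)
      thus ?thesis using b by (simp add: power2_eq_square)
    qed
    finally show ?thesis .
  qed

  have A: "(((\<lambda>t. arctan (t / b) / b) \<circ> real_of_ereal) \<longlongrightarrow> - (pi * inverse b / 2)) (at_right (-\<infinity>))"
    unfolding ereal_tendsto_simps using b by real_asymp
  have B: "(((\<lambda>t. arctan (t / b) / b) \<circ> real_of_ereal) \<longlongrightarrow> pi * inverse b / 2) (at_left \<infinity>)"
    unfolding ereal_tendsto_simps using b by real_asymp
  have C: "isCont (\<lambda>t. 1 / (b\<^sup>2 + t\<^sup>2)) t" for t
    using nz[of t] by (intro continuous_intros) auto
  note FTC = interval_integral_FTC_nonneg[of "-\<infinity>" \<infinity>, OF _ D C _ A B]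
  have "0 \<le> 1 / (b\<^sup>2 + t\<^sup>2)" for t using nz[of t] by simp
  hence "set_integrable lborel (einterval (-\<infinity>) \<infinity>) (\<lambda>t. 1 / (b\<^sup>2 + t\<^sup>2))"
    "(LBINT t=-\<infinity>..\<infinity>. 1 / (b\<^sup>2 + t\<^sup>2)) = pi * inverse b / 2 - (- (pi * inverse b / 2))"
    using FTC by auto
  note * = this[unfolded interval_lebesgue_integral_def einterval_eq_UNIV set_integrable_def set_lebesgue_integral_def]
  show "integrable lborel (\<lambda>t. 1 / (b\<^sup>2 + t\<^sup>2))"
    using *(1) by (simp only: indicator_UNIV scaleR_one)
  show "(LBINT t. 1 / (b\<^sup>2 + t\<^sup>2)) = pi / b"
  proof -
    have "(-\<infinity> :: ereal) \<le> \<infinity>" by simp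
    moreover have "pi * inverse b / 2 - - (pi * inverse b / 2) = pi / b" using b by (simp add: field_simps)
    ultimately show ?thesis using *(2) by (simp only: indicator_UNIV scaleR_one if_True)
  qed
qed

lemma cauchy_kernel_mult_integrable:
  fixes b :: real and f :: "real \<Rightarrow> 'a::{banach, second_countable_topology, real_normed_field}"
  assumes b: "b > 0" and f: "f \<in> borel_measurable lborel" and le: "\<And>t. norm (f t) \<le> C"
  shows "integrable lborel (\<lambda>t. f t / of_real (b\<^sup>2 + t\<^sup>2))"
proof (rule Bochner_Integration.integrable_bound)
  show "integrable lborel (\<lambda>t. C * (1 / (b\<^sup>2 + t\<^sup>2)))"
    by (intro integrable_mult_right cauchy_kernel_integral b)
  show "(\<lambda>t. f t / of_real (b\<^sup>2 + t\<^sup>2)) \<in> borel_measurable lborel" using f by measurable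
  have "norm (f t / of_real (b\<^sup>2 + t\<^sup>2)) \<le> norm (C * (1 / (b\<^sup>2 + t\<^sup>2)))" for t
  proof -
    have "norm (f t / of_real (b\<^sup>2 + t\<^sup>2)) = norm (f t) / (b\<^sup>2 + t\<^sup>2)"
      by (simp add: norm_divide del: of_real_add)
    also have "\<dots> \<le> C / (b\<^sup>2 + t\<^sup>2)" by (intro divide_right_mono le) auto
    also have "\<dots> \<le> norm (C * (1 / (b\<^sup>2 + t\<^sup>2)))" by (simp add: divide_right_mono)
    finally show ?thesis .
  qed
  thus "AE t in lborel. norm (f t / of_real (b\<^sup>2 + t\<^sup>2)) \<le> norm (C * (1 / (b\<^sup>2 + t\<^sup>2)))" by simp
qed

lemma set_integral_symmetric_tendsto:
  fixes f :: "real \<Rightarrow> complex"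
  assumes "integrable lborel f"
  shows "(\<lambda>n. integral {-real n..real n} f) \<longlonglongrightarrow> (LBINT t. f t)"
proof -
  have "(\<lambda>n. LBINT t. indicator {-real n..real n} t *\<^sub>R f t) \<longlonglongrightarrow> (LBINT t. f t)"
  proof (rule integral_dominated_convergence[where w = "\<lambda>t. norm (f t)"])
    show "AE t in lborel. (\<lambda>n. indicator {-real n..real n} t *\<^sub>R f t) \<longlonglongrightarrow> f t"
    proof (rule AE_I2)
      fix t :: real
      have "eventually (\<lambda>n. indicator {-real n..real n} t *\<^sub>R f t = f t) sequentially"
        using eventually_ge_at_top[of "nat \<lceil>\<bar>t\<bar>\<rceil>"]
      proof eventually_elim
        case (elim n)
        hence "\<bar>t\<bar> \<le> real n" by linarith
        thus ?case by (auto simp: indicator_def)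
      qed
      thus "(\<lambda>n. indicator {-real n..real n} t *\<^sub>R f t) \<longlonglongrightarrow> f t" by (rule tendsto_eventually)
    qed
  qed (use assms in \<open>auto simp: indicator_def\<close>)
  moreover have "(LBINT t. indicator {-real n..real n} t *\<^sub>R f t) = integral {-real n..real n} f" for n
  proof -
    have "set_integrable lborel {-real n..real n} f"
      unfolding set_integrable_def by (rule integrable_mult_indicator) (use assms in auto)
    from set_borel_integral_eq_integral(2)[OF this] show ?thesis by (simp add: set_lebesgue_integral_def)
  qed
  ultimately show ?thesis by simp
qed

text \<open>Subtracting the value of \<open>exp (\<i>uz)\<close> at the pole \<open>\<i>b\<close> makes the integrand holomorphic
  in the upper half-plane, so that Cauchy's theorem on half discs applies without residues.\<close>

lemma cauchy_kernel_fourier_nonneg: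
  fixes b u :: real
  assumes b: "b > 0" and u: "u \<ge> 0"
  shows "(LBINT t. cis (u * t) / of_real (b\<^sup>2 + t\<^sup>2)) = of_real (pi / b * exp (- b * u))"
proof -
  define f where "f z = exp (\<i> * of_real u * z)" for z :: complex
  define q where "q z = (if z = \<i> * b then deriv f (\<i> * b) else (f z - f (\<i> * b)) / (z - \<i> * b))" for z
  define h where "h z = q z / (z + \<i> * b)" for z
  \<comment> \<open>A convex domain that contains the closed upper half-plane and omits the other
    pole -ib of the kernel.\<close>
  define S where "S = {z. Im z > - b}"
  have "f holomorphic_on UNIV" unfolding f_def by (intro holomorphic_intros)
  hence q: "q holomorphic_on UNIV" unfolding q_def by (intro pole_lemma) auto
  have h: "h holomorphic_on S" unfolding h_def S_def
    by (intro holomorphic_intros holomorphic_on_subset[OF q]) (auto simp: complex_eq_iff)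
  have cS: "convex S" unfolding S_def by (rule convex_halfspace_Im_gt)
  have fib: "f (\<i> * b) = of_real (exp (- b * u))"
    by (simp add: f_def exp_of_real[symmetric] mult_ac)
  define g where "g t = (cis (u * t) - of_real (exp (- b * u))) / of_real (b\<^sup>2 + t\<^sup>2)" for t :: real
  have hg: "h (of_real t) = g t" for t
  proof -
    have "of_real t \<noteq> \<i> * of_real b" using b by (auto simp: complex_eq_iff)
    hence "h (of_real t) = (f t - f (\<i> * b)) / ((of_real t - \<i> * b) * (of_real t + \<i> * b))"
      by (simp add: h_def q_def)
    also have "(of_real t - \<i> * b) * (of_real t + \<i> * b) = of_real (b\<^sup>2 + t\<^sup>2)"
      by (simp add: algebra_simps power2_eq_square)
    also have "f t = cis (u * t)" by (simp add: f_def cis_conv_exp mult_ac)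
    finally show ?thesis by (simp add: g_def fib)
  qed
  have bound: "norm (integral {-R..R} g) \<le> 2 * pi * R / (R - b)\<^sup>2" if R: "R > b" for R
  proof -
    define c1 where "c1 = linepath (- of_real R) (of_real R :: complex)"
    define c2 where "c2 = part_circlepath 0 R 0 pi"
    have im1: "path_image c1 \<subseteq> S"
      unfolding c1_def path_image_linepath by (rule closed_segment_subset) (use b cS in \<open>auto simp: S_def\<close>)
    have im2: "z \<in> S \<and> norm z = R \<and> Im z \<ge> 0" if zc: "z \<in> path_image c2" for z
    proof -
      obtain t where t: "z = of_real R * exp (\<i> * of_real t)" "0 \<le> t" "t \<le> pi"
        using zc unfolding c2_def path_image_part_circlepath[OF pi_ge_zero] by auto
      have "Im z = R * sin t" "norm z = R" using t R b by (auto simp: norm_mult Im_exp)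
      moreover have "sin t \<ge> 0" using t by (intro sin_ge_zero) auto
      ultimately show ?thesis using R b by (simp add: S_def) (smt (verit) mult_nonneg_nonneg)
    qed
    have ends: "pathfinish c1 = pathstart c2" "pathfinish c2 = pathstart c1"
      by (simp_all add: c1_def c2_def)
    have valid: "valid_path c1" "valid_path c2" by (simp_all add: c1_def c2_def)
    have "(h has_contour_integral 0) (c1 +++ c2)"
      by (rule Cauchy_theorem_convex_simple[OF h cS])
         (use valid ends im1 im2 in \<open>auto simp: path_image_join intro: valid_path_join\<close>)
    moreover have ci: "h contour_integrable_on c1" "h contour_integrable_on c2"
      using im1 im2 valid by (auto simp: c1_def c2_def intro!: contour_integrable_continuous_linepath
         contour_integrable_continuous_part_circlepath holomorphic_on_imp_continuous_on holomorphic_on_subset[OF h])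
    ultimately have sum0: "contour_integral c1 h = - contour_integral c2 h"
      using contour_integral_join[OF ci valid] by (metis eq_neg_iff_add_eq_0 contour_integral_unique)
    have "(h has_contour_integral contour_integral c1 h) c1"
      using ci(1) by (rule has_contour_integral_integral)
    hence "((\<lambda>t. h (of_real t)) has_integral contour_integral c1 h) {-R..R}"
      unfolding c1_def using R b
      by (subst (asm) has_contour_integral_linepath_Reals_iff) auto
    hence "integral {-R..R} g = contour_integral c1 h"
      by (simp add: hg integral_unique)
    also have "norm \<dots> = norm (contour_integral c2 h)" by (simp add: sum0)
    \<comment> \<open>On the upper half circle |f| \<le> 1 because u \<ge> 0, and both factors of
      the denominator are at least R - b. With arc length \<pi> R the contribution tends to
      0.\<close>
    also have "\<dots> \<le> 2 / (R - b)\<^sup>2 * R * \<bar>pi - 0\<bar>"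
      unfolding c2_def
    proof (rule contour_integral_bound_part_circlepath)
      fix z assume "z \<in> path_image (part_circlepath 0 R 0 pi)"
      hence z: "norm z = R" "Im z \<ge> 0" using im2[of z] by (auto simp: c2_def)
      have n1: "norm (z - \<i> * b) \<ge> R - b" using norm_triangle_ineq2[of z "\<i> * b"] z b by (simp add: norm_mult)
      have n2: "norm (z + \<i> * b) \<ge> R - b" using norm_diff_ineq[of z "\<i> * b"] z b by (simp add: norm_mult)
      have "z \<noteq> \<i> * b" using n1 R by auto
      hence "h z = (f z - f (\<i> * b)) / ((z - \<i> * b) * (z + \<i> * b))" by (simp add: h_def q_def)
      also have "norm \<dots> = norm (f z - f (\<i> * b)) / (norm (z - \<i> * b) * norm (z + \<i> * b))"
        by (simp add: norm_divide norm_mult)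
      also have "\<dots> \<le> 2 / ((R - b) * (R - b))"
      proof (rule frac_le)
        have "norm (f z) \<le> 1" using z u by (simp add: f_def)
        moreover have "norm (f (\<i> * b)) \<le> 1" using b u unfolding fib by simp
        ultimately show "norm (f z - f (\<i> * b)) \<le> 2" using norm_triangle_ineq4[of "f z" "f (\<i> * b)"] by linarith
        show "(R - b) * (R - b) \<le> norm (z - \<i> * b) * norm (z + \<i> * b)"
          using n1 n2 R by (intro mult_mono) auto
      qed (use R in auto)
      finally show "norm (h z) \<le> 2 / (R - b)\<^sup>2" by (simp add: power2_eq_square)
    qed (use ci R b in \<open>auto simp: c2_def\<close>)
    finally show ?thesis by (simp add: mult_ac)
  qed
  have int1: "integrable lborel (\<lambda>t. cis (u * t) / of_real (b\<^sup>2 + t\<^sup>2))"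
    by (rule cauchy_kernel_mult_integrable[OF b, where C = 1]) (auto intro!: borel_measurable_continuous_onI continuous_intros)
  have int2: "integrable lborel (\<lambda>t. of_real (exp (- b * u)) / of_real (b\<^sup>2 + t\<^sup>2) :: complex)"
    by (rule cauchy_kernel_mult_integrable[OF b, where C = "exp (- b * u)"]) auto
  have g_eq: "g t = cis (u * t) / of_real (b\<^sup>2 + t\<^sup>2) - of_real (exp (- b * u)) / of_real (b\<^sup>2 + t\<^sup>2)" for t
    by (simp add: g_def diff_divide_distrib)
  have "integrable lborel g" unfolding g_eq by (intro Bochner_Integration.integrable_diff int1 int2)
  hence "(\<lambda>n. integral {-real n..real n} g) \<longlonglongrightarrow> (LBINT t. g t)" by (rule set_integral_symmetric_tendsto)
  moreover have "(\<lambda>n. integral {-real n..real n} g) \<longlonglongrightarrow> 0"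
  proof (rule Lim_null_comparison)
    show "eventually (\<lambda>n. norm (integral {-real n..real n} g) \<le> 2 * pi * real n / (real n - b)\<^sup>2) sequentially"
      using eventually_gt_at_top[of "nat \<lceil>b\<rceil>"] by eventually_elim (rule bound, linarith)
    show "(\<lambda>n. 2 * pi * real n / (real n - b)\<^sup>2) \<longlonglongrightarrow> 0" by real_asymp
  qed
  ultimately have "(LBINT t. g t) = 0" by (rule LIMSEQ_unique)
  hence "(LBINT t. cis (u * t) / of_real (b\<^sup>2 + t\<^sup>2)) = (LBINT t. of_real (exp (- b * u)) / of_real (b\<^sup>2 + t\<^sup>2))"
    unfolding g_eq using int1 int2 by (subst (asm) Bochner_Integration.integral_diff) auto
  also have "\<dots> = (LBINT t. complex_of_real (exp (- b * u) * (1 / (b\<^sup>2 + t\<^sup>2))))" by simp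
  also have "\<dots> = of_real (LBINT t. exp (- b * u) * (1 / (b\<^sup>2 + t\<^sup>2)))" by (rule integral_complex_of_real)
  also have "(LBINT t. exp (- b * u) * (1 / (b\<^sup>2 + t\<^sup>2))) = exp (- b * u) * (pi / b)"
    by (subst integral_mult_right_zero) (simp only: cauchy_kernel_integral(2)[OF b])
  finally show ?thesis by (simp add: mult.commute)
qed

lemma cauchy_kernel_fourier:
  fixes b u :: real
  assumes b: "b > 0"
  shows "integrable lborel (\<lambda>t. cis (u * t) / of_real (b\<^sup>2 + t\<^sup>2))"
    and "(LBINT t. cis (u * t) / of_real (b\<^sup>2 + t\<^sup>2)) = of_real (pi / b * exp (- b * \<bar>u\<bar>))"
proof -
  show "integrable lborel (\<lambda>t. cis (u * t) / of_real (b\<^sup>2 + t\<^sup>2))"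
    by (rule cauchy_kernel_mult_integrable[OF b, where C = 1]) (auto intro!: borel_measurable_continuous_onI continuous_intros)
  show "(LBINT t. cis (u * t) / of_real (b\<^sup>2 + t\<^sup>2)) = of_real (pi / b * exp (- b * \<bar>u\<bar>))"
  proof (cases "u \<ge> 0")
    case True
    thus ?thesis using cauchy_kernel_fourier_nonneg[OF b True] by simp
  next
    case False
    have "(LBINT t. cis (u * t) / of_real (b\<^sup>2 + t\<^sup>2)) = (LBINT t. cnj (cis (- u * t) / of_real (b\<^sup>2 + t\<^sup>2)))"
      by (simp add: cis_cnj)
    also have "\<dots> = cnj (LBINT t. cis (- u * t) / of_real (b\<^sup>2 + t\<^sup>2))"
    proof (rule integral_bounded_linear'[OF bounded_linear_cnj bounded_linear_cnj])
    qed auto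
    also have "\<dots> = of_real (pi / b * exp (- b * (- u)))"
      using False by (subst cauchy_kernel_fourier_nonneg[OF b]) (auto simp del: of_real_mult)
    finally show ?thesis using False by simp
  qed
qed

text \<open>Reduces the mean square of a finite sum to its Gram matrix. Plancherel then becomes the
  equality of two explicitly computed Gram matrices, and Fourier inversion is avoided.\<close>

lemma has_bochner_integral_quadratic_form:
  fixes e :: "'i \<Rightarrow> 'a \<Rightarrow> complex" and w :: "'a \<Rightarrow> real"
  assumes I: "finite I"
    and G: "\<And>i j. i \<in> I \<Longrightarrow> j \<in> I \<Longrightarrow> has_bochner_integral M (\<lambda>x. e i x * cnj (e j x) * of_real (w x)) (G i j)"
  shows "has_bochner_integral M (\<lambda>x. norm (\<Sum>i\<in>I. c i * e i x) ^ 2 * w x) (Re (\<Sum>i\<in>I. \<Sum>j\<in>I. c i * cnj (c j) * G i j))"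
proof -
  have "has_bochner_integral M (\<lambda>x. \<Sum>i\<in>I. \<Sum>j\<in>I. c i * cnj (c j) * (e i x * cnj (e j x) * of_real (w x)))
      (\<Sum>i\<in>I. \<Sum>j\<in>I. c i * cnj (c j) * G i j)"
    by (intro has_bochner_integral_sum has_bochner_integral_mult_right G)
  hence "has_bochner_integral M (\<lambda>x. Re (\<Sum>i\<in>I. \<Sum>j\<in>I. c i * cnj (c j) * (e i x * cnj (e j x) * of_real (w x))))
      (Re (\<Sum>i\<in>I. \<Sum>j\<in>I. c i * cnj (c j) * G i j))"
    by (rule has_bochner_integral_bounded_linear[OF bounded_linear_Re])
  moreover have "Re (\<Sum>i\<in>I. \<Sum>j\<in>I. c i * cnj (c j) * (e i x * cnj (e j x) * of_real (w x)))
      = norm (\<Sum>i\<in>I. c i * e i x) ^ 2 * w x" for x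
  proof -
    have "(\<Sum>i\<in>I. \<Sum>j\<in>I. c i * cnj (c j) * (e i x * cnj (e j x) * of_real (w x)))
       = (\<Sum>i\<in>I. c i * e i x) * cnj (\<Sum>i\<in>I. c i * e i x) * of_real (w x)"
    proof -
      have "(\<Sum>i\<in>I. c i * e i x) * cnj (\<Sum>i\<in>I. c i * e i x) = (\<Sum>i\<in>I. \<Sum>j\<in>I. (c i * e i x) * cnj (c j * e j x))"
        unfolding cnj_sum by (rule sum_product)
      thus ?thesis by (simp only: sum_distrib_right) (intro sum.cong refl, simp add: mult_ac)
    qed
    also have "\<dots> = of_real (norm (\<Sum>i\<in>I. c i * e i x) ^ 2 * w x)"
      by (simp only: of_real_mult complex_norm_square)
    finally show ?thesis by (simp only: Re_complex_of_real)
  qed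
  ultimately show ?thesis by simp
qed

section \<open>Gram matrices of Riesz weights and of Dirichlet polynomials\<close>

lemma of_nat_powr_neg_Complex:
  assumes "n > 0"
  shows "(of_nat n :: complex) powr (- Complex \<sigma> \<tau>) = of_real (real n powr - \<sigma>) * cis (- (\<tau> * ln (real n)))"
proof -
  have "(of_nat n :: complex) powr (- Complex \<sigma> \<tau>) = exp (- Complex \<sigma> \<tau> * of_real (ln (real n)))"
    using assms by (simp add: powr_def Ln_of_nat)
  also have "- Complex \<sigma> \<tau> * of_real (ln (real n)) = Complex (- \<sigma> * ln (real n)) (- (\<tau> * ln (real n)))"
    by (simp add: complex_eq_iff)
  also have "exp \<dots> = of_real (exp (- \<sigma> * ln (real n))) * cis (- (\<tau> * ln (real n)))"
    by (simp add: exp_eq_polar)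
  finally show ?thesis using assms by (simp add: powr_def)
qed

lemma has_bochner_integral_powr_at_top:
  fixes c x0 :: real
  assumes c: "c > 0" and x0: "x0 > 0"
  shows "has_bochner_integral lborel (\<lambda>t. indicator {x0<..} t * t powr (-1 - c)) (x0 powr (-c) / c)"
proof -
  let ?F = "\<lambda>t::real. - (t powr (-c) / c)"
  have D: "(?F has_real_derivative t powr (-1 - c)) (at t)" if "ereal x0 < ereal t" "ereal t < \<infinity>" for t
    using that c x0 by (auto intro!: derivative_eq_intros simp: algebra_simps) (simp add: powr_diff powr_minus divide_simps)
  have C: "isCont (\<lambda>t. t powr (-1 - c)) t" if "ereal x0 < ereal t" "ereal t < \<infinity>" for t
    using that x0 by (auto intro!: continuous_intros)
  have A: "((?F \<circ> real_of_ereal) \<longlongrightarrow> - (x0 powr (-c) / c)) (at_right (ereal x0))"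
    unfolding ereal_tendsto_simps using x0 c by (auto intro!: tendsto_eq_intros)
  have B: "((?F \<circ> real_of_ereal) \<longlongrightarrow> 0) (at_left \<infinity>)"
    unfolding ereal_tendsto_simps using c by real_asymp
  have N: "AE t in lborel. ereal x0 < ereal t \<longrightarrow> ereal t < \<infinity> \<longrightarrow> 0 \<le> t powr (-1 - c)" by simp
  note FTC = interval_integral_FTC_nonneg[of "ereal x0" \<infinity>, OF _ D C N A B]
  have 1: "set_integrable lborel {x0<..} (\<lambda>t. t powr (-1 - c))" using FTC(1) by simp
  have "(LBINT t=ereal x0..\<infinity>. t powr (-1 - c)) = 0 - (- (x0 powr (-c) / c))" using FTC(2) by simp
  hence 2: "(LBINT t:{x0<..}. t powr (-1 - c)) = x0 powr (-c) / c" by (simp add: interval_integral_to_infinity_eq)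
  show ?thesis using 1 2 by (simp add: has_bochner_integral_iff set_integrable_def set_lebesgue_integral_def)
qed

text \<open>The integral of \<open>riesz \<kappa> n t\<close> against t^(-s-1) over t is n^(-s)
  \<kappa> / (s (s + \<kappa>)); the square of the modulus of this factor is the weight on the
  frequency side of \<open>riesz_plancherel\<close>.\<close>

definition riesz :: "real \<Rightarrow> real \<Rightarrow> real \<Rightarrow> real" where
  "riesz \<kappa> n t = (if n < t then 1 - (n / t) powr \<kappa> else 0)"

text \<open>For m \<le> n both weights live on t > n, and expanding their product gives four power
  integrals. The value is written through m/n so as to match the Fourier transform in
  \<open>cauchy_pair_fourier\<close> at u = ln n - ln m.\<close>

lemma riesz_gram_le:
  fixes m n \<sigma> \<kappa> :: real
  assumes "0 < m" "m \<le> n" and s: "\<sigma> > 0" and k: "\<kappa> > 0"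
  shows "has_bochner_integral lborel (\<lambda>t. riesz \<kappa> m t * riesz \<kappa> n t * t powr (-1 - 2*\<sigma>))
           ((m * n) powr (-\<sigma>) * (\<kappa> / (2*(2*\<sigma>+\<kappa>))) * ((m/n) powr \<sigma> / \<sigma> - (m/n) powr (\<sigma>+\<kappa>) / (\<sigma>+\<kappa>)))"
proof -
  have n0: "n > 0" using assms by simp
  let ?J = "\<lambda>c t. indicator {n<..} t * t powr (-1 - c) :: real"
  have J: "has_bochner_integral lborel (?J c) (n powr (-c) / c)" if "c > 0" for c
    by (rule has_bochner_integral_powr_at_top[OF that n0])
  have "has_bochner_integral lborel
     (\<lambda>t. ?J (2*\<sigma>) t - n powr \<kappa> * ?J (2*\<sigma>+\<kappa>) t - m powr \<kappa> * ?J (2*\<sigma>+\<kappa>) t + (m powr \<kappa> * n powr \<kappa>) * ?J (2*\<sigma>+2*\<kappa>) t)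
     (n powr (-(2*\<sigma>)) / (2*\<sigma>) - n powr \<kappa> * (n powr (-(2*\<sigma>+\<kappa>)) / (2*\<sigma>+\<kappa>)) - m powr \<kappa> * (n powr (-(2*\<sigma>+\<kappa>)) / (2*\<sigma>+\<kappa>))
       + (m powr \<kappa> * n powr \<kappa>) * (n powr (-(2*\<sigma>+2*\<kappa>)) / (2*\<sigma>+2*\<kappa>)))"
    by (intro has_bochner_integral_add has_bochner_integral_diff has_bochner_integral_mult_right J) (use s k in auto)
  moreover have "(\<lambda>t. riesz \<kappa> m t * riesz \<kappa> n t * t powr (-1 - 2*\<sigma>)) =
     (\<lambda>t. ?J (2*\<sigma>) t - n powr \<kappa> * ?J (2*\<sigma>+\<kappa>) t - m powr \<kappa> * ?J (2*\<sigma>+\<kappa>) t + (m powr \<kappa> * n powr \<kappa>) * ?J (2*\<sigma>+2*\<kappa>) t)"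
  proof
    fix t :: real
    show "riesz \<kappa> m t * riesz \<kappa> n t * t powr (-1 - 2*\<sigma>) =
      ?J (2*\<sigma>) t - n powr \<kappa> * ?J (2*\<sigma>+\<kappa>) t - m powr \<kappa> * ?J (2*\<sigma>+\<kappa>) t + (m powr \<kappa> * n powr \<kappa>) * ?J (2*\<sigma>+2*\<kappa>) t"
    proof (cases "n < t")
      case True
      hence t0: "t > 0" using n0 by simp
      define X where "X = t powr (-1 - 2*\<sigma>)"
      define Y where "Y = t powr (-\<kappa>)"
      have e1: "t powr (-1 - (2*\<sigma>+\<kappa>)) = X * Y" unfolding X_def Y_def by (simp add: powr_add[symmetric] algebra_simps)
      have e2: "t powr (-1 - (2*\<sigma>+2*\<kappa>)) = X * Y * Y" unfolding X_def Y_def by (simp add: powr_add[symmetric] algebra_simps)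
      have e3: "(m / t) powr \<kappa> = m powr \<kappa> * Y" "(n / t) powr \<kappa> = n powr \<kappa> * Y"
        unfolding Y_def using assms n0 t0 by (simp_all add: powr_divide powr_minus_divide)
      show ?thesis using True assms unfolding riesz_def e1 e2 e3 X_def[symmetric]
        by (simp add: algebra_simps)
    qed (use assms in \<open>simp add: riesz_def\<close>)
  qed
  moreover have "n powr (-(2*\<sigma>)) / (2*\<sigma>) - n powr \<kappa> * (n powr (-(2*\<sigma>+\<kappa>)) / (2*\<sigma>+\<kappa>)) - m powr \<kappa> * (n powr (-(2*\<sigma>+\<kappa>)) / (2*\<sigma>+\<kappa>))
       + (m powr \<kappa> * n powr \<kappa>) * (n powr (-(2*\<sigma>+2*\<kappa>)) / (2*\<sigma>+2*\<kappa>))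
     = (m * n) powr (-\<sigma>) * (\<kappa> / (2*(2*\<sigma>+\<kappa>))) * ((m/n) powr \<sigma> / \<sigma> - (m/n) powr (\<sigma>+\<kappa>) / (\<sigma>+\<kappa>))"
  proof -
    define N where "N = n powr (-(2*\<sigma>))"
    define R where "R = (m / n) powr \<kappa>"
    have a1: "n powr \<kappa> * n powr (-(2*\<sigma>+\<kappa>)) = N" unfolding N_def by (simp add: powr_add[symmetric])
    have a2: "m powr \<kappa> * n powr (-(2*\<sigma>+\<kappa>)) = N * R"
      unfolding N_def R_def using assms n0 by (simp add: powr_divide powr_diff powr_minus powr_add divide_simps)
    have a3: "m powr \<kappa> * n powr \<kappa> * n powr (-(2*\<sigma>+2*\<kappa>)) = N * R"
    proof -
      have "n powr \<kappa> * n powr (-(2*\<sigma>+2*\<kappa>)) = n powr (\<kappa> + -(2*\<sigma>+2*\<kappa>))" by (rule powr_add[symmetric])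
      also have "\<kappa> + -(2*\<sigma>+2*\<kappa>) = -(2*\<sigma>+\<kappa>)" by simp
      finally have "n powr \<kappa> * n powr (-(2*\<sigma>+2*\<kappa>)) = n powr (-(2*\<sigma>+\<kappa>))" .
      thus ?thesis using a2 by (simp only: mult.assoc)
    qed
    have a4: "(m * n) powr (-\<sigma>) * (m/n) powr \<sigma> = N"
      unfolding N_def using assms n0 by (simp add: powr_divide powr_mult powr_minus divide_simps) (simp add: powr_add[symmetric])
    have a5: "(m/n) powr (\<sigma>+\<kappa>) = (m/n) powr \<sigma> * R" unfolding R_def by (rule powr_add)
    have "(m * n) powr (-\<sigma>) * (\<kappa> / (2*(2*\<sigma>+\<kappa>))) * ((m/n) powr \<sigma> / \<sigma> - (m/n) powr (\<sigma>+\<kappa>) / (\<sigma>+\<kappa>))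
       = (m * n) powr (-\<sigma>) * (m/n) powr \<sigma> * ((\<kappa> / (2*(2*\<sigma>+\<kappa>))) * (1/\<sigma> - R / (\<sigma>+\<kappa>)))"
      unfolding a5 by (simp add: algebra_simps)
    also have "\<dots> = N * ((\<kappa> / (2*(2*\<sigma>+\<kappa>))) * (1/\<sigma> - R / (\<sigma>+\<kappa>)))" by (simp only: a4)
    also have "(\<kappa> / (2*(2*\<sigma>+\<kappa>))) * (1/\<sigma> - R / (\<sigma>+\<kappa>)) = 1/(2*\<sigma>) - 1/(2*\<sigma>+\<kappa>) - (R/(2*\<sigma>+\<kappa>) - R/(2*\<sigma>+2*\<kappa>))"
    proof -
      have x1: "\<kappa> / (2*(2*\<sigma>+\<kappa>)) * (1/\<sigma>) = 1/(2*\<sigma>) - 1/(2*\<sigma>+\<kappa>)" using s k by (simp add: field_simps)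
      have x2: "\<kappa> / (2*(2*\<sigma>+\<kappa>)) * (1/(\<sigma>+\<kappa>)) = 1/(2*\<sigma>+\<kappa>) - 1/(2*\<sigma>+2*\<kappa>)"
      proof -
        have "2*\<sigma>+2*\<kappa> = 2*(\<sigma>+\<kappa>)" by simp
        moreover have "1/p - 1/(2*q) = (2*q-p)/(2*p) * (1/q)" if "p > 0" "q > 0" for p q :: real
          using that by (simp add: field_simps)
        from this[of "2*\<sigma>+\<kappa>" "\<sigma>+\<kappa>"] have "1/(2*\<sigma>+\<kappa>) - 1/(2*(\<sigma>+\<kappa>)) = \<kappa>/(2*(2*\<sigma>+\<kappa>)) * (1/(\<sigma>+\<kappa>))"
          using s k by simp
        ultimately show ?thesis by simp
      qed
      have "(\<kappa> / (2*(2*\<sigma>+\<kappa>))) * (1/\<sigma> - R / (\<sigma>+\<kappa>)) = \<kappa> / (2*(2*\<sigma>+\<kappa>)) * (1/\<sigma>) - R * (\<kappa> / (2*(2*\<sigma>+\<kappa>)) * (1/(\<sigma>+\<kappa>)))"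
      proof -
        have "p * (a - R / b) = p * a - R * (p * (1 / b))" for p a b :: real by (simp add: right_diff_distrib)
        thus ?thesis .
      qed
      also have "\<dots> = (1/(2*\<sigma>) - 1/(2*\<sigma>+\<kappa>)) - R * (1/(2*\<sigma>+\<kappa>) - 1/(2*\<sigma>+2*\<kappa>))" by (simp only: x1 x2)
      finally show ?thesis by (simp only: right_diff_distrib times_divide_eq_right mult_1_right)
    qed
    finally show ?thesis
      unfolding times_divide_eq_right a1 a2 a3 N_def[symmetric] by (simp add: algebra_simps)
  qed
  ultimately show ?thesis by simp
qed

text \<open>Partial fractions: the product of the two Cauchy kernels is their difference divided by
  \<kappa> (2\<sigma> + \<kappa>), and each kernel has a known transform.\<close>

lemma cauchy_pair_fourier:
  fixes u \<sigma> \<kappa> :: real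
  assumes s: "\<sigma> > 0" and k: "\<kappa> > 0"
  shows "has_bochner_integral lborel (\<lambda>\<tau>. cis (u * \<tau>) * of_real (\<kappa>\<^sup>2 / ((\<sigma>\<^sup>2 + \<tau>\<^sup>2) * ((\<sigma>+\<kappa>)\<^sup>2 + \<tau>\<^sup>2)) / (2 * pi)))
     (of_real ((\<kappa> / (2*(2*\<sigma>+\<kappa>))) * (exp (-\<sigma> * \<bar>u\<bar>) / \<sigma> - exp (-(\<sigma>+\<kappa>) * \<bar>u\<bar>) / (\<sigma>+\<kappa>))))"
proof -
  let ?c = "\<kappa> / (2*\<sigma>+\<kappa>) / (2*pi)"
  have H: "has_bochner_integral lborel (\<lambda>t. cis (u * t) / of_real (b\<^sup>2 + t\<^sup>2)) (of_real (pi / b * exp (- b * \<bar>u\<bar>)))" if "b > 0" for b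
    using cauchy_kernel_fourier[OF that, of u] by (simp only: has_bochner_integral_iff conj_assoc)
  have "has_bochner_integral lborel (\<lambda>\<tau>. of_real ?c * (cis (u * \<tau>) / of_real (\<sigma>\<^sup>2 + \<tau>\<^sup>2) - cis (u * \<tau>) / of_real ((\<sigma>+\<kappa>)\<^sup>2 + \<tau>\<^sup>2)))
     (of_real ?c * (of_real (pi / \<sigma> * exp (- \<sigma> * \<bar>u\<bar>)) - of_real (pi / (\<sigma>+\<kappa>) * exp (- (\<sigma>+\<kappa>) * \<bar>u\<bar>))))"
    by (intro has_bochner_integral_mult_right has_bochner_integral_diff H) (use s k in auto)
  moreover have "of_real ?c * (cis (u * \<tau>) / of_real (\<sigma>\<^sup>2 + \<tau>\<^sup>2) - cis (u * \<tau>) / of_real ((\<sigma>+\<kappa>)\<^sup>2 + \<tau>\<^sup>2))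
      = cis (u * \<tau>) * of_real (\<kappa>\<^sup>2 / ((\<sigma>\<^sup>2 + \<tau>\<^sup>2) * ((\<sigma>+\<kappa>)\<^sup>2 + \<tau>\<^sup>2)) / (2 * pi))" for \<tau>
  proof -
    have p: "\<sigma>\<^sup>2 + \<tau>\<^sup>2 > 0" "(\<sigma>+\<kappa>)\<^sup>2 + \<tau>\<^sup>2 > 0" using s k by (auto intro!: add_pos_nonneg)
    have "1/a - 1/b = (b-a) / (a*b)" if "a > 0" "b > 0" for a b :: real using that by (simp add: field_simps)
    hence "1 / (\<sigma>\<^sup>2 + \<tau>\<^sup>2) - 1 / ((\<sigma>+\<kappa>)\<^sup>2 + \<tau>\<^sup>2) = (((\<sigma>+\<kappa>)\<^sup>2 + \<tau>\<^sup>2) - (\<sigma>\<^sup>2 + \<tau>\<^sup>2)) / ((\<sigma>\<^sup>2 + \<tau>\<^sup>2) * ((\<sigma>+\<kappa>)\<^sup>2 + \<tau>\<^sup>2))"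
      using p by blast
    also have "((\<sigma>+\<kappa>)\<^sup>2 + \<tau>\<^sup>2) - (\<sigma>\<^sup>2 + \<tau>\<^sup>2) = \<kappa> * (2*\<sigma>+\<kappa>)" by (simp add: power2_eq_square algebra_simps)
    finally have "?c * (1 / (\<sigma>\<^sup>2 + \<tau>\<^sup>2) - 1 / ((\<sigma>+\<kappa>)\<^sup>2 + \<tau>\<^sup>2)) = ?c * (\<kappa> * (2*\<sigma>+\<kappa>) / ((\<sigma>\<^sup>2 + \<tau>\<^sup>2) * ((\<sigma>+\<kappa>)\<^sup>2 + \<tau>\<^sup>2)))"
      by simp
    also have "\<dots> = \<kappa>\<^sup>2 / ((\<sigma>\<^sup>2 + \<tau>\<^sup>2) * ((\<sigma>+\<kappa>)\<^sup>2 + \<tau>\<^sup>2)) / (2 * pi)"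
    proof -
      have "2*\<sigma>+\<kappa> \<noteq> 0" using s k by simp
      thus ?thesis by (simp add: power2_eq_square)
    qed
    finally have e: "?c * (1 / (\<sigma>\<^sup>2 + \<tau>\<^sup>2) - 1 / ((\<sigma>+\<kappa>)\<^sup>2 + \<tau>\<^sup>2)) = \<kappa>\<^sup>2 / ((\<sigma>\<^sup>2 + \<tau>\<^sup>2) * ((\<sigma>+\<kappa>)\<^sup>2 + \<tau>\<^sup>2)) / (2 * pi)" .
    have "of_real ?c * (cis (u * \<tau>) / of_real (\<sigma>\<^sup>2 + \<tau>\<^sup>2) - cis (u * \<tau>) / of_real ((\<sigma>+\<kappa>)\<^sup>2 + \<tau>\<^sup>2))
       = cis (u * \<tau>) * of_real (?c * (1 / (\<sigma>\<^sup>2 + \<tau>\<^sup>2) - 1 / ((\<sigma>+\<kappa>)\<^sup>2 + \<tau>\<^sup>2)))"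
    proof -
      have "of_real c * (z / of_real p - z / of_real q) = z * of_real (c * (1 / p - 1 / q))" for c p q :: real and z :: complex
        by (simp add: algebra_simps)
      thus ?thesis .
    qed
    thus ?thesis by (simp only: e)
  qed
  moreover have "of_real ?c * (of_real (pi / \<sigma> * exp (- \<sigma> * \<bar>u\<bar>)) - of_real (pi / (\<sigma>+\<kappa>) * exp (- (\<sigma>+\<kappa>) * \<bar>u\<bar>)))
     = (of_real ((\<kappa> / (2*(2*\<sigma>+\<kappa>))) * (exp (-\<sigma> * \<bar>u\<bar>) / \<sigma> - exp (-(\<sigma>+\<kappa>) * \<bar>u\<bar>) / (\<sigma>+\<kappa>))) :: complex)"
  proof -
    have "?c * (pi / \<sigma> * exp (- \<sigma> * \<bar>u\<bar>) - pi / (\<sigma>+\<kappa>) * exp (- (\<sigma>+\<kappa>) * \<bar>u\<bar>)) 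
      = (?c * pi) * (exp (-\<sigma> * \<bar>u\<bar>) / \<sigma> - exp (-(\<sigma>+\<kappa>) * \<bar>u\<bar>) / (\<sigma>+\<kappa>))"
      by (simp add: right_diff_distrib)
    also have "?c * pi = \<kappa> / (2*(2*\<sigma>+\<kappa>))" by simp
    finally show ?thesis by (simp only: of_real_mult[symmetric] of_real_diff[symmetric])
  qed
  ultimately show ?thesis by simp
qed

text \<open>Both quadratic forms have the Gram matrix g, since exp (-\<sigma> |ln n - ln m|) is
  (m/n)^\<sigma> for m \<le> n. Stating a common value I carries integrability of both sides along
  with their equality.\<close>

theorem riesz_plancherel:
  fixes a :: "nat \<Rightarrow> complex" and \<sigma> \<kappa> :: real
  assumes s: "\<sigma> > 0" and k: "\<kappa> > 0"
  defines "W \<equiv> (\<lambda>\<tau>. \<kappa>\<^sup>2 / ((\<sigma>\<^sup>2 + \<tau>\<^sup>2) * ((\<sigma>+\<kappa>)\<^sup>2 + \<tau>\<^sup>2)) / (2 * pi))"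
  shows "\<exists>I. has_bochner_integral lborel (\<lambda>t. norm (\<Sum>n\<in>{1..X}. a n * of_real (riesz \<kappa> (real n) t)) ^ 2 * t powr (-1 - 2*\<sigma>)) I \<and>
     has_bochner_integral lborel (\<lambda>\<tau>. norm (\<Sum>n\<in>{1..X}. a n * of_nat n powr (- Complex \<sigma> \<tau>)) ^ 2 * W \<tau>) I"
proof -
  define g where "g m n = (m * n) powr (-\<sigma>) * (\<kappa> / (2*(2*\<sigma>+\<kappa>))) * (exp (-\<sigma> * \<bar>ln n - ln m\<bar>) / \<sigma> - exp (-(\<sigma>+\<kappa>) * \<bar>ln n - ln m\<bar>) / (\<sigma>+\<kappa>))" for m n :: real
  define G where "G m n = complex_of_real (g (real m) (real n))" for m n :: nat
  have g_sym: "g m n = g n m" for m n by (simp add: g_def mult.commute abs_minus_commute)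
  have g_le: "g m n = (m * n) powr (-\<sigma>) * (\<kappa> / (2*(2*\<sigma>+\<kappa>))) * ((m/n) powr \<sigma> / \<sigma> - (m/n) powr (\<sigma>+\<kappa>) / (\<sigma>+\<kappa>))"
    if "0 < m" "m \<le> n" for m n
  proof -
    have l: "\<bar>ln n - ln m\<bar> = - ln (m / n)" using that by (simp add: ln_div)
    have "(m / n) powr x = exp (- x * \<bar>ln n - ln m\<bar>)" for x
      using that unfolding l by (simp add: powr_def)
    thus ?thesis unfolding g_def by (simp only:)
  qed
  have time0: "has_bochner_integral lborel (\<lambda>t. riesz \<kappa> m t * riesz \<kappa> n t * t powr (-1 - 2*\<sigma>)) (g m n)"
    if "0 < m" "m \<le> n" for m n
    unfolding g_le[OF that] by (rule riesz_gram_le[OF that s k])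
  have time1: "has_bochner_integral lborel (\<lambda>t. riesz \<kappa> m t * riesz \<kappa> n t * t powr (-1 - 2*\<sigma>)) (g m n)"
    if "0 < m" "0 < n" for m n
  proof (cases "m \<le> n")
    case False
    hence "has_bochner_integral lborel (\<lambda>t. riesz \<kappa> n t * riesz \<kappa> m t * t powr (-1 - 2*\<sigma>)) (g n m)"
      by (intro time0) (use that in auto)
    thus ?thesis by (simp add: g_sym[of m n] mult.commute)
  qed (use time0 that in auto)
  have "has_bochner_integral lborel (\<lambda>t. norm (\<Sum>n\<in>{1..X}. a n * of_real (riesz \<kappa> (real n) t)) ^ 2 * t powr (-1 - 2*\<sigma>))
     (Re (\<Sum>i\<in>{1..X}. \<Sum>j\<in>{1..X}. a i * cnj (a j) * G i j))"
  proof (rule has_bochner_integral_quadratic_form)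
    fix i j assume ij: "i \<in> {1..X}" "j \<in> {1..X}"
    have "has_bochner_integral lborel (\<lambda>t. complex_of_real (riesz \<kappa> (real i) t * riesz \<kappa> (real j) t * t powr (-1 - 2*\<sigma>))) (of_real (g (real i) (real j)))"
      by (rule has_bochner_integral_of_real[OF time1]) (use ij in auto)
    thus "has_bochner_integral lborel (\<lambda>t. of_real (riesz \<kappa> (real i) t) * cnj (of_real (riesz \<kappa> (real j) t)) * of_real (t powr (-1 - 2*\<sigma>))) (G i j)"
      by (simp add: G_def)
  qed simp
  moreover have "has_bochner_integral lborel (\<lambda>\<tau>. norm (\<Sum>n\<in>{1..X}. a n * of_nat n powr (- Complex \<sigma> \<tau>)) ^ 2 * W \<tau>)
     (Re (\<Sum>i\<in>{1..X}. \<Sum>j\<in>{1..X}. a i * cnj (a j) * G i j))"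
  proof (rule has_bochner_integral_quadratic_form)
    fix i j assume ij: "i \<in> {1..X}" "j \<in> {1..X}"
    hence pos: "i > 0" "j > 0" by auto
    have "has_bochner_integral lborel (\<lambda>\<tau>. of_real ((real i * real j) powr (-\<sigma>)) * (cis ((ln (real j) - ln (real i)) * \<tau>) * of_real (W \<tau>)))
      (of_real ((real i * real j) powr (-\<sigma>)) * of_real ((\<kappa> / (2*(2*\<sigma>+\<kappa>))) * (exp (-\<sigma> * \<bar>ln (real j) - ln (real i)\<bar>) / \<sigma> - exp (-(\<sigma>+\<kappa>) * \<bar>ln (real j) - ln (real i)\<bar>) / (\<sigma>+\<kappa>))))"
      unfolding W_def by (intro has_bochner_integral_mult_right cauchy_pair_fourier s k)
    also have "of_real ((real i * real j) powr (-\<sigma>)) * of_real ((\<kappa> / (2*(2*\<sigma>+\<kappa>))) * (exp (-\<sigma> * \<bar>ln (real j) - ln (real i)\<bar>) / \<sigma> - exp (-(\<sigma>+\<kappa>) * \<bar>ln (real j) - ln (real i)\<bar>) / (\<sigma>+\<kappa>))) = G i j"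
      unfolding G_def g_def by (simp only: of_real_mult[symmetric] mult.assoc)
    also have "(\<lambda>\<tau>. of_real ((real i * real j) powr (-\<sigma>)) * (cis ((ln (real j) - ln (real i)) * \<tau>) * of_real (W \<tau>)))
      = (\<lambda>\<tau>. of_nat i powr (- Complex \<sigma> \<tau>) * cnj (of_nat j powr (- Complex \<sigma> \<tau>)) * of_real (W \<tau>))"
    proof
      fix \<tau> :: real
      have "of_nat i powr (- Complex \<sigma> \<tau>) * cnj (of_nat j powr (- Complex \<sigma> \<tau>))
        = of_real (real i powr -\<sigma> * real j powr -\<sigma>) * (cis (-(\<tau> * ln (real i))) * cis (\<tau> * ln (real j)))"
        using pos by (simp add: of_nat_powr_neg_Complex cis_cnj)
      also have "cis (-(\<tau> * ln (real i))) * cis (\<tau> * ln (real j)) = cis ((ln (real j) - ln (real i)) * \<tau>)"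
        by (simp add: cis_mult algebra_simps)
      also have "real i powr -\<sigma> * real j powr -\<sigma> = (real i * real j) powr (-\<sigma>)"
        by (simp add: powr_mult)
      finally show "of_real ((real i * real j) powr (-\<sigma>)) * (cis ((ln (real j) - ln (real i)) * \<tau>) * of_real (W \<tau>)) =
         of_nat i powr (- Complex \<sigma> \<tau>) * cnj (of_nat j powr (- Complex \<sigma> \<tau>)) * of_real (W \<tau>)"
        by (simp add: mult.assoc)
    qed
    finally show "has_bochner_integral lborel (\<lambda>\<tau>. of_nat i powr (- Complex \<sigma> \<tau>) * cnj (of_nat j powr (- Complex \<sigma> \<tau>)) * of_real (W \<tau>)) (G i j)" .
  qed simp
  ultimately show ?thesis by blast
qed

section \<open>Sums over primes\<close>

text \<open>Partial summation in integral form: p^(-1-\<alpha>)/(1+\<alpha>) is the integral of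
  t^(-2-\<alpha>) over t > p, so the sum turns into an integral of \<open>theta t\<close>, which
  Chebyshev bounds by 60 t.\<close>

lemma sum_ln_primes_powr_le:
  fixes \<alpha> x :: real
  assumes a: "0 < \<alpha>" "\<alpha> \<le> 1"
  shows "(\<Sum>p | prime p \<and> real p \<le> x. ln (real p) * real p powr (-1 - \<alpha>)) \<le> 120 / \<alpha>"
proof -
  let ?P = "{p. prime p \<and> real p \<le> x}"
  have pos: "p > 0" "ln (real p) \<ge> 0" if "p \<in> ?P" for p using that by (auto dest: prime_gt_0_nat prime_ge_1_nat)
  have "has_bochner_integral lborel (\<lambda>t. \<Sum>p\<in>?P. ln (real p) * (indicator {real p<..} t * t powr (-1 - (1 + \<alpha>))))
     (\<Sum>p\<in>?P. ln (real p) * (real p powr (-(1+\<alpha>)) / (1 + \<alpha>)))"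
    by (intro has_bochner_integral_sum has_bochner_integral_mult_right has_bochner_integral_powr_at_top) (use pos a in auto)
  moreover have "has_bochner_integral lborel (\<lambda>t. 60 * (indicator {1<..} t * t powr (-1 - \<alpha>))) (60 * (1 powr (-\<alpha>) / \<alpha>))"
    by (intro has_bochner_integral_mult_right has_bochner_integral_powr_at_top) (use a in auto)
  moreover have "(\<Sum>p\<in>?P. ln (real p) * (indicator {real p<..} t * t powr (-1 - (1 + \<alpha>)))) \<le> 60 * (indicator {1<..} t * t powr (-1 - \<alpha>))" for t :: real
  proof (cases "t > 1")
    case True
    have "(\<Sum>p\<in>?P. ln (real p) * (indicator {real p<..} t * t powr (-1 - (1 + \<alpha>))))
        = (\<Sum>p\<in>?P. if real p < t then ln (real p) * t powr (-1 - (1 + \<alpha>)) else 0)"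
      by (intro sum.cong) auto
    also have "\<dots> = (\<Sum>p\<in>{p\<in>?P. real p < t}. ln (real p) * t powr (-1 - (1 + \<alpha>)))"
      by (rule sum.inter_filter[symmetric]) simp
    also have "\<dots> \<le> (\<Sum>p | prime p \<and> real p \<le> t. ln (real p) * t powr (-1 - (1 + \<alpha>)))"
      by (intro sum_mono2) (auto dest: prime_ge_1_nat)
    also have "\<dots> = theta t * t powr (-1 - (1 + \<alpha>))" by (simp add: theta_def sum_distrib_right)
    also have "\<dots> \<le> 60 * t * t powr (-1 - (1 + \<alpha>))" using theta_le[of t] True by (intro mult_right_mono) auto
    also have "t * t powr (-1 - (1 + \<alpha>)) = t powr (1 + (-1 - (1 + \<alpha>)))" using True by (simp only: powr_add) simp
    hence "60 * t * t powr (-1 - (1 + \<alpha>)) = 60 * (indicator {1<..} t * t powr (-1 - \<alpha>))" using True by (simp add: mult.assoc)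
    finally show ?thesis .
  next
    case False
    have "indicator {real p<..} t = (0 :: real)" if "p \<in> ?P" for p
      using that False by (auto simp: indicator_def dest: prime_ge_1_nat)
    thus ?thesis using False by simp
  qed
  ultimately have "(\<Sum>p\<in>?P. ln (real p) * (real p powr (-(1+\<alpha>)) / (1 + \<alpha>))) \<le> 60 * (1 powr (-\<alpha>) / \<alpha>)"
    unfolding has_bochner_integral_iff by (metis (no_types, lifting) integral_mono)
  also have "(\<Sum>p\<in>?P. ln (real p) * (real p powr (-(1+\<alpha>)) / (1 + \<alpha>))) = (\<Sum>p\<in>?P. ln (real p) * real p powr (-1 - \<alpha>)) / (1 + \<alpha>)"
    by (simp add: sum_divide_distrib)
  finally have "(\<Sum>p\<in>?P. ln (real p) * real p powr (-1 - \<alpha>)) \<le> 60 / \<alpha> * (1 + \<alpha>)" using a by (simp add: divide_le_eq)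
  also have "\<dots> \<le> 60 / \<alpha> * 2" using a by (intro mult_left_mono) auto
  finally show ?thesis by simp
qed

lemma ln_2_ge_half: "ln 2 \<ge> (1/2 :: real)"
proof -
  have "ln (1/2::real) \<le> 1/2 - 1" by (rule ln_le_minus_one) simp
  thus ?thesis by (simp add: ln_div)
qed

lemma sum_ln_primes_over_le:
  fixes w :: real
  assumes w: "w \<ge> 1"
  shows "(\<Sum>p | prime p \<and> real p \<le> w. ln (real p) / real p) \<le> 480 * ln w"
proof (cases "w \<ge> 2")
  case True
  \<comment> \<open>Chosen so that \<open>w powr \<alpha> = 2\<close>: inserting p^(-\<alpha>) costs
    at most a factor 2 for p \<le> w, and 120/\<alpha> becomes a multiple of ln w.\<close>
  define \<alpha> where "\<alpha> = ln 2 / ln w"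
  have l2: "ln (2::real) > 0" by simp
  have lw: "ln w \<ge> ln 2" using True by simp
  have lw0: "ln w > 0" using l2 lw by linarith
  have a: "0 < \<alpha>" "\<alpha> \<le> 1" unfolding \<alpha>_def using l2 lw lw0 by (simp_all only: divide_pos_pos divide_le_eq_1_pos)
  have "(\<Sum>p | prime p \<and> real p \<le> w. ln (real p) / real p) \<le> (\<Sum>p | prime p \<and> real p \<le> w. 2 * (ln (real p) * real p powr (-1 - \<alpha>)))"
  proof (intro sum_mono)
    fix p assume p: "p \<in> {p. prime p \<and> real p \<le> w}"
    hence p1: "real p \<ge> 1" by (auto dest: prime_ge_1_nat)
    have "real p powr \<alpha> \<le> w powr \<alpha>" using p p1 a by (intro powr_mono2) auto
    also have "w powr \<alpha> = 2" using True lw0 by (simp add: \<alpha>_def powr_def)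
    finally have "real p powr \<alpha> \<le> 2" .
    moreover have "1 / real p = real p powr \<alpha> * real p powr (-1 - \<alpha>)" using p1 by (simp add: powr_add[symmetric] powr_minus_divide)
    ultimately have "1 / real p \<le> 2 * real p powr (-1 - \<alpha>)" by (simp add: mult_right_mono)
    hence "ln (real p) * (1 / real p) \<le> ln (real p) * (2 * real p powr (-1 - \<alpha>))" using p1 by (intro mult_left_mono) auto
    thus "ln (real p) / real p \<le> 2 * (ln (real p) * real p powr (-1 - \<alpha>))" by simp
  qed
  also have "\<dots> = 2 * (\<Sum>p | prime p \<and> real p \<le> w. ln (real p) * real p powr (-1 - \<alpha>))" by (simp add: sum_distrib_left)
  also have "\<dots> \<le> 2 * (120 / \<alpha>)" using sum_ln_primes_powr_le[OF a, of w] by simp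
  also have "\<dots> = 240 * ln w / ln 2" by (simp add: \<alpha>_def)
  also have "\<dots> \<le> 240 * ln w / (1/2)" using ln_2_ge_half lw l2 by (intro divide_left_mono) auto
  finally show ?thesis by simp
next
  case False
  have "{p::nat. prime p \<and> real p \<le> w} = {}" using False by (auto dest: prime_ge_2_nat)
  hence "(\<Sum>p | prime p \<and> real p \<le> w. ln (real p) / real p) = 0" by (simp only: sum.empty)
  thus ?thesis using w by simp
qed

text \<open>A weak form of Mertens' theorem that still allows an arbitrarily small power of y after
  exponentiation. Beyond exp(480/\<epsilon>) the factor (\<epsilon>/480) ln p is at least 1; the
  finitely many smaller primes go into C.\<close>

lemma sum_inverse_primes_le:
  fixes \<epsilon> :: real
  assumes "\<epsilon> > 0"
  obtains C where "C \<ge> 0" "\<And>y. y \<ge> 1 \<Longrightarrow> (\<Sum>p | prime p \<and> real p \<le> y. 1 / real p) \<le> \<epsilon> * ln y + C"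
proof -
  define P0 where "P0 = exp (480 / \<epsilon>)"
  have P0: "P0 > 1" "ln P0 = 480 / \<epsilon>" using assms by (auto simp: P0_def)
  show ?thesis
  proof (rule that[of "real (card {p::nat. prime p \<and> real p \<le> P0})"])
    fix y :: real assume y: "y \<ge> 1"
    have "(\<Sum>p | prime p \<and> real p \<le> y. 1 / real p) \<le> (\<Sum>p | prime p \<and> real p \<le> y. (if real p \<le> P0 then 1 else 0) + (\<epsilon> / 480) * (ln (real p) / real p))"
    proof (intro sum_mono)
      fix p assume p: "p \<in> {p. prime p \<and> real p \<le> y}"
      hence p1: "real p \<ge> 1" by (auto dest: prime_ge_1_nat)
      show "1 / real p \<le> (if real p \<le> P0 then 1 else 0) + (\<epsilon> / 480) * (ln (real p) / real p)"
      proof (cases "real p \<le> P0")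
        case True
        have "1 / real p \<le> 1" "ln (real p) / real p \<ge> 0" using p1 by auto
        hence "1 / real p \<le> 1 + (\<epsilon> / 480) * (ln (real p) / real p)" using assms
          by (smt (verit) mult_nonneg_nonneg divide_nonneg_nonneg)
        thus ?thesis using True by simp
      next
        case False
        have "ln P0 \<le> ln (real p)" using False P0(1) by (intro ln_mono) auto
        hence "480 / \<epsilon> \<le> ln (real p)" by (simp only: P0(2))
        hence "1 \<le> (\<epsilon> / 480) * ln (real p)" using assms by (simp add: field_simps)
        hence "1 / real p \<le> ((\<epsilon> / 480) * ln (real p)) / real p" using p1 by (intro divide_right_mono) auto
        thus ?thesis using False by simp
      qed
    qed
    also have "\<dots> = (\<Sum>p | prime p \<and> real p \<le> y. (if real p \<le> P0 then 1 else 0)) + (\<epsilon> / 480) * (\<Sum>p | prime p \<and> real p \<le> y. ln (real p) / real p)"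
      by (simp add: sum.distrib sum_distrib_left)
    finally have 1: "(\<Sum>p | prime p \<and> real p \<le> y. 1 / real p) \<le> \<dots>" .
    have "(\<Sum>p | prime p \<and> real p \<le> y. (if real p \<le> P0 then 1 else 0 :: real)) = (\<Sum>p\<in>{p\<in>{p. prime p \<and> real p \<le> y}. real p \<le> P0}. 1)"
      by (rule sum.inter_filter[symmetric]) simp
    also have "\<dots> \<le> real (card {p::nat. prime p \<and> real p \<le> P0})"
      by (simp, rule card_mono) auto
    finally have 2: "(\<Sum>p | prime p \<and> real p \<le> y. (if real p \<le> P0 then 1 else 0 :: real)) \<le> real (card {p::nat. prime p \<and> real p \<le> P0})" .
    have "(\<epsilon> / 480) * (\<Sum>p | prime p \<and> real p \<le> y. ln (real p) / real p) \<le> (\<epsilon> / 480) * (480 * ln y)"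
      using assms sum_ln_primes_over_le[OF y] by (intro mult_left_mono) auto
    also have "\<dots> = \<epsilon> * ln y" by simp
    finally show "(\<Sum>p | prime p \<and> real p \<le> y. 1 / real p) \<le> \<epsilon> * ln y + real (card {p::nat. prime p \<and> real p \<le> P0})"
      using 1 2 by linarith
  qed simp
qed

text \<open>Insert ln p / ln y \<ge> 1. At y = exp(1/\<alpha>) the bound is an absolute constant: on
  the line \<sigma> = 1 + \<alpha> the primes beyond exp(1/\<alpha>) hardly matter.\<close>

lemma sum_primes_tail_powr_le:
  fixes \<alpha> x y :: real
  assumes a: "0 < \<alpha>" "\<alpha> \<le> 1" and y: "y > 1"
  shows "(\<Sum>p | prime p \<and> y \<le> real p \<and> real p \<le> x. real p powr (-1 - \<alpha>)) \<le> 120 / (\<alpha> * ln y)"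
proof -
  have ly: "ln y > 0" using y by simp
  have "(\<Sum>p | prime p \<and> y \<le> real p \<and> real p \<le> x. real p powr (-1 - \<alpha>))
     \<le> (\<Sum>p | prime p \<and> y \<le> real p \<and> real p \<le> x. ln (real p) * real p powr (-1 - \<alpha>) / ln y)"
  proof (intro sum_mono)
    fix p assume p: "p \<in> {p. prime p \<and> y \<le> real p \<and> real p \<le> x}"
    hence "ln y \<le> ln (real p)" using y by simp
    hence "ln y * real p powr (-1 - \<alpha>) \<le> ln (real p) * real p powr (-1 - \<alpha>)" by (intro mult_right_mono) auto
    thus "real p powr (-1 - \<alpha>) \<le> ln (real p) * real p powr (-1 - \<alpha>) / ln y" using ly by (simp add: field_simps)
  qed
  also have "\<dots> \<le> (\<Sum>p | prime p \<and> real p \<le> x. ln (real p) * real p powr (-1 - \<alpha>) / ln y)"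
    using ly by (intro sum_mono2) (auto dest: prime_ge_1_nat)
  also have "\<dots> = (\<Sum>p | prime p \<and> real p \<le> x. ln (real p) * real p powr (-1 - \<alpha>)) / ln y" by (simp add: sum_divide_distrib)
  also have "\<dots> \<le> 120 / \<alpha> / ln y" using ly by (intro divide_right_mono sum_ln_primes_powr_le a) auto
  finally show ?thesis by simp
qed

text \<open>Only windows of bounded length are needed, hence Chebyshev's bound suffices here.\<close>

lemma prime_polynomial_mean_square:
  fixes c :: "nat \<Rightarrow> complex" and A \<alpha> b x \<tau>0 :: real
  assumes a: "0 < \<alpha>" "\<alpha> \<le> 1" and b: "b \<ge> 1"
    and c: "\<And>p. prime p \<Longrightarrow> norm (c p) \<le> A * (ln (real p) * real p powr (-1 - \<alpha>))"
  defines "P \<equiv> {p. prime p \<and> real p \<le> x}"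
  shows "\<exists>J. has_bochner_integral lborel (\<lambda>\<tau>. norm (\<Sum>p\<in>P. c p * cis (- (\<tau> * ln (real p)))) ^ 2 * (1 / (b\<^sup>2 + (\<tau> - \<tau>0)\<^sup>2))) J
           \<and> J \<le> 14400 * pi * A\<^sup>2 / (b * \<alpha>)"
proof -
  have finP: "finite P" by (simp add: P_def)
  define G where "G p q = cis ((ln (real q) - ln (real p)) * \<tau>0) * of_real (pi / b * exp (- b * \<bar>ln (real q) - ln (real p)\<bar>))" for p q :: nat
  have b0: "b > 0" using b by simp
  have "has_bochner_integral lborel (\<lambda>\<tau>. norm (\<Sum>p\<in>P. c p * cis (- (\<tau> * ln (real p)))) ^ 2 * (1 / (b\<^sup>2 + (\<tau> - \<tau>0)\<^sup>2)))
     (Re (\<Sum>p\<in>P. \<Sum>q\<in>P. c p * cnj (c q) * G p q))"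
  proof (rule has_bochner_integral_quadratic_form[OF finP])
    fix p q
    let ?u = "ln (real q) - ln (real p)"
    have "has_bochner_integral lborel (\<lambda>t. cis (?u * t) / of_real (b\<^sup>2 + t\<^sup>2)) (of_real (pi / b * exp (- b * \<bar>?u\<bar>)))"
      using cauchy_kernel_fourier[OF b0, of ?u] by (simp only: has_bochner_integral_iff conj_assoc)
    hence "has_bochner_integral lborel (\<lambda>t. cis (?u * (- \<tau>0 + 1 * t)) / of_real (b\<^sup>2 + (- \<tau>0 + 1 * t)\<^sup>2)) (of_real (pi / b * exp (- b * \<bar>?u\<bar>)) /\<^sub>R \<bar>1\<bar>)"
      by (subst lborel_has_bochner_integral_real_affine_iff[of 1, symmetric]) auto
    hence "has_bochner_integral lborel (\<lambda>t. cis (?u * \<tau>0) * (cis (?u * (- \<tau>0 + t)) / of_real (b\<^sup>2 + (- \<tau>0 + t)\<^sup>2))) (G p q)"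
      unfolding G_def by (intro has_bochner_integral_mult_right) simp
    moreover have "cis (?u * \<tau>0) * (cis (?u * (- \<tau>0 + t)) / of_real (b\<^sup>2 + (- \<tau>0 + t)\<^sup>2)) =
        cis (- (t * ln (real p))) * cnj (cis (- (t * ln (real q)))) * of_real (1 / (b\<^sup>2 + (t - \<tau>0)\<^sup>2))" for t
    proof -
      have "cis (?u * \<tau>0) * cis (?u * (- \<tau>0 + t)) = cis (- (t * ln (real p))) * cnj (cis (- (t * ln (real q))))"
        by (simp add: cis_cnj cis_mult algebra_simps)
      moreover have "- \<tau>0 + t = t - \<tau>0" by simp
      ultimately show ?thesis by (simp only: times_divide_eq_right of_real_divide of_real_1 mult_1_right)
    qed
    ultimately show "has_bochner_integral lborel (\<lambda>x. cis (- (x * ln (real p))) * cnj (cis (- (x * ln (real q)))) * of_real (1 / (b\<^sup>2 + (x - \<tau>0)\<^sup>2))) (G p q)"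
      by (simp only:)
  qed
  moreover have "Re (\<Sum>p\<in>P. \<Sum>q\<in>P. c p * cnj (c q) * G p q) \<le> 14400 * pi * A\<^sup>2 / (b * \<alpha>)"
  proof -
    define d where "d p = ln (real p) * real p powr (-1 - \<alpha>)" for p :: nat
    \<comment> \<open>The kernel factor is min(p, q)/max(p, q). For q \<le> p the quotient q/p
      cancels the 1/q hidden in \<open>d q\<close> and leaves ln q / p; summing over q gives
      \<open>theta p\<close> / p, at most 60. With symmetry and the sum of \<open>d p\<close> the
      constant is 2 * 60 * 120.\<close>
    define h where "h p q = d p * d q * exp (- \<bar>ln (real q) - ln (real p)\<bar>)" for p q :: nat
    have pp: "real p \<ge> 2" "prime p" if "p \<in> P" for p using that by (auto simp: P_def dest: prime_ge_2_nat)
    have d0: "d p \<ge> 0" if "p \<in> P" for p unfolding d_def using pp[OF that] by simp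
    have "Re (\<Sum>p\<in>P. \<Sum>q\<in>P. c p * cnj (c q) * G p q) \<le> norm (\<Sum>p\<in>P. \<Sum>q\<in>P. c p * cnj (c q) * G p q)"
      by (rule complex_Re_le_cmod)
    also have "\<dots> \<le> (\<Sum>p\<in>P. \<Sum>q\<in>P. norm (c p * cnj (c q) * G p q))"
      by (rule order_trans[OF norm_sum]) (intro sum_mono norm_sum)
    also have "\<dots> \<le> (\<Sum>p\<in>P. \<Sum>q\<in>P. A\<^sup>2 * (pi / b) * h p q)"
    proof (intro sum_mono)
      fix p q assume pq: "p \<in> P" "q \<in> P"
      have "norm (c p) * norm (c q) \<le> (A * d p) * (A * d q)"
      proof (rule mult_mono)
        show "norm (c p) \<le> A * d p" "norm (c q) \<le> A * d q" using c pp pq by (auto simp: d_def)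
        thus "0 \<le> A * d p" using norm_ge_zero[of "c p"] by linarith
      qed simp
      note cc = this
      \<comment> \<open>As b \<ge> 1, the width may be replaced by 1 in the exponent. Only the outer
        factor 1/b is kept; with b = T it later supplies one of the two factors 1/T of the
        tail.\<close>
      have ee: "exp (- b * \<bar>ln (real q) - ln (real p)\<bar>) \<le> exp (- \<bar>ln (real q) - ln (real p)\<bar>)"
        using b mult_right_mono[of 1 b "\<bar>ln (real q) - ln (real p)\<bar>"] by simp
      have pb: "0 \<le> pi / b" using b0 by simp
      have "0 \<le> norm (c p) * norm (c q)" by simp
      hence A0: "0 \<le> (A * d p) * (A * d q)" using cc by linarith
      have "(norm (c p) * norm (c q)) * (pi / b * exp (- b * \<bar>ln (real q) - ln (real p)\<bar>))
          \<le> ((A * d p) * (A * d q)) * (pi / b * exp (- \<bar>ln (real q) - ln (real p)\<bar>))"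
        by (rule mult_mono[OF cc mult_left_mono[OF ee pb] A0]) (rule mult_nonneg_nonneg[OF pb exp_ge_zero])
      moreover have "norm (G p q) = pi / b * exp (- b * \<bar>ln (real q) - ln (real p)\<bar>)"
      proof -
        have "norm (G p q) = \<bar>pi / b * exp (- b * \<bar>ln (real q) - ln (real p)\<bar>)\<bar>"
          unfolding G_def norm_mult norm_cis norm_of_real by (rule mult_1_left)
        also have "\<dots> = pi / b * exp (- b * \<bar>ln (real q) - ln (real p)\<bar>)"
          by (rule abs_of_nonneg[OF mult_nonneg_nonneg[OF pb exp_ge_zero]])
        finally show ?thesis .
      qed
      ultimately show "norm (c p * cnj (c q) * G p q) \<le> A\<^sup>2 * (pi / b) * h p q"
        by (simp add: norm_mult h_def power2_eq_square mult_ac)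
    qed
    also have "\<dots> = A\<^sup>2 * (pi / b) * (\<Sum>p\<in>P. \<Sum>q\<in>P. h p q)" by (simp add: sum_distrib_left)
    also have "(\<Sum>p\<in>P. \<Sum>q\<in>P. h p q) \<le> 14400 / \<alpha>"
    proof -
      let ?hl = "\<lambda>p q. if q \<le> p then h p q else 0"
      have h0: "h p q \<ge> 0" if "p \<in> P" "q \<in> P" for p q unfolding h_def using d0 that by simp
      have hsym: "h p q = h q p" for p q by (simp add: h_def abs_minus_commute mult_ac)
      have "(\<Sum>p\<in>P. \<Sum>q\<in>P. h p q) \<le> (\<Sum>p\<in>P. \<Sum>q\<in>P. ?hl p q + ?hl q p)"
        by (intro sum_mono) (use h0 hsym in auto)
      also have "\<dots> = (\<Sum>p\<in>P. \<Sum>q\<in>P. ?hl p q) + (\<Sum>p\<in>P. \<Sum>q\<in>P. ?hl q p)" by (simp only: sum.distrib)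
      also have "(\<Sum>p\<in>P. \<Sum>q\<in>P. ?hl q p) = (\<Sum>p\<in>P. \<Sum>q\<in>P. ?hl p q)" by (rule sum.swap)
      finally have 1: "(\<Sum>p\<in>P. \<Sum>q\<in>P. h p q) \<le> 2 * (\<Sum>p\<in>P. \<Sum>q\<in>P. ?hl p q)" by simp
      have "(\<Sum>p\<in>P. \<Sum>q\<in>P. ?hl p q) \<le> (\<Sum>p\<in>P. d p * 60)"
      proof (intro sum_mono)
        fix p assume p: "p \<in> P"
        have p2: "real p \<ge> 2" using pp[OF p] by simp
        have "(\<Sum>q\<in>P. ?hl p q) = (\<Sum>q\<in>{q\<in>P. q \<le> p}. h p q)" by (rule sum.inter_filter[symmetric, OF finP])
        also have "\<dots> \<le> (\<Sum>q\<in>{q\<in>P. q \<le> p}. d p * (ln (real q) / real p))"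
        proof (intro sum_mono)
          fix q assume q: "q \<in> {q\<in>P. q \<le> p}"
          hence q2: "real q \<ge> 2" and qp: "real q \<le> real p" using pp by auto
          have l: "- \<bar>ln (real q) - ln (real p)\<bar> = ln (real q / real p)" using q2 qp p2 by (simp add: ln_div)
          have "h p q = d p * (ln (real q) * (real q powr (-1 - \<alpha>) * (real q / real p)))"
            unfolding h_def l d_def[of q] using q2 p2 by simp
          also have "real q powr (-1 - \<alpha>) * (real q / real p) \<le> 1 / real p"
          proof -
            have "real q powr (-1 - \<alpha>) \<le> real q powr (-1)" using q2 a by (intro powr_mono) auto
            also have "\<dots> = 1 / real q" using q2 by (simp add: powr_minus_divide)
            finally have "real q powr (-1 - \<alpha>) * (real q / real p) \<le> 1 / real q * (real q / real p)" by (intro mult_right_mono) auto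
            thus ?thesis using q2 by simp
          qed
          hence "d p * (ln (real q) * (real q powr (-1 - \<alpha>) * (real q / real p))) \<le> d p * (ln (real q) * (1 / real p))"
            using d0[OF p] q2 by (intro mult_left_mono) auto
          finally show "h p q \<le> d p * (ln (real q) / real p)" by simp
        qed
        also have "\<dots> = d p * ((\<Sum>q\<in>{q\<in>P. q \<le> p}. ln (real q)) / real p)" by (simp add: sum_distrib_left sum_divide_distrib)
        also have "\<dots> \<le> d p * 60"
        proof (rule mult_left_mono[OF _ d0[OF p]])
          have "(\<Sum>q\<in>{q\<in>P. q \<le> p}. ln (real q)) \<le> theta (real p)" unfolding theta_def
            by (intro sum_mono2) (auto simp: P_def dest: prime_ge_1_nat)
          also have "\<dots> \<le> 60 * real p" using theta_le[of "real p"] by simp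
          finally show "(\<Sum>q\<in>{q\<in>P. q \<le> p}. ln (real q)) / real p \<le> 60" using p2 by (simp add: field_simps)
        qed
        finally show "(\<Sum>q\<in>P. ?hl p q) \<le> d p * 60" .
      qed
      also have "\<dots> = (\<Sum>p\<in>P. d p) * 60" by (simp add: sum_distrib_right)
      also have "\<dots> \<le> 120 / \<alpha> * 60" unfolding d_def P_def by (intro mult_right_mono sum_ln_primes_powr_le a) simp
      finally have "(\<Sum>p\<in>P. \<Sum>q\<in>P. ?hl p q) \<le> 7200 / \<alpha>" by simp
      thus ?thesis using 1 by simp
    qed
    hence "A\<^sup>2 * (pi / b) * (\<Sum>p\<in>P. \<Sum>q\<in>P. h p q) \<le> A\<^sup>2 * (pi / b) * (14400 / \<alpha>)"
      using b by (intro mult_left_mono) auto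
    finally show ?thesis by (simp add: mult_ac)
  qed
  ultimately show ?thesis by blast
qed

section \<open>Bounds by logarithmic means\<close>

lemma powr_const_measurable: "(\<lambda>t::real. t powr a) \<in> borel_measurable borel"
proof -
  have "(\<lambda>t::real. if t = 0 then 0 else exp (a * ln t)) \<in> borel_measurable borel" by measurable
  thus ?thesis by (simp add: powr_def[abs_def])
qed

lemma Msum_measurable: "(\<lambda>t. Msum t (g :: nat \<Rightarrow> complex)) \<in> borel_measurable borel"
proof -
  have "(\<lambda>k. \<Sum>n\<in>{1..k}. g n) \<in> measurable (count_space UNIV) borel" by simp
  moreover have "(\<lambda>t::real. nat \<lfloor>t\<rfloor>) \<in> measurable borel (count_space UNIV)" by measurable
  ultimately have "(\<lambda>k. \<Sum>n\<in>{1..k}. g n) \<circ> (\<lambda>t::real. nat \<lfloor>t\<rfloor>) \<in> borel_measurable borel"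
    by (rule measurable_comp[rotated])
  thus ?thesis by (simp add: Msum_def[abs_def] o_def)
qed

lemma Msum_less_1: "t < 1 \<Longrightarrow> Msum t g = 0"
proof -
  assume "t < 1"
  hence "nat \<lfloor>t\<rfloor> = 0" by simp
  thus ?thesis by (simp add: Msum_def)
qed

lemma Msum_eq: "0 \<le> t \<Longrightarrow> Msum t g = (\<Sum>n | 1 \<le> n \<and> real n \<le> t. g n)"
  unfolding Msum_def by (rule sum.cong) (auto simp: le_nat_floor le_nat_iff le_floor_iff)

lemma finite_nat_le_real [simp]: "finite {n::nat. 1 \<le> n \<and> real n \<le> t}" "finite {n::nat. real n \<le> t}"
proof -
  show "finite {n::nat. real n \<le> t}" by (rule finite_subset[of _ "{..nat \<lfloor>t\<rfloor>}"]) (auto simp: le_nat_floor)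
  thus "finite {n::nat. 1 \<le> n \<and> real n \<le> t}" by (rule rev_finite_subset) auto
qed

lemma norm_Msum_le:
  fixes g :: "nat \<Rightarrow> complex"
  assumes "0 \<le> t" "t \<le> y"
  shows "norm (Msum t g) \<le> (\<Sum>n | 1 \<le> n \<and> real n \<le> y. norm (g n))"
proof -
  have "norm (Msum t g) \<le> (\<Sum>n | 1 \<le> n \<and> real n \<le> t. norm (g n))"
    unfolding Msum_eq[OF assms(1)] by (rule norm_sum)
  also have "\<dots> \<le> (\<Sum>n | 1 \<le> n \<and> real n \<le> y. norm (g n))"
    by (rule sum_mono2) (use assms in auto)
  finally show ?thesis .
qed

definition Mint :: "(nat \<Rightarrow> complex) \<Rightarrow> real \<Rightarrow> real" where
  "Mint g y = (LBINT t. indicator {1..y} t * (norm (Msum t g) * t powr (-2)))"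

lemma Mint_integrable:
  fixes g :: "nat \<Rightarrow> complex"
  shows "integrable lborel (\<lambda>t. indicator {1..y} t * (norm (Msum t g) * t powr (-2)) :: real)"
proof (rule Bochner_Integration.integrable_bound)
  define S where "S = (\<Sum>n | 1 \<le> n \<and> real n \<le> y. norm (g n))"
  show "integrable lborel (\<lambda>t. S * indicator {1..y} t :: real)"
    by (intro integrable_mult_right integrable_real_indicator) (auto simp: emeasure_lborel_Icc_eq)
  show "(\<lambda>t. indicator {1..y} t * (norm (Msum t g) * t powr (-2)) :: real) \<in> borel_measurable lborel"
    using Msum_measurable[of g] powr_const_measurable[of "-2"] by simp
  show "AE t in lborel. norm (indicator {1..y} t * (norm (Msum t g) * t powr (-2)) :: real) \<le> norm (S * indicator {1..y} t :: real)"
  proof (rule AE_I2)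
    fix t :: real
    have S0: "S \<ge> 0" unfolding S_def by (intro sum_nonneg) auto
    show "norm (indicator {1..y} t * (norm (Msum t g) * t powr (-2)) :: real) \<le> norm (S * indicator {1..y} t :: real)"
    proof (cases "t \<in> {1..y}")
      case True
      have "norm (Msum t g) \<le> S" unfolding S_def by (rule norm_Msum_le) (use True in auto)
      moreover have "t powr (-2) \<le> t powr 0" using True by (intro powr_mono) auto
      ultimately have "norm (Msum t g) * t powr (-2) \<le> S * 1" using True S0 by (intro mult_mono) auto
      thus ?thesis using True S0 by simp
    qed simp
  qed
qed

lemma Mint_nonneg: "Mint g y \<ge> 0"
  unfolding Mint_def by (rule Bochner_Integration.integral_nonneg) simp

lemma Mint_mono: "y \<le> y' \<Longrightarrow> Mint g y \<le> Mint g y'"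
  unfolding Mint_def by (intro integral_mono Mint_integrable) (auto simp: indicator_def)

text \<open>Since ln(y/n) is the integral of 1/u over [n, y], the sum is the integral of M(u; g)/u;
  then 1/u \<le> y/u^2 for u \<le> y.\<close>

lemma norm_sum_ln_quotient_le:
  fixes g :: "nat \<Rightarrow> complex"
  assumes y: "y \<ge> 1"
  shows "norm (\<Sum>n | 1 \<le> n \<and> real n \<le> y. g n * of_real (ln (y / real n))) \<le> y * Mint g y"
proof -
  let ?S = "{n. 1 \<le> n \<and> real n \<le> y}"
  have "has_bochner_integral lborel (\<lambda>u. inverse u * indicator {real n..y} u) (ln y - ln (real n))" if "n \<in> ?S" for n
    by (rule has_bochner_integral_FTC_Icc_real) (use that in \<open>auto intro!: derivative_eq_intros continuous_intros simp: inverse_eq_divide\<close>)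
  hence "has_bochner_integral lborel (\<lambda>u. complex_of_real (inverse u * indicator {real n..y} u)) (of_real (ln y - ln (real n)))" if "n \<in> ?S" for n
    using that by (intro has_bochner_integral_of_real)
  hence "has_bochner_integral lborel (\<lambda>u. \<Sum>n\<in>?S. g n * of_real (inverse u * indicator {real n..y} u)) (\<Sum>n\<in>?S. g n * of_real (ln y - ln (real n)))"
    by (intro has_bochner_integral_sum has_bochner_integral_mult_right)
  moreover have "(\<Sum>n\<in>?S. g n * of_real (ln y - ln (real n))) = (\<Sum>n\<in>?S. g n * of_real (ln (y / real n)))"
    by (intro sum.cong refl) (use y in \<open>auto simp: ln_div\<close>)
  moreover have "(\<Sum>n\<in>?S. g n * of_real (inverse u * indicator {real n..y} u)) = of_real (indicator {1..y} u * inverse u) * Msum u g" for u :: real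
  proof (cases "u \<in> {1..y}")
    case True
    have "(\<Sum>n\<in>?S. g n * of_real (inverse u * indicator {real n..y} u)) = (\<Sum>n\<in>?S. if real n \<le> u then of_real (inverse u) * g n else 0)"
      using True by (intro sum.cong refl) auto
    also have "\<dots> = (\<Sum>n\<in>{n\<in>?S. real n \<le> u}. of_real (inverse u) * g n)" by (rule sum.inter_filter[symmetric]) simp
    also have "{n\<in>?S. real n \<le> u} = {n. 1 \<le> n \<and> real n \<le> u}" using True by auto
    also have "(\<Sum>n\<in>\<dots>. of_real (inverse u) * g n) = of_real (inverse u) * Msum u g" using True by (simp add: Msum_eq sum_distrib_left)
    finally show ?thesis using True by simp
  next
    case False
    have "indicator {real n..y} u = (0::real)" if "n \<in> ?S" for n using that False by (auto simp: indicator_def)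
    hence "(\<Sum>n\<in>?S. g n * of_real (inverse u * indicator {real n..y} u)) = 0" by (intro sum.neutral) simp
    thus ?thesis using False by simp
  qed
  ultimately have "has_bochner_integral lborel (\<lambda>u. of_real (indicator {1..y} u * inverse u) * Msum u g) (\<Sum>n\<in>?S. g n * of_real (ln (y / real n)))"
    by simp
  hence "integrable lborel (\<lambda>u. of_real (indicator {1..y} u * inverse u) * Msum u g)"
    and e: "(\<Sum>n\<in>?S. g n * of_real (ln (y / real n))) = (LBINT u. of_real (indicator {1..y} u * inverse u) * Msum u g)"
    by (auto simp: has_bochner_integral_iff)
  hence "integrable lborel (\<lambda>u. norm (of_real (indicator {1..y} u * inverse u) * Msum u g))" by (intro integrable_norm)
  moreover have "norm (of_real (indicator {1..y} u * inverse u) * Msum u g) \<le> y * (indicator {1..y} u * (norm (Msum u g) * u powr (-2)))" for u :: real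
  proof (cases "u \<in> {1..y}")
    case True
    have "u powr (-2) = inverse u * inverse u" using True by (simp add: powr_minus power2_eq_square)
    moreover have "inverse u \<le> y * (inverse u * inverse u)" using True by (simp add: field_simps)
    hence "inverse u * norm (Msum u g) \<le> y * (inverse u * inverse u) * norm (Msum u g)" by (rule mult_right_mono) simp
    moreover have "norm (of_real (indicator {1..y} u * inverse u) * Msum u g) = inverse u * norm (Msum u g)"
      unfolding norm_mult norm_of_real using True by simp
    ultimately show ?thesis using True by (simp only: indicator_simps mult_1_left mult_ac)
  qed simp
  ultimately have "(LBINT u. norm (of_real (indicator {1..y} u * inverse u) * Msum u g)) \<le> (LBINT u. y * (indicator {1..y} u * (norm (Msum u g) * u powr (-2))))"
    by (intro integral_mono integrable_mult_right Mint_integrable)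
  also have "\<dots> = y * Mint g y" unfolding Mint_def by (rule integral_mult_right_zero)
  finally show ?thesis unfolding e
    using integral_norm_bound[of lborel "\<lambda>u. of_real (indicator {1..y} u * inverse u) * Msum u g"] by (rule order_trans[rotated])
qed

section \<open>The Halasz-Montgomery inequality for exponential multiplicative functions\<close>

lemma sum_expmult_ln_eq:
  fixes F :: "nat \<Rightarrow> complex"
  assumes y: "y \<ge> 1"
  shows "(\<Sum>n | 1 \<le> n \<and> real n \<le> y. expmult F n * of_real (ln (real n)))
       = (\<Sum>p | prime p \<and> real p \<le> y. F p * of_real (ln (real p)) * Msum (y / real p) (expmult F))"
proof -
  let ?S = "{n. 1 \<le> n \<and> real n \<le> y}" and ?P = "{p. prime p \<and> real p \<le> y}"
  have "(\<Sum>n\<in>?S. expmult F n * of_real (ln (real n)))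
      = (\<Sum>n\<in>?S. \<Sum>p\<in>{p\<in>?P. p dvd n}. F p * of_real (ln (real p)) * expmult F (n div p))"
  proof (intro sum.cong refl)
    fix n assume n: "n \<in> ?S"
    have "{p\<in>?P. p dvd n} = prime_factors n"
    proof -
      have "real p \<le> y" if "p dvd n" for p
      proof -
        have "p \<le> n" using that n by (intro dvd_imp_le) auto
        hence "real p \<le> real n" by simp
        thus ?thesis using n by simp
      qed
      thus ?thesis using n by (auto simp: prime_factors_dvd)
    qed
    thus "expmult F n * of_real (ln (real n)) = (\<Sum>p\<in>{p\<in>?P. p dvd n}. F p * of_real (ln (real p)) * expmult F (n div p))"
      using expmult_ln[of n F] n by simp
  qed
  also have "\<dots> = (\<Sum>p\<in>?P. \<Sum>n\<in>{n\<in>?S. p dvd n}. F p * of_real (ln (real p)) * expmult F (n div p))"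
    by (rule sum.swap_restrict) auto
  also have "\<dots> = (\<Sum>p\<in>?P. F p * of_real (ln (real p)) * Msum (y / real p) (expmult F))"
  proof (intro sum.cong refl)
    fix p assume p: "p \<in> ?P"
    hence p0: "p > 0" by (auto dest: prime_gt_0_nat)
    have "(\<Sum>n\<in>{n\<in>?S. p dvd n}. F p * of_real (ln (real p)) * expmult F (n div p))
        = (\<Sum>m | 1 \<le> m \<and> real m \<le> y / real p. F p * of_real (ln (real p)) * expmult F m)"
      by (rule sum.reindex_bij_witness[of _ "\<lambda>m. p * m" "\<lambda>n. n div p"])
         (use p0 in \<open>auto simp: field_simps Suc_le_eq elim!: dvdE\<close>)
    thus "(\<Sum>n\<in>{n\<in>?S. p dvd n}. F p * of_real (ln (real p)) * expmult F (n div p)) = F p * of_real (ln (real p)) * Msum (y / real p) (expmult F)"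
      using y p0 by (simp add: Msum_eq sum_distrib_left)
  qed
  finally show ?thesis .
qed

text \<open>Averages M(t; g) over (a, b] with density t^(-2), whose total mass there is 1/a - 1/b =
  1/(l b); the difference between M(b; g) and M(t; g) is at most the last sum. The restriction to t
  \<ge> 1 is harmless because M vanishes below 1.\<close>

lemma norm_Msum_smoothing:
  fixes g :: "nat \<Rightarrow> complex"
  assumes b: "b > 0" "b \<le> y" and l: "l > 0"
  defines "a \<equiv> b / (1 + 1 / l)"
  shows "norm (Msum b g) \<le> l * b * (LBINT t. indicator {a<..b} t * (indicator {1..y} t * (norm (Msum t g) * t powr (-2))))
           + (\<Sum>n | 1 \<le> n \<and> a < real n \<and> real n \<le> b. norm (g n))"
proof -
  define E where "E = (\<Sum>n | 1 \<le> n \<and> a < real n \<and> real n \<le> b. norm (g n))"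
  define J where "J = (LBINT t. indicator {a<..b} t * (indicator {1..y} t * (norm (Msum t g) * t powr (-2))))"
  have l1: "1 + 1/l > 0" using l by (simp add: add_pos_pos)
  have a0: "a > 0" using b l1 by (simp add: a_def)
  have ab: "a \<le> b" using b l by (simp add: a_def field_simps)
  have H: "has_bochner_integral lborel (\<lambda>t. indicator {c<..} t * t powr (-2)) (1 / c)" if "c > 0" for c :: real
    using has_bochner_integral_powr_at_top[of 1 c] that by (simp add: powr_minus_divide)
  have "has_bochner_integral lborel (\<lambda>t. indicator {a<..} t * t powr (-2) - indicator {b<..} t * t powr (-2)) (1/a - 1/b)"
    by (intro has_bochner_integral_diff H a0 b)
  moreover have "indicator {a<..} t * t powr (-2) - indicator {b<..} t * t powr (-2) = indicator {a<..b} t * t powr (-2)" for t :: real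
    using ab by (auto simp: indicator_def)
  moreover have "1/a - 1/b = 1 / (l * b)" using b l unfolding a_def by (simp add: field_simps)
  ultimately have W: "has_bochner_integral lborel (\<lambda>t. indicator {a<..b} t * t powr (-2)) (1 / (l * b))" by simp
  have Wc: "integrable lborel (\<lambda>t. c * (indicator {a<..b} t * t powr (-2)))" "(LBINT t. c * (indicator {a<..b} t * t powr (-2))) = c / (l * b)" for c :: real
    using has_bochner_integral_mult_right[OF W, of c] by (auto simp: has_bochner_integral_iff)
  have Ji: "integrable lborel (\<lambda>t. indicator {a<..b} t * (indicator {1..y} t * (norm (Msum t g) * t powr (-2))))"
    using integrable_mult_indicator[OF _ Mint_integrable[of y g], of "{a<..b}"] by simp
  have "(LBINT t. norm (Msum b g) * (indicator {a<..b} t * t powr (-2)))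
     \<le> (LBINT t. indicator {a<..b} t * (indicator {1..y} t * (norm (Msum t g) * t powr (-2))) + E * (indicator {a<..b} t * t powr (-2)))"
  proof (rule integral_mono)
    fix t :: real
    show "norm (Msum b g) * (indicator {a<..b} t * t powr (-2)) \<le> indicator {a<..b} t * (indicator {1..y} t * (norm (Msum t g) * t powr (-2))) + E * (indicator {a<..b} t * t powr (-2))"
    proof (cases "t \<in> {a<..b}")
      case True
      have t0: "t > 0" using True a0 by simp
      have "{n. 1 \<le> n \<and> real n \<le> b} = {n. 1 \<le> n \<and> real n \<le> t} \<union> {n. 1 \<le> n \<and> t < real n \<and> real n \<le> b}" using True by auto
      hence "Msum b g = Msum t g + (\<Sum>n | 1 \<le> n \<and> t < real n \<and> real n \<le> b. g n)"
        using b t0 by (simp add: Msum_eq) (subst sum.union_disjoint, auto intro: finite_subset[OF _ finite_nat_le_real(2)[of b]])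
      hence "norm (Msum b g) \<le> norm (Msum t g) + norm (\<Sum>n | 1 \<le> n \<and> t < real n \<and> real n \<le> b. g n)" by (simp add: norm_triangle_ineq)
      also have "norm (\<Sum>n | 1 \<le> n \<and> t < real n \<and> real n \<le> b. g n) \<le> (\<Sum>n | 1 \<le> n \<and> t < real n \<and> real n \<le> b. norm (g n))" by (rule norm_sum)
      also have "\<dots> \<le> E" unfolding E_def
        by (rule sum_mono2) (use True in \<open>auto intro: finite_subset[OF _ finite_nat_le_real(2)[of b]]\<close>)
      finally have 1: "norm (Msum b g) \<le> norm (Msum t g) + E" by simp
      have 2: "indicator {1..y} t * (norm (Msum t g) * t powr (-2)) = norm (Msum t g) * t powr (-2)"
        using True b by (cases "t < 1") (auto simp: Msum_less_1)
      have "norm (Msum b g) * t powr (-2) \<le> (norm (Msum t g) + E) * t powr (-2)" by (rule mult_right_mono[OF 1]) simp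
      thus ?thesis using True by (simp add: 2 distrib_right)
    qed simp
  qed (intro Bochner_Integration.integrable_add Wc Ji)+
  hence "norm (Msum b g) / (l * b) \<le> J + E / (l * b)"
    using Wc Ji by (simp add: J_def)
  hence "norm (Msum b g) \<le> l * b * J + E" using b l by (simp add: field_simps)
  thus ?thesis by (simp add: J_def E_def)
qed

lemma sum_norm_expmult_over_le:
  fixes F :: "nat \<Rightarrow> complex"
  shows "(\<Sum>n | 1 \<le> n \<and> real n \<le> y. norm (expmult F n) / real n) \<le> exp (\<Sum>p | prime p \<and> real p \<le> y. norm (F p) / real p)"
proof (cases "y \<ge> 0")
  case True
  have tw: "norm (expmult F n) / real n = expmult (\<lambda>p. norm (F p) / real p) n" if "n \<ge> 1" for n
    using expmult_twist[of n "\<lambda>n. 1 / real n" "\<lambda>p. norm (F p)"] that by (simp add: norm_expmult)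
  have e: "{n. 1 \<le> n \<and> real n \<le> y} = {1..nat \<lfloor>y\<rfloor>}" "{p. prime p \<and> real p \<le> y} = {p. prime p \<and> p \<le> nat \<lfloor>y\<rfloor>}"
    using True by (auto simp: le_nat_iff le_floor_iff)
  have "(\<Sum>n\<in>{1..nat \<lfloor>y\<rfloor>}. norm (expmult F n) / real n) = (\<Sum>n\<in>{1..nat \<lfloor>y\<rfloor>}. expmult (\<lambda>p. norm (F p) / real p) n)"
    by (rule sum.cong) (auto simp: tw)
  also have "\<dots> \<le> exp (\<Sum>p | prime p \<and> p \<le> nat \<lfloor>y\<rfloor>. norm (F p) / real p)"
    by (rule sum_expmult_le_exp) simp
  finally show ?thesis unfolding e .
next
  case False
  hence "{n. 1 \<le> n \<and> real n \<le> y} = {}" by auto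
  hence "(\<Sum>n | 1 \<le> n \<and> real n \<le> y. norm (expmult F n) / real n) = 0" by (simp only: sum.empty)
  thus ?thesis by simp
qed

text \<open>Each M(y/p; g) is replaced by an average over a short interval ending at y/p. After
  interchanging sum and integral, the primes attached to a fixed t fill the interval from y/(t q) to
  y/t; there the sieve saves 1/l, which cancels the factor l produced by averaging.\<close>

lemma halasz_montgomery_large:
  fixes F :: "nat \<Rightarrow> complex"
  assumes A: "A > 0" and F: "\<And>p. prime p \<Longrightarrow> norm (F p) \<le> A"
    and l: "l \<ge> 4" and y: "y \<ge> 1"
  defines "g \<equiv> expmult F"
  shows "(\<Sum>p | prime p \<and> l\<^sup>2 < real p \<and> real p \<le> y. A * ln (real p) * norm (Msum (y / real p) g))
     \<le> 480 * A * y * Mint g y + 240 * A * y / l * (\<Sum>n | 1 \<le> n \<and> real n \<le> y. norm (g n) / real n)"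
proof -
  let ?P = "{p. prime p \<and> l\<^sup>2 < real p \<and> real p \<le> y}"
  let ?S = "{n. 1 \<le> n \<and> real n \<le> y}"
  define q where "q = 1 + 1 / l"
  have l0: "l > 0" and q: "q > 0" "q \<le> 2" using l by (auto simp: q_def field_simps)
  have finP: "finite ?P" by (rule finite_subset[OF _ finite_primes_le_real[of y]]) auto
  have pP: "real p \<ge> 2" "real p \<le> y" "prime p" "l\<^sup>2 < real p" "real p > 0" "ln (real p) \<ge> 0" if "p \<in> ?P" for p
    using that by (auto dest: prime_ge_2_nat prime_ge_1_nat prime_gt_0_nat)
  define \<phi> where "\<phi> t = indicator {1..y} t * (norm (Msum t g) * t powr (-2))" for t :: real
  have \<phi>i: "integrable lborel \<phi>" unfolding \<phi>_def by (rule Mint_integrable)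
  have \<phi>0: "\<phi> t \<ge> 0" for t by (simp add: \<phi>_def)
  define b where "b p = y / real p" for p :: nat
  define I where "I p = {b p / q<..b p}" for p :: nat
  define E where "E p = (\<Sum>n | 1 \<le> n \<and> b p / q < real n \<and> real n \<le> b p. norm (g n))" for p
  have Ii: "integrable lborel (\<lambda>t. indicator (I p) t * \<phi> t)" for p
    using integrable_mult_indicator[OF _ \<phi>i, of "I p"] by (simp add: I_def)
  have memI: "t \<in> I p \<longleftrightarrow> y / t / q < real p \<and> real p \<le> y / t" if "p \<in> ?P" "t > 0" for p t
    using pP[OF that(1)] that(2) q y unfolding I_def b_def by (auto simp: field_simps)
  \<comment> \<open>If y/t \<ge> l^2 the interval is long enough for the sieve. Otherwise no prime
    above l^2 lies below y/t and the range is empty.\<close>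
  have short: "(\<Sum>p\<in>{p\<in>?P. y / t / q < real p \<and> real p \<le> y / t}. ln (real p)) \<le> 240 * (y / t) / l" if "t > 0" for t
  proof (cases "y / t \<ge> l\<^sup>2")
    case True
    have "(\<Sum>p\<in>{p\<in>?P. y / t / q < real p \<and> real p \<le> y / t}. ln (real p))
       \<le> (\<Sum>p | prime p \<and> y / t / q < real p \<and> real p \<le> y / t. ln (real p))"
      by (rule sum_mono2) (auto intro: finite_subset[OF _ finite_primes_le_real[of "y/t"]] dest: prime_ge_1_nat)
    also have "\<dots> \<le> 240 * (y / t) / l" unfolding q_def by (rule sum_ln_primes_short_le[OF l True])
    finally show ?thesis .
  next
    case False
    hence "{p\<in>?P. y / t / q < real p \<and> real p \<le> y / t} = {}" by auto
    hence "(\<Sum>p\<in>{p\<in>?P. y / t / q < real p \<and> real p \<le> y / t}. ln (real p)) = 0" by (simp only: sum.empty)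
    thus ?thesis using y that l0 by simp
  qed
  have step: "A * ln (real p) * norm (Msum (y / real p) g) \<le> (LBINT t. (A * l * y) * (ln (real p) / real p) * (indicator (I p) t * \<phi> t)) + A * (ln (real p) * E p)"
    if p: "p \<in> ?P" for p
  proof -
    have "b p > 0" "b p \<le> y" using pP[OF p] y by (auto simp: b_def divide_le_eq intro: order_trans[of _ 1])
    from norm_Msum_smoothing[OF this l0, of g]
    have "norm (Msum (b p) g) \<le> l * b p * (LBINT t. indicator (I p) t * \<phi> t) + E p"
      unfolding I_def E_def \<phi>_def q_def .
    hence "A * ln (real p) * norm (Msum (b p) g) \<le> A * ln (real p) * (l * b p * (LBINT t. indicator (I p) t * \<phi> t) + E p)"
      using A pP(6)[OF p] by (intro mult_left_mono) auto
    also have "\<dots> = (A * l * y) * (ln (real p) / real p) * (LBINT t. indicator (I p) t * \<phi> t) + A * (ln (real p) * E p)"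
      by (simp add: b_def algebra_simps)
    finally show ?thesis by (simp add: b_def)
  qed
  have "(\<Sum>p\<in>?P. A * ln (real p) * norm (Msum (y / real p) g))
     \<le> (\<Sum>p\<in>?P. (LBINT t. (A * l * y) * (ln (real p) / real p) * (indicator (I p) t * \<phi> t)) + A * (ln (real p) * E p))"
    by (rule sum_mono[OF step])
  also have "\<dots> = (\<Sum>p\<in>?P. (LBINT t. (A * l * y) * (ln (real p) / real p) * (indicator (I p) t * \<phi> t))) + A * (\<Sum>p\<in>?P. ln (real p) * E p)"
    by (simp only: sum.distrib sum_distrib_left)
  also have "(\<Sum>p\<in>?P. (LBINT t. (A * l * y) * (ln (real p) / real p) * (indicator (I p) t * \<phi> t)))
     = (LBINT t. (\<Sum>p\<in>?P. (A * l * y) * (ln (real p) / real p) * (indicator (I p) t * \<phi> t)))"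
    by (rule Bochner_Integration.integral_sum[symmetric]) (intro integrable_mult_right Ii)
  finally have main: "(\<Sum>p\<in>?P. A * ln (real p) * norm (Msum (y / real p) g))
     \<le> (LBINT t. (\<Sum>p\<in>?P. (A * l * y) * (ln (real p) / real p) * (indicator (I p) t * \<phi> t))) + A * (\<Sum>p\<in>?P. ln (real p) * E p)" .
  have "(LBINT t. (\<Sum>p\<in>?P. (A * l * y) * (ln (real p) / real p) * (indicator (I p) t * \<phi> t))) \<le> (LBINT t. 480 * A * y * \<phi> t)"
  proof (rule integral_mono)
    show "integrable lborel (\<lambda>t. \<Sum>p\<in>?P. (A * l * y) * (ln (real p) / real p) * (indicator (I p) t * \<phi> t))"
      by (intro Bochner_Integration.integrable_sum integrable_mult_right Ii)
    show "integrable lborel (\<lambda>t. 480 * A * y * \<phi> t)" by (intro integrable_mult_right \<phi>i)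
    fix t :: real
    show "(\<Sum>p\<in>?P. (A * l * y) * (ln (real p) / real p) * (indicator (I p) t * \<phi> t)) \<le> 480 * A * y * \<phi> t"
    proof (cases "t \<ge> 1")
      case True
      hence t0: "t > 0" by simp
      have "(\<Sum>p\<in>?P. (ln (real p) / real p) * indicator (I p) t)
         = (\<Sum>p\<in>?P. if y / t / q < real p \<and> real p \<le> y / t then ln (real p) / real p else 0)"
        by (intro sum.cong refl) (use memI t0 in \<open>auto simp: indicator_def\<close>)
      also have "\<dots> = (\<Sum>p\<in>{p\<in>?P. y / t / q < real p \<and> real p \<le> y / t}. ln (real p) / real p)"
        by (rule sum.inter_filter[symmetric, OF finP])
      also have "\<dots> \<le> (\<Sum>p\<in>{p\<in>?P. y / t / q < real p \<and> real p \<le> y / t}. ln (real p) * (2 * t / y))"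
      proof (intro sum_mono)
        fix p assume p: "p \<in> {p\<in>?P. y / t / q < real p \<and> real p \<le> y / t}"
        \<comment> \<open>Because q \<le> 2, the prime p is within a factor 2 of y/t, so 1/p may be
          replaced by 2t/y; this doubles 240 to 480.\<close>
        have "y / t / 2 \<le> y / t / q" using q y t0 by (intro divide_left_mono) auto
        hence "y / t / 2 < real p" using p by simp
        hence "y < real p * (2 * t)" using t0 by (simp add: field_simps)
        hence "1 / real p \<le> 2 * t / y" using y pP(5)[of p] p by (simp add: divide_simps) (simp add: mult_ac)
        hence "ln (real p) * (1 / real p) \<le> ln (real p) * (2 * t / y)" using pP(6)[of p] p by (intro mult_left_mono) auto
        thus "ln (real p) / real p \<le> ln (real p) * (2 * t / y)" by simp
      qed
      also have "\<dots> = (\<Sum>p\<in>{p\<in>?P. y / t / q < real p \<and> real p \<le> y / t}. ln (real p)) * (2 * t / y)" by (simp only: sum_distrib_right)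
      also have "\<dots> \<le> 240 * (y / t) / l * (2 * t / y)" using short[OF t0] y t0 by (intro mult_right_mono) auto
      also have "\<dots> = 480 / l" using y t0 by simp
      finally have 1: "(\<Sum>p\<in>?P. (ln (real p) / real p) * indicator (I p) t) \<le> 480 / l" .
      have "(\<Sum>p\<in>?P. (A * l * y) * (ln (real p) / real p) * (indicator (I p) t * \<phi> t)) = (A * l * y * \<phi> t) * (\<Sum>p\<in>?P. (ln (real p) / real p) * indicator (I p) t)"
        by (simp only: sum_distrib_left) (intro sum.cong refl, simp)
      also have "\<dots> \<le> (A * l * y * \<phi> t) * (480 / l)" using 1 A l0 y \<phi>0[of t] by (intro mult_left_mono) auto
      also have "\<dots> = 480 * A * y * \<phi> t" using l0 by simp
      finally show ?thesis .
    qed (simp add: \<phi>_def)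
  qed
  also have "\<dots> = 480 * A * y * Mint g y" unfolding Mint_def \<phi>_def[symmetric] by simp
  finally have 1: "(LBINT t. (\<Sum>p\<in>?P. (A * l * y) * (ln (real p) / real p) * (indicator (I p) t * \<phi> t))) \<le> 480 * A * y * Mint g y" .
  have "(\<Sum>p\<in>?P. ln (real p) * E p) = (\<Sum>p\<in>?P. \<Sum>n\<in>{n\<in>?S. real n \<in> I p}. ln (real p) * norm (g n))"
  proof (intro sum.cong refl)
    fix p assume p: "p \<in> ?P"
    have "b p \<le> y" using pP[OF p] y by (simp add: b_def divide_le_eq)
    hence "{n. 1 \<le> n \<and> b p / q < real n \<and> real n \<le> b p} = {n\<in>?S. real n \<in> I p}" by (auto simp: I_def)
    thus "ln (real p) * E p = (\<Sum>n\<in>{n\<in>?S. real n \<in> I p}. ln (real p) * norm (g n))" by (simp add: E_def sum_distrib_left)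
  qed
  also have "\<dots> = (\<Sum>n\<in>?S. \<Sum>p\<in>{p\<in>?P. real n \<in> I p}. ln (real p) * norm (g n))"
    by (rule sum.swap_restrict[OF finP]) simp
  also have "\<dots> \<le> (\<Sum>n\<in>?S. 240 * y / l * (norm (g n) / real n))"
  proof (intro sum_mono)
    fix n assume n: "n \<in> ?S"
    hence n0: "real n > 0" by simp
    have "{p\<in>?P. real n \<in> I p} = {p\<in>?P. y / real n / q < real p \<and> real p \<le> y / real n}" using memI[OF _ n0] by blast
    hence "(\<Sum>p\<in>{p\<in>?P. real n \<in> I p}. ln (real p)) \<le> 240 * (y / real n) / l" using short[OF n0] by simp
    hence "(\<Sum>p\<in>{p\<in>?P. real n \<in> I p}. ln (real p)) * norm (g n) \<le> 240 * (y / real n) / l * norm (g n)" by (rule mult_right_mono) simp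
    also have "240 * (y / real n) / l * norm (g n) = 240 * y / l * (norm (g n) / real n)" by (simp add: mult_ac)
    finally show "(\<Sum>p\<in>{p\<in>?P. real n \<in> I p}. ln (real p) * norm (g n)) \<le> 240 * y / l * (norm (g n) / real n)" by (simp only: sum_distrib_right)
  qed
  also have "\<dots> = 240 * y / l * (\<Sum>n\<in>?S. norm (g n) / real n)" by (simp only: sum_distrib_left)
  finally have "A * (\<Sum>p\<in>?P. ln (real p) * E p) \<le> A * (240 * y / l * (\<Sum>n\<in>?S. norm (g n) / real n))" using A by (intro mult_left_mono) auto
  also have "A * (240 * y / l * (\<Sum>n\<in>?S. norm (g n) / real n)) = 240 * A * y / l * (\<Sum>n\<in>?S. norm (g n) / real n)" by (simp add: mult_ac)
  finally show ?thesis using main 1 by linarith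
qed

text \<open>Strong induction on the integer part of y, which drops when y is divided by a prime. The
  induction hypothesis is spent on primes up to y^\<delta> only, where its total contribution is a
  quarter of the claim. Writing ln(2y) rather than ln y keeps the logarithm bounded below down to y
  = 1.\<close>

theorem halasz_montgomery:
  assumes A: "A > 0"
  obtains K where "K > 0" "\<And>F y. (\<And>p. prime p \<Longrightarrow> norm (F p :: complex) \<le> A) \<Longrightarrow> y \<ge> 1 \<Longrightarrow>
     norm (Msum y (expmult F)) * ln (2 * y) \<le> K * y * (1 + Mint (expmult F) y)"
proof -
  \<comment> \<open>The small primes contribute 2 * 480 * A * \<delta> = 960 A \<delta> times the
    claimed bound; 1/(3840 A) makes this at most 1/4.\<close>
  define \<delta> where "\<delta> = min (1/2) (1 / (3840 * A))"
  have d: "\<delta> > 0" "\<delta> \<le> 1/2" "\<delta> \<le> 1 / (3840 * A)" using A by (auto simp: \<delta>_def)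
  have d2: "\<delta> / (2 * A) > 0" using d A by simp
  obtain C where C: "C \<ge> 0" "\<And>y. y \<ge> 1 \<Longrightarrow> (\<Sum>p | prime p \<and> real p \<le> y. 1 / real p) \<le> \<delta> / (2 * A) * ln y + C"
    using sum_inverse_primes_le[OF d2] by blast
  define D where "D = exp (A * C)"
  \<comment> \<open>Ensures \<open>y powr (\<delta> / 2) \<ge> 4\<close> from y0 on, as the sieve
    requires of l. Below y0 the same power is at most 4 and a trivial estimate suffices.\<close>
  define y0 where "y0 = 4 powr (2 / \<delta>)"
  have D0: "D > 0" by (simp add: D_def)
  have y01: "y0 \<ge> 4"
  proof -
    have "2 / \<delta> \<ge> 1" using d by (simp add: field_simps)
    hence "(4::real) powr 1 \<le> 4 powr (2 / \<delta>)" by (intro powr_mono) auto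
    thus ?thesis by (simp add: y0_def)
  qed
  define K where "K = 4 * (1 + 480 * A + 240 * A * D) + 4 * D * ln (2 * y0)"
  have lny0: "ln (2 * y0) \<ge> 0" using y01 by simp
  have K0: "K > 0" unfolding K_def using A D0 lny0 by (intro add_pos_nonneg mult_pos_pos) (auto intro: add_pos_nonneg)
  have K1: "K \<ge> 4 * (1 + 480 * A + 240 * A * D)" unfolding K_def using D0 lny0 by simp
  have K2: "K \<ge> 4 * D * ln (2 * y0)" unfolding K_def using A D0 by simp
  have key: "norm (Msum y (expmult F)) * ln (2 * y) \<le> K * y * (1 + Mint (expmult F) y)"
    if F: "\<And>p. prime p \<Longrightarrow> norm (F p :: complex) \<le> A" and y: "y \<ge> 1" for F y
    using y
  proof (induction "nat \<lfloor>y\<rfloor>" arbitrary: y rule: less_induct)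
    case (less y)
    define g where "g = expmult F"
    define I where "I = 1 + Mint g y"
    have I1: "I \<ge> 1" using Mint_nonneg[of g y] by (simp add: I_def)
    have y1: "y \<ge> 1" by (rule less.prems)
    let ?S = "{n. 1 \<le> n \<and> real n \<le> y}"
    have Sg: "(\<Sum>n\<in>?S. norm (g n) / real n) \<le> D * y powr (\<delta> / 2)"
    proof -
      have "(\<Sum>n\<in>?S. norm (g n) / real n) \<le> exp (\<Sum>p | prime p \<and> real p \<le> y. norm (F p) / real p)"
        unfolding g_def by (rule sum_norm_expmult_over_le)
      also have "(\<Sum>p | prime p \<and> real p \<le> y. norm (F p) / real p) \<le> (\<Sum>p | prime p \<and> real p \<le> y. A * (1 / real p))"
        by (intro sum_mono) (auto simp: F divide_right_mono)
      also have "\<dots> = A * (\<Sum>p | prime p \<and> real p \<le> y. 1 / real p)" by (simp only: sum_distrib_left)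
      also have "\<dots> \<le> A * (\<delta> / (2 * A) * ln y + C)" using A C(2)[OF y1] by (intro mult_left_mono) auto
      also have "\<dots> = A * C + \<delta> / 2 * ln y" using A by (simp add: field_simps)
      also have "exp \<dots> = D * y powr (\<delta> / 2)" using y1 by (simp add: exp_add D_def powr_def)
      finally show ?thesis by simp
    qed
    show ?case
    proof (cases "y \<ge> y0")
      case False
      have "norm (Msum y g) \<le> (\<Sum>n\<in>?S. norm (g n))" by (rule norm_Msum_le) (use y1 in auto)
      also have "\<dots> \<le> (\<Sum>n\<in>?S. y * (norm (g n) / real n))"
      proof (intro sum_mono)
        fix n assume n: "n \<in> ?S"
        have "norm (g n) * real n \<le> norm (g n) * y" using n by (intro mult_left_mono) auto
        thus "norm (g n) \<le> y * (norm (g n) / real n)" using n by (simp add: field_simps)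
      qed
      also have "\<dots> = y * (\<Sum>n\<in>?S. norm (g n) / real n)" by (simp only: sum_distrib_left)
      also have "\<dots> \<le> y * (D * y powr (\<delta> / 2))" using Sg y1 by (intro mult_left_mono) auto
      also have "y powr (\<delta> / 2) \<le> y0 powr (\<delta> / 2)" using False y1 d by (intro powr_mono2) auto
      hence "y * (D * y powr (\<delta> / 2)) \<le> y * (D * y0 powr (\<delta> / 2))" using y1 D0 by (intro mult_left_mono) auto
      also have "y0 powr (\<delta> / 2) = 4" unfolding y0_def using d by (simp add: powr_powr)
      finally have 1: "norm (Msum y g) \<le> 4 * D * y" by (simp add: mult_ac)
      have "ln (2 * y) \<le> ln (2 * y0)" using False y1 by simp
      hence "norm (Msum y g) * ln (2 * y) \<le> (4 * D * y) * ln (2 * y0)" using 1 y1 D0 by (intro mult_mono) auto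
      also have "\<dots> = (4 * D * ln (2 * y0)) * y * 1" by simp
      also have "\<dots> \<le> K * y * I" using K2 I1 y1 K0 by (intro mult_mono) auto
      finally show ?thesis by (simp add: g_def I_def)
    next
      case True
      \<comment> \<open>The sum of |g(n)|/n is at most D l, which exactly cancels the factor 1/l in
        \<open>halasz_montgomery_large\<close>; the dividing point l^2 is y^\<delta>.\<close>
      define l where "l = y powr (\<delta> / 2)"
      have y4: "y \<ge> 4" using True y01 by simp
      have lny: "ln y > 0" using y4 by simp
      have l4: "l \<ge> 4"
      proof -
        have "y0 powr (\<delta> / 2) = 4" unfolding y0_def using d by (simp add: powr_powr)
        moreover have "y0 powr (\<delta> / 2) \<le> y powr (\<delta> / 2)" using True y01 d by (intro powr_mono2) auto
        ultimately show ?thesis by (simp add: l_def)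
      qed
      have l2: "l\<^sup>2 = y powr \<delta>" unfolding l_def power2_eq_square by (simp add: powr_add[symmetric])
      let ?P = "{p. prime p \<and> real p \<le> y}"
      let ?L = "{p. prime p \<and> l\<^sup>2 < real p \<and> real p \<le> y}"
      let ?s = "{p. prime p \<and> real p \<le> l\<^sup>2 \<and> real p \<le> y}"
      have fin: "finite ?L" "finite ?s" by (auto intro: finite_subset[OF _ finite_primes_le_real[of y]])
      \<comment> \<open>Split ln y = ln(y/n) + ln n. The first part is an integral of M; the second
        is a sum over primes of values M(y/p; g).\<close>
      have "Msum y g * of_real (ln y) = (\<Sum>n\<in>?S. g n * of_real (ln (y / real n))) + (\<Sum>n\<in>?S. g n * of_real (ln (real n)))"
      proof -
        have "(\<Sum>n\<in>?S. g n * of_real (ln (y / real n))) + (\<Sum>n\<in>?S. g n * of_real (ln (real n))) = (\<Sum>n\<in>?S. g n * of_real (ln y))"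
          unfolding sum.distrib[symmetric] using y1 by (intro sum.cong refl) (auto simp: ln_div algebra_simps)
        thus ?thesis using y1 by (simp add: Msum_eq sum_distrib_right)
      qed
      also have "(\<Sum>n\<in>?S. g n * of_real (ln (real n))) = (\<Sum>p\<in>?P. F p * of_real (ln (real p)) * Msum (y / real p) g)"
        unfolding g_def by (rule sum_expmult_ln_eq[OF y1])
      finally have e: "Msum y g * of_real (ln y) = (\<Sum>n\<in>?S. g n * of_real (ln (y / real n))) + (\<Sum>p\<in>?P. F p * of_real (ln (real p)) * Msum (y / real p) g)" .
      have "norm (Msum y g) * ln y = norm (Msum y g * of_real (ln y))" unfolding norm_mult norm_of_real using lny by simp
      also have "\<dots> \<le> norm (\<Sum>n\<in>?S. g n * of_real (ln (y / real n))) + norm (\<Sum>p\<in>?P. F p * of_real (ln (real p)) * Msum (y / real p) g)"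
        unfolding e by (rule norm_triangle_ineq)
      finally have "norm (Msum y g) * ln y \<le> norm (\<Sum>n\<in>?S. g n * of_real (ln (y / real n))) + norm (\<Sum>p\<in>?P. F p * of_real (ln (real p)) * Msum (y / real p) g)" .
      moreover have "norm (\<Sum>n\<in>?S. g n * of_real (ln (y / real n))) \<le> y * Mint g y" by (rule norm_sum_ln_quotient_le[OF y1])
      moreover have "norm (\<Sum>p\<in>?P. F p * of_real (ln (real p)) * Msum (y / real p) g) \<le> (\<Sum>p\<in>?P. A * ln (real p) * norm (Msum (y / real p) g))"
      proof (rule order_trans[OF norm_sum], rule sum_mono)
        fix p assume p: "p \<in> ?P"
        hence "ln (real p) \<ge> 0" by (auto dest: prime_ge_1_nat)
        thus "norm (F p * of_real (ln (real p)) * Msum (y / real p) g) \<le> A * ln (real p) * norm (Msum (y / real p) g)"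
          using F[of p] p by (simp add: norm_mult mult_right_mono)
      qed
      moreover have "(\<Sum>p\<in>?P. A * ln (real p) * norm (Msum (y / real p) g)) =
         (\<Sum>p\<in>?s. A * ln (real p) * norm (Msum (y / real p) g)) + (\<Sum>p\<in>?L. A * ln (real p) * norm (Msum (y / real p) g))"
        by (subst sum.union_disjoint[symmetric]) (use fin in \<open>auto intro!: sum.cong\<close>)
      moreover have "(\<Sum>p\<in>?L. A * ln (real p) * norm (Msum (y / real p) g)) \<le> 480 * A * y * Mint g y + 240 * A * D * y"
      proof -
        have "240 * A * y / l * (\<Sum>n\<in>?S. norm (g n) / real n) \<le> 240 * A * y / l * (D * l)"
          using Sg A y1 l4 by (intro mult_left_mono) (auto simp: l_def)
        also have "\<dots> = 240 * A * D * y" using l4 by simp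
        finally have s: "240 * A * y / l * (\<Sum>n\<in>?S. norm (g n) / real n) \<le> 240 * A * D * y" .
        have "(\<Sum>p\<in>?L. A * ln (real p) * norm (Msum (y / real p) g))
          \<le> 480 * A * y * Mint g y + 240 * A * y / l * (\<Sum>n\<in>?S. norm (g n) / real n)"
          unfolding g_def by (rule halasz_montgomery_large[of A F, OF A _ l4 y1]) (rule F)
        with s show ?thesis by linarith
      qed
      moreover have "(\<Sum>p\<in>?s. A * ln (real p) * norm (Msum (y / real p) g)) \<le> K / 4 * y * I"
      proof -
        have "(\<Sum>p\<in>?s. A * ln (real p) * norm (Msum (y / real p) g)) \<le> (\<Sum>p\<in>?s. (2 * A * K * y * I / ln y) * (ln (real p) / real p))"
        proof (rule sum_mono)
          fix p assume p: "p \<in> ?s"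
          have p2: "real p \<ge> 2" using p by (auto dest: prime_ge_2_nat)
          have py: "y / real p \<ge> 1" using p p2 by simp
          have "y / real p \<le> y / 2" using p2 y1 by (intro divide_left_mono) auto
          hence "nat \<lfloor>y / real p\<rfloor> < nat \<lfloor>y\<rfloor>" using y1 py by linarith
          from less.hyps[OF this py] have IH: "norm (Msum (y / real p) g) * ln (2 * (y / real p)) \<le> K * (y / real p) * (1 + Mint g (y / real p))"
            by (simp add: g_def)
          have "Mint g (y / real p) \<le> Mint g y" by (rule Mint_mono) (use p2 y1 in \<open>simp add: divide_le_eq\<close>)
          hence "K * (y / real p) * (1 + Mint g (y / real p)) \<le> K * (y / real p) * I"          proof (intro mult_left_mono)
            show "0 \<le> K * (y / real p)" using K0 py by (intro mult_nonneg_nonneg) linarith+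
          qed (simp add: I_def)
          hence 1: "norm (Msum (y / real p) g) * ln (2 * (y / real p)) \<le> K * (y / real p) * I" using IH by linarith
          \<comment> \<open>As \<delta> \<le> 1/2, the argument y/p is at least sqrt y, so passing
            from ln(2y/p) back to ln y costs only a factor 2.\<close>
          have "real p \<le> y powr \<delta>" using p l2 by simp
          also have "\<dots> \<le> y powr (1/2)" using d y1 by (intro powr_mono) auto
          finally have "y / y powr (1/2) \<le> y / real p" using p2 y1 by (intro divide_left_mono) auto
          moreover have "y / y powr (1/2) = y powr (1/2)" using y1 by (simp add: powr_half_sqrt real_div_sqrt)
          ultimately have "y powr (1/2) \<le> 2 * (y / real p)" using py by linarith
          hence "ln (y powr (1/2)) \<le> ln (2 * (y / real p))" using y1 by (intro ln_mono) auto
          hence "ln y / 2 \<le> ln (2 * (y / real p))" using y1 by (simp add: ln_powr)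
          hence "norm (Msum (y / real p) g) * (ln y / 2) \<le> norm (Msum (y / real p) g) * ln (2 * (y / real p))" by (intro mult_left_mono) auto
          with 1 have "norm (Msum (y / real p) g) * (ln y / 2) \<le> K * (y / real p) * I" by linarith
          hence "norm (Msum (y / real p) g) * ln y \<le> 2 * K * (y / real p) * I" by linarith
          hence "norm (Msum (y / real p) g) \<le> 2 * K * (y / real p) * I / ln y" by (simp only: pos_le_divide_eq[OF lny])
          hence "A * ln (real p) * norm (Msum (y / real p) g) \<le> A * ln (real p) * (2 * K * (y / real p) * I / ln y)"
            using A p2 by (intro mult_left_mono) auto
          thus "A * ln (real p) * norm (Msum (y / real p) g) \<le> (2 * A * K * y * I / ln y) * (ln (real p) / real p)" by (simp add: mult_ac)
        qed
        also have "\<dots> = (2 * A * K * y * I / ln y) * (\<Sum>p\<in>?s. ln (real p) / real p)" by (simp only: sum_distrib_left)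
        finally have s1: "(\<Sum>p\<in>?s. A * ln (real p) * norm (Msum (y / real p) g)) \<le> (2 * A * K * y * I / ln y) * (\<Sum>p\<in>?s. ln (real p) / real p)" .
        have "(\<Sum>p\<in>?s. ln (real p) / real p) \<le> (\<Sum>p | prime p \<and> real p \<le> l\<^sup>2. ln (real p) / real p)"
          by (rule sum_mono2) (auto dest: prime_ge_1_nat)
        also have "\<dots> \<le> 480 * ln (l\<^sup>2)" by (rule sum_ln_primes_over_le) (use l4 in \<open>simp add: one_le_power\<close>)
        also have "\<dots> = 480 * \<delta> * ln y" unfolding l2 using y1 by (simp add: ln_powr)
        finally have s2: "(\<Sum>p\<in>?s. ln (real p) / real p) \<le> 480 * \<delta> * ln y" .
        have "0 \<le> 2 * A * K * y * I / ln y" using A K0 y1 I1 lny by simp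
        with s1 s2 have "(\<Sum>p\<in>?s. A * ln (real p) * norm (Msum (y / real p) g)) \<le> (2 * A * K * y * I / ln y) * (480 * \<delta> * ln y)"
          by (meson mult_left_mono order_trans)
        also have "\<dots> = (960 * A * \<delta>) * (K * y * I)" using lny by simp
        also have "\<dots> \<le> (1 / 4) * (K * y * I)"
        proof (rule mult_right_mono)
          have "960 * A * \<delta> \<le> 960 * A * (1 / (3840 * A))" using d A by (intro mult_left_mono) auto
          thus "960 * A * \<delta> \<le> 1/4" using A by simp
        qed (use K0 y1 I1 in auto)
        finally show ?thesis by simp
      qed
      ultimately have "norm (Msum y g) * ln y \<le> y * Mint g y + K / 4 * y * I + 480 * A * y * Mint g y + 240 * A * D * y" by linarith
      also have "\<dots> \<le> y * I + K / 4 * y * I + 480 * A * y * I + 240 * A * D * y * I"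
        using A y1 D0 Mint_nonneg[of g y] by (intro add_mono mult_left_mono order_refl) (auto simp: I_def algebra_simps)
      also have "\<dots> = (K / 4 + (1 + 480 * A + 240 * A * D)) * y * I" by (simp add: algebra_simps)
      also have "\<dots> \<le> (K / 4 + K / 4) * y * I" using K1 y1 I1 by (intro mult_right_mono) auto
      finally have 1: "norm (Msum y g) * ln y \<le> K / 2 * y * I" by simp
      have "ln (2 * y) = ln 2 + ln y" using y1 by (simp add: ln_mult)
      also have "\<dots> \<le> 2 * ln y" using y4 by simp
      finally have "norm (Msum y g) * ln (2 * y) \<le> norm (Msum y g) * (2 * ln y)" by (intro mult_left_mono) auto
      also have "\<dots> \<le> K * y * I" using 1 by simp
      finally show ?thesis by (simp add: g_def I_def)
    qed
  qed
  show ?thesis by (rule that[OF K0 key])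
qed

section \<open>Splitting off the exponential part\<close>

text \<open>The Bell series of f at p divided by that of \<open>expmult F\<close>; dividing by an
  exponential series means multiplying by the one of opposite exponent.\<close>

definition expquot :: "(nat \<Rightarrow> complex) \<Rightarrow> (nat \<Rightarrow> complex) \<Rightarrow> nat \<Rightarrow> nat \<Rightarrow> complex" where
  "expquot f F p k = (Abs_fps (\<lambda>j. f (p ^ j)) * fps_exp (- F p)) $ k"

lemma expquot_eq: "expquot f F p k = (\<Sum>j\<le>k. f (p ^ j) * ((- F p) ^ (k - j) / fact (k - j)))"
  by (simp add: expquot_def fps_mult_nth atMost_atLeast0)

lemma expquot_convolution: "(\<Sum>j\<le>k. expquot f F p j * (F p ^ (k - j) / fact (k - j))) = f (p ^ k)"
proof -
  let ?f = "Abs_fps (\<lambda>j. f (p ^ j))"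
  have "(\<Sum>j\<le>k. expquot f F p j * (F p ^ (k - j) / fact (k - j))) = (?f * fps_exp (- F p) * fps_exp (F p)) $ k"
    by (simp add: expquot_def fps_mult_nth[of "?f * fps_exp (- F p)"] atMost_atLeast0)
  also have "?f * fps_exp (- F p) * fps_exp (F p) = ?f"
    by (simp add: mult.assoc fps_exp_add_mult[symmetric])
  finally show ?thesis by simp
qed

lemma multiplicative_expmult_decomposition:
  assumes "multiplicative f" "n > 0"
  shows "f n = (\<Sum>d | d dvd n. mulfun (expquot f F) d * expmult F (n div d))"
proof -
  have "(\<Sum>d | d dvd n. mulfun (expquot f F) d * mulfun (\<lambda>p k. F p ^ k / fact k) (n div d)) = mulfun (\<lambda>p k. f (p ^ k)) n"
  proof (rule mulfun_convolution[OF assms(2)])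
    show "expquot f F p 0 = 1" for p using assms(1) by (simp add: expquot_eq multiplicative_def)
    show "f (p ^ k) = (\<Sum>j\<le>k. expquot f F p j * (F p ^ (k - j) / fact (k - j)))" for p k
      by (rule expquot_convolution[symmetric])
  qed simp
  thus ?thesis using multiplicative_eq_mulfun[OF assms] by (simp add: expmult_def)
qed

lemma mulfun_over_nat:
  fixes a :: "nat \<Rightarrow> nat \<Rightarrow> real"
  assumes "n > 0"
  shows "mulfun a n / real n = mulfun (\<lambda>p k. a p k / real p ^ k) n"
proof -
  have e: "(\<Prod>p\<in>prime_factors n. p ^ multiplicity p n) = n"
    using prod_prime_factors[of n] assms by simp
  have "(\<Prod>p\<in>prime_factors n. real p ^ multiplicity p n) = real (\<Prod>p\<in>prime_factors n. p ^ multiplicity p n)"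
    by simp
  also have "\<dots> = real n" by (simp only: e)
  finally show ?thesis unfolding mulfun_def prod_dividef by simp
qed

text \<open>Distribute ln d over the prime powers exactly dividing d. For each p the map from d to
  (k, d/p^k) is injective, and dropping coprimality and the joint size condition only adds
  nonnegative terms.\<close>

lemma sum_mulfun_ln_le:
  fixes w :: "nat \<Rightarrow> nat \<Rightarrow> real" and X :: nat
  assumes w: "\<And>p k. w p k \<ge> 0" and w0: "\<And>p. w p 0 = 1"
  shows "(\<Sum>d\<in>{1..X}. mulfun w d * ln (real d))
     \<le> (\<Sum>p | prime p \<and> p \<le> X. \<Sum>k | 1 \<le> k \<and> p ^ k \<le> X. w p k * (real k * ln (real p))) * (\<Sum>m\<in>{1..X}. mulfun w m)"
proof -
  let ?P = "{p. prime p \<and> p \<le> X}"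
  have "(\<Sum>d\<in>{1..X}. mulfun w d * ln (real d)) = (\<Sum>d\<in>{1..X}. \<Sum>p\<in>{p\<in>?P. p dvd d}. mulfun w d * (real (multiplicity p d) * ln (real p)))"
  proof (intro sum.cong refl)
    fix d assume d: "d \<in> {1..X}"
    have "p \<le> X" if "p dvd d" for p
    proof -
      have "p \<le> d" using that d by (intro dvd_imp_le) auto
      thus ?thesis using d by simp
    qed
    hence "{p\<in>?P. p dvd d} = prime_factors d" using d by (auto simp: prime_factors_dvd)
    thus "mulfun w d * ln (real d) = (\<Sum>p\<in>{p\<in>?P. p dvd d}. mulfun w d * (real (multiplicity p d) * ln (real p)))"
      using ln_eq_sum_multiplicity[of d] d by (simp add: sum_distrib_left)
  qed
  also have "\<dots> = (\<Sum>p\<in>?P. \<Sum>d\<in>{d\<in>{1..X}. p dvd d}. mulfun w d * (real (multiplicity p d) * ln (real p)))"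
    by (rule sum.swap_restrict) auto
  also have "\<dots> \<le> (\<Sum>p\<in>?P. (\<Sum>k | 1 \<le> k \<and> p ^ k \<le> X. w p k * (real k * ln (real p))) * (\<Sum>m\<in>{1..X}. mulfun w m))"
  proof (rule sum_mono)
    fix p assume p: "p \<in> ?P"
    hence pp: "prime p" and p1: "real p \<ge> 1" by (auto dest: prime_ge_1_nat)
    let ?D = "{d\<in>{1..X}. p dvd d}" and ?K = "{k. 1 \<le> k \<and> p ^ k \<le> X}"
    have finK: "finite ?K" by (rule finite_subset[OF _ finite_prime_powers_le[OF pp, of X]]) auto
    define j where "j d = (multiplicity p d, d div p ^ multiplicity p d)" for d
    define \<psi> where "\<psi> = (\<lambda>(k,m). w p k * (real k * ln (real p)) * mulfun w m)"
    have dec: "p ^ multiplicity p d * (d div p ^ multiplicity p d) = d" for d by (simp add: multiplicity_dvd)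
    have nd: "\<not> p dvd d div p ^ multiplicity p d" if "d > 0" for d
      using multiplicity_decompose[of d p] that pp by (auto dest: prime_gt_1_nat)
    have inj: "inj_on j ?D" unfolding j_def by (rule inj_onI) (metis dec prod.inject)
    have "(\<Sum>d\<in>?D. mulfun w d * (real (multiplicity p d) * ln (real p))) = (\<Sum>d\<in>?D. \<psi> (j d))"
    proof (intro sum.cong refl)
      fix d assume d: "d \<in> ?D"
      have "mulfun w (p ^ multiplicity p d * (d div p ^ multiplicity p d)) = w p (multiplicity p d) * mulfun w (d div p ^ multiplicity p d)"
        by (rule mulfun_prime_power_mult[of p _ w, OF pp nd w0]) (use d in auto)
      thus "mulfun w d * (real (multiplicity p d) * ln (real p)) = \<psi> (j d)" by (simp only: dec j_def \<psi>_def prod.case mult_ac)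
    qed
    also have "\<dots> = (\<Sum>x\<in>j ` ?D. \<psi> x)" by (subst sum.reindex[OF inj]) simp
    also have "\<dots> \<le> (\<Sum>x\<in>?K \<times> {1..X}. \<psi> x)"
    proof (rule sum_mono2)
      show "j ` ?D \<subseteq> ?K \<times> {1..X}"
      proof
        fix x assume "x \<in> j ` ?D"
        then obtain d where d: "x = j d" "d \<in> ?D" by blast
        have "multiplicity p d \<ge> 1" using d pp by (auto simp: prime_multiplicity_gt_zero_iff Suc_le_eq)
        moreover have "p ^ multiplicity p d \<le> d" using d by (intro dvd_imp_le multiplicity_dvd) auto
        moreover have "d div p ^ multiplicity p d \<le> X" using d(2) order_trans[OF div_le_dividend[of d "p ^ multiplicity p d"], of X] by simp
        moreover have "d div p ^ multiplicity p d > 0" using nd[of d] d by (auto intro!: Nat.gr0I)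
        ultimately show "x \<in> ?K \<times> {1..X}" using d by (auto simp: j_def)
      qed
      show "\<psi> x \<ge> 0" for x using w p1 by (auto simp: \<psi>_def case_prod_unfold mulfun_nonneg)
    qed (use finK in auto)
    also have "\<dots> = (\<Sum>k\<in>?K. w p k * (real k * ln (real p))) * (\<Sum>m\<in>{1..X}. mulfun w m)"
      by (simp add: \<psi>_def sum_product sum.cartesian_product)
    finally show "(\<Sum>d\<in>?D. mulfun w d * (real (multiplicity p d) * ln (real p))) \<le> (\<Sum>k\<in>?K. w p k * (real k * ln (real p))) * (\<Sum>m\<in>{1..X}. mulfun w m)" .
  qed
  finally show ?thesis by (simp only: sum_distrib_right)
qed

section \<open>Convergence of the correction factor h\<close>

lemma prime_power_eq_imp:
  fixes p q :: nat
  assumes "prime p" "prime q" "p ^ j = q ^ k" "j \<ge> 1"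
  shows "p = q \<and> j = k"
proof -
  have "p dvd p ^ j" using assms(4) by (cases j) auto
  hence "p dvd q ^ k" using assms by simp
  hence "p = q" using assms by (metis prime_dvd_power primes_dvd_imp_eq)
  moreover from this have "j = k" using assms by (metis power_inject_exp prime_gt_1_nat)
  ultimately show ?thesis by simp
qed

lemma sum_prime_powers_classM_le:
  fixes f :: "nat \<Rightarrow> complex"
  assumes "classM x A B f"
  shows "(\<Sum>p | prime p \<and> p \<le> nat \<lfloor>x\<rfloor>. \<Sum>k | 2 \<le> k \<and> p ^ k \<le> nat \<lfloor>x\<rfloor>. norm (f (p ^ k)) * ln (real (p ^ k)) / real (p ^ k)) \<le> B"
proof -
  let ?X = "nat \<lfloor>x\<rfloor>"
  let ?P = "{p. prime p \<and> p \<le> ?X}" and ?K = "\<lambda>p. {k. 2 \<le> k \<and> p ^ k \<le> ?X}"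
  let ?N = "{n. real n \<le> x \<and> (\<exists>p \<nu>. prime p \<and> 2 \<le> \<nu> \<and> n = p ^ \<nu>)}"
  define \<phi> where "\<phi> n = norm (f n) * ln (real n) / real n" for n
  have finN: "finite ?N" by (rule finite_subset[of _ "{..?X}"]) (auto simp: le_nat_floor)
  have finK: "finite (?K p)" if "p \<in> ?P" for p
    by (rule finite_subset[OF _ finite_prime_powers_le[of p ?X]]) (use that in auto)
  have "(\<Sum>p\<in>?P. \<Sum>k\<in>?K p. \<phi> (p ^ k)) = (\<Sum>(p,k)\<in>Sigma ?P ?K. \<phi> (p ^ k))"
    using finK by (intro sum.Sigma) auto
  also have "\<dots> = (\<Sum>n\<in>(\<lambda>(p,k). p ^ k) ` Sigma ?P ?K. \<phi> n)"
  proof (subst sum.reindex)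
    show "inj_on (\<lambda>(p,k). p ^ k) (Sigma ?P ?K)"
    proof (rule inj_onI)
      fix a b assume a: "a \<in> Sigma ?P ?K" and b: "b \<in> Sigma ?P ?K" and e: "(\<lambda>(p,k). p ^ k) a = (\<lambda>(p,k). p ^ k) b"
      have "fst a = fst b \<and> snd a = snd b"
        by (rule prime_power_eq_imp) (use a b e in \<open>auto simp: case_prod_unfold\<close>)
      thus "a = b" by (simp add: prod_eq_iff)
    qed
  qed (simp add: case_prod_unfold)
  also have "\<dots> \<le> (\<Sum>n\<in>?N. \<phi> n)"
  proof (rule sum_mono2[OF finN])
    show "(\<lambda>(p,k). p ^ k) ` Sigma ?P ?K \<subseteq> ?N"
    proof
      fix n assume "n \<in> (\<lambda>(p,k). p ^ k) ` Sigma ?P ?K"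
      then obtain p k where pk: "n = p ^ k" "prime p" "2 \<le> k" "p ^ k \<le> ?X" by auto
      have "n > 0" using pk by (simp add: prime_gt_0_nat)
      hence "real n \<le> x" using pk by linarith
      thus "n \<in> ?N" using pk by blast
    qed
    show "\<phi> n \<ge> 0" for n unfolding \<phi>_def by (cases "n = 0") auto
  qed
  also have "\<dots> \<le> B" using assms unfolding classM_def \<phi>_def by simp
  finally show ?thesis by (simp add: \<phi>_def)
qed

lemma sum_exp_terms_le:
  fixes A :: real
  assumes "A \<ge> 0"
  shows "(\<Sum>i\<le>N. A ^ i / fact i) \<le> exp A"
proof -
  have "(\<Sum>i\<le>N. A ^ i / fact i) = 1 + (\<Sum>i\<in>{1..N}. A ^ i / fact i)"
    by (simp add: atMost_atLeast0 sum.atLeast_Suc_atMost)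
  also have "\<dots> \<le> exp A" by (rule sum_exp_series_le) (use assms in auto)
  finally show ?thesis .
qed

lemma sq_le_four_times_two_power: "real k ^ 2 \<le> 4 * 2 ^ k"
proof (induction k)
  case (Suc k)
  show ?case
  proof (cases "k \<ge> 3")
    case True
    have "real (Suc k) ^ 2 = real k ^ 2 + (2 * real k + 1)" by (simp add: power2_eq_square algebra_simps)
    also have "2 * real k + 1 \<le> real k ^ 2"
    proof -
      have "3 * real k \<le> real k * real k" using True by (intro mult_right_mono) auto
      thus ?thesis using True unfolding power2_eq_square by linarith
    qed
    finally show ?thesis using Suc by simp
  next
    case False
    hence "k = 0 \<or> k = 1 \<or> k = 2" by auto
    thus ?thesis by auto
  qed
qed simp

text \<open>In the convolution with the exponential, the indices 0 and 1 involve only f(1) = 1 and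
  f(p), and leave a multiple of ln p / p^2 because k \<ge> 2. The indices j \<ge> 2 are controlled
  by the prime power sum of \<open>classM\<close> at the cost of a factor exp A.\<close>

lemma expquot_sum_at_prime_le:
  fixes f F :: "nat \<Rightarrow> complex" and X :: nat
  assumes p: "prime p" and A: "A \<ge> 0" and f1: "f 1 = 1" and Ff: "F p = f p" and fp: "norm (f p) \<le> A"
  defines "K \<equiv> {k. 2 \<le> k \<and> p ^ k \<le> X}"
  shows "(\<Sum>k\<in>K. norm (expquot f F p k) / real p ^ k * (real k * ln (real p)))
     \<le> 32 * exp A * (ln (real p) * real p powr (-1-1)) + exp A * (\<Sum>k\<in>K. norm (f (p ^ k)) * ln (real (p ^ k)) / real (p ^ k))"
proof -
  have p2: "real p \<ge> 2" using p by (auto dest: prime_ge_2_nat)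
  have lnp: "ln (real p) \<ge> 0" using p2 by simp
  have finK: "finite K" unfolding K_def by (rule finite_subset[OF _ finite_prime_powers_le[OF p, of X]]) auto
  have KX: "k \<le> X" if "k \<in> K" for k
  proof -
    have "k < p ^ k" using prime_gt_1_nat[OF p] by (simp add: power_gt_expt)
    thus ?thesis using that by (simp add: K_def)
  qed
  define T where "T j i = norm (f (p ^ j)) * (A ^ i / fact i) * (real (j + i) * ln (real p)) / real p ^ (j + i)" for j i
  have T0: "T j i \<ge> 0" for j i unfolding T_def using A lnp by simp
  have "norm (expquot f F p k) / real p ^ k * (real k * ln (real p)) \<le> T 0 k + T 1 (k - 1) + (\<Sum>j\<in>{2..k}. T j (k - j))" if k: "k \<in> K" for k
  proof -
    have k2: "k \<ge> 2" using k by (simp add: K_def)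
    have "norm (expquot f F p k) \<le> (\<Sum>j\<le>k. norm (f (p ^ j)) * (A ^ (k - j) / fact (k - j)))"
      unfolding expquot_eq
    proof (rule order_trans[OF norm_sum], rule sum_mono)
      fix j
      have "norm (f (p ^ j) * ((- F p) ^ (k - j) / fact (k - j))) = norm (f (p ^ j)) * (norm (f p) ^ (k - j) / fact (k - j))"
        by (simp add: norm_mult norm_divide norm_power Ff)
      also have "\<dots> \<le> norm (f (p ^ j)) * (A ^ (k - j) / fact (k - j))"
        by (intro mult_left_mono divide_right_mono power_mono fp) auto
      finally show "norm (f (p ^ j) * ((- F p) ^ (k - j) / fact (k - j))) \<le> norm (f (p ^ j)) * (A ^ (k - j) / fact (k - j))" .
    qed
    hence "norm (expquot f F p k) * ((real k * ln (real p)) / real p ^ k) \<le> (\<Sum>j\<le>k. norm (f (p ^ j)) * (A ^ (k - j) / fact (k - j))) * ((real k * ln (real p)) / real p ^ k)"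
      by (rule mult_right_mono) (use lnp in simp)
    also have "\<dots> = (\<Sum>j\<le>k. T j (k - j))"
      unfolding sum_distrib_right by (intro sum.cong refl) (simp add: T_def)
    also have "{..k} = insert 0 (insert 1 {2..k})" using k2 by auto
    also have "(\<Sum>j\<in>\<dots>. T j (k - j)) = T 0 k + (T 1 (k - 1) + (\<Sum>j\<in>{2..k}. T j (k - j)))" by simp
    finally show ?thesis by simp
  qed
  hence "(\<Sum>k\<in>K. norm (expquot f F p k) / real p ^ k * (real k * ln (real p))) \<le> (\<Sum>k\<in>K. T 0 k + T 1 (k - 1) + (\<Sum>j\<in>{2..k}. T j (k - j)))"
    by (rule sum_mono)
  also have "\<dots> = (\<Sum>k\<in>K. T 0 k + T 1 (k - 1)) + (\<Sum>k\<in>K. \<Sum>j\<in>{2..k}. T j (k - j))" by (rule sum.distrib)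
  finally have main: "(\<Sum>k\<in>K. norm (expquot f F p k) / real p ^ k * (real k * ln (real p))) \<le> (\<Sum>k\<in>K. T 0 k + T 1 (k - 1)) + (\<Sum>k\<in>K. \<Sum>j\<in>{2..k}. T j (k - j))" .
  have part1: "(\<Sum>k\<in>K. T 0 k + T 1 (k - 1)) \<le> 32 * exp A * (ln (real p) * real p powr (-1-1))"
  proof -
    define c where "c = ln (real p) * real p powr (-1-1)"
    have c0: "c \<ge> 0" using lnp by (simp add: c_def)
    have "T 0 k + T 1 (k - 1) \<le> 32 * c * (A ^ k / fact k)" if k: "k \<in> K" for k
    proof -
      have k2: "k \<ge> 2" using k by (simp add: K_def)
      then obtain m where m: "k = Suc m" by (cases k) auto
      \<comment> \<open>After splitting off p^2 and using p \<ge> 2 for the rest, k^2 / 2^(k-2)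
        remains, at most 16 by \<open>sq_le_four_times_two_power\<close>; two such terms give
        32.\<close>
      have pk: "real p ^ k \<ge> real p ^ 2 * 2 ^ (k - 2)"
      proof -
        have "real p ^ k = real p ^ (2 + (k - 2))" by (simp only: le_add_diff_inverse[OF k2])
        hence "real p ^ k = real p ^ 2 * real p ^ (k - 2)" by (simp only: power_add)
        thus ?thesis using p2 by (simp add: mult_left_mono power_mono)
      qed
      have "T 1 (k - 1) \<le> A * (A ^ (k - 1) / fact (k - 1)) * (real k * ln (real p)) / real p ^ k"
        unfolding T_def using k2 fp A lnp by (simp add: divide_right_mono mult_right_mono)
      also have "A * (A ^ (k - 1) / fact (k - 1)) = real k * (A ^ k / fact k)" by (simp add: m)
      finally have t1: "T 1 (k - 1) \<le> real k * (A ^ k / fact k) * (real k * ln (real p)) / real p ^ k" .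
      have t0: "T 0 k \<le> real k * (A ^ k / fact k) * (real k * ln (real p)) / real p ^ k"
      proof -
        have "1 * (A ^ k / fact k) \<le> real k * (A ^ k / fact k)" using k2 A by (intro mult_right_mono) auto
        hence "1 * (A ^ k / fact k) * (real k * ln (real p)) / real p ^ k \<le> real k * (A ^ k / fact k) * (real k * ln (real p)) / real p ^ k"
          by (rule divide_right_mono[OF mult_right_mono]) (use lnp in auto)
        thus ?thesis unfolding T_def using f1 by simp
      qed
      have "T 0 k + T 1 (k - 1) \<le> 2 * (real k ^ 2 * (A ^ k / fact k) * ln (real p)) / real p ^ k"
      proof -
        define Y where "Y = real k * (A ^ k / fact k) * (real k * ln (real p)) / real p ^ k"
        have "2 * (real k ^ 2 * (A ^ k / fact k) * ln (real p)) / real p ^ k = 2 * Y" by (simp add: Y_def power2_eq_square)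
        thus ?thesis using t0 t1 unfolding Y_def[symmetric] by linarith
      qed
      also have "\<dots> \<le> 2 * (real k ^ 2 * (A ^ k / fact k) * ln (real p)) / (real p ^ 2 * 2 ^ (k - 2))"
        using pk A lnp p2 by (intro divide_left_mono) auto
      also have "\<dots> \<le> 2 * ((4 * 2 ^ k) * (A ^ k / fact k) * ln (real p)) / (real p ^ 2 * 2 ^ (k - 2))"
        using A lnp p2 by (intro divide_right_mono mult_left_mono mult_right_mono sq_le_four_times_two_power) auto
      also have "(2::real) ^ k = 4 * 2 ^ (k - 2)" using k2 by (metis le_add_diff_inverse power_add four_x_squared power2_eq_square mult_2_right numeral_Bit0)
      also have "2 * ((4 * (4 * 2 ^ (k - 2))) * (A ^ k / fact k) * ln (real p)) / (real p ^ 2 * 2 ^ (k - 2)) = 32 * (ln (real p) / real p ^ 2) * (A ^ k / fact k)"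
        by (simp add: mult_ac)
      also have "ln (real p) / real p ^ 2 = c" using p2 by (simp add: c_def powr_minus_divide)
      finally show ?thesis .
    qed
    hence "(\<Sum>k\<in>K. T 0 k + T 1 (k - 1)) \<le> (\<Sum>k\<in>K. 32 * c * (A ^ k / fact k))" by (rule sum_mono)
    also have "\<dots> = 32 * c * (\<Sum>k\<in>K. A ^ k / fact k)" by (simp only: sum_distrib_left)
    also have "\<dots> \<le> 32 * c * exp A"
    proof (rule mult_left_mono)
      have "(\<Sum>k\<in>K. A ^ k / fact k) \<le> (\<Sum>k\<le>X. A ^ k / fact k)" by (rule sum_mono2) (use KX A in auto)
      also have "\<dots> \<le> exp A" by (rule sum_exp_terms_le[OF A])
      finally show "(\<Sum>k\<in>K. A ^ k / fact k) \<le> exp A" .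
    qed (use c0 in simp)
    finally show ?thesis by (simp only: c_def mult_ac)
  qed
  have part2: "(\<Sum>k\<in>K. \<Sum>j\<in>{2..k}. T j (k - j)) \<le> exp A * (\<Sum>k\<in>K. norm (f (p ^ k)) * ln (real (p ^ k)) / real (p ^ k))"
  proof -
    have sub: "{2..k} = {j\<in>K. j \<le> k}" if k: "k \<in> K" for k
    proof -
      have "p ^ j \<le> X" if "j \<le> k" for j
      proof -
        have "p ^ j \<le> p ^ k" using that p by (intro power_increasing) (auto dest: prime_ge_1_nat)
        thus ?thesis using k by (simp add: K_def)
      qed
      thus ?thesis by (auto simp: K_def)
    qed
    have "(\<Sum>k\<in>K. \<Sum>j\<in>{2..k}. T j (k - j)) = (\<Sum>k\<in>K. \<Sum>j\<in>{j\<in>K. j \<le> k}. T j (k - j))"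
      by (intro sum.cong refl) (use sub in auto)
    also have "\<dots> = (\<Sum>j\<in>K. \<Sum>k\<in>{k\<in>K. j \<le> k}. T j (k - j))" by (rule sum.swap_restrict[OF finK finK])
    also have "\<dots> \<le> (\<Sum>j\<in>K. exp A * (norm (f (p ^ j)) * ln (real (p ^ j)) / real (p ^ j)))"
    proof (rule sum_mono)
      fix j assume j: "j \<in> K"
      hence j2: "j \<ge> 2" by (simp add: K_def)
      define c where "c = norm (f (p ^ j)) * ln (real (p ^ j)) / real (p ^ j)"
      have c0: "c \<ge> 0" unfolding c_def using p2 by (intro divide_nonneg_nonneg mult_nonneg_nonneg) auto
      \<comment> \<open>The growth j + i \<le> j 2^i of the logarithm is compensated by p^(j+i)
        \<ge> p^j 2^i, so shifting the exponent by i costs only A^i / i!.\<close>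
      have Tc: "T j i \<le> c * (A ^ i / fact i)" for i
      proof -
        have a: "real (j + i) \<le> real j * 2 ^ i"
        proof -
          have "real i + 1 \<le> 2 ^ i" by (induction i) auto
          hence "real j * (real i + 1) \<le> real j * 2 ^ i" by (intro mult_left_mono) auto
          moreover have "real i \<le> real j * real i" using j2 mult_right_mono[of 1 "real j" "real i"] by simp
          ultimately show ?thesis by (simp add: algebra_simps)
        qed
        have b: "real p ^ j * 2 ^ i \<le> real p ^ (j + i)" unfolding power_add using p2 by (intro mult_left_mono power_mono) auto
        have "T j i \<le> norm (f (p ^ j)) * (A ^ i / fact i) * ((real j * 2 ^ i) * ln (real p)) / (real p ^ j * 2 ^ i)"
          unfolding T_def using a b A lnp p2 by (intro frac_le mult_left_mono mult_right_mono mult_nonneg_nonneg) auto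
        also have "\<dots> = c * (A ^ i / fact i)" unfolding c_def using p2 by (simp add: ln_realpow mult_ac)
        finally show ?thesis .
      qed
      have "(\<Sum>k\<in>{k\<in>K. j \<le> k}. T j (k - j)) = (\<Sum>i\<in>(\<lambda>k. k - j) ` {k\<in>K. j \<le> k}. T j i)"
        by (subst sum.reindex) (auto simp: inj_on_def)
      also have "\<dots> \<le> (\<Sum>i\<le>X. T j i)"
      proof (rule sum_mono2)
        show "(\<lambda>k. k - j) ` {k\<in>K. j \<le> k} \<subseteq> {..X}" using KX by fastforce
      qed (use T0 in auto)
      also have "\<dots> \<le> (\<Sum>i\<le>X. c * (A ^ i / fact i))" by (rule sum_mono[OF Tc])
      also have "\<dots> = c * (\<Sum>i\<le>X. A ^ i / fact i)" by (simp only: sum_distrib_left)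
      also have "\<dots> \<le> c * exp A" using sum_exp_terms_le[OF A] c0 by (intro mult_left_mono) auto
      finally show "(\<Sum>k\<in>{k\<in>K. j \<le> k}. T j (k - j)) \<le> exp A * (norm (f (p ^ j)) * ln (real (p ^ j)) / real (p ^ j))"
        by (simp only: c_def mult.commute)
    qed
    also have "\<dots> = exp A * (\<Sum>k\<in>K. norm (f (p ^ k)) * ln (real (p ^ k)) / real (p ^ k))" by (simp only: sum_distrib_left)
    finally show ?thesis .
  qed
  show ?thesis using main part1 part2 by linarith
qed

text \<open>Here 3840 = 32 * 120, from \<open>expquot_sum_at_prime_le\<close> and from
  \<open>sum_ln_primes_powr_le\<close> at \<alpha> = 1. The factor exp C bounds the sum of the
  nonnegative function, and 1 + 2 C accounts for its logarithmic weight.\<close>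

definition expquot_bound :: "real \<Rightarrow> real \<Rightarrow> real" where
  "expquot_bound A B = (let C = exp A * (3840 + B) in exp C * (1 + 2 * C))"

text \<open>Since \<open>F p = f p\<close>, the local factors have no term k = 1, which leaves an
  absolutely convergent Euler product. The weight 1 + 2 ln d is what replacing ln(2x/d) by ln x will
  cost.\<close>

theorem expquot_sum_le:
  fixes f :: "nat \<Rightarrow> complex" and A B x :: real
  assumes A: "A > 0" and f: "multiplicative f" "classM x A B f"
  defines "F \<equiv> (\<lambda>p. if prime p \<and> real p \<le> x then f p else 0)" and "X \<equiv> nat \<lfloor>x\<rfloor>"
  shows "(\<Sum>d\<in>{1..X}. norm (mulfun (expquot f F) d) / real d * (1 + 2 * ln (real d))) \<le> expquot_bound A B"
proof -
  define C where "C = exp A * (3840 + B)"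
  define w where "w p k = norm (expquot f F p k) / real p ^ k" for p k
  have w0: "w p 0 = 1" for p using f(1) by (simp add: w_def expquot_eq multiplicative_def)
  have wn: "w p k \<ge> 0" for p k by (simp add: w_def)
  let ?P = "{p. prime p \<and> p \<le> X}"
  have P: "prime p" "real p \<le> x" "p \<le> X" "real p \<ge> 2" if "p \<in> ?P" for p
  proof -
    show "prime p" "p \<le> X" using that by auto
    hence "p \<ge> 2" by (auto dest: prime_ge_2_nat)
    thus "real p \<ge> 2" by simp
    show "real p \<le> x" using that \<open>p \<ge> 2\<close> unfolding X_def by auto linarith
  qed
  define S where "S = (\<Sum>p\<in>?P. \<Sum>k | 1 \<le> k \<and> p ^ k \<le> X. w p k * (real k * ln (real p)))"
  have spl: "w p 1 = 0" "{k. 1 \<le> k \<and> p ^ k \<le> X} = insert 1 {k. 2 \<le> k \<and> p ^ k \<le> X}" "finite {k. 2 \<le> k \<and> p ^ k \<le> X}" if "p \<in> ?P" for p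
  proof -
    have "expquot f F p 1 = f p - F p" using f(1) by (simp add: expquot_eq multiplicative_def)
    thus "w p 1 = 0" using P[OF that] by (simp add: w_def F_def)
    show "{k. 1 \<le> k \<and> p ^ k \<le> X} = insert 1 {k. 2 \<le> k \<and> p ^ k \<le> X}"
      using P[OF that] by (auto simp: le_Suc_eq Suc_le_eq intro: Suc_lessI)
    show "finite {k. 2 \<le> k \<and> p ^ k \<le> X}" by (rule finite_subset[OF _ finite_prime_powers_le[OF P(1)[OF that], of X]]) auto
  qed
  have "S = (\<Sum>p\<in>?P. \<Sum>k | 2 \<le> k \<and> p ^ k \<le> X. w p k * (real k * ln (real p)))"
    unfolding S_def
  proof (rule sum.cong[OF refl])
    fix p assume p: "p \<in> ?P"
    have "(\<Sum>k\<in>insert 1 {k. 2 \<le> k \<and> p ^ k \<le> X}. w p k * (real k * ln (real p))) =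
        w p 1 * (real 1 * ln (real p)) + (\<Sum>k | 2 \<le> k \<and> p ^ k \<le> X. w p k * (real k * ln (real p)))"
      by (rule sum.insert[OF spl(3)[OF p]]) simp
    thus "(\<Sum>k | 1 \<le> k \<and> p ^ k \<le> X. w p k * (real k * ln (real p))) = (\<Sum>k | 2 \<le> k \<and> p ^ k \<le> X. w p k * (real k * ln (real p)))"
      by (simp only: spl(1,2)[OF p] mult_zero_left add_0_left)
  qed
  also have "\<dots> \<le> (\<Sum>p\<in>?P. 32 * exp A * (ln (real p) * real p powr (-1-1)) + exp A * (\<Sum>k | 2 \<le> k \<and> p ^ k \<le> X. norm (f (p ^ k)) * ln (real (p ^ k)) / real (p ^ k)))"
  proof (rule sum_mono)
    fix p assume p: "p \<in> ?P"
    show "(\<Sum>k | 2 \<le> k \<and> p ^ k \<le> X. w p k * (real k * ln (real p)))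
       \<le> 32 * exp A * (ln (real p) * real p powr (-1-1)) + exp A * (\<Sum>k | 2 \<le> k \<and> p ^ k \<le> X. norm (f (p ^ k)) * ln (real (p ^ k)) / real (p ^ k))"
      unfolding w_def
    proof (rule expquot_sum_at_prime_le)
      show "prime p" "F p = f p" using P[OF p] by (auto simp: F_def)
      show "norm (f p) \<le> A" using f(2) P[OF p] by (simp add: classM_def)
      show "f 1 = 1" using f(1) by (simp add: multiplicative_def)
    qed (use A in simp)
  qed
  also have "\<dots> = 32 * exp A * (\<Sum>p\<in>?P. ln (real p) * real p powr (-1-1)) + exp A * (\<Sum>p\<in>?P. \<Sum>k | 2 \<le> k \<and> p ^ k \<le> X. norm (f (p ^ k)) * ln (real (p ^ k)) / real (p ^ k))"
    by (simp only: sum.distrib sum_distrib_left)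
  also have "\<dots> \<le> 32 * exp A * 120 + exp A * B"
  proof (intro add_mono mult_left_mono)
    have "(\<Sum>p\<in>?P. ln (real p) * real p powr (-1-1)) = (\<Sum>p | prime p \<and> real p \<le> real X. ln (real p) * real p powr (-1-1))" by simp
    also have "\<dots> \<le> 120 / 1" by (rule sum_ln_primes_powr_le) auto
    finally show "(\<Sum>p\<in>?P. ln (real p) * real p powr (-1-1)) \<le> 120" by simp
    show "(\<Sum>p\<in>?P. \<Sum>k | 2 \<le> k \<and> p ^ k \<le> X. norm (f (p ^ k)) * ln (real (p ^ k)) / real (p ^ k)) \<le> B"
      unfolding X_def by (rule sum_prime_powers_classM_le[OF f(2)])
  qed auto
  also have "\<dots> = C" by (simp add: C_def algebra_simps)
  finally have SC: "S \<le> C" .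
  have S0: "S \<ge> 0" unfolding S_def by (intro sum_nonneg mult_nonneg_nonneg wn) (auto dest: prime_ge_1_nat)
  define R where "R = (\<Sum>d\<in>{1..X}. mulfun w d)"
  have R0: "R \<ge> 0" unfolding R_def by (intro sum_nonneg mulfun_nonneg wn)
  \<comment> \<open>The logarithmic local sum S dominates the plain one: k ln p \<ge> 2 ln 2 \<ge> 1
    for k \<ge> 2, and the term k = 1 is zero.\<close>
  have "(\<Sum>p\<in>?P. \<Sum>k | 1 \<le> k \<and> p ^ k \<le> X. w p k) \<le> S" unfolding S_def
  proof (intro sum_mono)
    fix p k assume p: "p \<in> ?P" and k: "k \<in> {k. 1 \<le> k \<and> p ^ k \<le> X}"
    show "w p k \<le> w p k * (real k * ln (real p))"
    proof (cases "k = 1")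
      case False
      hence k2: "k \<ge> 2" using k by auto
      have "ln (real p) \<ge> ln 2" using P[OF p] by (intro ln_mono) auto
      hence "ln (real p) \<ge> 1/2" using ln_2_ge_half by linarith
      hence "2 * (1/2) \<le> real k * ln (real p)" using k2 by (intro mult_mono) auto
      hence "w p k * 1 \<le> w p k * (real k * ln (real p))" using wn by (intro mult_left_mono) auto
      thus ?thesis by simp
    qed (simp add: spl(1)[OF p] del: One_nat_def)
  qed
  hence "(\<Sum>p\<in>?P. \<Sum>k | 1 \<le> k \<and> p ^ k \<le> X. w p k) \<le> C" using SC by linarith
  moreover have "R \<le> exp (\<Sum>p\<in>?P. \<Sum>k | 1 \<le> k \<and> p ^ k \<le> X. w p k)"
    unfolding R_def using wn w0 by (intro sum_mulfun_le_exp) auto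
  ultimately have RC: "R \<le> exp C" by (meson exp_le_cancel_iff order_trans)
  have "(\<Sum>d\<in>{1..X}. norm (mulfun (expquot f F) d) / real d * (1 + 2 * ln (real d))) = (\<Sum>d\<in>{1..X}. mulfun w d * (1 + 2 * ln (real d)))"
  proof (intro sum.cong refl)
    fix d assume "d \<in> {1..X}"
    hence "norm (mulfun (expquot f F) d) / real d = mulfun w d"
      unfolding norm_mulfun w_def by (intro mulfun_over_nat) auto
    thus "norm (mulfun (expquot f F) d) / real d * (1 + 2 * ln (real d)) = mulfun w d * (1 + 2 * ln (real d))" by simp
  qed
  also have "\<dots> = R + 2 * (\<Sum>d\<in>{1..X}. mulfun w d * ln (real d))"
    by (simp add: R_def sum.distrib sum_distrib_left distrib_left mult_ac)
  also have "(\<Sum>d\<in>{1..X}. mulfun w d * ln (real d)) \<le> S * R"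
    unfolding S_def R_def using wn w0 by (intro sum_mulfun_ln_le) auto
  also have "R + 2 * (S * R) = R * (1 + 2 * S)" by (simp add: algebra_simps)
  also have "\<dots> \<le> exp C * (1 + 2 * C)" using RC SC S0 R0 by (intro mult_mono) auto
  finally show ?thesis by (simp add: expquot_bound_def C_def Let_def)
qed

section \<open>Smoothed logarithmic means\<close>

lemma finite_int_abs_le [simp]: "finite {k::int. real_of_int \<bar>k\<bar> \<le> T}"
  by (rule finite_subset[of _ "{-\<lfloor>T\<rfloor>..\<lfloor>T\<rfloor>}"]) (auto simp: le_floor_iff abs_le_iff, linarith)

lemma finite_int_abs_le' [simp]: "finite {k::int. \<bar>real_of_int k\<bar> \<le> T}"
  using finite_int_abs_le[of T] by (simp only: of_int_abs)

text \<open>The trivial bound for |v_F| on the line \<sigma> = 1 + \<alpha>; at \<alpha> = 0 it is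
  Z(x; |F|).\<close>

definition Zpow :: "(nat \<Rightarrow> complex) \<Rightarrow> real \<Rightarrow> real \<Rightarrow> real" where
  "Zpow F x \<alpha> = (\<Sum>p | prime p \<and> real p \<le> x. norm (F p) * real p powr (-1 - \<alpha>))"

lemma vsum_eq:
  "vsum F (Complex \<sigma> \<tau>) x = (\<Sum>p | prime p \<and> real p \<le> x. F p * of_real (real p powr - \<sigma>) * cis (- (\<tau> * ln (real p))))"
  unfolding vsum_def by (intro sum.cong refl) (auto simp: of_nat_powr_neg_Complex prime_gt_0_nat)

lemma norm_vsum_le: "norm (vsum F (Complex (1 + \<alpha>) \<tau>) x) \<le> Zpow F x \<alpha>"
  unfolding vsum_eq Zpow_def by (rule order_trans[OF norm_sum]) (simp add: norm_mult)

definition win_sup :: "(nat \<Rightarrow> complex) \<Rightarrow> real \<Rightarrow> real \<Rightarrow> int \<Rightarrow> real" where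
  "win_sup F x \<alpha> k = (SUP \<tau>\<in>{real_of_int k - 1/2 .. real_of_int k + 1/2}. cmod (exp (vsum F (Complex (1 + \<alpha>) \<tau>) x)) ^ 2)"

lemma exp_vsum_le: "cmod (exp (vsum F (Complex (1 + \<alpha>) \<tau>) x)) ^ 2 \<le> exp (2 * Zpow F x \<alpha>)"
proof -
  have "cmod (exp (vsum F (Complex (1 + \<alpha>) \<tau>) x)) \<le> exp (Zpow F x \<alpha>)"
    by (rule order_trans[OF norm_exp]) (simp add: norm_vsum_le)
  hence "cmod (exp (vsum F (Complex (1 + \<alpha>) \<tau>) x)) ^ 2 \<le> exp (Zpow F x \<alpha>) ^ 2" by (rule power_mono) simp
  thus ?thesis by (simp add: exp_double)
qed

lemma win_sup_ge:
  assumes "\<bar>\<tau> - real_of_int k\<bar> \<le> 1/2"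
  shows "cmod (exp (vsum F (Complex (1 + \<alpha>) \<tau>) x)) ^ 2 \<le> win_sup F x \<alpha> k"
  unfolding win_sup_def
proof (rule cSUP_upper)
  show "\<tau> \<in> {real_of_int k - 1/2 .. real_of_int k + 1/2}" unfolding atLeastAtMost_iff using assms by linarith
  show "bdd_above ((\<lambda>\<tau>. cmod (exp (vsum F (Complex (1 + \<alpha>) \<tau>) x)) ^ 2) ` {real_of_int k - 1/2 .. real_of_int k + 1/2})"
    using exp_vsum_le by (intro bdd_aboveI2)
qed

lemma win_sup_nonneg: "win_sup F x \<alpha> k \<ge> 0"
  by (rule order_trans[OF zero_le_power2 win_sup_ge[of "real_of_int k"]]) simp

lemma HT_nonneg: "HT F x T \<alpha> \<ge> 0"
  unfolding HT_def win_sup_def[symmetric] real_sqrt_ge_0_iff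
  by (intro sum_nonneg mult_nonneg_nonneg win_sup_nonneg) auto

lemma HT_sq: "HT F x T \<alpha> ^ 2 = (\<Sum>k | real_of_int \<bar>k\<bar> \<le> T. 1 / (real_of_int k ^ 2 + 1) * win_sup F x \<alpha> k)"
  unfolding HT_def win_sup_def[symmetric] by (rule real_sqrt_pow2) (intro sum_nonneg mult_nonneg_nonneg win_sup_nonneg, auto)

text \<open>The Riesz mean of g log. Stopping at x loses nothing for t \<le> x, because
  \<open>riesz\<close> vanishes for n \<ge> t.\<close>

definition Npoly :: "(nat \<Rightarrow> complex) \<Rightarrow> real \<Rightarrow> real \<Rightarrow> real \<Rightarrow> complex" where
  "Npoly F \<kappa> x t = (\<Sum>n\<in>{1..nat \<lfloor>x\<rfloor>}. expmult F n * of_real (ln (real n)) * of_real (riesz \<kappa> (real n) t))"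

lemma riesz_measurable [measurable]: "riesz \<kappa> n \<in> borel_measurable borel"
proof -
  have "riesz \<kappa> n = (\<lambda>t. if n < t then 1 - (if n / t = 0 then 0 else exp (\<kappa> * ln (n / t))) else 0)"
    by (auto simp: riesz_def powr_def fun_eq_iff)
  thus ?thesis by simp
qed

lemma Npoly_measurable [measurable]: "Npoly F \<kappa> x \<in> borel_measurable borel"
  unfolding Npoly_def[abs_def] by measurable

lemma of_nat_powr_mult_Complex:
  "(of_nat (m * n) :: complex) powr (- Complex \<sigma> \<tau>) = of_nat m powr (- Complex \<sigma> \<tau>) * of_nat n powr (- Complex \<sigma> \<tau>)"
proof (cases "m = 0 \<or> n = 0")
  case False
  hence "m > 0" "n > 0" by auto
  thus ?thesis by (simp add: of_nat_powr_neg_Complex powr_mult ln_mult cis_mult algebra_simps del: of_nat_mult) (simp add: powr_mult ln_mult algebra_simps)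
qed auto

text \<open>The two regimes of the Plancherel weight at \<kappa> = sqrt T: the decay 1/(1 +
  \<tau>^2) of the unsmoothed weight, and T/\<tau>^4 for large \<tau>. The extra decay makes the
  region |\<tau>| > T cost 1/T^2 instead of 1/T in mean square.\<close>

lemma riesz_weight_le:
  fixes \<tau> T \<alpha> :: real
  assumes a: "0 < \<alpha>" and T: "T \<ge> 1"
  defines "W \<equiv> (sqrt T)\<^sup>2 / (((1 + \<alpha>)\<^sup>2 + \<tau>\<^sup>2) * ((1 + \<alpha> + sqrt T)\<^sup>2 + \<tau>\<^sup>2)) / (2 * pi)"
  shows "0 \<le> W" "W \<le> 1 / (1 + \<tau>\<^sup>2) / (2 * pi)" "\<tau> \<noteq> 0 \<Longrightarrow> W \<le> T / (\<tau>\<^sup>2 * \<tau>\<^sup>2) / (2 * pi)"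
proof -
  have s1: "1 + \<tau>\<^sup>2 \<le> (1 + \<alpha>)\<^sup>2 + \<tau>\<^sup>2" using a by (simp add: power2_eq_square algebra_simps)
  have t0: "1 + \<tau>\<^sup>2 > 0" by (simp add: add_pos_nonneg)
  have sT: "(sqrt T)\<^sup>2 = T" "sqrt T \<ge> 1" using T by auto
  have "(sqrt T)\<^sup>2 \<le> (1 + \<alpha> + sqrt T)\<^sup>2" using a sT by (intro power_mono) auto
  hence s2: "(sqrt T)\<^sup>2 \<le> (1 + \<alpha> + sqrt T)\<^sup>2 + \<tau>\<^sup>2" by (simp add: add_increasing2)
  have p2: "(1 + \<alpha> + sqrt T)\<^sup>2 + \<tau>\<^sup>2 > 0" using a sT T s2 by simp
  show "0 \<le> W" unfolding W_def by (intro divide_nonneg_nonneg mult_nonneg_nonneg add_nonneg_nonneg) (auto simp: pi_ge_zero)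
  have "(sqrt T)\<^sup>2 / (((1 + \<alpha>)\<^sup>2 + \<tau>\<^sup>2) * ((1 + \<alpha> + sqrt T)\<^sup>2 + \<tau>\<^sup>2)) \<le> ((1 + \<alpha> + sqrt T)\<^sup>2 + \<tau>\<^sup>2) / ((1 + \<tau>\<^sup>2) * ((1 + \<alpha> + sqrt T)\<^sup>2 + \<tau>\<^sup>2))"
    using s1 s2 t0 p2 by (intro frac_le mult_right_mono) auto
  also have "\<dots> = 1 / (1 + \<tau>\<^sup>2)" by (rule nonzero_divide_mult_cancel_right[OF less_imp_neq[OF p2, symmetric]])
  finally show "W \<le> 1 / (1 + \<tau>\<^sup>2) / (2 * pi)" unfolding W_def by (rule divide_right_mono) simp
  assume "\<tau> \<noteq> 0"
  hence "(sqrt T)\<^sup>2 / (((1 + \<alpha>)\<^sup>2 + \<tau>\<^sup>2) * ((1 + \<alpha> + sqrt T)\<^sup>2 + \<tau>\<^sup>2)) \<le> (sqrt T)\<^sup>2 / (\<tau>\<^sup>2 * \<tau>\<^sup>2)"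
    using T by (intro divide_left_mono mult_mono mult_pos_pos) (auto intro: add_nonneg_pos)
  also have "\<dots> = T / (\<tau>\<^sup>2 * \<tau>\<^sup>2)" by (simp only: sT)
  finally show "W \<le> T / (\<tau>\<^sup>2 * \<tau>\<^sup>2) / (2 * pi)" unfolding W_def by (rule divide_right_mono) simp
qed

text \<open>Round \<tau> to the nearest integer k. If |k| \<le> T, the window of k alone dominates;
  otherwise the last term does. Windows are encoded by Cauchy kernels instead of indicators, since
  these are the weights of \<open>prime_polynomial_mean_square\<close>; all |k| > T share one kernel
  of width T.\<close>

lemma weighted_pointwise_le:
  fixes \<tau> T \<alpha> v :: real
  assumes a: "0 < \<alpha>" and T: "T \<ge> 1" and v: "v \<ge> 0"
  defines "W \<equiv> (sqrt T)\<^sup>2 / (((1 + \<alpha>)\<^sup>2 + \<tau>\<^sup>2) * ((1 + \<alpha> + sqrt T)\<^sup>2 + \<tau>\<^sup>2)) / (2 * pi)"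
  shows "v * cmod (exp (vsum F (Complex (1 + \<alpha>) \<tau>) x)) ^ 2 * W
     \<le> (\<Sum>k | real_of_int \<bar>k\<bar> \<le> T. 1 / (real_of_int k ^ 2 + 1) * win_sup F x \<alpha> k * (v * (1 / (1\<^sup>2 + (\<tau> - real_of_int k)\<^sup>2))))
       + 4 * exp (2 * Zpow F x \<alpha>) / T * (v * (1 / (T\<^sup>2 + (\<tau> - 0)\<^sup>2)))"
proof -
  let ?E = "cmod (exp (vsum F (Complex (1 + \<alpha>) \<tau>) x)) ^ 2"
  let ?t = "\<lambda>k. 1 / (real_of_int k ^ 2 + 1) * win_sup F x \<alpha> k * (v * (1 / (1\<^sup>2 + (\<tau> - real_of_int k)\<^sup>2)))"
  let ?B = "4 * exp (2 * Zpow F x \<alpha>) / T * (v * (1 / (T\<^sup>2 + (\<tau> - 0)\<^sup>2)))"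
  note W = riesz_weight_le[OF a T, of \<tau>, folded W_def]
  have pi1: "2 * pi \<ge> 5" using pi_gt3 by simp
  have t0: "?t k \<ge> 0" for k using v win_sup_nonneg[of F x \<alpha> k] by (intro mult_nonneg_nonneg) auto
  have B0: "?B \<ge> 0" using v T by (intro mult_nonneg_nonneg divide_nonneg_nonneg) auto
  define k where "k = round \<tau>"
  have k: "\<bar>\<tau> - real_of_int k\<bar> \<le> 1/2" unfolding k_def using of_int_round_abs_le[of \<tau>] by (simp add: abs_minus_commute)
  show ?thesis
  proof (cases "real_of_int \<bar>k\<bar> \<le> T")
    case True
    define d where "d = \<tau> - real_of_int k"
    have d2: "d\<^sup>2 \<le> 1/4" using k power_mono[of "\<bar>d\<bar>" "1/2" 2] by (simp add: d_def power2_eq_square)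
    have kd: "real_of_int k = \<tau> - d" by (simp add: d_def)
    have "(\<tau> - d)\<^sup>2 + (\<tau> + d)\<^sup>2 = 2 * \<tau>\<^sup>2 + 2 * d\<^sup>2" by (simp add: power2_eq_square algebra_simps)
    moreover have "a + 1 \<le> 2 * (1 + t)" if "a + b = 2 * t + 2 * e" "b \<ge> 0" "e \<le> 1/4" for a b t e :: real
      using that by argo
    ultimately have "(\<tau> - d)\<^sup>2 + 1 \<le> 2 * (1 + \<tau>\<^sup>2)" using d2 zero_le_power2 by blast
    hence "real_of_int k ^ 2 + 1 \<le> 2 * (1 + \<tau>\<^sup>2)" by (simp only: kd)
    hence "1 / (1 + \<tau>\<^sup>2) \<le> 2 / (real_of_int k ^ 2 + 1)" by (simp add: field_simps add_pos_nonneg)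
    also have "\<dots> \<le> (5/2) * (1 / (1 + d\<^sup>2)) / (real_of_int k ^ 2 + 1)"
    proof (rule divide_right_mono)
      show "2 \<le> (5/2) * (1 / (1 + d\<^sup>2))" using d2 by (simp add: field_simps add_pos_nonneg)
    qed simp
    also have "\<dots> = (5/2) * (1 / (real_of_int k ^ 2 + 1) * (1 / (1 + d\<^sup>2)))" 
      by (simp only: times_divide_eq_left times_divide_eq_right mult_1_left mult_1_right divide_divide_eq_left mult_ac)
    finally have "1 / (1 + \<tau>\<^sup>2) \<le> (5/2) * (1 / (real_of_int k ^ 2 + 1) * (1 / (1 + d\<^sup>2)))" .
    hence "1 / (1 + \<tau>\<^sup>2) / (2 * pi) \<le> (5/2) * (1 / (real_of_int k ^ 2 + 1) * (1 / (1 + d\<^sup>2))) / (2 * pi)" by (rule divide_right_mono) simp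
    also have "\<dots> \<le> (5/2) * (1 / (real_of_int k ^ 2 + 1) * (1 / (1 + d\<^sup>2))) / 5" using pi1 by (intro divide_left_mono) auto
    also have "\<dots> \<le> 1 / (real_of_int k ^ 2 + 1) * (1 / (1 + d\<^sup>2))"
    proof -
      have "(5/2) * z / 5 \<le> z" if "z \<ge> 0" for z :: real using that by simp
      moreover have "1 / (real_of_int k ^ 2 + 1) * (1 / (1 + d\<^sup>2)) \<ge> 0" by (intro mult_nonneg_nonneg) auto
      ultimately show ?thesis by blast
    qed
    finally have W1: "W \<le> 1 / (real_of_int k ^ 2 + 1) * (1 / (1 + d\<^sup>2))" using W(2) by linarith
    have "?E * W \<le> win_sup F x \<alpha> k * (1 / (real_of_int k ^ 2 + 1) * (1 / (1 + d\<^sup>2)))"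
      by (rule mult_mono[OF win_sup_ge[OF k] W1 win_sup_nonneg W(1)])
    hence "v * (?E * W) \<le> v * (win_sup F x \<alpha> k * (1 / (real_of_int k ^ 2 + 1) * (1 / (1 + d\<^sup>2))))" using v by (rule mult_left_mono)
    also have "\<dots> = ?t k" by (simp add: d_def)
    also have "?t k \<le> (\<Sum>k | real_of_int \<bar>k\<bar> \<le> T. ?t k)" by (rule member_le_sum) (use True t0 in auto)
    finally show ?thesis using B0 by (simp add: mult.assoc)
  next
    \<comment> \<open>Here |\<tau>| \<ge> T - 1/2 \<ge> T/2, so T^2 \<le> 4 \<tau>^2 and the bound
      T/\<tau>^4 is at most 20/(T (T^2 + \<tau>^2)); division by 2 \<pi> \<ge> 5 leaves 4.\<close>
    case False
    have "\<bar>\<tau>\<bar> \<ge> T - 1/2" using False k by linarith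
    hence tT: "\<bar>\<tau>\<bar> \<ge> T / 2" using T by linarith
    hence tn: "\<tau> \<noteq> 0" using T by auto
    have q: "T\<^sup>2 \<le> 4 * \<tau>\<^sup>2" using power_mono[OF tT, of 2] T by (simp add: power2_eq_square)
    have "T\<^sup>2 * (T\<^sup>2 + \<tau>\<^sup>2) \<le> (4 * \<tau>\<^sup>2) * (5 * \<tau>\<^sup>2)" using q by (intro mult_mono) auto
    hence "T * (T * (T\<^sup>2 + \<tau>\<^sup>2)) \<le> 20 * (\<tau>\<^sup>2 * \<tau>\<^sup>2)" by (simp add: power2_eq_square mult_ac)
    moreover have "T * (T\<^sup>2 + \<tau>\<^sup>2) > 0" "\<tau>\<^sup>2 * \<tau>\<^sup>2 > 0" using T tn by (auto intro!: mult_pos_pos add_pos_nonneg)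
    moreover have "T / q \<le> 20 / r" if "T * r \<le> 20 * q" "r > 0" "q > 0" for q r :: real using that by (simp add: field_simps)
    ultimately have "T / (\<tau>\<^sup>2 * \<tau>\<^sup>2) \<le> 20 / (T * (T\<^sup>2 + \<tau>\<^sup>2))" by blast
    hence "T / (\<tau>\<^sup>2 * \<tau>\<^sup>2) / (2 * pi) \<le> 20 / (T * (T\<^sup>2 + \<tau>\<^sup>2)) / (2 * pi)" by (rule divide_right_mono) simp
    also have "\<dots> \<le> 20 / (T * (T\<^sup>2 + \<tau>\<^sup>2)) / 5" using pi1 \<open>T * (T\<^sup>2 + \<tau>\<^sup>2) > 0\<close> by (intro divide_left_mono) auto
    also have "\<dots> = 4 / (T * (T\<^sup>2 + \<tau>\<^sup>2))" by simp
    finally have W1: "W \<le> 4 / (T * (T\<^sup>2 + \<tau>\<^sup>2))" using W(3)[OF tn] by linarith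
    have "?E * W \<le> exp (2 * Zpow F x \<alpha>) * (4 / (T * (T\<^sup>2 + \<tau>\<^sup>2)))"
      by (rule mult_mono[OF exp_vsum_le W1 _ W(1)]) simp
    hence "v * (?E * W) \<le> v * (exp (2 * Zpow F x \<alpha>) * (4 / (T * (T\<^sup>2 + \<tau>\<^sup>2))))" using v by (rule mult_left_mono)
    also have "\<dots> = ?B" by simp
    finally show ?thesis using sum_nonneg[of "{k. real_of_int \<bar>k\<bar> \<le> T}" ?t] t0 by (simp add: mult.assoc)
  qed
qed

lemma has_bochner_integral_mono_le:
  fixes f g :: "'a \<Rightarrow> real"
  assumes "has_bochner_integral M f a" "has_bochner_integral M g b" "\<And>x. f x \<le> g x"
  shows "a \<le> b"
  using assms integral_mono[of M f g] by (auto simp: has_bochner_integral_iff)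

lemma expmult_powr_twist:
  "expmult F n * of_nat n powr (- Complex \<sigma> \<tau>) = expmult (\<lambda>p. F p * of_nat p powr (- Complex \<sigma> \<tau>)) n" if "n > 0"
  using that by (intro expmult_twist) (auto simp: of_nat_powr_mult_Complex simp del: of_nat_mult)

text \<open>Plancherel turns the left side into a mean square of the series, which is the prime sum
  V times exp v up to the truncation error 1. The factor exp v is removed pointwise and V is
  averaged kernel by kernel; squaring the sum with the error doubles 14400.\<close>

lemma Npoly_mean_square:
  fixes F :: "nat \<Rightarrow> complex"
  assumes A: "A > 0" and F: "\<And>p. norm (F p) \<le> A" and F0: "\<And>p. \<not> (prime p \<and> real p \<le> x) \<Longrightarrow> F p = 0"
    and a: "0 < \<alpha>" "\<alpha> \<le> 1" and T: "T \<ge> 1"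
  shows "\<exists>J. has_bochner_integral lborel (\<lambda>t. indicator {1..x} t * (norm (Npoly F (sqrt T) x t) ^ 2 * t powr (-1 - 2 * (1 + \<alpha>)))) J
     \<and> J \<le> 28800 * pi * A\<^sup>2 / \<alpha> * (HT F x T \<alpha> ^ 2 + 4 * exp (2 * Zpow F x \<alpha>) / T\<^sup>2) + 1"
proof -
  let ?P = "{p. prime p \<and> real p \<le> x}"
  define \<kappa> where "\<kappa> = sqrt T"
  define \<sigma> where "\<sigma> = 1 + \<alpha>"
  have k: "\<kappa> > 0" and s: "\<sigma> > 0" using T a by (auto simp: \<kappa>_def \<sigma>_def)
  define W where "W \<tau> = \<kappa>\<^sup>2 / ((\<sigma>\<^sup>2 + \<tau>\<^sup>2) * ((\<sigma>+\<kappa>)\<^sup>2 + \<tau>\<^sup>2)) / (2 * pi)" for \<tau>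
  have Weq: "W \<tau> = (sqrt T)\<^sup>2 / (((1 + \<alpha>)\<^sup>2 + \<tau>\<^sup>2) * ((1 + \<alpha> + sqrt T)\<^sup>2 + \<tau>\<^sup>2)) / (2 * pi)" for \<tau>
    by (simp only: W_def \<sigma>_def \<kappa>_def)
  define Ft where "Ft \<tau> p = F p * of_nat p powr (- Complex \<sigma> \<tau>)" for \<tau> p
  define b where "b p = norm (F p) * real p powr -\<sigma>" for p
  \<comment> \<open>The moduli are independent of \<tau>, so one truncation point serves the whole
    line.\<close>
  have nFt: "norm (Ft \<tau> p) = b p" for \<tau> p
    using F0[of p] by (cases "prime p") (auto simp: Ft_def b_def norm_mult of_nat_powr_neg_Complex prime_gt_0_nat)
  obtain X0 where X0: "\<And>X G. X \<ge> X0 \<Longrightarrow> (\<And>p. norm (G p :: complex) = b p) \<Longrightarrow>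
     norm ((\<Sum>p\<in>?P. G p * of_real (ln (real p))) * exp (\<Sum>p\<in>?P. G p) - (\<Sum>n\<in>{1..X}. expmult G n * of_real (ln (real n)))) \<le> 1"
  proof (rule expmult_ln_truncation[of ?P b])
    show "b p = 0" if "p \<notin> ?P" for p using F0[of p] that by (auto simp: b_def)
  qed (auto simp: b_def)
  \<comment> \<open>Large enough for \<open>AX\<close> to agree with the complete series up to 1.
    For t \<le> x the additional n exceed t and have Riesz weight 0, so the time side is still
    \<open>Npoly\<close>.\<close>
  define X where "X = max X0 (nat \<lfloor>x\<rfloor>)"
  define V where "V \<tau> = (\<Sum>p\<in>?P. Ft \<tau> p * of_real (ln (real p)))" for \<tau>
  define AX where "AX \<tau> = (\<Sum>n\<in>{1..X}. (expmult F n * of_real (ln (real n))) * of_nat n powr (- Complex \<sigma> \<tau>))" for \<tau>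
  define E where "E \<tau> = cmod (exp (vsum F (Complex (1 + \<alpha>) \<tau>) x))" for \<tau>
  have AXV: "norm (AX \<tau>) ^ 2 \<le> 2 * (norm (V \<tau>) ^ 2 * E \<tau> ^ 2) + 2" for \<tau>
  proof -
    have "AX \<tau> = (\<Sum>n\<in>{1..X}. expmult (Ft \<tau>) n * of_real (ln (real n)))"
      unfolding AX_def Ft_def by (intro sum.cong refl) (auto simp: expmult_powr_twist[symmetric])
    moreover have "(\<Sum>p\<in>?P. Ft \<tau> p) = vsum F (Complex (1 + \<alpha>) \<tau>) x" by (simp add: vsum_def Ft_def \<sigma>_def)
    ultimately have "norm (V \<tau> * exp (vsum F (Complex (1 + \<alpha>) \<tau>) x) - AX \<tau>) \<le> 1"
      using X0[where X = X and G = "Ft \<tau>"] nFt by (simp add: V_def X_def)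
    hence "norm (AX \<tau>) \<le> norm (V \<tau>) * E \<tau> + 1"
      using norm_triangle_ineq2[of "AX \<tau>" "V \<tau> * exp (vsum F (Complex (1 + \<alpha>) \<tau>) x)"]
      by (simp only: E_def norm_mult norm_minus_commute)
    hence "norm (AX \<tau>) ^ 2 \<le> (norm (V \<tau>) * E \<tau> + 1) ^ 2" by (rule power_mono) simp
    also have "\<dots> \<le> 2 * (norm (V \<tau>) * E \<tau>) ^ 2 + 2"
    proof -
      have "(u + 1)\<^sup>2 \<le> 2 * u\<^sup>2 + 2" for u :: real
      proof -
        have "(u + 1)\<^sup>2 + (u - 1)\<^sup>2 = 2 * u\<^sup>2 + 2" by (simp add: power2_eq_square algebra_simps)
        moreover have "r \<le> t" if "r + q = t" "q \<ge> 0" for r q t :: real using that by linarith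
        ultimately show ?thesis using zero_le_power2 by blast
      qed
      thus ?thesis .
    qed
    finally show ?thesis by (simp only: power_mult_distrib)
  qed
  obtain I where I1: "has_bochner_integral lborel (\<lambda>t. norm (\<Sum>n\<in>{1..X}. (expmult F n * of_real (ln (real n))) * of_real (riesz \<kappa> (real n) t)) ^ 2 * t powr (-1 - 2*\<sigma>)) I"
    and I2: "has_bochner_integral lborel (\<lambda>\<tau>. norm (AX \<tau>) ^ 2 * W \<tau>) I"
    using riesz_plancherel[OF s k, where X = X and a = "\<lambda>n. expmult F n * of_real (ln (real n))"] unfolding AX_def W_def by blast
  define \<Phi> where "\<Phi> t = norm (\<Sum>n\<in>{1..X}. (expmult F n * of_real (ln (real n))) * of_real (riesz \<kappa> (real n) t)) ^ 2 * t powr (-1 - 2*\<sigma>)" for t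
  have \<Phi>0: "\<Phi> t \<ge> 0" for t by (simp add: \<Phi>_def)
  have eqPhi: "indicator {1..x} t * (norm (Npoly F (sqrt T) x t) ^ 2 * t powr (-1 - 2 * (1 + \<alpha>))) = indicator {1..x} t * \<Phi> t" for t
  proof (cases "t \<in> {1..x}")
    case True
    have "(\<Sum>n\<in>{1..X}. (expmult F n * of_real (ln (real n))) * of_real (riesz \<kappa> (real n) t)) = Npoly F (sqrt T) x t"
      unfolding Npoly_def \<kappa>_def
    proof (rule sum.mono_neutral_right)
      show "{1..nat \<lfloor>x\<rfloor>} \<subseteq> {1..X}" by (auto simp: X_def)
      show "\<forall>n\<in>{1..X} - {1..nat \<lfloor>x\<rfloor>}. (expmult F n * of_real (ln (real n))) * of_real (riesz (sqrt T) (real n) t) = 0"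
      proof
        fix n assume "n \<in> {1..X} - {1..nat \<lfloor>x\<rfloor>}"
        hence "n > nat \<lfloor>x\<rfloor>" by auto
        hence "real n > x" by linarith
        hence "riesz (sqrt T) (real n) t = 0" using True by (simp add: riesz_def)
        thus "(expmult F n * of_real (ln (real n))) * of_real (riesz (sqrt T) (real n) t) = 0" by simp
      qed
    qed simp
    thus ?thesis by (simp add: \<Phi>_def \<sigma>_def)
  qed simp
  have Phi_int: "integrable lborel \<Phi>" "(LBINT t. \<Phi> t) = I" using I1 unfolding \<Phi>_def[symmetric] by (auto simp: has_bochner_integral_iff)
  have J1: "integrable lborel (\<lambda>t. indicator {1..x} t * \<Phi> t)"
    using integrable_mult_indicator[OF _ Phi_int(1), of "{1..x}"] by simp
  have JI: "(LBINT t. indicator {1..x} t * \<Phi> t) \<le> I"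
    unfolding Phi_int(2)[symmetric] by (rule integral_mono[OF J1 Phi_int(1)]) (simp add: indicator_def \<Phi>0)
  define cA where "cA = 14400 * pi * A\<^sup>2 / \<alpha>"
  have cA0: "cA \<ge> 0" using a by (simp add: cA_def pi_ge_zero)
  have Vms: "\<exists>J. has_bochner_integral lborel (\<lambda>\<tau>. norm (V \<tau>) ^ 2 * (1 / (B\<^sup>2 + (\<tau> - \<tau>0)\<^sup>2))) J \<and> J \<le> cA / B" if B: "B \<ge> 1" for B \<tau>0
  proof -
    have Veq: "V \<tau> = (\<Sum>p\<in>?P. (F p * of_real (ln (real p) * real p powr (-1 - \<alpha>))) * cis (- (\<tau> * ln (real p))))" for \<tau>
      unfolding V_def
    proof (intro sum.cong refl)
      fix p assume p: "p \<in> ?P"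
      hence p0: "p > 0" by (auto dest: prime_gt_0_nat)
      have "- \<sigma> = -1 - \<alpha>" by (simp add: \<sigma>_def)
      thus "Ft \<tau> p * of_real (ln (real p)) = (F p * of_real (ln (real p) * real p powr (-1 - \<alpha>))) * cis (- (\<tau> * ln (real p)))"
        unfolding Ft_def of_nat_powr_neg_Complex[OF p0] by simp
    qed
    have "\<exists>J. has_bochner_integral lborel (\<lambda>\<tau>. norm (\<Sum>p\<in>?P. (F p * of_real (ln (real p) * real p powr (-1 - \<alpha>))) * cis (- (\<tau> * ln (real p)))) ^ 2 * (1 / (B\<^sup>2 + (\<tau> - \<tau>0)\<^sup>2))) J
           \<and> J \<le> 14400 * pi * A\<^sup>2 / (B * \<alpha>)"
    proof (rule prime_polynomial_mean_square[OF a B])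
      fix p :: nat assume "prime p"
      hence "ln (real p) * real p powr (-1 - \<alpha>) \<ge> 0" by (auto dest: prime_ge_1_nat)
      thus "norm (F p * of_real (ln (real p) * real p powr (-1 - \<alpha>))) \<le> A * (ln (real p) * real p powr (-1 - \<alpha>))"
        unfolding norm_mult norm_of_real by (intro mult_mono F) (use A in auto)
    qed
    thus ?thesis unfolding Veq cA_def by (simp add: mult_ac)
  qed
  define Jw where "Jw \<tau>0 B = (LBINT \<tau>. norm (V \<tau>) ^ 2 * (1 / (B\<^sup>2 + (\<tau> - \<tau>0)\<^sup>2)))" for \<tau>0 B
  have Jw: "has_bochner_integral lborel (\<lambda>\<tau>. norm (V \<tau>) ^ 2 * (1 / (B\<^sup>2 + (\<tau> - \<tau>0)\<^sup>2))) (Jw \<tau>0 B)" "Jw \<tau>0 B \<le> cA / B"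
    if "B \<ge> 1" for B \<tau>0
    using Vms[OF that, of \<tau>0] by (auto simp: Jw_def has_bochner_integral_iff)
  let ?K = "{k::int. real_of_int \<bar>k\<bar> \<le> T}"
  define co where "co k = 1 / (real_of_int k ^ 2 + 1) * win_sup F x \<alpha> k" for k
  have co0: "co k \<ge> 0" for k unfolding co_def by (intro mult_nonneg_nonneg win_sup_nonneg) auto
  define ct where "ct = 4 * exp (2 * Zpow F x \<alpha>) / T"
  have ct0: "ct \<ge> 0" using T by (simp add: ct_def)
  have K1: "has_bochner_integral lborel (\<lambda>\<tau>. 1 / (1\<^sup>2 + \<tau>\<^sup>2)) (pi / 1)"
    using cauchy_kernel_integral[of 1] by (simp only: has_bochner_integral_iff zero_less_one simp_thms)
  \<comment> \<open>The first two groups are mean squares of V against Cauchy kernels. The last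
    summand comes from the truncation error and integrates to 1, the final term of the
    claim.\<close>
  have major: "has_bochner_integral lborel
     (\<lambda>\<tau>. 2 * ((\<Sum>k\<in>?K. co k * (norm (V \<tau>) ^ 2 * (1 / (1\<^sup>2 + (\<tau> - real_of_int k)\<^sup>2)))) + ct * (norm (V \<tau>) ^ 2 * (1 / (T\<^sup>2 + (\<tau> - 0)\<^sup>2)))) + 1 / pi * (1 / (1\<^sup>2 + \<tau>\<^sup>2)))
     (2 * ((\<Sum>k\<in>?K. co k * Jw (real_of_int k) 1) + ct * Jw 0 T) + 1 / pi * (pi / 1))"
    by (intro has_bochner_integral_add has_bochner_integral_mult_right has_bochner_integral_sum Jw K1) (use T in auto)
  have "I \<le> 2 * ((\<Sum>k\<in>?K. co k * Jw (real_of_int k) 1) + ct * Jw 0 T) + 1 / pi * (pi / 1)"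
  proof (rule has_bochner_integral_mono_le[OF I2 major])
    fix \<tau> :: real
    have W: "0 \<le> W \<tau>" "W \<tau> \<le> 1 / (1 + \<tau>\<^sup>2) / (2 * pi)" unfolding Weq by (rule riesz_weight_le[OF a(1) T])+
    have "norm (AX \<tau>) ^ 2 * W \<tau> \<le> (2 * (norm (V \<tau>) ^ 2 * E \<tau> ^ 2) + 2) * W \<tau>" by (rule mult_right_mono[OF AXV W(1)])
    also have "\<dots> = 2 * (norm (V \<tau>) ^ 2 * E \<tau> ^ 2 * W \<tau>) + 2 * W \<tau>" by (simp add: algebra_simps)
    finally have m1: "norm (AX \<tau>) ^ 2 * W \<tau> \<le> 2 * (norm (V \<tau>) ^ 2 * E \<tau> ^ 2 * W \<tau>) + 2 * W \<tau>" .
    have m2: "norm (V \<tau>) ^ 2 * E \<tau> ^ 2 * W \<tau> \<le> (\<Sum>k\<in>?K. co k * (norm (V \<tau>) ^ 2 * (1 / (1\<^sup>2 + (\<tau> - real_of_int k)\<^sup>2)))) + ct * (norm (V \<tau>) ^ 2 * (1 / (T\<^sup>2 + (\<tau> - 0)\<^sup>2)))"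
      unfolding E_def co_def ct_def Weq by (rule weighted_pointwise_le[OF a(1) T]) simp
    have "2 * W \<tau> \<le> 2 * (1 / (1 + \<tau>\<^sup>2) / (2 * pi))" using W(2) by (rule mult_left_mono) simp
    also have "\<dots> = 1 / pi * (1 / (1\<^sup>2 + \<tau>\<^sup>2))" by simp
    finally have m3: "2 * W \<tau> \<le> 1 / pi * (1 / (1\<^sup>2 + \<tau>\<^sup>2))" .
    have "a \<le> 2 * y + z" if "a \<le> 2 * x + w" "x \<le> y" "w \<le> z" for a x y z w :: real using that by argo
    from this[OF m1 m2 m3] show "norm (AX \<tau>) ^ 2 * W \<tau> \<le> 2 * ((\<Sum>k\<in>?K. co k * (norm (V \<tau>) ^ 2 * (1 / (1\<^sup>2 + (\<tau> - real_of_int k)\<^sup>2)))) + ct * (norm (V \<tau>) ^ 2 * (1 / (T\<^sup>2 + (\<tau> - 0)\<^sup>2)))) + 1 / pi * (1 / (1\<^sup>2 + \<tau>\<^sup>2))" .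
  qed
  also have "\<dots> \<le> 2 * ((\<Sum>k\<in>?K. co k * (cA / 1)) + ct * (cA / T)) + 1 / pi * (pi / 1)"
    by (intro add_mono mult_left_mono sum_mono Jw(2) co0 ct0) (use T in auto)
  also have "\<dots> = 2 * cA * ((\<Sum>k\<in>?K. co k) + 4 * exp (2 * Zpow F x \<alpha>) / T\<^sup>2) + 1"
  proof -
    have "(\<Sum>k\<in>?K. co k * (cA / 1)) = cA * (\<Sum>k\<in>?K. co k)" by (simp add: sum_distrib_left mult.commute)
    thus ?thesis by (simp add: ct_def power2_eq_square distrib_left mult_ac)
  qed
  also have "(\<Sum>k\<in>?K. co k) = HT F x T \<alpha> ^ 2" by (simp add: HT_sq co_def)
  finally have "I \<le> 2 * cA * (HT F x T \<alpha> ^ 2 + 4 * exp (2 * Zpow F x \<alpha>) / T\<^sup>2) + 1" .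
  hence "(LBINT t. indicator {1..x} t * \<Phi> t) \<le> 28800 * pi * A\<^sup>2 / \<alpha> * (HT F x T \<alpha> ^ 2 + 4 * exp (2 * Zpow F x \<alpha>) / T\<^sup>2) + 1"
    using JI by (simp add: cA_def)
  moreover have "has_bochner_integral lborel (\<lambda>t. indicator {1..x} t * \<Phi> t) (LBINT t. indicator {1..x} t * \<Phi> t)"
    using J1 by (simp only: has_bochner_integral_iff)
  ultimately show ?thesis unfolding eqPhi by blast
qed

lemma nn_integral_eq_of_has_bochner:
  fixes f :: "'a \<Rightarrow> real"
  assumes "has_bochner_integral M f a" "\<And>x. f x \<ge> 0"
  shows "(\<integral>\<^sup>+x. ennreal (f x) \<partial>M) = ennreal a"
  using assms by (subst nn_integral_eq_integral) (auto simp: has_bochner_integral_iff)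

lemma powr_minus_two_alpha_integral:
  fixes t a b :: real
  assumes "t > 1" "a \<le> b"
  shows "has_bochner_integral lborel (\<lambda>\<alpha>. t powr (-2*\<alpha>) * indicator {a..b} \<alpha>) ((t powr (-2*a) - t powr (-2*b)) / (2 * ln t))"
proof -
  have "has_bochner_integral lborel (\<lambda>\<alpha>. t powr (-2*\<alpha>) * indicator {a..b} \<alpha>) (- (t powr (-2*b) / (2 * ln t)) - - (t powr (-2*a) / (2 * ln t)))"
    by (rule has_bochner_integral_FTC_Icc_real)
       (use assms in \<open>auto intro!: derivative_eq_intros continuous_intros\<close>)
  thus ?thesis by (simp add: diff_divide_distrib)
qed

text \<open>Cauchy--Schwarz in the form \<open>2ab \<le> a\<^sup>2/U + U b\<^sup>2\<close>, with \<open>U\<close> the expected size.\<close>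

lemma Npoly_L1_le:
  fixes F :: "nat \<Rightarrow> complex"
  assumes A: "A > 0" and F: "\<And>p. norm (F p) \<le> A" and F0: "\<And>p. \<not> (prime p \<and> real p \<le> x) \<Longrightarrow> F p = 0"
    and a: "0 < \<alpha>" "\<alpha> \<le> 1" and T: "T \<ge> 1"
  shows "(\<integral>\<^sup>+t. ennreal (indicator {1..x} t * (norm (Npoly F (sqrt T) x t) * t powr (-2 - 2 * \<alpha>))) \<partial>lborel)
     \<le> ennreal ((28800 * pi * A\<^sup>2 + 1) * (HT F x T \<alpha> + 2 * exp (Zpow F x \<alpha>) / T + sqrt \<alpha>) / \<alpha>)"
proof -
  \<comment> \<open>The summand \<open>sqrt \<alpha>\<close> gives \<alpha> \<le> U^2, so that the
    additive 1 of the mean square bound is at most U^2/\<alpha>; it also makes U positive.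
    Integrated against 1/\<alpha> it contributes only O(1).\<close>
  define U where "U = HT F x T \<alpha> + 2 * exp (Zpow F x \<alpha>) / T + sqrt \<alpha>"
  define c where "c = 28800 * pi * A\<^sup>2"
  have c0: "c \<ge> 0" by (simp add: c_def pi_ge_zero)
  have H0: "HT F x T \<alpha> \<ge> 0" by (rule HT_nonneg)
  have E0: "2 * exp (Zpow F x \<alpha>) / T \<ge> 0" using T by simp
  have U0: "U > 0" unfolding U_def using H0 E0 a by (intro add_nonneg_pos add_nonneg_nonneg) auto
  obtain J where J: "has_bochner_integral lborel (\<lambda>t. indicator {1..x} t * (norm (Npoly F (sqrt T) x t) ^ 2 * t powr (-1 - 2 * (1 + \<alpha>)))) J"
    and Jle: "J \<le> c / \<alpha> * (HT F x T \<alpha> ^ 2 + 4 * exp (2 * Zpow F x \<alpha>) / T\<^sup>2) + 1"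
  proof -
    have "\<exists>J. has_bochner_integral lborel (\<lambda>t. indicator {1..x} t * (norm (Npoly F (sqrt T) x t) ^ 2 * t powr (-1 - 2 * (1 + \<alpha>)))) J
     \<and> J \<le> 28800 * pi * A\<^sup>2 / \<alpha> * (HT F x T \<alpha> ^ 2 + 4 * exp (2 * Zpow F x \<alpha>) / T\<^sup>2) + 1"
      by (rule Npoly_mean_square) (fact A F F0 a T)+
    thus ?thesis using that unfolding c_def by blast
  qed
  have U2: "HT F x T \<alpha> ^ 2 + 4 * exp (2 * Zpow F x \<alpha>) / T\<^sup>2 + \<alpha> \<le> U\<^sup>2"
  proof -
    have "4 * exp (2 * Zpow F x \<alpha>) / T\<^sup>2 = (2 * exp (Zpow F x \<alpha>) / T)\<^sup>2"
      by (simp add: power_divide power_mult_distrib exp_double)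
    moreover have "\<alpha> = (sqrt \<alpha>)\<^sup>2" using a by simp
    moreover have "h\<^sup>2 + e\<^sup>2 + s\<^sup>2 \<le> (h + e + s)\<^sup>2" if "h \<ge> 0" "e \<ge> 0" "s \<ge> 0" for h e s :: real
    proof -
      have "(h + e + s)\<^sup>2 = h\<^sup>2 + e\<^sup>2 + s\<^sup>2 + 2 * (h * e + h * s + e * s)" by (simp add: power2_eq_square algebra_simps)
      moreover have "h * e + h * s + e * s \<ge> 0" using that by (intro add_nonneg_nonneg mult_nonneg_nonneg) auto
      ultimately show ?thesis by simp
    qed
    ultimately show ?thesis unfolding U_def using H0 E0 a by (metis real_sqrt_ge_zero less_imp_le)
  qed
  have JU: "J \<le> (c + 1) * U\<^sup>2 / \<alpha>"
  proof -
    have "c / \<alpha> * (HT F x T \<alpha> ^ 2 + 4 * exp (2 * Zpow F x \<alpha>) / T\<^sup>2) \<le> c / \<alpha> * U\<^sup>2"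
      using U2 a c0 by (intro mult_left_mono) auto
    moreover have "\<alpha> \<le> U\<^sup>2" 
    proof -
      have "0 \<le> HT F x T \<alpha> ^ 2 + 4 * exp (2 * Zpow F x \<alpha>) / T\<^sup>2" by simp
      thus ?thesis using U2 by linarith
    qed
    hence "1 \<le> U\<^sup>2 / \<alpha>" using a by (simp add: field_simps)
    moreover have "(c + 1) * U\<^sup>2 / \<alpha> = c / \<alpha> * U\<^sup>2 + U\<^sup>2 / \<alpha>" by (simp add: add_divide_distrib distrib_right)
    ultimately show ?thesis using Jle by linarith
  qed
  have P: "has_bochner_integral lborel (\<lambda>t. indicator {1<..} t * t powr (-1 - 2*\<alpha>)) (1 powr (-(2*\<alpha>)) / (2*\<alpha>))"
    by (rule has_bochner_integral_powr_at_top) (use a in auto)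
  have B: "has_bochner_integral lborel (\<lambda>t. (1/2) * ((1/U) * (indicator {1..x} t * (norm (Npoly F (sqrt T) x t) ^ 2 * t powr (-1 - 2 * (1 + \<alpha>)))) + U * (indicator {1<..} t * t powr (-1 - 2*\<alpha>))))
     ((1/2) * ((1/U) * J + U * (1 powr (-(2*\<alpha>)) / (2*\<alpha>))))"
    by (intro has_bochner_integral_mult_right has_bochner_integral_add J P)
  have "(\<integral>\<^sup>+t. ennreal (indicator {1..x} t * (norm (Npoly F (sqrt T) x t) * t powr (-2 - 2 * \<alpha>))) \<partial>lborel)
     \<le> (\<integral>\<^sup>+t. ennreal ((1/2) * ((1/U) * (indicator {1..x} t * (norm (Npoly F (sqrt T) x t) ^ 2 * t powr (-1 - 2 * (1 + \<alpha>)))) + U * (indicator {1<..} t * t powr (-1 - 2*\<alpha>)))) \<partial>lborel)"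
  proof (rule nn_integral_mono, rule ennreal_leI)
    fix t :: real
    show "indicator {1..x} t * (norm (Npoly F (sqrt T) x t) * t powr (-2 - 2 * \<alpha>))
       \<le> (1/2) * ((1/U) * (indicator {1..x} t * (norm (Npoly F (sqrt T) x t) ^ 2 * t powr (-1 - 2 * (1 + \<alpha>)))) + U * (indicator {1<..} t * t powr (-1 - 2*\<alpha>)))"
    proof (cases "t \<in> {1<..x}")
      case True
      \<comment> \<open>The weight t^(-2-2\<alpha>) is split as u v so that u^2 is the weight of the
        mean square and v^2 = t^(-1-2\<alpha>) integrates to 1/(2\<alpha>) over t > 1.\<close>
      define u where "u = t powr (-3/2 - \<alpha>)"
      define v where "v = t powr (-1/2 - \<alpha>)"
      define n where "n = norm (Npoly F (sqrt T) x t)"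
      have e: "t powr (-2 - 2*\<alpha>) = u * v" "t powr (-1 - 2*(1+\<alpha>)) = u * u" "t powr (-1 - 2*\<alpha>) = v * v"
        unfolding u_def v_def by (simp_all add: powr_add[symmetric])
      have "2 * ((n * u) * (U * v)) \<le> (n * u)\<^sup>2 + (U * v)\<^sup>2" using sum_squares_bound[of "n * u" "U * v"] by (simp add: mult.assoc)
      hence "2 * ((n * u) * (U * v)) / U \<le> ((n * u)\<^sup>2 + (U * v)\<^sup>2) / U" using U0 by (intro divide_right_mono) auto
      moreover have "2 * ((n * u) * (U * v)) / U = 2 * (n * (u * v))" using U0 by simp
      moreover have "((n * u)\<^sup>2 + (U * v)\<^sup>2) / U = (1/U) * (n\<^sup>2 * (u * u)) + U * (v * v)"
        using U0 by (simp add: add_divide_distrib power2_eq_square)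
      ultimately have "n * (u * v) \<le> (1/2) * ((1/U) * (n\<^sup>2 * (u * u)) + U * (v * v))" by argo
      thus ?thesis using True unfolding e n_def by simp
    next
      case False
      show ?thesis
      proof (cases "t = 1")
        case True
        \<comment> \<open>The comparison function lives on t > 1 while the left side includes t = 1;
          there all Riesz weights with n \<ge> 1 vanish.\<close>
        have "Npoly F (sqrt T) x 1 = 0" unfolding Npoly_def by (rule sum.neutral) (auto simp: riesz_def)
        thus ?thesis using True U0 by simp
      next
        case F2: False
        hence "indicator {1..x} t = (0::real)" using False by (auto simp: indicator_def)
        thus ?thesis using U0 by simp
      qed
    qed
  qed
  also have "\<dots> = ennreal ((1/2) * ((1/U) * J + U * (1 powr (-(2*\<alpha>)) / (2*\<alpha>))))"
    by (rule nn_integral_eq_of_has_bochner[OF B]) (use U0 in \<open>auto intro!: add_nonneg_nonneg mult_nonneg_nonneg\<close>)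
  also have "\<dots> \<le> ennreal ((c + 1) * U / \<alpha>)"
  proof (rule ennreal_leI)
    have "(1/U) * J \<le> (1/U) * ((c + 1) * U\<^sup>2 / \<alpha>)" using U0 JU by (intro mult_left_mono) auto
    also have "\<dots> = (c + 1) * (U / \<alpha>)" using U0 by (simp add: power2_eq_square)
    finally have 1: "(1/U) * J \<le> (c + 1) * (U / \<alpha>)" .
    have 2: "U * (1 powr (-(2*\<alpha>)) / (2*\<alpha>)) = (1/2) * (U / \<alpha>)" by simp
    have 3: "U / \<alpha> \<ge> 0" "c * (U / \<alpha>) \<ge> 0" using U0 a c0 by auto
    have 4: "(c + 1) * (U / \<alpha>) = c * (U / \<alpha>) + U / \<alpha>" by (simp only: distrib_right mult_1_left)
    have "(1/2) * ((1/U) * J + U * (1 powr (-(2*\<alpha>)) / (2*\<alpha>))) \<le> (c + 1) * (U / \<alpha>)"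
      using 1 3 unfolding 2 4 by argo
    thus "(1/2) * ((1/U) * J + U * (1 powr (-(2*\<alpha>)) / (2*\<alpha>))) \<le> (c + 1) * U / \<alpha>" by simp
  qed
  finally show ?thesis by (simp only: U_def c_def)
qed

section \<open>Continuity of H_T in \<alpha>\<close>

lemma continuous_on_Zpow: "continuous_on S (Zpow F x)"
  unfolding Zpow_def[abs_def] by (intro continuous_intros) (auto dest: prime_gt_0_nat)

text \<open>Functions that are uniformly close on K have suprema at least as close; halving e turns
  the weak inequality of the hypothesis into the strict one of continuity.\<close>

lemma isCont_SUP_Icc:
  fixes h :: "real \<Rightarrow> real \<Rightarrow> real"
  assumes bdd: "\<And>s. s \<in> S \<Longrightarrow> bdd_above (h s ` K)" and K: "K \<noteq> {}"
    and unif: "\<And>e s. s \<in> S \<Longrightarrow> e > 0 \<Longrightarrow> \<exists>d>0. \<forall>s'\<in>S. dist s' s < d \<longrightarrow> (\<forall>\<tau>\<in>K. \<bar>h s' \<tau> - h s \<tau>\<bar> \<le> e)"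
  shows "continuous_on S (\<lambda>s. SUP \<tau>\<in>K. h s \<tau>)"
  unfolding continuous_on_iff
proof (intro ballI allI impI)
  fix s and e :: real assume s: "s \<in> S" and e: "e > 0"
  obtain d where d: "d > 0" "\<And>s' \<tau>. s' \<in> S \<Longrightarrow> dist s' s < d \<Longrightarrow> \<tau> \<in> K \<Longrightarrow> \<bar>h s' \<tau> - h s \<tau>\<bar> \<le> e / 2"
    using unif[OF s, of "e/2"] e by auto
  show "\<exists>d>0. \<forall>s'\<in>S. dist s' s < d \<longrightarrow> dist (SUP \<tau>\<in>K. h s' \<tau>) (SUP \<tau>\<in>K. h s \<tau>) < e"
  proof (intro exI[of _ d] conjI d(1) ballI impI)
    fix s' assume s': "s' \<in> S" "dist s' s < d"
    have "(SUP \<tau>\<in>K. h s' \<tau>) \<le> (SUP \<tau>\<in>K. h s \<tau>) + e / 2"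
    proof (rule cSUP_least[OF K])
      fix \<tau> assume t: "\<tau> \<in> K"
      have "h s \<tau> \<le> (SUP \<tau>\<in>K. h s \<tau>)" by (rule cSUP_upper[OF t bdd[OF s]])
      thus "h s' \<tau> \<le> (SUP \<tau>\<in>K. h s \<tau>) + e / 2" using d(2)[OF s' t] by linarith
    qed
    moreover have "(SUP \<tau>\<in>K. h s \<tau>) \<le> (SUP \<tau>\<in>K. h s' \<tau>) + e / 2"
    proof (rule cSUP_least[OF K])
      fix \<tau> assume t: "\<tau> \<in> K"
      have "h s' \<tau> \<le> (SUP \<tau>\<in>K. h s' \<tau>)" by (rule cSUP_upper[OF t bdd[OF s'(1)]])
      thus "h s \<tau> \<le> (SUP \<tau>\<in>K. h s' \<tau>) + e / 2" using d(2)[OF s' t] by linarith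
    qed
    ultimately show "dist (SUP \<tau>\<in>K. h s' \<tau>) (SUP \<tau>\<in>K. h s \<tau>) < e"
      using e by (simp add: dist_real_def abs_less_iff)
  qed
qed

lemma continuous_on_win_sup: "continuous_on {0..1} (\<lambda>\<alpha>. win_sup F x \<alpha> k)"
proof -
  define K where "K = {real_of_int k - 1/2 .. real_of_int k + 1/2}"
  define h where "h \<alpha> \<tau> = cmod (exp (vsum F (Complex (1 + \<alpha>) \<tau>) x)) ^ 2" for \<alpha> \<tau>
  have cont: "continuous_on ({0..1} \<times> K) (\<lambda>z. h (fst z) (snd z))"
    unfolding h_def vsum_eq by (intro continuous_intros) (auto dest: prime_gt_0_nat)
  have "compact ({0..1::real} \<times> K)" unfolding K_def by (intro compact_Times compact_Icc)
  hence uc: "uniformly_continuous_on ({0..1} \<times> K) (\<lambda>z. h (fst z) (snd z))"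
    using cont compact_uniformly_continuous by blast
  have "continuous_on {0..1} (\<lambda>\<alpha>. SUP \<tau>\<in>K. h \<alpha> \<tau>)"
  proof (rule isCont_SUP_Icc)
    show "bdd_above (h \<alpha> ` K)" for \<alpha> unfolding h_def by (rule bdd_aboveI2) (rule exp_vsum_le)
    show "K \<noteq> {}" by (simp add: K_def)
  next
    fix e s :: real assume s: "s \<in> {0..1}" and e: "e > 0"
    obtain d where d: "d > 0" "\<And>z z'. z \<in> {0..1} \<times> K \<Longrightarrow> z' \<in> {0..1} \<times> K \<Longrightarrow> dist z' z < d \<Longrightarrow> dist (h (fst z') (snd z')) (h (fst z) (snd z)) < e"
      using uc e unfolding uniformly_continuous_on_def by blast
    have "\<bar>h s' \<tau> - h s \<tau>\<bar> \<le> e" if "s' \<in> {0..1}" "dist s' s < d" "\<tau> \<in> K" for s' \<tau>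
      using d(2)[of "(s, \<tau>)" "(s', \<tau>)"] that s by (simp add: dist_Pair_Pair dist_real_def)
    thus "\<exists>d>0. \<forall>s'\<in>{0..1}. dist s' s < d \<longrightarrow> (\<forall>\<tau>\<in>K. \<bar>h s' \<tau> - h s \<tau>\<bar> \<le> e)" using d(1) by blast
  qed
  thus ?thesis by (simp only: win_sup_def h_def K_def)
qed

text \<open>Makes the integrand H_T(\<alpha>)/\<alpha> integrable on {1 / ln x..1}; on a
  non-integrable function \<open>integral\<close> would only return its default value. Including
  \<alpha> = 0 gives a compact domain independent of x.\<close>

lemma continuous_on_HT: "continuous_on {0..1} (HT F x T)"
proof -
  have "HT F x T = (\<lambda>\<alpha>. sqrt (\<Sum>k | real_of_int \<bar>k\<bar> \<le> T. 1 / (real_of_int k ^ 2 + 1) * win_sup F x \<alpha> k))"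
    by (simp add: HT_def[abs_def] win_sup_def)
  moreover have "continuous_on {0..1} \<dots>"
    by (intro continuous_on_real_sqrt continuous_on_sum continuous_on_mult continuous_on_const continuous_on_win_sup)
  ultimately show ?thesis by simp
qed

section \<open>Partial summation and opening of the factor 1 / log t\<close>

lemma has_bochner_integral_powr_Icc:
  fixes a b c :: real
  assumes "0 < a" "a \<le> b" "c > 0"
  shows "has_bochner_integral lborel (\<lambda>t. t powr (-1 - c) * indicator {a..b} t) ((a powr (-c) - b powr (-c)) / c)"
proof -
  have "has_bochner_integral lborel (\<lambda>t. t powr (-1 - c) * indicator {a..b} t) (- (b powr (-c) / c) - - (a powr (-c) / c))"
  proof (rule has_bochner_integral_FTC_Icc_real[OF assms(2)])
    fix t assume t: "a \<le> t" "t \<le> b"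
    hence t0: "t > 0" using assms by simp
    have "((\<lambda>t. - (t powr (-c) / c)) has_real_derivative - ((-c) * t powr (-c - 1) / c)) (at t)"
      using t0 assms by (auto intro!: derivative_eq_intros)
    moreover have "- ((-c) * t powr (-c - 1) / c) = t powr (-1 - c)"
    proof -
      have e: "-c - 1 = -1 - c" by simp
      show ?thesis unfolding e using assms by simp
    qed
    ultimately show "((\<lambda>t. - (t powr (-c) / c)) has_real_derivative t powr (-1 - c)) (at t)" by simp
    show "isCont (\<lambda>t. t powr (-1 - c)) t" using t0 by (intro continuous_intros) auto
  qed
  thus ?thesis by (simp add: diff_divide_distrib)
qed

lemma nn_integral_powr_Icc_le:
  fixes a b c :: real
  assumes "0 < a" "c > 0"
  shows "(\<integral>\<^sup>+t. ennreal (t powr (-1 - c) * indicator {a..b} t) \<partial>lborel) \<le> ennreal (a powr (-c) / c)"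
proof (cases "a \<le> b")
  case True
  have "(\<integral>\<^sup>+t. ennreal (t powr (-1 - c) * indicator {a..b} t) \<partial>lborel) = ennreal ((a powr (-c) - b powr (-c)) / c)"
    by (rule nn_integral_eq_of_has_bochner[OF has_bochner_integral_powr_Icc[OF assms(1) True assms(2)]]) simp
  also have "\<dots> \<le> ennreal (a powr (-c) / c)" using assms by (intro ennreal_leI divide_right_mono) auto
  finally show ?thesis .
qed simp

text \<open>For n \<ge> 2 write 1 = ln n / ln t + ln n (1/ln n - 1/ln t), the bracket being the
  integral of 1/(u (ln u)^2) from n to t. The term n = 1 is kept apart because ln 1 = 0 loses
  it.\<close>

lemma Msum_partial_summation:
  fixes g :: "nat \<Rightarrow> complex"
  assumes t: "t \<ge> 2"
  defines "N \<equiv> (\<lambda>u. Msum u (\<lambda>n. g n * of_real (ln (real n))))"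
  shows "norm (Msum t g) \<le> norm (g 1) + norm (N t) / ln t + (LBINT u. indicator {2..t} u * (norm (N u) / (u * (ln u)\<^sup>2)))"
    and "integrable lborel (\<lambda>u. indicator {2..t} u * (norm (N u) / (u * (ln u)\<^sup>2)))"
proof -
  let ?S = "{n. 2 \<le> n \<and> real n \<le> t}"
  define w where "w u = 1 / (u * (ln u)\<^sup>2)" for u :: real
  have lnt: "ln t > 0" using t by simp
  have finS: "finite ?S" by (rule finite_subset[OF _ finite_nat_le_real(2)[of t]]) auto
  have FTC: "has_bochner_integral lborel (\<lambda>u. w u * indicator {real n..t} u) (- (1 / ln t) - - (1 / ln (real n)))" if n: "n \<in> ?S" for n
  proof (rule has_bochner_integral_FTC_Icc_real)
    show "real n \<le> t" using n by simp
    fix u assume u: "real n \<le> u" "u \<le> t"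
    hence u1: "u > 1" using n by auto
    have "((\<lambda>u. - (1 / ln u)) has_real_derivative - (- (1 / u) / (ln u * ln u))) (at u)"
      using u1 by (auto intro!: derivative_eq_intros)
    moreover have "- (- (1 / u) / (ln u * ln u)) = w u" by (simp add: w_def power2_eq_square)
    ultimately show "((\<lambda>u. - (1 / ln u)) has_real_derivative w u) (at u)" by simp
    show "isCont w u" unfolding w_def[abs_def] using u1 by (intro continuous_intros) auto
  qed
  have B: "has_bochner_integral lborel (\<lambda>u. \<Sum>n\<in>?S. (g n * of_real (ln (real n))) * of_real (w u * indicator {real n..t} u))
     (\<Sum>n\<in>?S. (g n * of_real (ln (real n))) * of_real (- (1 / ln t) - - (1 / ln (real n))))"
    by (intro has_bochner_integral_sum has_bochner_integral_mult_right has_bochner_integral_of_real FTC)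
  have NS: "N u = (\<Sum>n | 2 \<le> n \<and> real n \<le> u. g n * of_real (ln (real n)))" if "u \<ge> 0" for u
  proof -
    have "N u = (\<Sum>n | 1 \<le> n \<and> real n \<le> u. g n * of_real (ln (real n)))" unfolding N_def by (rule Msum_eq[OF that])
    also have "\<dots> = (\<Sum>n | 2 \<le> n \<and> real n \<le> u. g n * of_real (ln (real n)))"
    proof (rule sum.mono_neutral_right)
      show "\<forall>n\<in>{n. 1 \<le> n \<and> real n \<le> u} - {n. 2 \<le> n \<and> real n \<le> u}. g n * of_real (ln (real n)) = 0"
      proof
        fix n assume "n \<in> {n. 1 \<le> n \<and> real n \<le> u} - {n. 2 \<le> n \<and> real n \<le> u}"
        hence "n = 1" by auto
        thus "g n * of_real (ln (real n)) = 0" by simp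
      qed
    qed auto
    finally show ?thesis .
  qed
  have eqf: "(\<Sum>n\<in>?S. (g n * of_real (ln (real n))) * of_real (w u * indicator {real n..t} u)) = of_real (indicator {2..t} u * w u) * N u" for u
  proof (cases "u \<in> {2..t}")
    case True
    have "(\<Sum>n\<in>?S. (g n * of_real (ln (real n))) * of_real (w u * indicator {real n..t} u))
      = (\<Sum>n\<in>?S. if real n \<le> u then of_real (w u) * (g n * of_real (ln (real n))) else 0)"
      by (rule sum.cong[OF refl]) (use True in auto)
    also have "\<dots> = (\<Sum>n\<in>{n\<in>?S. real n \<le> u}. of_real (w u) * (g n * of_real (ln (real n))))" by (rule sum.inter_filter[symmetric, OF finS])
    also have "{n\<in>?S. real n \<le> u} = {n. 2 \<le> n \<and> real n \<le> u}" using True by auto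
    finally show ?thesis using True by (simp add: NS sum_distrib_left)
  next
    case False
    have "indicator {real n..t} u = (0::real)" if "n \<in> ?S" for n using that False by (auto simp: indicator_def)
    hence "(\<Sum>n\<in>?S. (g n * of_real (ln (real n))) * of_real (w u * indicator {real n..t} u)) = 0" by (intro sum.neutral) simp
    thus ?thesis using False by simp
  qed
  have I: "integrable lborel (\<lambda>u. of_real (indicator {2..t} u * w u) * N u)"
    and L: "(LBINT u. of_real (indicator {2..t} u * w u) * N u) = (\<Sum>n\<in>?S. (g n * of_real (ln (real n))) * of_real (- (1 / ln t) - - (1 / ln (real n))))"
    using B unfolding eqf by (auto simp: has_bochner_integral_iff)
  have normeq: "norm (of_real (indicator {2..t} u * w u) * N u) = indicator {2..t} u * (norm (N u) / (u * (ln u)\<^sup>2))" for u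
  proof (cases "u \<in> {2..t}")
    case True
    hence "w u \<ge> 0" by (simp add: w_def)
    thus ?thesis using True unfolding norm_mult norm_of_real by (simp add: w_def)
  qed simp
  show i2: "integrable lborel (\<lambda>u. indicator {2..t} u * (norm (N u) / (u * (ln u)\<^sup>2)))"
    using integrable_norm[OF I] unfolding normeq .
  have "Msum t g = g 1 + (\<Sum>n\<in>?S. g n)"
  proof -
    have "{n. 1 \<le> n \<and> real n \<le> t} = insert 1 ?S" using t by auto
    thus ?thesis using t finS by (simp add: Msum_eq)
  qed
  also have "(\<Sum>n\<in>?S. g n) = (\<Sum>n\<in>?S. (g n * of_real (ln (real n))) * of_real (1 / ln t) + (g n * of_real (ln (real n))) * of_real (- (1 / ln t) - - (1 / ln (real n))))"
  proof (rule sum.cong[OF refl])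
    fix n assume "n \<in> ?S"
    hence "ln (real n) \<noteq> 0" by auto
    hence "ln (real n) * (1 / ln t) + ln (real n) * (- (1 / ln t) - - (1 / ln (real n))) = 1" by (simp add: algebra_simps)
    hence "of_real (ln (real n)) * of_real (1 / ln t) + of_real (ln (real n)) * of_real (- (1 / ln t) - - (1 / ln (real n))) = (1 :: complex)"
      by (simp only: of_real_mult[symmetric] of_real_add[symmetric] of_real_1)
    thus "g n = (g n * of_real (ln (real n))) * of_real (1 / ln t) + (g n * of_real (ln (real n))) * of_real (- (1 / ln t) - - (1 / ln (real n)))"
      by (simp only: mult.assoc distrib_left[symmetric] mult_1_right)
  qed
  also have "\<dots> = N t * of_real (1 / ln t) + (LBINT u. of_real (indicator {2..t} u * w u) * N u)"
  proof -
    have "N t = (\<Sum>n\<in>?S. g n * of_real (ln (real n)))" using t by (intro NS) simp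
    thus ?thesis by (simp only: sum.distrib L sum_distrib_right)
  qed
  finally have M: "Msum t g = g 1 + (N t * of_real (1 / ln t) + (LBINT u. of_real (indicator {2..t} u * w u) * N u))" .
  have 1: "norm (Msum t g) \<le> norm (g 1) + (norm (N t * of_real (1 / ln t)) + norm (LBINT u. of_real (indicator {2..t} u * w u) * N u))"
    unfolding M by (intro order_trans[OF norm_triangle_ineq] add_left_mono norm_triangle_ineq)
  have 2: "norm (N t * of_real (1 / ln t)) = norm (N t) / ln t" unfolding norm_mult norm_of_real using lnt by simp
  have 3: "norm (LBINT u. of_real (indicator {2..t} u * w u) * N u) \<le> (LBINT u. indicator {2..t} u * (norm (N u) / (u * (ln u)\<^sup>2)))"
    unfolding normeq[symmetric] by (rule integral_norm_bound)
  show "norm (Msum t g) \<le> norm (g 1) + norm (N t) / ln t + (LBINT u. indicator {2..t} u * (norm (N u) / (u * (ln u)\<^sup>2)))"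
    using 1 2 3 by linarith
qed

text \<open>Partial summation is integrated against t^(-2). By Tonelli the double integral reduces
  to the single one, since t^(-2) over t \<ge> u integrates to at most 1/u and 1/ln u \<le> 2; this
  gives 1 + 2 = 3 copies. The constant 2 covers t in [1, 2] and the term g(1).\<close>

lemma Mint_le_log_weighted:
  fixes g :: "nat \<Rightarrow> complex"
  assumes g1: "norm (g 1) \<le> 1"
  defines "N \<equiv> (\<lambda>u. Msum u (\<lambda>n. g n * of_real (ln (real n))))"
  shows "ennreal (Mint g x) \<le> 2 + 3 * (\<integral>\<^sup>+t. ennreal (indicator {2..x} t * (norm (N t) * t powr (-2) / ln t)) \<partial>lborel)"
proof -
  define q where "q u = norm (N u) / (u * (ln u)\<^sup>2)" for u :: real
  define D where "D = (\<integral>\<^sup>+t. ennreal (indicator {2..x} t * (norm (N t) * t powr (-2) / ln t)) \<partial>lborel)"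
  have Nap: "Msum u (\<lambda>n. g n * of_real (ln (real n))) = N u" for u by (simp add: N_def)
  have [measurable]: "N \<in> borel_measurable borel" unfolding N_def by (rule Msum_measurable)
  have [measurable]: "q \<in> borel_measurable borel" unfolding q_def[abs_def] by measurable
  have [measurable]: "(\<lambda>t::real. t powr (-2)) \<in> borel_measurable borel" by (rule powr_const_measurable)
  have q0: "u \<ge> 1 \<Longrightarrow> q u \<ge> 0" for u by (simp add: q_def)
  define K where "K t u = ennreal (indicator {2..x} t * t powr (-2) * (indicator {2..t} u * q u))" for t u
  have Km: "case_prod K \<in> borel_measurable (lborel \<Otimes>\<^sub>M lborel)"
  proof -
    have "case_prod K = (\<lambda>z. ennreal (indicator {2..x} (fst z) * fst z powr (-2) * ((if 2 \<le> snd z \<and> snd z \<le> fst z then 1 else 0) * q (snd z))))"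
      by (auto simp: K_def fun_eq_iff indicator_def)
    also have "\<dots> \<in> borel_measurable (lborel \<Otimes>\<^sub>M lborel)" by measurable
    finally show ?thesis .
  qed
  have pt: "ennreal (indicator {1..x} t * (norm (Msum t g) * t powr (-2)))
     \<le> ennreal (indicator {1..2} t) + (ennreal (t powr (-1-1) * indicator {1..x} t) + (ennreal (indicator {2..x} t * (norm (N t) * t powr (-2) / ln t))
        + (\<integral>\<^sup>+u. ennreal (indicator {2..x} t * t powr (-2) * (indicator {2..t} u * q u)) \<partial>lborel)))" (is "?l \<le> ?a + (?b + (?c + ?d))") for t
  proof (cases "t \<in> {2..x}")
    case True
    note ps = Msum_partial_summation[of t g, unfolded Nap]
    have t2: "t \<ge> 2" using True by simp
    define Q where "Q = (LBINT u. indicator {2..t} u * q u)"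
    have nnQ: "(\<integral>\<^sup>+u. ennreal (t powr (-2) * (indicator {2..t} u * q u)) \<partial>lborel) = ennreal (t powr (-2) * Q)"
    proof (rule nn_integral_eq_of_has_bochner)
      show "has_bochner_integral lborel (\<lambda>u. t powr (-2) * (indicator {2..t} u * q u)) (t powr (-2) * Q)"
        using ps(2)[OF t2] unfolding Q_def q_def by (intro has_bochner_integral_mult_right) (simp only: has_bochner_integral_iff)
      show "0 \<le> t powr (-2) * (indicator {2..t} u * q u)" for u using q0[of u] by (cases "u \<in> {2..t}") auto
    qed
    have Q0: "Q \<ge> 0" unfolding Q_def by (intro Bochner_Integration.integral_nonneg) (use q0 in \<open>auto simp: indicator_def\<close>)
    have "norm (Msum t g) * t powr (-2) \<le> (1 + norm (N t) / ln t + Q) * t powr (-2)"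
      using ps(1)[OF t2] g1 unfolding Q_def q_def by (intro mult_right_mono) auto
    also have "\<dots> = t powr (-2) + (norm (N t) * t powr (-2) / ln t + t powr (-2) * Q)" by (simp add: algebra_simps)
    finally have "ennreal (norm (Msum t g) * t powr (-2)) \<le> ennreal (t powr (-2) + (norm (N t) * t powr (-2) / ln t + t powr (-2) * Q))"
      by (rule ennreal_leI)
    also have "\<dots> = ennreal (t powr (-2)) + (ennreal (norm (N t) * t powr (-2) / ln t) + ennreal (t powr (-2) * Q))"
      using t2 Q0 by (simp add: ennreal_plus)
    also have "ennreal (t powr (-2) * Q) = ?d" unfolding nnQ[symmetric] using True by simp
    finally have "?l \<le> ?b + (?c + ?d)" using True by simp
    thus ?thesis by (rule order_trans) (rule add_increasing, simp_all)
  next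
    case False
    show ?thesis
    proof (cases "t \<in> {1..x}")
      case True
      hence t: "1 \<le> t" "t < 2" using False by auto
      hence "nat \<lfloor>t\<rfloor> = 1" by linarith
      hence "Msum t g = g 1" by (simp add: Msum_def)
      moreover have "t powr (-2) \<le> t powr 0" using t by (intro powr_mono) auto
      ultimately have "norm (Msum t g) * t powr (-2) \<le> 1 * 1" using g1 t by (intro mult_mono) auto
      hence "?l \<le> ?a" using True t by (simp add: ennreal_le_1)
      thus ?thesis by (rule order_trans) simp
    qed simp
  qed
  have "ennreal (Mint g x) = (\<integral>\<^sup>+t. ennreal (indicator {1..x} t * (norm (Msum t g) * t powr (-2))) \<partial>lborel)"
    unfolding Mint_def by (rule nn_integral_eq_integral[symmetric]) (auto intro: Mint_integrable)
  also have "\<dots> \<le> (\<integral>\<^sup>+t. ennreal (indicator {1..2} t) + (ennreal (t powr (-1-1) * indicator {1..x} t) + (ennreal (indicator {2..x} t * (norm (N t) * t powr (-2) / ln t))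
        + (\<integral>\<^sup>+u. ennreal (indicator {2..x} t * t powr (-2) * (indicator {2..t} u * q u)) \<partial>lborel))) \<partial>lborel)"
    by (rule nn_integral_mono) (rule pt)
  also have "\<dots> = (\<integral>\<^sup>+t. ennreal (indicator {1..2::real} t) \<partial>lborel) + ((\<integral>\<^sup>+t. ennreal (t powr (-1-1) * indicator {1..x} t) \<partial>lborel) + (D
        + (\<integral>\<^sup>+t. \<integral>\<^sup>+u. ennreal (indicator {2..x} t * t powr (-2) * (indicator {2..t} u * q u)) \<partial>lborel \<partial>lborel)))"
  proof -
    have ma: "(\<lambda>t::real. ennreal (indicator {1..2} t)) \<in> borel_measurable lborel" by measurable
    have mb: "(\<lambda>t. ennreal (t powr (-1-1) * indicator {1..x} t)) \<in> borel_measurable lborel"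
      using powr_const_measurable[of "-1-1"] by simp
    have mc: "(\<lambda>t. ennreal (indicator {2..x} t * (norm (N t) * t powr (-2) / ln t))) \<in> borel_measurable lborel" by measurable
    have md: "(\<lambda>t. \<integral>\<^sup>+u. ennreal (indicator {2..x} t * t powr (-2) * (indicator {2..t} u * q u)) \<partial>lborel) \<in> borel_measurable lborel"
      using lborel.borel_measurable_nn_integral[OF Km] by (simp only: K_def)
    show ?thesis unfolding D_def
      by (subst nn_integral_add[OF ma borel_measurable_add[OF mb borel_measurable_add[OF mc md]]],
          subst nn_integral_add[OF mb borel_measurable_add[OF mc md]], subst nn_integral_add[OF mc md]) (rule refl)
  qed
  also have "\<dots> \<le> 1 + (1 + (D + 2 * D))"
  proof (intro add_mono order_refl)
    have "(\<integral>\<^sup>+t. ennreal (indicator {1..2::real} t) \<partial>lborel) = emeasure lborel {1..2::real}" by (simp add: ennreal_indicator)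
    thus "(\<integral>\<^sup>+t. ennreal (indicator {1..2::real} t) \<partial>lborel) \<le> 1" by simp
    show "(\<integral>\<^sup>+t. ennreal (t powr (-1-1) * indicator {1..x} t) \<partial>lborel) \<le> 1"
      using nn_integral_powr_Icc_le[of 1 1 x] by simp
    have "(\<integral>\<^sup>+t. \<integral>\<^sup>+u. K t u \<partial>lborel \<partial>lborel) = (\<integral>\<^sup>+u. \<integral>\<^sup>+t. K t u \<partial>lborel \<partial>lborel)"
      by (rule lborel_pair.Fubini'[symmetric, OF Km])
    also have "\<dots> \<le> (\<integral>\<^sup>+u. 2 * ennreal (indicator {2..x} u * (norm (N u) * u powr (-2) / ln u)) \<partial>lborel)"
    proof (rule nn_integral_mono)
      fix u :: real
      show "(\<integral>\<^sup>+t. K t u \<partial>lborel) \<le> 2 * ennreal (indicator {2..x} u * (norm (N u) * u powr (-2) / ln u))"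
      proof (cases "u \<in> {2..x}")
        case True
        have u: "u \<ge> 2" "u \<le> x" using True by auto
        have lnu: "ln u \<ge> 1/2" using ln_2_ge_half ln_mono[of 2 u] u by linarith
        have "(\<integral>\<^sup>+t. K t u \<partial>lborel) = (\<integral>\<^sup>+t. ennreal (q u) * ennreal (t powr (-1-1) * indicator {u..x} t) \<partial>lborel)"
        proof (rule nn_integral_cong)
          fix t :: real
          have "indicator {2..x} t * t powr (-2) * (indicator {2..t} u * q u) = q u * (t powr (-1-1) * indicator {u..x} t)"
            using u by (auto simp: indicator_def)
          hence "K t u = ennreal (q u * (t powr (-1-1) * indicator {u..x} t))" by (simp only: K_def)
          also have "\<dots> = ennreal (q u) * ennreal (t powr (-1-1) * indicator {u..x} t)"
            by (rule ennreal_mult) (use q0[of u] u in auto)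
          finally show "K t u = ennreal (q u) * ennreal (t powr (-1-1) * indicator {u..x} t)" .
        qed
        also have "\<dots> = ennreal (q u) * (\<integral>\<^sup>+t. ennreal (t powr (-1-1) * indicator {u..x} t) \<partial>lborel)"
          using powr_const_measurable[of "-1-1"] by (intro nn_integral_cmult) simp
        also have "\<dots> \<le> ennreal (q u) * ennreal (u powr (-1) / 1)"
          using nn_integral_powr_Icc_le[of u 1 x] u by (intro mult_left_mono) auto
        also have "\<dots> = ennreal (q u * u powr (-1))"
        proof -
          have "ennreal (q u * u powr (-1)) = ennreal (q u) * ennreal (u powr (-1))" by (rule ennreal_mult) (use q0[of u] u in auto)
          thus ?thesis by simp
        qed
        also have "\<dots> \<le> ennreal (2 * (norm (N u) * u powr (-2) / ln u))"
        proof (rule ennreal_leI)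
          have "u powr (-2) = 1 / u * (1 / u)" "u powr (-1) = 1 / u" using u by (simp_all add: powr_minus_divide power2_eq_square)
          hence e1: "q u * u powr (-1) = (norm (N u) * u powr (-2) / ln u) * (1 / ln u)"
            by (simp add: q_def power2_eq_square)
          have "1 / ln u \<le> 2" using lnu by (simp add: divide_le_eq)
          hence "(norm (N u) * u powr (-2) / ln u) * (1 / ln u) \<le> (norm (N u) * u powr (-2) / ln u) * 2"
            using lnu by (intro mult_left_mono) auto
          thus "q u * u powr (-1) \<le> 2 * (norm (N u) * u powr (-2) / ln u)" unfolding e1 by (simp add: mult.commute)
        qed
        also have "\<dots> = 2 * ennreal (indicator {2..x} u * (norm (N u) * u powr (-2) / ln u))"
        proof -
          have "ennreal (2 * (norm (N u) * u powr (-2) / ln u)) = ennreal 2 * ennreal (norm (N u) * u powr (-2) / ln u)"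
            by (rule ennreal_mult) (use lnu in auto)
          thus ?thesis using True by simp
        qed
        finally show ?thesis .
      next
        case False
        have "K t u = 0" for t using False by (auto simp: K_def indicator_def)
        thus ?thesis by simp
      qed
    qed
    also have "\<dots> = 2 * D" unfolding D_def by (rule nn_integral_cmult) measurable
    finally show "(\<integral>\<^sup>+t. \<integral>\<^sup>+u. ennreal (indicator {2..x} t * t powr (-2) * (indicator {2..t} u * q u)) \<partial>lborel \<partial>lborel) \<le> 2 * D"
      unfolding K_def .
  qed
  also have "1 + (1 + (D + 2 * D)) = 2 + 3 * D"
  proof -
    have "(2::ennreal) + 3 * D = (1 + 1) + (1 + 2) * D" by (simp add: one_add_one)
    also have "\<dots> = 1 + (1 + (D + 2 * D))" by (simp only: distrib_right mult_1_left add.assoc)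
    finally show ?thesis by simp
  qed
  finally show ?thesis unfolding D_def .
qed

text \<open>The integral of t^(-2\<alpha>) over \<alpha> in [1/L, 1] is (t^(-2/L) - t^(-2))/(2 ln
  t). For exp 2 \<le> t \<le> x = exp L the first power is at least e^(-2) and the second at most
  e^(-4); the cut at exp 2 keeps the difference bounded away from 0.\<close>

lemma nn_integral_log_weight_le:
  fixes \<phi> :: "real \<Rightarrow> real" and B :: "real \<Rightarrow> real"
  assumes \<phi>m [measurable]: "\<phi> \<in> borel_measurable borel" and \<phi>0: "\<And>t. \<phi> t \<ge> 0"
    and x: "x > 1"
    and B: "\<And>\<alpha>. 1 / ln x \<le> \<alpha> \<Longrightarrow> \<alpha> \<le> 1 \<Longrightarrow> (\<integral>\<^sup>+t. ennreal (indicator {1..x} t * (\<phi> t * t powr (-2 - 2*\<alpha>))) \<partial>lborel) \<le> ennreal (B \<alpha>)"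
  shows "(\<integral>\<^sup>+t. ennreal ((exp (-2) - exp (-4)) / 2 * (indicator {exp 2..x} t * (\<phi> t * t powr (-2) / ln t))) \<partial>lborel)
     \<le> (\<integral>\<^sup>+\<alpha>. ennreal (B \<alpha>) * indicator {1 / ln x..1} \<alpha> \<partial>lborel)"
proof -
  define L where "L = ln x"
  have L0: "L > 0" using x by (simp add: L_def)
  define K where "K t \<alpha> = ennreal (indicator {1..x} t * (\<phi> t * t powr (-2 - 2*\<alpha>)) * indicator {1/L..1} \<alpha>)" for t \<alpha>
  have Km: "case_prod K \<in> borel_measurable (lborel \<Otimes>\<^sub>M lborel)"
  proof -
    have "case_prod K = (\<lambda>z. ennreal (indicator {1..x} (fst z) * (\<phi> (fst z) * exp ((-2 - 2 * snd z) * ln (fst z))) * indicator {1/L..1} (snd z)))"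
      by (auto simp: K_def fun_eq_iff indicator_def powr_def)
    also have "\<dots> \<in> borel_measurable (lborel \<Otimes>\<^sub>M lborel)" by measurable
    finally show ?thesis .
  qed
  have "(\<integral>\<^sup>+t. ennreal ((exp (-2) - exp (-4)) / 2 * (indicator {exp 2..x} t * (\<phi> t * t powr (-2) / ln t))) \<partial>lborel)
     \<le> (\<integral>\<^sup>+t. \<integral>\<^sup>+\<alpha>. K t \<alpha> \<partial>lborel \<partial>lborel)"
  proof (rule nn_integral_mono)
    fix t :: real
    show "ennreal ((exp (-2) - exp (-4)) / 2 * (indicator {exp 2..x} t * (\<phi> t * t powr (-2) / ln t))) \<le> (\<integral>\<^sup>+\<alpha>. K t \<alpha> \<partial>lborel)"
    proof (cases "t \<in> {exp 2..x}")
      case True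
      have e1: "exp 2 > (1::real)" by simp
      have t1: "t > 1" using True e1 by (metis atLeastAtMost_iff less_le_trans)
      have lnt2: "ln t \<ge> 2" using True t1 by (metis atLeastAtMost_iff ln_exp ln_mono exp_gt_zero)
      have lntL: "ln t \<le> L" unfolding L_def using True t1 by (intro ln_mono) auto
      have L2: "L \<ge> 2" using lnt2 lntL by linarith
      have aL: "1 / L \<le> 1" using L2 by simp
      have "(\<integral>\<^sup>+\<alpha>. K t \<alpha> \<partial>lborel) = ennreal (\<phi> t * t powr (-2) * ((t powr (-2*(1/L)) - t powr (-2*1)) / (2 * ln t)))"
      proof -
        have "has_bochner_integral lborel (\<lambda>\<alpha>. \<phi> t * t powr (-2) * (t powr (-2*\<alpha>) * indicator {1/L..1} \<alpha>)) (\<phi> t * t powr (-2) * ((t powr (-2*(1/L)) - t powr (-2*1)) / (2 * ln t)))"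
          by (intro has_bochner_integral_mult_right powr_minus_two_alpha_integral t1 aL)
        from nn_integral_eq_of_has_bochner[OF this]
        have "(\<integral>\<^sup>+\<alpha>. ennreal (\<phi> t * t powr (-2) * (t powr (-2*\<alpha>) * indicator {1/L..1} \<alpha>)) \<partial>lborel) = ennreal (\<phi> t * t powr (-2) * ((t powr (-2*(1/L)) - t powr (-2*1)) / (2 * ln t)))"
          using \<phi>0[of t] by simp
        moreover have "K t \<alpha> = ennreal (\<phi> t * t powr (-2) * (t powr (-2*\<alpha>) * indicator {1/L..1} \<alpha>))" for \<alpha>
        proof -
          have "t powr (-2 - 2*\<alpha>) = t powr (-2) * t powr (-2*\<alpha>)" by (simp add: powr_add[symmetric])
          thus ?thesis unfolding K_def using True t1 by (simp add: mult.assoc)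
        qed
        ultimately show ?thesis by simp
      qed
      moreover have "(exp (-2) - exp (-4)) / 2 * (\<phi> t * t powr (-2) / ln t) \<le> \<phi> t * t powr (-2) * ((t powr (-2*(1/L)) - t powr (-2*1)) / (2 * ln t))"
      proof -
        have "ln t / L \<le> 1" using lntL L0 by simp
        hence "exp (-2) \<le> exp (-2 * (ln t / L))" by simp
        also have "\<dots> = t powr (-2*(1/L))" using t1 by (simp add: powr_def)
        finally have a: "exp (-2) \<le> t powr (-2*(1/L))" .
        have "t powr (-2*1) = exp (-2 * ln t)" using t1 by (simp add: powr_def)
        also have "\<dots> \<le> exp (-4)" using lnt2 by simp
        finally have b: "t powr (-2*1) \<le> exp (-4)" .
        have "(exp (-2) - exp (-4)) / (2 * ln t) \<le> (t powr (-2*(1/L)) - t powr (-2*1)) / (2 * ln t)"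
          using a b lnt2 by (intro divide_right_mono) auto
        hence "\<phi> t * t powr (-2) * ((exp (-2) - exp (-4)) / (2 * ln t)) \<le> \<phi> t * t powr (-2) * ((t powr (-2*(1/L)) - t powr (-2*1)) / (2 * ln t))"
          using \<phi>0[of t] by (intro mult_left_mono) auto
        moreover have "(exp (-2) - exp (-4)) / 2 * (\<phi> t * t powr (-2) / ln t) = \<phi> t * t powr (-2) * ((exp (-2) - exp (-4)) / (2 * ln t))"
          by (simp add: mult.commute)
        ultimately show ?thesis by (simp only:)
      qed
      ultimately show ?thesis using True by (simp only: indicator_simps mult_1_left) (rule ennreal_leI)
    qed simp
  qed
  also have "\<dots> = (\<integral>\<^sup>+\<alpha>. \<integral>\<^sup>+t. K t \<alpha> \<partial>lborel \<partial>lborel)"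
    by (rule lborel_pair.Fubini'[symmetric, OF Km])
  also have "\<dots> \<le> (\<integral>\<^sup>+\<alpha>. ennreal (B \<alpha>) * indicator {1 / L..1} \<alpha> \<partial>lborel)"
  proof (rule nn_integral_mono)
    fix \<alpha> :: real
    show "(\<integral>\<^sup>+t. K t \<alpha> \<partial>lborel) \<le> ennreal (B \<alpha>) * indicator {1 / L..1} \<alpha>"
    proof (cases "\<alpha> \<in> {1/L..1}")
      case True
      hence "(\<integral>\<^sup>+t. K t \<alpha> \<partial>lborel) = (\<integral>\<^sup>+t. ennreal (indicator {1..x} t * (\<phi> t * t powr (-2 - 2*\<alpha>))) \<partial>lborel)"
        by (simp add: K_def)
      also have "\<dots> \<le> ennreal (B \<alpha>)" by (rule B) (use True in \<open>auto simp: L_def\<close>)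
      finally show ?thesis using True by simp
    qed (simp add: K_def)
  qed
  finally show ?thesis by (simp add: L_def)
qed

text \<open>For n \<le> t the sharp and the Riesz weight differ by (n/t)^\<kappa>. The bound ln n
  \<le> ln t is used on purpose: its ln t cancels the 1/ln t of the logarithmic weight.\<close>

lemma norm_Msum_ln_le_Npoly:
  fixes F :: "nat \<Rightarrow> complex"
  assumes t: "1 \<le> t" "t \<le> x"
  shows "norm (Msum t (\<lambda>n. expmult F n * of_real (ln (real n))))
     \<le> norm (Npoly F \<kappa> x t) + (\<Sum>n | 1 \<le> n \<and> real n \<le> x. norm (expmult F n) * ln t * (real n powr \<kappa> * t powr (- \<kappa>) * indicator {real n..x} t))"
proof -
  let ?S = "{n. 1 \<le> n \<and> real n \<le> x}"
  have SX: "?S = {1..nat \<lfloor>x\<rfloor>}" using t by (auto simp: le_nat_iff le_floor_iff)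
  define a where "a n = expmult F n * of_real (ln (real n))" for n
  have "Msum t a = (\<Sum>n\<in>?S. if real n \<le> t then a n else 0)"
  proof -
    have "Msum t a = (\<Sum>n\<in>{n\<in>?S. real n \<le> t}. a n)" using t by (subst Msum_eq) (auto intro!: sum.cong)
    thus ?thesis by (simp only: sum.inter_filter[OF finite_nat_le_real(1)])
  qed
  moreover have "Npoly F \<kappa> x t = (\<Sum>n\<in>?S. a n * of_real (riesz \<kappa> (real n) t))" by (simp only: Npoly_def SX a_def)
  ultimately have "Msum t a = Npoly F \<kappa> x t + (\<Sum>n\<in>?S. (if real n \<le> t then a n else 0) - a n * of_real (riesz \<kappa> (real n) t))"
    by (simp add: sum_subtractf)
  hence "norm (Msum t a) \<le> norm (Npoly F \<kappa> x t) + norm (\<Sum>n\<in>?S. (if real n \<le> t then a n else 0) - a n * of_real (riesz \<kappa> (real n) t))"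
    by (simp add: norm_triangle_ineq)
  also have "norm (\<Sum>n\<in>?S. (if real n \<le> t then a n else 0) - a n * of_real (riesz \<kappa> (real n) t))
     \<le> (\<Sum>n\<in>?S. norm (expmult F n) * ln t * (real n powr \<kappa> * t powr (- \<kappa>) * indicator {real n..x} t))"
  proof (rule order_trans[OF norm_sum], rule sum_mono)
    fix n assume n: "n \<in> ?S"
    show "norm ((if real n \<le> t then a n else 0) - a n * of_real (riesz \<kappa> (real n) t)) \<le> norm (expmult F n) * ln t * (real n powr \<kappa> * t powr (- \<kappa>) * indicator {real n..x} t)"
    proof (cases "real n \<le> t")
      case True
      have pw: "(real n / t) powr \<kappa> = real n powr \<kappa> * t powr (- \<kappa>)" using t n by (simp add: powr_divide powr_minus_divide)
      have "a n - a n * of_real (riesz \<kappa> (real n) t) = a n * of_real ((real n / t) powr \<kappa>)"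
        using True t n by (cases "real n = t") (auto simp: riesz_def algebra_simps)
      hence "norm (a n - a n * of_real (riesz \<kappa> (real n) t)) = norm (expmult F n) * ln (real n) * (real n powr \<kappa> * t powr (- \<kappa>))"
        using n unfolding pw a_def by (simp add: norm_mult)
      also have "\<dots> \<le> norm (expmult F n) * ln t * (real n powr \<kappa> * t powr (- \<kappa>))"
        using True n by (intro mult_right_mono mult_left_mono) auto
      finally show ?thesis using True t by simp
    next
      case False
      thus ?thesis by (simp add: riesz_def)
    qed
  qed
  finally have "norm (Msum t a) \<le> norm (Npoly F \<kappa> x t) + (\<Sum>n\<in>?S. norm (expmult F n) * ln t * (real n powr \<kappa> * t powr (- \<kappa>) * indicator {real n..x} t))"
    by simp
  thus ?thesis unfolding a_def[abs_def] .
qed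

text \<open>Accounts for 2 \<le> t \<le> exp 2, where \<open>nn_integral_log_weight_le\<close> does
  not apply. The last factor bounds the sum of |g(n)|/n up to exp 2, each prime contributing at most
  A to the exponent.\<close>

definition Mconst :: "real \<Rightarrow> real" where
  "Mconst A = 4 * exp 2 * exp 2 * exp (A * real (card {p::nat. prime p \<and> real p \<le> exp 2}))"

text \<open>Besides small t and the Riesz mean there remains the smoothing error: n^\<kappa> times
  the integral of t^(-2-\<kappa>) over t \<ge> n is 1/(n (1+\<kappa>)), and the sum of |g(n)|/n is
  at most e^Z. Hence e^Z/\<kappa>.\<close>

lemma log_weighted_mean_le:
  fixes F :: "nat \<Rightarrow> complex" and B :: "real \<Rightarrow> real"
  assumes A: "A > 0" and F: "\<And>p. norm (F p) \<le> A" and k: "\<kappa> > 0" and x: "x > 1"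
    and B: "\<And>\<alpha>. 1 / ln x \<le> \<alpha> \<Longrightarrow> \<alpha> \<le> 1 \<Longrightarrow> (\<integral>\<^sup>+t. ennreal (indicator {1..x} t * (norm (Npoly F \<kappa> x t) * t powr (-2 - 2*\<alpha>))) \<partial>lborel) \<le> ennreal (B \<alpha>)"
  shows "(\<integral>\<^sup>+t. ennreal (indicator {2..x} t * (norm (Msum t (\<lambda>n. expmult F n * of_real (ln (real n)))) * t powr (-2) / ln t)) \<partial>lborel)
     \<le> ennreal (Mconst A) + (ennreal (exp (Zpow F x 0) / \<kappa>) + ennreal (2 / (exp (-2) - exp (-4))) * (\<integral>\<^sup>+\<alpha>. ennreal (B \<alpha>) * indicator {1 / ln x..1} \<alpha> \<partial>lborel))"
proof -
  define N where "N t = Msum t (\<lambda>n. expmult F n * of_real (ln (real n)))" for t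
  let ?S = "{n. 1 \<le> n \<and> real n \<le> x}"
  define S8 where "S8 = 2 * (\<Sum>n | 1 \<le> n \<and> real n \<le> exp 2. norm (expmult F n * of_real (ln (real n))))"
  have S80: "S8 \<ge> 0" unfolding S8_def by (intro mult_nonneg_nonneg sum_nonneg) auto
  define E where "E t = (\<Sum>n\<in>?S. norm (expmult F n) * real n powr \<kappa> * (t powr (-1 - (1 + \<kappa>)) * indicator {real n..x} t))" for t
  have E0: "E t \<ge> 0" for t unfolding E_def by (intro sum_nonneg mult_nonneg_nonneg) auto
  define P where "P t = indicator {exp 2..x} t * (norm (Npoly F \<kappa> x t) * t powr (-2) / ln t)" for t
  have e2: "exp 2 > (2::real)" using exp_ge_add_one_self[of "2::real"] by linarith
  have P0: "P t \<ge> 0" for t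
  proof (cases "t \<in> {exp 2..x}")
    case True
    hence "t \<ge> 1" using e2 by (auto intro: order_trans[of 1 "exp 2"])
    thus ?thesis by (simp add: P_def)
  qed (simp add: P_def)
  have powm [measurable]: "(\<lambda>t::real. t powr a) \<in> borel_measurable borel" for a by (rule powr_const_measurable)
  have pt: "indicator {2..x} t * (norm (N t) * t powr (-2) / ln t) \<le> S8 * indicator {2..exp 2::real} t + (E t + P t)" for t
  proof (cases "t \<in> {2..x}")
    case True
    have t2: "t \<ge> 2" using True by simp
    have lnt: "ln t \<ge> 1/2" using ln_2_ge_half ln_mono[of 2 t] t2 by linarith
    show ?thesis
    proof (cases "t \<le> exp 2")
      case te: True
      have "norm (N t) \<le> (\<Sum>n | 1 \<le> n \<and> real n \<le> exp 2. norm (expmult F n * of_real (ln (real n))))"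
        unfolding N_def by (rule norm_Msum_le) (use t2 te in auto)
      moreover have "t powr (-2) \<le> t powr 0" using t2 by (intro powr_mono) auto
      ultimately have "norm (N t) * t powr (-2) \<le> (\<Sum>n | 1 \<le> n \<and> real n \<le> exp 2. norm (expmult F n * of_real (ln (real n)))) * 1"
        using t2 by (intro mult_mono sum_nonneg) auto
      hence "norm (N t) * t powr (-2) \<le> S8 / 2" by (simp add: S8_def)
      hence "norm (N t) * t powr (-2) / ln t \<le> (S8 / 2) / (1/2)" using lnt S80 by (intro frac_le) auto
      hence "norm (N t) * t powr (-2) / ln t \<le> S8" by simp
      thus ?thesis using True te E0[of t] P0[of t] by simp
    next
      case te: False
      have "norm (N t) \<le> norm (Npoly F \<kappa> x t) + (\<Sum>n\<in>?S. norm (expmult F n) * ln t * (real n powr \<kappa> * t powr (- \<kappa>) * indicator {real n..x} t))"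
        unfolding N_def by (rule norm_Msum_ln_le_Npoly) (use True in auto)
      hence "norm (N t) * (t powr (-2) / ln t) \<le> (norm (Npoly F \<kappa> x t) + (\<Sum>n\<in>?S. norm (expmult F n) * ln t * (real n powr \<kappa> * t powr (- \<kappa>) * indicator {real n..x} t))) * (t powr (-2) / ln t)"
        using lnt by (intro mult_right_mono) auto
      also have "\<dots> = norm (Npoly F \<kappa> x t) * (t powr (-2) / ln t) + (\<Sum>n\<in>?S. norm (expmult F n) * ln t * (real n powr \<kappa> * t powr (- \<kappa>) * indicator {real n..x} t) * (t powr (-2) / ln t))"
        by (simp only: distrib_right sum_distrib_right)
      also have "(\<Sum>n\<in>?S. norm (expmult F n) * ln t * (real n powr \<kappa> * t powr (- \<kappa>) * indicator {real n..x} t) * (t powr (-2) / ln t)) = E t"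
        unfolding E_def
      proof (rule sum.cong[OF refl])
        fix n
        have "t powr (-1 - (1 + \<kappa>)) = t powr (- \<kappa>) * t powr (-2)" by (simp add: powr_add[symmetric] algebra_simps)
        moreover have "ln t \<noteq> 0" using lnt by auto
        ultimately show "norm (expmult F n) * ln t * (real n powr \<kappa> * t powr (- \<kappa>) * indicator {real n..x} t) * (t powr (-2) / ln t) = norm (expmult F n) * real n powr \<kappa> * (t powr (-1 - (1 + \<kappa>)) * indicator {real n..x} t)"
          by simp
      qed
      also have "norm (Npoly F \<kappa> x t) * (t powr (-2) / ln t) = P t" using True te by (simp add: P_def)
      finally show ?thesis using True te by simp
    qed
  next
    case False
    have "0 \<le> S8 * indicator {2..exp 2::real} t + (E t + P t)" using S80 E0[of t] P0[of t] by (intro add_nonneg_nonneg mult_nonneg_nonneg) auto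
    thus ?thesis using False by simp
  qed
  have Nm: "(\<lambda>t. norm (Npoly F \<kappa> x t)) \<in> borel_measurable borel" by measurable
  have mP: "(\<lambda>t. ennreal (P t)) \<in> borel_measurable lborel" unfolding P_def using Nm by simp
  have mE: "(\<lambda>t. ennreal (E t)) \<in> borel_measurable lborel" unfolding E_def by simp
  have "(\<integral>\<^sup>+t. ennreal (indicator {2..x} t * (norm (N t) * t powr (-2) / ln t)) \<partial>lborel) \<le> (\<integral>\<^sup>+t. ennreal (S8 * indicator {2..exp 2::real} t) + (ennreal (E t) + ennreal (P t)) \<partial>lborel)"
  proof (rule nn_integral_mono)
    fix t :: real
    have "ennreal (indicator {2..x} t * (norm (N t) * t powr (-2) / ln t)) \<le> ennreal (S8 * indicator {2..exp 2::real} t + (E t + P t))"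
      by (rule ennreal_leI[OF pt])
    also have "\<dots> = ennreal (S8 * indicator {2..exp 2::real} t) + (ennreal (E t) + ennreal (P t))"
      using S80 E0[of t] P0[of t] by (simp add: ennreal_plus)
    finally show "ennreal (indicator {2..x} t * (norm (N t) * t powr (-2) / ln t)) \<le> \<dots>" .
  qed
  also have "\<dots> = (\<integral>\<^sup>+t. ennreal (S8 * indicator {2..exp 2::real} t) \<partial>lborel) + ((\<integral>\<^sup>+t. ennreal (E t) \<partial>lborel) + (\<integral>\<^sup>+t. ennreal (P t) \<partial>lborel))"
    by (subst nn_integral_add[OF _ borel_measurable_add[OF mE mP]], simp, subst nn_integral_add[OF mE mP]) (rule refl)
  also have "\<dots> \<le> ennreal (Mconst A) + (ennreal (exp (Zpow F x 0) / \<kappa>) + ennreal (2 / (exp (-2) - exp (-4))) * (\<integral>\<^sup>+\<alpha>. ennreal (B \<alpha>) * indicator {1 / ln x..1} \<alpha> \<partial>lborel))"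
  proof (intro add_mono)
    have "(\<integral>\<^sup>+t. ennreal (S8 * indicator {2..exp 2::real} t) \<partial>lborel) = (\<integral>\<^sup>+t. ennreal S8 * indicator {2..exp 2::real} t \<partial>lborel)"
      by (rule nn_integral_cong) (simp add: indicator_def)
    also have "\<dots> = ennreal S8 * emeasure lborel {2..exp 2::real}" by (rule nn_integral_cmult_indicator) simp
    also have "\<dots> = ennreal (S8 * (exp 2 - 2))" using e2 S80 by (simp add: ennreal_mult)
    also have "\<dots> \<le> ennreal (Mconst A)"
    proof (rule ennreal_leI)
      have "(\<Sum>n | 1 \<le> n \<and> real n \<le> exp 2. norm (expmult F n * of_real (ln (real n)))) \<le> (\<Sum>n | 1 \<le> n \<and> real n \<le> exp 2. (2 * exp 2) * (norm (expmult F n) / real n))"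
      proof (rule sum_mono)
        fix n assume n: "n \<in> {n. 1 \<le> n \<and> real n \<le> exp 2}"
        have "ln (real n) \<le> ln (exp 2)" using n by (intro ln_mono) auto
        hence "ln (real n) * real n \<le> 2 * exp 2" using n by (intro mult_mono) auto
        hence "ln (real n) \<le> 2 * exp 2 / real n" using n by (simp add: field_simps)
        hence "norm (expmult F n) * ln (real n) \<le> norm (expmult F n) * (2 * exp 2 / real n)" by (intro mult_left_mono) auto
        thus "norm (expmult F n * of_real (ln (real n))) \<le> (2 * exp 2) * (norm (expmult F n) / real n)"
          using n by (simp add: norm_mult mult.commute)
      qed
      also have "\<dots> = (2 * exp 2) * (\<Sum>n | 1 \<le> n \<and> real n \<le> exp 2. norm (expmult F n) / real n)" by (simp only: sum_distrib_left)
      also have "\<dots> \<le> (2 * exp 2) * exp (A * real (card {p::nat. prime p \<and> real p \<le> exp 2}))"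
      proof (rule mult_left_mono)
        have "(\<Sum>p | prime p \<and> real p \<le> exp 2. norm (F p) / real p) \<le> real (card {p::nat. prime p \<and> real p \<le> exp 2}) * A"
        proof (rule sum_bounded_above)
          fix p assume "p \<in> {p::nat. prime p \<and> real p \<le> exp 2}"
          hence "real p \<ge> 1" by (auto dest: prime_ge_1_nat)
          hence "norm (F p) / real p \<le> norm (F p) / 1" by (intro divide_left_mono) auto
          thus "norm (F p) / real p \<le> A" using F[of p] by simp
        qed
        thus "(\<Sum>n | 1 \<le> n \<and> real n \<le> exp 2. norm (expmult F n) / real n) \<le> exp (A * real (card {p::nat. prime p \<and> real p \<le> exp 2}))"
          by (intro order_trans[OF sum_norm_expmult_over_le]) (simp add: mult.commute)
      qed simp
      finally have "S8 \<le> 2 * ((2 * exp 2) * exp (A * real (card {p::nat. prime p \<and> real p \<le> exp 2})))" by (simp add: S8_def)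
      hence "S8 * (exp 2 - 2) \<le> (2 * ((2 * exp 2) * exp (A * real (card {p::nat. prime p \<and> real p \<le> exp 2})))) * exp 2"
        using e2 S80 by (intro mult_mono) auto
      also have "\<dots> = Mconst A" by (simp add: Mconst_def)
      finally show "S8 * (exp 2 - 2) \<le> Mconst A" .
    qed
    finally show "(\<integral>\<^sup>+t. ennreal (S8 * indicator {2..exp 2::real} t) \<partial>lborel) \<le> ennreal (Mconst A)" .
    have "(\<integral>\<^sup>+t. ennreal (E t) \<partial>lborel) = (\<integral>\<^sup>+t. (\<Sum>n\<in>?S. ennreal (norm (expmult F n) * real n powr \<kappa>) * ennreal (t powr (-1 - (1 + \<kappa>)) * indicator {real n..x} t)) \<partial>lborel)"
      unfolding E_def by (rule nn_integral_cong) (simp add: ennreal_mult[symmetric])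
    also have "\<dots> = (\<Sum>n\<in>?S. \<integral>\<^sup>+t. ennreal (norm (expmult F n) * real n powr \<kappa>) * ennreal (t powr (-1 - (1 + \<kappa>)) * indicator {real n..x} t) \<partial>lborel)"
      by (rule nn_integral_sum) simp
    also have "\<dots> \<le> (\<Sum>n\<in>?S. ennreal (norm (expmult F n) / real n / \<kappa>))"
    proof (rule sum_mono)
      fix n assume n: "n \<in> ?S"
      have "(\<integral>\<^sup>+t. ennreal (norm (expmult F n) * real n powr \<kappa>) * ennreal (t powr (-1 - (1 + \<kappa>)) * indicator {real n..x} t) \<partial>lborel)
         = ennreal (norm (expmult F n) * real n powr \<kappa>) * (\<integral>\<^sup>+t. ennreal (t powr (-1 - (1 + \<kappa>)) * indicator {real n..x} t) \<partial>lborel)"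
        by (rule nn_integral_cmult) simp
      also have "\<dots> \<le> ennreal (norm (expmult F n) * real n powr \<kappa>) * ennreal (real n powr (-(1 + \<kappa>)) / (1 + \<kappa>))"
        by (intro mult_left_mono nn_integral_powr_Icc_le) (use n k in auto)
      also have "\<dots> = ennreal (norm (expmult F n) * real n powr \<kappa> * (real n powr (-(1 + \<kappa>)) / (1 + \<kappa>)))"
        using k by (simp add: ennreal_mult[symmetric])
      also have "\<dots> \<le> ennreal (norm (expmult F n) / real n / \<kappa>)"
      proof (rule ennreal_leI)
        have "real n powr \<kappa> * real n powr (-(1 + \<kappa>)) = 1 / real n" using n by (simp add: powr_add[symmetric] powr_minus_divide)
        hence "norm (expmult F n) * real n powr \<kappa> * (real n powr (-(1 + \<kappa>)) / (1 + \<kappa>)) = norm (expmult F n) / real n / (1 + \<kappa>)"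
          by (simp add: mult.assoc)
        also have "\<dots> \<le> norm (expmult F n) / real n / \<kappa>" using k by (intro divide_left_mono) auto
        finally show "norm (expmult F n) * real n powr \<kappa> * (real n powr (-(1 + \<kappa>)) / (1 + \<kappa>)) \<le> norm (expmult F n) / real n / \<kappa>" .
      qed
      finally show "(\<integral>\<^sup>+t. ennreal (norm (expmult F n) * real n powr \<kappa>) * ennreal (t powr (-1 - (1 + \<kappa>)) * indicator {real n..x} t) \<partial>lborel) \<le> ennreal (norm (expmult F n) / real n / \<kappa>)" .
    qed
    also have "\<dots> = ennreal (\<Sum>n\<in>?S. norm (expmult F n) / real n / \<kappa>)" using k by (intro sum_ennreal) auto
    also have "\<dots> \<le> ennreal (exp (Zpow F x 0) / \<kappa>)"
    proof (rule ennreal_leI)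
      have "(\<Sum>n\<in>?S. norm (expmult F n) / real n) \<le> exp (\<Sum>p | prime p \<and> real p \<le> x. norm (F p) / real p)" by (rule sum_norm_expmult_over_le)
      also have "(\<Sum>p | prime p \<and> real p \<le> x. norm (F p) / real p) = Zpow F x 0"
        unfolding Zpow_def by (rule sum.cong[OF refl]) (auto simp: powr_minus_divide prime_gt_0_nat)
      finally show "(\<Sum>n\<in>?S. norm (expmult F n) / real n / \<kappa>) \<le> exp (Zpow F x 0) / \<kappa>"
        using k unfolding sum_divide_distrib[symmetric] by (intro divide_right_mono) auto
    qed
    finally show "(\<integral>\<^sup>+t. ennreal (E t) \<partial>lborel) \<le> ennreal (exp (Zpow F x 0) / \<kappa>)" .
    define c where "c = (exp (-2) - exp (-4)) / (2::real)"
    have c0: "c > 0" by (simp add: c_def)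
    have "(\<integral>\<^sup>+t. ennreal (P t) \<partial>lborel) = (\<integral>\<^sup>+t. ennreal (1 / c) * ennreal (c * P t) \<partial>lborel)"
      using c0 P0 by (intro nn_integral_cong) (simp add: ennreal_mult[symmetric])
    also have "\<dots> = ennreal (1 / c) * (\<integral>\<^sup>+t. ennreal (c * P t) \<partial>lborel)"
      by (rule nn_integral_cmult) (use Nm in \<open>simp add: P_def\<close>)
    also have "\<dots> \<le> ennreal (1 / c) * (\<integral>\<^sup>+\<alpha>. ennreal (B \<alpha>) * indicator {1 / ln x..1} \<alpha> \<partial>lborel)"
      unfolding c_def P_def by (intro mult_left_mono nn_integral_log_weight_le[OF Nm _ x B]) auto
    also have "1 / c = 2 / (exp (-2) - exp (-4))" by (simp add: c_def)
    finally show "(\<integral>\<^sup>+t. ennreal (P t) \<partial>lborel) \<le> ennreal (2 / (exp (-2) - exp (-4))) * (\<integral>\<^sup>+\<alpha>. ennreal (B \<alpha>) * indicator {1 / ln x..1} \<alpha> \<partial>lborel)" .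
  qed
  finally show ?thesis unfolding N_def .
qed

section \<open>Mean values of multiplicative functions\<close>

lemma nn_integral_continuous_Icc:
  fixes \<phi> :: "real \<Rightarrow> real"
  assumes c: "continuous_on {a..b} \<phi>" and p: "\<And>t. t \<in> {a..b} \<Longrightarrow> \<phi> t \<ge> 0"
  shows "(\<integral>\<^sup>+t. ennreal (\<phi> t) * indicator {a..b} t \<partial>lborel) = ennreal (integral {a..b} \<phi>)"
proof -
  have si: "set_integrable lborel {a..b} \<phi>" by (rule borel_integrable_atLeastAtMost'[OF c])
  have "(\<integral>\<^sup>+t. ennreal (\<phi> t) * indicator {a..b} t \<partial>lborel) = (\<integral>\<^sup>+t. ennreal (indicator {a..b} t *\<^sub>R \<phi> t) \<partial>lborel)"
    by (rule nn_integral_cong) (simp add: indicator_def)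
  also have "\<dots> = ennreal (LINT t|lborel. indicator {a..b} t *\<^sub>R \<phi> t)"
    by (rule nn_integral_eq_integral) (use si p in \<open>auto simp: set_integrable_def indicator_def\<close>)
  also have "(LINT t|lborel. indicator {a..b} t *\<^sub>R \<phi> t) = integral {a..b} \<phi>"
    using set_borel_integral_eq_integral(2)[OF si] by (simp add: set_lebesgue_integral_def)
  finally show ?thesis .
qed

lemma integral_sqrt_over_le:
  assumes "0 < a" "a \<le> 1"
  shows "integral {a..1} (\<lambda>\<alpha>. sqrt \<alpha> / \<alpha>) \<le> 2"
proof -
  have "((\<lambda>\<alpha>. sqrt \<alpha> / \<alpha>) has_integral 2 * sqrt 1 - 2 * sqrt a) {a..1}"
  proof (rule fundamental_theorem_of_calculus[OF assms(2)])
    fix t assume "t \<in> {a..1}"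
    hence t: "t > 0" using assms by auto
    have "((\<lambda>t. 2 * sqrt t) has_real_derivative sqrt t / t) (at t within {a..1})"
      using t by (auto intro!: derivative_eq_intros simp: field_simps)
    thus "((\<lambda>t. 2 * sqrt t) has_vector_derivative sqrt t / t) (at t within {a..1})"
      by (simp add: has_real_derivative_iff_has_vector_derivative)
  qed
  hence "integral {a..1} (\<lambda>\<alpha>. sqrt \<alpha> / \<alpha>) = 2 * sqrt 1 - 2 * sqrt a" by (rule integral_unique)
  thus ?thesis using assms by simp
qed

lemma has_integral_inverse_Icc:
  assumes "0 < a" "a \<le> 1"
  shows "((\<lambda>\<alpha>::real. 1 / \<alpha>) has_integral - ln a) {a..1}"
proof -
  have "((\<lambda>\<alpha>::real. 1 / \<alpha>) has_integral ln 1 - ln a) {a..1}"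
  proof (rule fundamental_theorem_of_calculus[OF assms(2)])
    fix t assume "t \<in> {a..1}"
    hence t: "t > 0" using assms by auto
    have "(ln has_real_derivative 1 / t) (at t within {a..1})"
      using t by (auto intro!: derivative_eq_intros)
    thus "(ln has_vector_derivative 1 / t) (at t within {a..1})"
      by (simp add: has_real_derivative_iff_has_vector_derivative)
  qed
  thus ?thesis by simp
qed

lemma has_integral_powr_neg_Icc:
  assumes "0 < a" "a \<le> 1" "c > 0"
  shows "((\<lambda>\<alpha>::real. \<alpha> powr (- c) / \<alpha>) has_integral (a powr (- c) - 1) / c) {a..1}"
proof -
  have "((\<lambda>\<alpha>::real. \<alpha> powr (- c) / \<alpha>) has_integral (- (1 powr (- c)) / c) - (- (a powr (- c)) / c)) {a..1}"
  proof (rule fundamental_theorem_of_calculus[OF assms(2)])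
    fix t assume "t \<in> {a..1}"
    hence t: "t > 0" using assms by auto
    have e: "t powr (- c - 1) = t powr (- c) / t" using t by (simp add: powr_diff)
    have "((\<lambda>t. - (t powr (- c)) / c) has_real_derivative - (- c * t powr (- c - 1)) / c) (at t within {a..1})"
      using t assms(3) by (auto intro!: derivative_eq_intros)
    thus "((\<lambda>t. - (t powr (- c)) / c) has_vector_derivative t powr (- c) / t) (at t within {a..1})"
      using assms(3) by (simp add: has_real_derivative_iff_has_vector_derivative e)
  qed
  thus ?thesis using assms(3) by (simp add: field_simps)
qed

lemma ln_3_gt_1: "ln (3::real) > 1"
proof -
  have "exp 1 < (3::real)" using e_less_272 by simp
  hence "ln (exp 1) < ln (3::real)" by (subst ln_less_cancel_iff) auto
  thus ?thesis by simp
qed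

text \<open>Chains the three reductions with \<kappa> = sqrt T and integrates the bound of
  \<open>Npoly_L1_le\<close> over \<alpha>. The final \<open>P * 2\<close> is the share of
  \<open>sqrt \<alpha>\<close>, whose quotient by \<alpha> has integral at most 2.\<close>

lemma Mint_expmult_le:
  fixes F :: "nat \<Rightarrow> complex"
  assumes A: "A > 0" and F: "\<And>p. norm (F p) \<le> A" and F0: "\<And>p. \<not> (prime p \<and> real p \<le> x) \<Longrightarrow> F p = 0"
    and T: "T \<ge> 1" and x: "x \<ge> 3"
  defines "P \<equiv> 28800 * pi * A\<^sup>2 + 1"
  shows "Mint (expmult F) x \<le> 2 + 3 * (Mconst A + (exp (Zpow F x 0) / sqrt T + 2 / (exp (-2) - exp (-4)) * (P * integral {1 / ln x..1} (\<lambda>\<alpha>. HT F x T \<alpha> / \<alpha>)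
      + 2 * P / T * integral {1 / ln x..1} (\<lambda>\<alpha>. exp (Zpow F x \<alpha>) / \<alpha>) + P * 2)))"
proof -
  define a where "a = 1 / ln x"
  have lnx: "ln x > 1" using ln_3_gt_1 ln_mono[of 3 x] x by linarith
  have a: "0 < a" "a \<le> 1" using lnx by (auto simp: a_def)
  have P0: "P > 0" using A by (simp add: P_def add_nonneg_pos)
  define \<delta> where "\<delta> = 2 / (exp (-2) - exp (-4) :: real)"
  have d0: "\<delta> > 0" by (simp add: \<delta>_def)
  define B where "B \<alpha> = P * (HT F x T \<alpha> + 2 * exp (Zpow F x \<alpha>) / T + sqrt \<alpha>) / \<alpha>" for \<alpha>
  have cH: "continuous_on {a..1} (\<lambda>\<alpha>. HT F x T \<alpha> / \<alpha>)"
    by (intro continuous_intros continuous_on_subset[OF continuous_on_HT]) (use a in auto)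
  have cZ: "continuous_on {a..1} (\<lambda>\<alpha>. exp (Zpow F x \<alpha>) / \<alpha>)"
    by (intro continuous_intros continuous_on_Zpow) (use a in auto)
  have cS: "continuous_on {a..1} (\<lambda>\<alpha>. sqrt \<alpha> / \<alpha>)"
    by (intro continuous_intros) (use a in auto)
  have Beq: "B = (\<lambda>\<alpha>. P * (HT F x T \<alpha> / \<alpha>) + 2 * P / T * (exp (Zpow F x \<alpha>) / \<alpha>) + P * (sqrt \<alpha> / \<alpha>))"
    by (simp add: B_def fun_eq_iff add_divide_distrib distrib_left)
  have cB: "continuous_on {a..1} B" unfolding Beq
    by (intro continuous_on_add continuous_on_mult continuous_on_const cH cZ cS)
  have B0: "B \<alpha> \<ge> 0" if "\<alpha> \<in> {a..1}" for \<alpha>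
    unfolding B_def using that a P0 T HT_nonneg[of F x T \<alpha>] by (intro divide_nonneg_nonneg mult_nonneg_nonneg add_nonneg_nonneg) auto
  have iB: "integral {a..1} B = P * integral {a..1} (\<lambda>\<alpha>. HT F x T \<alpha> / \<alpha>) + 2 * P / T * integral {a..1} (\<lambda>\<alpha>. exp (Zpow F x \<alpha>) / \<alpha>)
      + P * integral {a..1} (\<lambda>\<alpha>. sqrt \<alpha> / \<alpha>)"
  proof -
    note hi = integrable_integral[OF integrable_continuous_interval]
    show ?thesis unfolding Beq
      by (rule integral_unique) (intro has_integral_add has_integral_mult_right hi cH cZ cS)
  qed
  have iBle: "integral {a..1} B \<le> P * integral {a..1} (\<lambda>\<alpha>. HT F x T \<alpha> / \<alpha>) + 2 * P / T * integral {a..1} (\<lambda>\<alpha>. exp (Zpow F x \<alpha>) / \<alpha>) + P * 2" (is "_ \<le> ?R")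
    using mult_left_mono[OF integral_sqrt_over_le[OF a], of P] P0 unfolding iB by linarith
  have iB0: "integral {a..1} B \<ge> 0"
    by (rule integral_nonneg[OF integrable_continuous_interval[OF cB] B0])
  have M0: "Mconst A \<ge> 0" by (simp add: Mconst_def)
  have sT: "sqrt T > 0" using T by simp
  have E1: "norm (expmult F 1) \<le> 1" by (simp add: expmult_def mulfun_def)
  have "(\<integral>\<^sup>+t. ennreal (indicator {2..x} t * (norm (Msum t (\<lambda>n. expmult F n * of_real (ln (real n)))) * t powr (-2) / ln t)) \<partial>lborel)
     \<le> ennreal (Mconst A) + (ennreal (exp (Zpow F x 0) / sqrt T) + ennreal \<delta> * (\<integral>\<^sup>+\<alpha>. ennreal (B \<alpha>) * indicator {1 / ln x..1} \<alpha> \<partial>lborel))"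
    unfolding \<delta>_def
  proof (rule log_weighted_mean_le[OF A F sT])
    show "x > 1" using x by simp
    fix \<alpha> assume al: "1 / ln x \<le> \<alpha>" "\<alpha> \<le> 1"
    have "\<alpha> > 0" using al(1) a(1) unfolding a_def by linarith
    thus "(\<integral>\<^sup>+t. ennreal (indicator {1..x} t * (norm (Npoly F (sqrt T) x t) * t powr (-2 - 2*\<alpha>))) \<partial>lborel) \<le> ennreal (B \<alpha>)"
      unfolding B_def P_def by (intro Npoly_L1_le A F F0 T al)
  qed
  also have "\<dots> = ennreal (Mconst A + (exp (Zpow F x 0) / sqrt T + \<delta> * integral {a..1} B))"
  proof -
    have n: "(\<integral>\<^sup>+\<alpha>. ennreal (B \<alpha>) * indicator {1 / ln x..1} \<alpha> \<partial>lborel) = ennreal (integral {a..1} B)"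
      unfolding a_def[symmetric] by (rule nn_integral_continuous_Icc[OF cB B0])
    have m: "ennreal \<delta> * ennreal (integral {a..1} B) = ennreal (\<delta> * integral {a..1} B)"
      using d0 iB0 by (simp add: ennreal_mult)
    have z: "\<delta> * integral {a..1} B \<ge> 0" using d0 iB0 by simp
    have y: "exp (Zpow F x 0) / sqrt T \<ge> 0" using T by simp
    show ?thesis unfolding n m using z y M0 by (simp only: ennreal_plus add_nonneg_nonneg)
  qed
  finally have D: "(\<integral>\<^sup>+t. ennreal (indicator {2..x} t * (norm (Msum t (\<lambda>n. expmult F n * of_real (ln (real n)))) * t powr (-2) / ln t)) \<partial>lborel)
     \<le> ennreal (Mconst A + (exp (Zpow F x 0) / sqrt T + \<delta> * integral {a..1} B))" (is "?D \<le> ennreal ?Q") .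
  have Q0: "?Q \<ge> 0" using M0 d0 iB0 T by simp
  have "ennreal (Mint (expmult F) x) \<le> 2 + 3 * ?D" using E1 by (rule Mint_le_log_weighted[where g = "expmult F"])
  also have "\<dots> \<le> 2 + 3 * ennreal ?Q" by (intro add_mono mult_left_mono D) auto
  also have "\<dots> = ennreal (2 + 3 * ?Q)"
  proof -
    have "ennreal (2 + 3 * ?Q) = ennreal 2 + ennreal (3 * ?Q)" using Q0 by (intro ennreal_plus) auto
    also have "ennreal (3 * ?Q) = ennreal 3 * ennreal ?Q" using Q0 by (intro ennreal_mult) auto
    finally show ?thesis by simp
  qed
  finally have "Mint (expmult F) x \<le> 2 + 3 * ?Q" using Q0 by (subst (asm) ennreal_le_iff) auto
  moreover have "\<delta> * integral {a..1} B \<le> \<delta> * ?R" using iBle d0 by (intro mult_left_mono) auto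
  moreover have "M \<le> 2 + 3 * (u + (v + w'))" if "M \<le> 2 + 3 * (u + (v + w))" "w \<le> w'" for M u v w w' :: real
    by (rule order_trans[OF that(1)]) (use that(2) in simp)
  ultimately have "Mint (expmult F) x \<le> 2 + 3 * (Mconst A + (exp (Zpow F x 0) / sqrt T + \<delta> * ?R))" by blast
  thus ?thesis unfolding \<delta>_def a_def .
qed

section \<open>Passage from g to f\<close>

lemma sum_divisors_swap:
  fixes h g :: "nat \<Rightarrow> complex"
  shows "(\<Sum>n\<in>{1..X}. \<Sum>d | d dvd n. h d * g (n div d)) = (\<Sum>d\<in>{1..X}. h d * (\<Sum>m\<in>{1..X div d}. g m))"
proof -
  have "(\<Sum>n\<in>{1..X}. \<Sum>d | d dvd n. h d * g (n div d)) = (\<Sum>(n,d)\<in>(SIGMA n:{1..X}. {d. d dvd n}). h d * g (n div d))"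
    by (rule sum.Sigma) (auto intro: finite_divisors_nat)
  also have "\<dots> = (\<Sum>(d,m)\<in>(SIGMA d:{1..X}. {1..X div d}). h d * g m)"
  proof (rule sum.reindex_bij_witness[of _ "\<lambda>(d,m). (d * m, d)" "\<lambda>(n,d). (d, n div d)"])
    fix z assume "z \<in> (SIGMA n:{1..X}. {d. d dvd n})"
    then obtain n d where z: "z = (n, d)" "1 \<le> n" "n \<le> X" "d dvd n" by auto
    have d: "d \<ge> 1" using z by (metis One_nat_def Suc_leI dvd_pos_nat less_le_trans zero_less_one)
    have dn: "d \<le> n" using z by (intro dvd_imp_le) auto
    show "(case case z of (n, d) \<Rightarrow> (d, n div d) of (d, m) \<Rightarrow> (d * m, d)) = z" using z by simp
    show "(case z of (n, d) \<Rightarrow> (d, n div d)) \<in> (SIGMA d:{1..X}. {1..X div d})"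
      using z d dn by (auto simp: div_le_mono Suc_le_eq div_greater_zero_iff)
    show "(case case z of (n, d) \<Rightarrow> (d, n div d) of (d, m) \<Rightarrow> h d * g m) = (case z of (n, d) \<Rightarrow> h d * g (n div d))"
      using z by simp
  next
    fix z assume "z \<in> (SIGMA d:{1..X}. {1..X div d})"
    then obtain d m where z: "z = (d, m)" "1 \<le> d" "d \<le> X" "1 \<le> m" "m \<le> X div d" by auto
    have "m * d \<le> X" using z by (simp add: less_eq_div_iff_mult_less_eq)
    thus "(case z of (d, m) \<Rightarrow> (d * m, d)) \<in> (SIGMA n:{1..X}. {d. d dvd n})" using z by (auto simp: mult.commute)
    show "(case case z of (d, m) \<Rightarrow> (d * m, d) of (n, d) \<Rightarrow> (d, n div d)) = z" using z by simp
  qed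
  also have "\<dots> = (\<Sum>d\<in>{1..X}. \<Sum>m\<in>{1..X div d}. h d * g m)" by (rule sum.Sigma[symmetric]) auto
  finally show ?thesis by (simp only: sum_distrib_left)
qed

lemma Zpow_cong: "(\<And>p. prime p \<Longrightarrow> real p \<le> x \<Longrightarrow> F p = G p) \<Longrightarrow> Zpow F x \<alpha> = Zpow G x \<alpha>"
  unfolding Zpow_def by (rule sum.cong) auto

lemma HT_cong:
  assumes "\<And>p. prime p \<Longrightarrow> real p \<le> x \<Longrightarrow> F p = G p"
  shows "HT F x T \<alpha> = HT G x T \<alpha>"
proof -
  have "vsum F s x = vsum G s x" for s unfolding vsum_def by (rule sum.cong) (use assms in auto)
  thus ?thesis by (simp only: HT_def)
qed

text \<open>M(x; f) is the sum of h(d) M(x/d; g). Each term is estimated by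
  \<open>halasz_montgomery\<close> at y = x/d; monotonicity of \<open>Mint\<close> replaces y by x
  in the integral, so the dependence on d is left to \<open>expquot_sum_le\<close>.\<close>

lemma norm_Msum_multiplicative_le:
  fixes A B :: real
  assumes A: "A > 0"
  obtains K where "K > 0"
    "\<And>x T (f :: nat \<Rightarrow> complex). x \<ge> 3 \<Longrightarrow> T \<ge> 1 \<Longrightarrow> multiplicative f \<Longrightarrow> classM x A B f \<Longrightarrow>
      norm (Msum x f) \<le> K * (x / ln x) * (1 + integral {1 / ln x..1} (\<lambda>\<alpha>. HT f x T \<alpha> / \<alpha>) + exp (Zpow f x 0) / sqrt T
        + integral {1 / ln x..1} (\<lambda>\<alpha>. exp (Zpow f x \<alpha>) / \<alpha>) / T)"
proof -
  obtain K where K: "K > 0" and hm: "\<And>F y. (\<And>p. prime p \<Longrightarrow> norm (F p :: complex) \<le> A) \<Longrightarrow> y \<ge> 1 \<Longrightarrow>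
      norm (Msum y (expmult F)) * ln (2*y) \<le> K * y * (1 + Mint (expmult F) y)"
    using halasz_montgomery[OF A] by blast
  define P where "P = 28800 * pi * A\<^sup>2 + 1"
  define \<delta> where "\<delta> = 2 / (exp (-2) - exp (-4) :: real)"
  define E where "E = \<bar>expquot_bound A B\<bar>"
  define C where "C = 3 + 3 * Mconst A + 3 + 6 * \<delta> * P"
  have P0: "P > 0" using A by (simp add: P_def add_nonneg_pos)
  have d0: "\<delta> > 0" by (simp add: \<delta>_def)
  have M0: "Mconst A \<ge> 0" by (simp add: Mconst_def)
  have dP: "\<delta> * P > 0" using d0 P0 by simp
  show ?thesis
  proof (rule that[of "K * C * (E + 1)"])
    have "C > 0" using M0 dP unfolding C_def by linarith
    thus "K * C * (E + 1) > 0" using K by (intro mult_pos_pos) (auto simp: E_def)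
    fix x T :: real and f :: "nat \<Rightarrow> complex"
    assume x: "x \<ge> 3" and T: "T \<ge> 1" and mf: "multiplicative f" and cf: "classM x A B f"
    define F where "F p = (if prime p \<and> real p \<le> x then f p else 0)" for p
    have Feq: "F = (\<lambda>p. if prime p \<and> real p \<le> x then f p else 0)" by (simp add: F_def fun_eq_iff)
    have FA: "norm (F p) \<le> A" for p using cf A by (auto simp: F_def classM_def)
    have F0: "F p = 0" if "\<not> (prime p \<and> real p \<le> x)" for p using that by (auto simp: F_def)
    define IH where "IH = integral {1 / ln x..1} (\<lambda>\<alpha>. HT f x T \<alpha> / \<alpha>)"
    define IZ where "IZ = integral {1 / ln x..1} (\<lambda>\<alpha>. exp (Zpow f x \<alpha>) / \<alpha>)"
    define Z where "Z = exp (Zpow f x 0) / sqrt T"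
    have lnx: "ln x > 1" using ln_3_gt_1 ln_mono[of 3 x] x by linarith
    have ZF: "Zpow F x = Zpow f x" by (rule ext, rule Zpow_cong) (simp add: F_def)
    have HF: "HT F x T = HT f x T" by (rule ext, rule HT_cong) (simp add: F_def)
    have Mi: "Mint (expmult F) x \<le> 2 + 3 * (Mconst A + (Z + \<delta> * (P * IH + 2 * P / T * IZ + P * 2)))"
      unfolding ZF[symmetric] HF[symmetric] IH_def IZ_def Z_def P_def \<delta>_def
      by (rule Mint_expmult_le) (fact A FA F0 T x)+
    have IH0: "IH \<ge> 0" unfolding IH_def
    proof (rule integral_nonneg)
      show "(\<lambda>\<alpha>. HT f x T \<alpha> / \<alpha>) integrable_on {1 / ln x..1}"
        by (intro integrable_continuous_interval continuous_intros continuous_on_subset[OF continuous_on_HT]) (use lnx in auto)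
      fix \<alpha> assume al: "\<alpha> \<in> {1 / ln x..1}"
      have "0 < 1 / ln x" using lnx by simp
      hence "\<alpha> > 0" using al by (simp only: atLeastAtMost_iff) linarith
      thus "0 \<le> HT f x T \<alpha> / \<alpha>" using HT_nonneg[of f x T \<alpha>] by simp
    qed
    have IZ0: "IZ \<ge> 0" unfolding IZ_def
    proof (rule integral_nonneg)
      show "(\<lambda>\<alpha>. exp (Zpow f x \<alpha>) / \<alpha>) integrable_on {1 / ln x..1}"
        by (intro integrable_continuous_interval continuous_intros continuous_on_Zpow) (use lnx in auto)
      fix \<alpha> assume al: "\<alpha> \<in> {1 / ln x..1}"
      have "0 < 1 / ln x" using lnx by simp
      hence "\<alpha> > 0" using al by (simp only: atLeastAtMost_iff) linarith
      thus "0 \<le> exp (Zpow f x \<alpha>) / \<alpha>" by simp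
    qed
    have Z0: "Z \<ge> 0" using T by (simp add: Z_def)
    define W where "W = 1 + IH + Z + IZ / T"
    have W: "W \<ge> 1" "IH \<le> W" "Z \<le> W" "IZ / T \<le> W" using IH0 IZ0 Z0 T by (auto simp: W_def)
    have MW: "1 + Mint (expmult F) x \<le> C * W"
    proof -
      have e: "1 + (2 + 3 * (Mconst A + (Z + \<delta> * (P * IH + 2 * P / T * IZ + P * 2)))) = (3 + 3 * Mconst A) * 1 + 3 * Z + 6 * (\<delta> * P) * (1 + IH / 2 + IZ / T)"
        by (simp add: algebra_simps)
      have a: "(3 + 3 * Mconst A) * 1 \<le> (3 + 3 * Mconst A) * W" using W M0 by (intro mult_left_mono) auto
      have "1 + IH / 2 + IZ / T \<le> W" using IH0 Z0 unfolding W_def by linarith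
      hence "6 * (\<delta> * P) * (1 + IH / 2 + IZ / T) \<le> 6 * (\<delta> * P) * W" using dP by (intro mult_left_mono) auto
      hence "1 + Mint (expmult F) x \<le> (3 + 3 * Mconst A) * W + 3 * W + 6 * (\<delta> * P) * W" using Mi e a W by linarith
      thus ?thesis by (simp add: C_def algebra_simps)
    qed
    define X where "X = nat \<lfloor>x\<rfloor>"
    define h where "h = mulfun (expquot f F)"
    have "Msum x f = (\<Sum>n\<in>{1..X}. \<Sum>d | d dvd n. h d * expmult F (n div d))"
      unfolding Msum_def X_def h_def by (rule sum.cong[OF refl], rule multiplicative_expmult_decomposition[OF mf]) auto
    also have "\<dots> = (\<Sum>d\<in>{1..X}. h d * (\<Sum>m\<in>{1..X div d}. expmult F m))" by (rule sum_divisors_swap)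
    finally have Mf: "Msum x f = (\<Sum>d\<in>{1..X}. h d * (\<Sum>m\<in>{1..X div d}. expmult F m))" .
    have summand: "norm (h d * (\<Sum>m\<in>{1..X div d}. expmult F m)) \<le> K * C * W * (x / ln x) * (norm (h d) / real d * (1 + 2 * ln (real d)))" if d: "d \<in> {1..X}" for d
    proof -
      have d1: "real d \<ge> 1" using d by simp
      have dx: "real d \<le> x" using d x unfolding X_def by (simp add: le_nat_iff le_floor_iff)
      have fl: "nat \<lfloor>x / real d\<rfloor> = X div d"
        using floor_divide_real_eq_div[of "int d" x] x by (simp add: X_def nat_div_distrib)
      define y where "y = x / real d"
      have y1: "y \<ge> 1" and yx: "y \<le> x" using d1 dx x by (auto simp: y_def divide_le_eq mult_le_cancel_left1)
      have Ms: "(\<Sum>m\<in>{1..X div d}. expmult F m) = Msum y (expmult F)" unfolding Msum_def y_def fl ..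
      have "norm (Msum y (expmult F)) * ln (2 * y) \<le> K * y * (1 + Mint (expmult F) y)" by (rule hm[OF FA y1])
      also have "\<dots> \<le> K * y * (C * W)"
        using MW Mint_mono[OF yx, of "expmult F"] K y1 by (intro mult_left_mono) auto
      finally have 1: "norm (Msum y (expmult F)) * ln (2 * y) \<le> K * y * (C * W)" .
      have l2y: "ln (2 * y) \<ge> 1 / 2" using ln_2_ge_half ln_mono[of 2 "2 * y"] y1 by linarith
      \<comment> \<open>Write ln(2x) = ln(2y) + ln d; as y \<ge> 1, the factor 2 ln(2y) is at least
        1 and may be multiplied onto ln d.\<close>
      have lx: "ln x \<le> ln (2 * y) * (1 + 2 * ln (real d))"
      proof -
        have "ln x \<le> ln (2 * x)" using x by simp
        also have "2 * x = 2 * y * real d" using d1 by (simp add: y_def)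
        also have "ln (2 * y * real d) = ln (2 * y) + ln (real d)" using y1 d1 by (intro ln_mult_pos) auto
        also have "\<dots> \<le> ln (2 * y) + 2 * ln (2 * y) * ln (real d)"
          using mult_right_mono[of 1 "2 * ln (2 * y)" "ln (real d)"] l2y d1 by simp
        finally show ?thesis by (simp add: algebra_simps)
      qed
      have ld: "1 + 2 * ln (real d) \<ge> 0" using d1 by simp
      have "norm (Msum y (expmult F)) * ln x \<le> norm (Msum y (expmult F)) * (ln (2 * y) * (1 + 2 * ln (real d)))"
        using lx by (intro mult_left_mono) auto
      also have "\<dots> \<le> K * y * (C * W) * (1 + 2 * ln (real d))"
        using mult_right_mono[OF 1 ld] by (simp only: mult.assoc)
      finally have "norm (Msum y (expmult F)) \<le> K * y * (C * W) * (1 + 2 * ln (real d)) / ln x"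
        using lnx by (simp add: pos_le_divide_eq)
      hence "norm (h d) * norm (Msum y (expmult F)) \<le> norm (h d) * (K * y * (C * W) * (1 + 2 * ln (real d)) / ln x)"
        by (intro mult_left_mono) auto
      also have "\<dots> = K * C * W * (x / ln x) * (norm (h d) / real d * (1 + 2 * ln (real d)))"
      proof -
        have "h * (K * (x / d) * (C * W) * l / lx) = K * C * W * (x / lx) * (h / d * l)" for h K x d C W l lx :: real
          by (simp add: mult.commute mult.left_commute)
        thus ?thesis unfolding y_def .
      qed
      finally show ?thesis unfolding Ms by (simp add: norm_mult)
    qed
    have C0: "K * C * W * (x / ln x) \<ge> 0" using K W x lnx \<open>C > 0\<close> by simp
    have "norm (Msum x f) \<le> (\<Sum>d\<in>{1..X}. K * C * W * (x / ln x) * (norm (h d) / real d * (1 + 2 * ln (real d))))"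
      unfolding Mf by (rule order_trans[OF norm_sum sum_mono[OF summand]])
    also have "\<dots> = K * C * W * (x / ln x) * (\<Sum>d\<in>{1..X}. norm (h d) / real d * (1 + 2 * ln (real d)))" by (simp only: sum_distrib_left)
    also have "\<dots> \<le> K * C * W * (x / ln x) * (E + 1)"
    proof (rule mult_left_mono[OF _ C0])
      have "(\<Sum>d\<in>{1..X}. norm (h d) / real d * (1 + 2 * ln (real d))) \<le> expquot_bound A B"
        unfolding h_def X_def Feq by (rule expquot_sum_le[OF A mf cf])
      thus "(\<Sum>d\<in>{1..X}. norm (h d) / real d * (1 + 2 * ln (real d))) \<le> E + 1" unfolding E_def by linarith
    qed
    also have "\<dots> = K * C * (E + 1) * (x / ln x) * W" by simp
    finally show "norm (Msum x f) \<le> K * C * (E + 1) * (x / ln x) * (1 + integral {1 / ln x..1} (\<lambda>\<alpha>. HT f x T \<alpha> / \<alpha>) + exp (Zpow f x 0) / sqrt T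
        + integral {1 / ln x..1} (\<lambda>\<alpha>. exp (Zpow f x \<alpha>) / \<alpha>) / T)"
      unfolding W_def IH_def IZ_def Z_def .
  qed
qed

text \<open>The window k = 0 belongs to H_T with weight 1, and at \<tau> = 0 the exponential is
  bounded below by the trivial bound on |v_f|.\<close>

lemma exp_neg_Zpow_le_HT:
  assumes "T \<ge> 1"
  shows "exp (- Zpow f x \<alpha>) \<le> HT f x T \<alpha>"
proof -
  have fin: "finite {k::int. real_of_int \<bar>k\<bar> \<le> T}" by (rule finite_int_abs_le)
  have "Re (vsum f (Complex (1 + \<alpha>) 0) x) \<ge> - norm (vsum f (Complex (1 + \<alpha>) 0) x)"
    using abs_Re_le_cmod[of "vsum f (Complex (1 + \<alpha>) 0) x"] by linarith
  also have "- norm (vsum f (Complex (1 + \<alpha>) 0) x) \<ge> - Zpow f x \<alpha>" using norm_vsum_le[of f \<alpha> 0 x] by simp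
  finally have "exp (- Zpow f x \<alpha>) \<le> norm (exp (vsum f (Complex (1 + \<alpha>) 0) x))" by simp
  hence "(exp (- Zpow f x \<alpha>))\<^sup>2 \<le> (norm (exp (vsum f (Complex (1 + \<alpha>) 0) x)))\<^sup>2" by (intro power_mono) auto
  also have "\<dots> \<le> win_sup f x \<alpha> 0" by (rule win_sup_ge) simp
  also have "\<dots> = 1 / ((real_of_int 0)\<^sup>2 + 1) * win_sup f x \<alpha> 0" by simp
  also have "\<dots> \<le> (\<Sum>k | real_of_int \<bar>k\<bar> \<le> T. 1 / ((real_of_int k)\<^sup>2 + 1) * win_sup f x \<alpha> k)"
    by (rule member_le_sum[OF _ _ fin]) (use assms win_sup_nonneg in auto)
  also have "\<dots> = (HT f x T \<alpha>)\<^sup>2" by (rule HT_sq[symmetric])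
  finally show ?thesis by (rule power2_le_imp_le) (rule HT_nonneg)
qed

text \<open>The cut y is free: y = 3/2 leaves no small primes and bounds \<open>Zpow\<close> for
  \<alpha> away from 0, while y = exp(1/\<alpha>) makes the tail an absolute multiple of A. A prime
  equal to y is counted twice, which is harmless for an upper bound.\<close>

lemma Zpow_le_tail:
  assumes A: "\<And>p. prime p \<Longrightarrow> real p \<le> x \<Longrightarrow> norm (f p) \<le> A" and "A > 0" "0 < \<alpha>" "\<alpha> \<le> 1" "y > 1"
  shows "Zpow f x \<alpha> \<le> (\<Sum>p | prime p \<and> real p \<le> min x y. norm (f p) * real p powr (-1 - \<alpha>)) + 120 * A / (\<alpha> * ln y)"
proof -
  let ?S = "{p. prime p \<and> real p \<le> min x y}" and ?R = "{p. prime p \<and> y \<le> real p \<and> real p \<le> x}"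
  have fin: "finite ?S" "finite ?R" by (rule finite_subset[OF _ finite_primes_le_real[of x]]; auto)+
  have "Zpow f x \<alpha> \<le> (\<Sum>p\<in>?S \<union> ?R. norm (f p) * real p powr (-1 - \<alpha>))"
    unfolding Zpow_def by (rule sum_mono2) (use fin in auto)
  also have "\<dots> \<le> (\<Sum>p\<in>?S. norm (f p) * real p powr (-1 - \<alpha>)) + (\<Sum>p\<in>?R. norm (f p) * real p powr (-1 - \<alpha>))"
    using sum.union_inter[OF fin, of "\<lambda>p. norm (f p) * real p powr (-1 - \<alpha>)"] sum_nonneg[of "?S \<inter> ?R" "\<lambda>p. norm (f p) * real p powr (-1 - \<alpha>)"] by auto
  also have "(\<Sum>p\<in>?R. norm (f p) * real p powr (-1 - \<alpha>)) \<le> (\<Sum>p\<in>?R. A * real p powr (-1 - \<alpha>))"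
    by (intro sum_mono mult_right_mono) (use A in auto)
  also have "\<dots> = A * (\<Sum>p\<in>?R. real p powr (-1 - \<alpha>))" by (simp only: sum_distrib_left)
  also have "\<dots> \<le> A * (120 / (\<alpha> * ln y))"
    using assms by (intro mult_left_mono sum_primes_tail_powr_le) auto
  finally show ?thesis by (simp add: mult.commute)
qed

text \<open>This lets the additive 1 of \<open>norm_Msum_multiplicative_le\<close> be absorbed. For
  \<alpha> \<ge> 1/2 the sum of p^(-1-\<alpha>) is bounded, hence H_T is bounded below; the interval
  from 1/ln 3 to 1 lies in the range of integration for every x \<ge> 3.\<close>

lemma integral_HT_lower:
  assumes A: "A > 0" and x: "x \<ge> 3" and T: "T \<ge> 1" and f: "\<And>p. prime p \<Longrightarrow> real p \<le> x \<Longrightarrow> norm (f p) \<le> A"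
  shows "exp (- (720 * A)) * (1 - 1 / ln 3) \<le> integral {1 / ln x..1} (\<lambda>\<alpha>. HT f x T \<alpha> / \<alpha>)"
proof -
  have l3: "ln (3::real) > 1" by (rule ln_3_gt_1)
  have l3': "ln (3::real) \<le> 2" using ln_le_minus_one[of "3::real"] by simp
  have l3x: "ln 3 \<le> ln x" using x by simp
  have i3: "1 / ln 3 \<ge> (1 / 2 :: real)" using l3 l3' by (simp add: le_divide_eq)
  have i31: "1 / ln 3 \<le> (1 :: real)" using l3 by simp
  have ix: "1 / ln x \<le> 1 / ln 3" using l3 l3x by (intro divide_left_mono) auto
  have ix0: "1 / ln x > 0" using l3 l3x by simp
  have c: "continuous_on {1 / ln x..1} (\<lambda>\<alpha>. HT f x T \<alpha> / \<alpha>)"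
    by (intro continuous_intros continuous_on_subset[OF continuous_on_HT]) (use ix0 in auto)
  have int: "(\<lambda>\<alpha>. HT f x T \<alpha> / \<alpha>) integrable_on {1 / ln x..1}" by (rule integrable_continuous_interval[OF c])
  have int3: "(\<lambda>\<alpha>. HT f x T \<alpha> / \<alpha>) integrable_on {1 / ln 3..1::real}"
    by (rule integrable_continuous_interval, rule continuous_on_subset[OF c]) (use ix in auto)
  have "exp (- (720 * A)) * (1 - 1 / ln 3) = integral {1 / ln 3..1::real} (\<lambda>_. exp (- (720 * A)))"
    using i31 by (simp add: mult.commute)
  also have "\<dots> \<le> integral {1 / ln 3..1::real} (\<lambda>\<alpha>. HT f x T \<alpha> / \<alpha>)"
  proof (rule integral_le[OF _ int3])
    fix \<alpha> assume "\<alpha> \<in> {1 / ln 3..1::real}"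
    hence al: "1 / 2 \<le> \<alpha>" "\<alpha> \<le> 1" using order_trans[OF i3] by auto
    \<comment> \<open>No prime is at most 3/2, so the tail estimate covers all primes. With \<alpha>
      \<ge> 1/2 and ln(3/2) \<ge> 1/3 it yields 120 * 6 = 720 times A.\<close>
    have "(\<Sum>p | prime p \<and> real p \<le> min x (3/2). norm (f p) * real p powr (-1 - \<alpha>)) = 0"
      by (rule sum.neutral) (auto dest!: prime_ge_2_nat)
    moreover have "Zpow f x \<alpha> \<le> (\<Sum>p | prime p \<and> real p \<le> min x (3/2). norm (f p) * real p powr (-1 - \<alpha>)) + 120 * A / (\<alpha> * ln (3/2))"
      by (rule Zpow_le_tail) (use f A al in auto)
    ultimately have "Zpow f x \<alpha> \<le> 120 * A / (\<alpha> * ln (3/2))" by simp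
    also have "\<dots> \<le> 120 * A / (1 / 6)"
    proof (intro divide_left_mono)
      have "ln (2/3::real) \<le> 2/3 - 1" by (rule ln_le_minus_one) simp
      moreover have "ln (3/2::real) = - ln (2/3)" by (simp add: ln_div)
      ultimately have "ln (3/2::real) \<ge> 1/3" by linarith
      from mult_mono[OF al(1) this] show "1/6 \<le> \<alpha> * ln (3/2)" using al by simp
      thus "0 < \<alpha> * ln (3/2) * (1/6)" by linarith
    qed (use A in simp)
    finally have "exp (- (720 * A)) \<le> exp (- Zpow f x \<alpha>)" by simp
    also have "\<dots> \<le> HT f x T \<alpha>" by (rule exp_neg_Zpow_le_HT[OF T])
    also have "\<dots> \<le> HT f x T \<alpha> / \<alpha>"
      using al HT_nonneg[of f x T \<alpha>] by (simp add: le_divide_eq mult_left_le)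
    finally show "exp (- (720 * A)) \<le> HT f x T \<alpha> / \<alpha>" .
  qed (rule integrable_const_ivl)
  also have "\<dots> \<le> integral {1 / ln x..1} (\<lambda>\<alpha>. HT f x T \<alpha> / \<alpha>)"
  proof (rule integral_subset_le[OF _ int3 int])
    show "{1 / ln 3..1::real} \<subseteq> {1 / ln x..1}" using ix by auto
    show "\<forall>\<alpha>\<in>{1 / ln x..1}. 0 \<le> HT f x T \<alpha> / \<alpha>"
    proof
      fix \<alpha> assume "\<alpha> \<in> {1 / ln x..1}"
      hence "1 / ln x \<le> \<alpha>" by (simp only: atLeastAtMost_iff)
      hence "0 \<le> \<alpha>" using ix0 by linarith
      thus "0 \<le> HT f x T \<alpha> / \<alpha>" by (intro divide_nonneg_nonneg HT_nonneg)
    qed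
  qed
  finally show ?thesis .
qed


section \<open>Comparison of the trivial exponent with Z(x; r)\<close>

lemma Zpow_le_Zsum:
  fixes r :: "nat \<Rightarrow> real"
  assumes fr: "\<And>n. norm (f n) \<le> r n" and "\<alpha> \<ge> 0"
  shows "Zpow f x \<alpha> \<le> Zsum x r"
  unfolding Zpow_def Zsum_def
proof (rule sum_mono)
  fix p assume "p \<in> {p. prime p \<and> real p \<le> x}"
  hence p: "real p \<ge> 1" by (auto dest: prime_ge_1_nat)
  have "real p powr (-1 - \<alpha>) \<le> real p powr (-1)" using p assms(2) by (intro powr_mono) auto
  hence "norm (f p) * real p powr (-1 - \<alpha>) \<le> r p * real p powr (-1)"
    using fr[of p] order_trans[OF norm_ge_zero fr] by (intro mult_mono) auto
  thus "norm (f p) * real p powr (-1 - \<alpha>) \<le> r p / of_nat p" using p by (simp add: powr_minus_divide)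
qed

text \<open>Primes beyond exp(1/\<alpha>) contribute at most 120 A; below that point the factor
  p^(-\<alpha>) is dropped. This turns \<alpha> into the variable y = exp(1/\<alpha>) of the
  regularity hypothesis.\<close>

lemma Zpow_le_Zsum_tail:
  fixes r :: "nat \<Rightarrow> real"
  assumes fr: "\<And>n. norm (f n) \<le> r n" and A: "A > 0" and fA: "\<And>p. prime p \<Longrightarrow> real p \<le> x \<Longrightarrow> norm (f p) \<le> A"
    and al: "0 < \<alpha>" "\<alpha> \<le> 1" and ex: "exp (1 / \<alpha>) \<le> x"
  shows "Zpow f x \<alpha> \<le> Zsum (exp (1 / \<alpha>)) r + 120 * A"
proof -
  have "Zpow f x \<alpha> \<le> (\<Sum>p | prime p \<and> real p \<le> min x (exp (1 / \<alpha>)). norm (f p) * real p powr (-1 - \<alpha>)) + 120 * A / (\<alpha> * ln (exp (1 / \<alpha>)))"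
    by (rule Zpow_le_tail[OF fA A al]) (use al in auto)
  also have "min x (exp (1 / \<alpha>)) = exp (1 / \<alpha>)" using ex by simp
  also have "(\<Sum>p | prime p \<and> real p \<le> exp (1 / \<alpha>). norm (f p) * real p powr (-1 - \<alpha>)) = Zpow f (exp (1 / \<alpha>)) \<alpha>"
    by (simp only: Zpow_def)
  also have "\<dots> \<le> Zsum (exp (1 / \<alpha>)) r" by (rule Zpow_le_Zsum[OF fr]) (use al in simp)
  finally show ?thesis using al by simp
qed

lemma integral_exp_Zpow_le:
  fixes r :: "nat \<Rightarrow> real"
  assumes fr: "\<And>n. norm (f n) \<le> r n" and x: "x \<ge> 3"
  shows "integral {1 / ln x..1} (\<lambda>\<alpha>. exp (Zpow f x \<alpha>) / \<alpha>) \<le> exp (Zsum x r) * ln (ln x)"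
proof -
  have lnx: "ln x > 1" using ln_3_gt_1 ln_mono[of 3 x] x by linarith
  define a where "a = 1 / ln x"
  have a: "0 < a" "a \<le> 1" using lnx by (auto simp: a_def)
  have hi: "((\<lambda>\<alpha>. exp (Zsum x r) * (1 / \<alpha>)) has_integral exp (Zsum x r) * (- ln a)) {a..1}"
    by (rule has_integral_mult_right[OF has_integral_inverse_Icc[OF a]])
  have "integral {a..1} (\<lambda>\<alpha>. exp (Zpow f x \<alpha>) / \<alpha>) \<le> integral {a..1} (\<lambda>\<alpha>. exp (Zsum x r) * (1 / \<alpha>))"
  proof (rule integral_le)
    show "(\<lambda>\<alpha>. exp (Zpow f x \<alpha>) / \<alpha>) integrable_on {a..1}"
      by (intro integrable_continuous_interval continuous_intros continuous_on_Zpow) (use a in auto)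
    show "(\<lambda>\<alpha>. exp (Zsum x r) * (1 / \<alpha>)) integrable_on {a..1}" using hi by blast
    fix \<alpha> assume "\<alpha> \<in> {a..1}"
    hence "\<alpha> > 0" using a by auto
    moreover have "Zpow f x \<alpha> \<le> Zsum x r" by (rule Zpow_le_Zsum) (use fr \<open>\<alpha> > 0\<close> in auto)
    ultimately show "exp (Zpow f x \<alpha>) / \<alpha> \<le> exp (Zsum x r) * (1 / \<alpha>)"
      by (simp add: divide_right_mono)
  qed
  also have "\<dots> = exp (Zsum x r) * (- ln a)" by (rule integral_unique[OF hi])
  also have "- ln a = ln (ln x)" using lnx by (simp add: a_def ln_div)
  finally show ?thesis by (simp only: a_def)
qed

lemma integral_exp_Zpow_le_regular:
  fixes r :: "nat \<Rightarrow> real"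
  assumes fr: "\<And>n. norm (f n) \<le> r n" and x: "x \<ge> 3" and A: "A > 0" and c: "c > 0"
    and fA: "\<And>p. prime p \<Longrightarrow> real p \<le> x \<Longrightarrow> norm (f p) \<le> A"
    and reg: "\<And>y. 2 \<le> y \<Longrightarrow> y \<le> x \<Longrightarrow> Zsum x r - Zsum y r \<ge> c * ln (ln x / ln y) - K"
  shows "integral {1 / ln x..1} (\<lambda>\<alpha>. exp (Zpow f x \<alpha>) / \<alpha>) \<le> exp (K + 120 * A) / c * exp (Zsum x r)"
proof -
  have lnx: "ln x > 1" using ln_3_gt_1 ln_mono[of 3 x] x by linarith
  define a where "a = 1 / ln x"
  have a: "0 < a" "a \<le> 1" using lnx by (auto simp: a_def)
  \<comment> \<open>At y = exp(1/\<alpha>) one has ln x / ln y = \<alpha>/a, so the hypothesis saves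
    (\<alpha>/a)^(-c) and exp(Zpow) is at most D \<alpha>^(-c). The integral of
    \<alpha>^(-c)/\<alpha> is at most a^(-c)/c, and the factor a^c in D cancels it.\<close>
  define D where "D = exp (K + 120 * A) * exp (Zsum x r) * a powr c"
  have D0: "D \<ge> 0" by (simp add: D_def)
  have hi: "((\<lambda>\<alpha>. D * (\<alpha> powr (- c) / \<alpha>)) has_integral D * ((a powr (- c) - 1) / c)) {a..1}"
    by (rule has_integral_mult_right[OF has_integral_powr_neg_Icc[OF a c]])
  have "integral {a..1} (\<lambda>\<alpha>. exp (Zpow f x \<alpha>) / \<alpha>) \<le> integral {a..1} (\<lambda>\<alpha>. D * (\<alpha> powr (- c) / \<alpha>))"
  proof (rule integral_le)
    show "(\<lambda>\<alpha>. exp (Zpow f x \<alpha>) / \<alpha>) integrable_on {a..1}"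
      by (intro integrable_continuous_interval continuous_intros continuous_on_Zpow) (use a in auto)
    show "(\<lambda>\<alpha>. D * (\<alpha> powr (- c) / \<alpha>)) integrable_on {a..1}" using hi by blast
    fix \<alpha> assume al': "\<alpha> \<in> {a..1}"
    hence al: "\<alpha> > 0" "\<alpha> \<le> 1" "a \<le> \<alpha>" using a by auto
    have "1 / \<alpha> \<le> 1 / a" using al a by (intro divide_left_mono) auto
    also have "\<dots> = ln x" using lnx by (simp add: a_def)
    finally have "exp (1 / \<alpha>) \<le> exp (ln x)" by simp
    hence ex: "exp (1 / \<alpha>) \<le> x" using x by simp
    have "1 \<le> 1 / \<alpha>" using al by simp
    hence e2: "exp (1 / \<alpha>) \<ge> 2" using exp_ge_add_one_self[of "1 / \<alpha>"] by linarith
    have "ln x / ln (exp (1 / \<alpha>)) = \<alpha> / a" by (simp add: a_def)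
    hence "Zsum (exp (1 / \<alpha>)) r \<le> Zsum x r - c * ln (\<alpha> / a) + K" using reg[OF e2 ex] by simp
    moreover have "Zpow f x \<alpha> \<le> Zsum (exp (1 / \<alpha>)) r + 120 * A" by (rule Zpow_le_Zsum_tail[OF fr A fA al(1,2) ex])
    moreover have "ln (\<alpha> / a) = ln \<alpha> - ln a" using al a by (simp add: ln_div)
    ultimately have "Zpow f x \<alpha> \<le> (K + 120 * A) + Zsum x r + c * ln a + (- c) * ln \<alpha>" by (simp add: right_diff_distrib)
    hence "exp (Zpow f x \<alpha>) \<le> exp ((K + 120 * A) + Zsum x r + c * ln a + (- c) * ln \<alpha>)" by simp
    also have "\<dots> = D * \<alpha> powr (- c)" using al a by (simp only: D_def powr_def exp_add) simp
    finally have "exp (Zpow f x \<alpha>) / \<alpha> \<le> D * \<alpha> powr (- c) / \<alpha>" using al by (intro divide_right_mono) auto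
    thus "exp (Zpow f x \<alpha>) / \<alpha> \<le> D * (\<alpha> powr (- c) / \<alpha>)" by simp
  qed
  also have "\<dots> = D * ((a powr (- c) - 1) / c)" by (rule integral_unique[OF hi])
  also have "\<dots> \<le> D * (a powr (- c) / c)" using D0 c by (intro mult_left_mono divide_right_mono) auto
  also have "\<dots> = exp (K + 120 * A) / c * exp (Zsum x r) * (a powr c * a powr (- c))" by (simp add: D_def)
  also have "a powr c * a powr (- c) = 1" using a by (simp add: powr_add[symmetric])
  finally show ?thesis by (simp add: a_def)
qed

text \<open>For x \<ge> 3 the logarithm ln(ln x) is positive and the interval of integration
  contains [1/ln 3, 1], the source of the lower bound c0. The O(1) of the regularity hypothesis is
  quantified as -K before the constant C.\<close>

theorem theorem1p1:
  fixes A B :: real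
  assumes "A > 0" and "B > 0"
  shows
   "(\<exists>C::real. \<forall>(x::real) (T::real) (f::nat \<Rightarrow> complex) (r::nat \<Rightarrow> real).
      x \<ge> 3 \<and> T \<ge> 1 \<and> multiplicative f \<and> multiplicative r \<and>
      classM x A B f \<and> classM x A B r \<and> (\<forall>n. cmod (f n) \<le> r n) \<longrightarrow>
      cmod (Msum x f) \<le> C * \<bar>x / ln x *
        (integral {1 / ln x .. 1} (\<lambda>\<alpha>. HT f x T \<alpha> / \<alpha>)
         + exp (Zsum x r) / sqrt T
         + exp (Zsum x r) * ln (ln x) / T)\<bar>) \<and>
   (\<forall>(c::real) (K::real). c > 0 \<longrightarrow>
      (\<exists>C::real. \<forall>(x::real) (T::real) (f::nat \<Rightarrow> complex) (r::nat \<Rightarrow> real).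
        x \<ge> 3 \<and> T \<ge> 1 \<and> multiplicative f \<and> multiplicative r \<and>
        classM x A B f \<and> classM x A B r \<and> (\<forall>n. cmod (f n) \<le> r n) \<and>
        (\<forall>y. 2 \<le> y \<and> y \<le> x \<longrightarrow> Zsum x r - Zsum y r \<ge> c * ln (ln x / ln y) - K) \<longrightarrow>
        cmod (Msum x f) \<le> C * \<bar>x / ln x *
          (integral {1 / ln x .. 1} (\<lambda>\<alpha>. HT f x T \<alpha> / \<alpha>)
           + exp (Zsum x r) / sqrt T)\<bar>))"
proof -
  obtain K0 where K0: "K0 > 0" and Mf: "\<And>x T (f :: nat \<Rightarrow> complex). x \<ge> 3 \<Longrightarrow> T \<ge> 1 \<Longrightarrow> multiplicative f \<Longrightarrow> classM x A B f \<Longrightarrow>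
      norm (Msum x f) \<le> K0 * (x / ln x) * (1 + integral {1 / ln x..1} (\<lambda>\<alpha>. HT f x T \<alpha> / \<alpha>) + exp (Zpow f x 0) / sqrt T
        + integral {1 / ln x..1} (\<lambda>\<alpha>. exp (Zpow f x \<alpha>) / \<alpha>) / T)"
    using norm_Msum_multiplicative_le[OF assms(1), of B] by blast
  define c0 where "c0 = exp (- (720 * A)) * (1 - 1 / ln 3)"
  have c0: "c0 > 0" using ln_3_gt_1 by (simp add: c0_def)
  \<comment> \<open>Serves both assertions: W is the last term in the braces and E the constant lost
    in the tail. The general case takes E = 1 and W = e^Z ln(ln x)/T, the regular case W = 0 and E =
    1 + \<open>G\<close>.\<close>
  have main: "norm (Msum x f) \<le> K0 * (1 / c0 + 1) * E * \<bar>x / ln x * (integral {1 / ln x..1} (\<lambda>\<alpha>. HT f x T \<alpha> / \<alpha>) + exp (Zsum x r) / sqrt T + W)\<bar>"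
    if x: "x \<ge> 3" and T: "T \<ge> 1" and mf: "multiplicative f" and cf: "classM x A B f" and fr: "\<And>n. norm (f n) \<le> r n"
      and E: "E \<ge> 1" and W: "W \<ge> 0" "exp (Zsum x r) / sqrt T + integral {1 / ln x..1} (\<lambda>\<alpha>. exp (Zpow f x \<alpha>) / \<alpha>) / T \<le> E * (exp (Zsum x r) / sqrt T + W)"
    for x T E W :: real and f :: "nat \<Rightarrow> complex" and r :: "nat \<Rightarrow> real"
  proof -
    define I where "I = integral {1 / ln x..1} (\<lambda>\<alpha>. HT f x T \<alpha> / \<alpha>)"
    define V where "V = exp (Zsum x r) / sqrt T + W"
    have lnx: "ln x > 1" using ln_3_gt_1 ln_mono[of 3 x] x by linarith
    have fA: "norm (f p) \<le> A" if "prime p" "real p \<le> x" for p using cf that by (simp add: classM_def)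
    have I: "c0 \<le> I" unfolding c0_def I_def by (rule integral_HT_lower) (fact assms(1) x T fA)+
    have V0: "V \<ge> 0" using W T by (simp add: V_def)
    have "Zpow f x 0 \<le> Zsum x r" by (rule Zpow_le_Zsum) (use fr in auto)
    hence "exp (Zpow f x 0) / sqrt T \<le> exp (Zsum x r) / sqrt T"
      using T by (intro divide_right_mono) auto
    hence "1 + I + exp (Zpow f x 0) / sqrt T + integral {1 / ln x..1} (\<lambda>\<alpha>. exp (Zpow f x \<alpha>) / \<alpha>) / T \<le> 1 + I + E * V"
      using W unfolding V_def by linarith
    \<comment> \<open>Absorbs the additive 1 into the integral I, which explains the factor 1/c0 +
      1.\<close>
    moreover have "1 \<le> I / c0" using I c0 by simp
    moreover have "(1 / c0 + 1) * I = I / c0 + I" by (simp add: distrib_right)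
    moreover have "(1 / c0 + 1) * I \<le> (1 / c0 + 1) * (E * I)"
      using E I c0 by (intro mult_left_mono mult_le_cancel_right1[THEN iffD2]) auto
    moreover have "1 * (E * V) \<le> (1 / c0 + 1) * (E * V)"
      using E V0 c0 by (intro mult_right_mono) auto
    moreover have "(1 / c0 + 1) * E * (I + V) = (1 / c0 + 1) * (E * I) + (1 / c0 + 1) * (E * V)"
      by (simp only: distrib_left mult.assoc)
    ultimately have b: "1 + I + exp (Zpow f x 0) / sqrt T + integral {1 / ln x..1} (\<lambda>\<alpha>. exp (Zpow f x \<alpha>) / \<alpha>) / T \<le> (1 / c0 + 1) * E * (I + V)"
      by linarith
    have "norm (Msum x f) \<le> K0 * (x / ln x) * (1 + I + exp (Zpow f x 0) / sqrt T + integral {1 / ln x..1} (\<lambda>\<alpha>. exp (Zpow f x \<alpha>) / \<alpha>) / T)"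
      unfolding I_def by (rule Mf[OF x T mf cf])
    also have "\<dots> \<le> K0 * (x / ln x) * ((1 / c0 + 1) * E * (I + V))"
      using b K0 lnx x by (intro mult_left_mono) auto
    also have "\<dots> = K0 * (1 / c0 + 1) * E * (x / ln x * (I + V))"
      by (simp only: mult.assoc mult.left_commute mult.commute)
    also have "\<dots> \<le> K0 * (1 / c0 + 1) * E * \<bar>x / ln x * (I + V)\<bar>"
      using K0 c0 E by (intro mult_left_mono[OF abs_ge_self]) auto
    finally show ?thesis by (simp only: I_def V_def add.assoc)
  qed
  show ?thesis
  proof (intro conjI allI impI)
    show "\<exists>C::real. \<forall>(x::real) (T::real) (f::nat \<Rightarrow> complex) (r::nat \<Rightarrow> real).
      x \<ge> 3 \<and> T \<ge> 1 \<and> multiplicative f \<and> multiplicative r \<and>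
      classM x A B f \<and> classM x A B r \<and> (\<forall>n. cmod (f n) \<le> r n) \<longrightarrow>
      cmod (Msum x f) \<le> C * \<bar>x / ln x *
        (integral {1 / ln x .. 1} (\<lambda>\<alpha>. HT f x T \<alpha> / \<alpha>)
         + exp (Zsum x r) / sqrt T
         + exp (Zsum x r) * ln (ln x) / T)\<bar>"
    proof (intro exI[of _ "K0 * (1 / c0 + 1) * 1"] allI impI, elim conjE)
      fix x T :: real and f :: "nat \<Rightarrow> complex" and r :: "nat \<Rightarrow> real"
      assume x: "x \<ge> 3" and T: "T \<ge> 1" and mf: "multiplicative f" and cf: "classM x A B f" and fr: "\<forall>n. cmod (f n) \<le> r n"
      have lnx: "ln x > 1" using ln_3_gt_1 ln_mono[of 3 x] x by linarith
      have fr': "norm (f n) \<le> r n" for n using fr by simp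
      show "cmod (Msum x f) \<le> K0 * (1 / c0 + 1) * 1 * \<bar>x / ln x *
        (integral {1 / ln x .. 1} (\<lambda>\<alpha>. HT f x T \<alpha> / \<alpha>)
         + exp (Zsum x r) / sqrt T
         + exp (Zsum x r) * ln (ln x) / T)\<bar>"
      proof (rule main[OF x T mf cf fr'])
        show "0 \<le> exp (Zsum x r) * ln (ln x) / T" using lnx T by simp
        have "integral {1 / ln x..1} (\<lambda>\<alpha>. exp (Zpow f x \<alpha>) / \<alpha>) / T \<le> exp (Zsum x r) * ln (ln x) / T"
          by (rule divide_right_mono[OF integral_exp_Zpow_le[OF fr' x]]) (use T in simp)
        thus "exp (Zsum x r) / sqrt T + integral {1 / ln x..1} (\<lambda>\<alpha>. exp (Zpow f x \<alpha>) / \<alpha>) / T \<le> 1 * (exp (Zsum x r) / sqrt T + exp (Zsum x r) * ln (ln x) / T)"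
          by (simp only: mult_1_left add_left_mono)
      qed simp
    qed
  next
    fix c K :: real assume c: "c > 0"
    define G where "G = exp (K + 120 * A) / c"
    have G0: "G > 0" using c by (simp add: G_def)
    show "\<exists>C::real. \<forall>(x::real) (T::real) (f::nat \<Rightarrow> complex) (r::nat \<Rightarrow> real).
        x \<ge> 3 \<and> T \<ge> 1 \<and> multiplicative f \<and> multiplicative r \<and>
        classM x A B f \<and> classM x A B r \<and> (\<forall>n. cmod (f n) \<le> r n) \<and>
        (\<forall>y. 2 \<le> y \<and> y \<le> x \<longrightarrow> Zsum x r - Zsum y r \<ge> c * ln (ln x / ln y) - K) \<longrightarrow>
        cmod (Msum x f) \<le> C * \<bar>x / ln x *
          (integral {1 / ln x .. 1} (\<lambda>\<alpha>. HT f x T \<alpha> / \<alpha>)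
           + exp (Zsum x r) / sqrt T)\<bar>"
    proof (intro exI[of _ "K0 * (1 / c0 + 1) * (1 + G)"] allI impI, elim conjE)
      fix x T :: real and f :: "nat \<Rightarrow> complex" and r :: "nat \<Rightarrow> real"
      assume x: "x \<ge> 3" and T: "T \<ge> 1" and mf: "multiplicative f" and cf: "classM x A B f" and fr: "\<forall>n. cmod (f n) \<le> r n"
        and reg: "\<forall>y. 2 \<le> y \<and> y \<le> x \<longrightarrow> Zsum x r - Zsum y r \<ge> c * ln (ln x / ln y) - K"
      have fr': "norm (f n) \<le> r n" for n using fr by simp
      have fA: "norm (f p) \<le> A" if "prime p" "real p \<le> x" for p using cf that by (simp add: classM_def)
      have reg': "Zsum x r - Zsum y r \<ge> c * ln (ln x / ln y) - K" if "2 \<le> y" "y \<le> x" for y using reg that by simp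
      \<comment> \<open>As T \<ge> 1, the remaining tail G e^Z/T of the regular case is covered by
        e^Z/sqrt T.\<close>
      have sT: "0 < sqrt T" "sqrt T \<le> T" using T real_sqrt_le_mono[of T "T * T"] by (auto simp: mult_le_cancel_left1)
      have "cmod (Msum x f) \<le> K0 * (1 / c0 + 1) * (1 + G) * \<bar>x / ln x *
          (integral {1 / ln x .. 1} (\<lambda>\<alpha>. HT f x T \<alpha> / \<alpha>) + exp (Zsum x r) / sqrt T + 0)\<bar>"
      proof (rule main[OF x T mf cf fr'])
        have "integral {1 / ln x..1} (\<lambda>\<alpha>. exp (Zpow f x \<alpha>) / \<alpha>) / T \<le> G * exp (Zsum x r) / T"
          unfolding G_def by (rule divide_right_mono[OF integral_exp_Zpow_le_regular[OF fr' x assms(1) c fA reg']]) (use T in auto)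
        also have "\<dots> \<le> G * exp (Zsum x r) / sqrt T" using G0 sT T by (intro divide_left_mono) auto
        finally have "integral {1 / ln x..1} (\<lambda>\<alpha>. exp (Zpow f x \<alpha>) / \<alpha>) / T \<le> G * (exp (Zsum x r) / sqrt T)" by simp
        thus "exp (Zsum x r) / sqrt T + integral {1 / ln x..1} (\<lambda>\<alpha>. exp (Zpow f x \<alpha>) / \<alpha>) / T \<le> (1 + G) * (exp (Zsum x r) / sqrt T + 0)"
          by (simp only: distrib_right add_0_right mult_1_left add_left_mono)
      qed (use G0 in auto)
      thus "cmod (Msum x f) \<le> K0 * (1 / c0 + 1) * (1 + G) * \<bar>x / ln x *
          (integral {1 / ln x .. 1} (\<lambda>\<alpha>. HT f x T \<alpha> / \<alpha>) + exp (Zsum x r) / sqrt T)\<bar>"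
        by (simp only: add_0_right)
    qed
  qed
qed

end
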